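(* Let $(M,\omega_0)$ be a compact Kähler manifold of complex dimension $n$, let $0<T\le\infty$, let $F:M\to\mathbb{R}$ be a function on $M$ (independent of time), and let $\varphi$ be a $C^2$ solution on $M\times[0,T)$ of the flow $$\partial_t\varphi=\log\left(\frac{\omega_\varphi^n}{e^{nF}\omega_0^n}\right),\qquad \varphi(\cdot,0)=\varphi_0 .$$ Assume that for some $p>n+1$ the $p$-entropy $\mathrm{Ent}_p(F)=\int_M|F|^pe^{nF}\omega_0^n$ is bounded, and that $\int_M nF\,\omega_0^n\ge -K$. Let $\tilde\varphi=\varphi-\frac{1}{V}\int_M\varphi\,\omega_0^n$, where $V=\int_M\omega_0^n$. Then $$\|\tilde\varphi\|_{L^\infty(M\times[0,T))}\le C,$$ where the constant $C$ depends only on $n,\ \omega_0,\ \varphi_0,\ p,\ K$ and $\mathrm{Ent}_p(F)$ (in particular it does not depend on $T$).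
   Context: For a function $\varphi$ on $M\times[0,T)$, $\omega_\varphi=\omega_0+\sqrt{-1}\,\partial\bar\partial\varphi$, where $\partial,\bar\partial$ act in the space variable at each fixed time. A solution of the flow is understood to satisfy $\omega_\varphi>0$ at every time. *)

theory Defs
  imports "HOL-Analysis.Analysis" "HOL-Probability.Essential_Supremum"
begin

section \<open>Functions of class \<open>C\<^sup>k\<close>\<close>

text \<open>Derivatives are taken within \<open>S\<close>, so that one-sided derivatives in time are used at \<open>t = 0\<close>.
  The definition is applied only to sets \<open>V\<close> and \<open>V \<times> [0, T)\<close> with \<open>V\<close> open, where derivatives within
  the set are unique.\<close>

primrec Ck_on ::
  "nat \<Rightarrow> ('a::euclidean_space \<Rightarrow> 'b::real_normed_vector) \<Rightarrow> 'a set \<Rightarrow> bool" where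
  "Ck_on 0 f S \<longleftrightarrow> continuous_on S f"
| "Ck_on (Suc k) f S \<longleftrightarrow>
     (\<exists>f'. (\<forall>y\<in>S. (f has_derivative f' y) (at y within S)) \<and> (\<forall>v. Ck_on k (\<lambda>y. f' y v) S))"

definition smooth_on :: "('a::euclidean_space \<Rightarrow> 'b::real_normed_vector) \<Rightarrow> 'a set \<Rightarrow> bool" where
  "smooth_on f S \<longleftrightarrow> (\<forall>k. Ck_on k f S)"


section \<open>Complex manifolds\<close>

text \<open>A chart is a domain together with a coordinate map; the values of the map outside the domain are
  irrelevant. The manifold is the whole type \<open>'m\<close>, and its complex dimension is \<open>CARD('n)\<close>.\<close>

type_synonym ('m, 'n) chart = "'m set \<times> ('m \<Rightarrow> complex ^ 'n)"

abbreviation dom_chart :: "('m, 'n) chart \<Rightarrow> 'm set" where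
  "dom_chart c \<equiv> fst c"

abbreviation coord :: "('m, 'n) chart \<Rightarrow> 'm \<Rightarrow> complex ^ 'n" where
  "coord c \<equiv> snd c"

abbreviation img_chart :: "('m, 'n) chart \<Rightarrow> (complex ^ 'n) set" where
  "img_chart c \<equiv> coord c ` dom_chart c"

definition inv_coord :: "('m, 'n) chart \<Rightarrow> complex ^ 'n \<Rightarrow> 'm" where
  "inv_coord c = inv_into (dom_chart c) (coord c)"

definition transition :: "('m, 'n) chart \<Rightarrow> ('m, 'n) chart \<Rightarrow> complex ^ 'n \<Rightarrow> complex ^ 'n" where
  "transition c d = coord d \<circ> inv_coord c"

definition holomorphic_map_on ::
  "(complex ^ 'n::finite \<Rightarrow> complex ^ 'n) \<Rightarrow> (complex ^ 'n) set \<Rightarrow> bool" where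
  "holomorphic_map_on f S \<longleftrightarrow>
     (\<forall>y\<in>S. \<exists>D. (f has_derivative D) (at y) \<and> (\<forall>a v. D (a *s v) = a *s D v))"

definition complex_atlas :: "('m::topological_space, 'n::finite) chart set \<Rightarrow> bool" where
  "complex_atlas A \<longleftrightarrow>
     (\<Union>c\<in>A. dom_chart c) = UNIV \<and>
     (\<forall>c\<in>A. open (dom_chart c) \<and> open (img_chart c) \<and>
             homeomorphism (dom_chart c) (img_chart c) (coord c) (inv_coord c)) \<and>
     (\<forall>c\<in>A. \<forall>d\<in>A. holomorphic_map_on (transition c d) (coord c ` (dom_chart c \<inter> dom_chart d)))"


section \<open>Kaehler forms\<close>

text \<open>\<open>\<omega> c x u v\<close> is the value of a real 2-form at the point \<open>x\<close> on the two tangent vectors that have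
  coordinates \<open>u\<close> and \<open>v\<close> in the chart \<open>c\<close>. Here \<open>\<complex>\<^sup>n\<close> is regarded as the real tangent
  space, with complex structure \<open>u \<mapsto> \<i> u\<close>.\<close>

type_synonym ('m, 'n) two_form =
  "('m, 'n) chart \<Rightarrow> 'm \<Rightarrow> complex ^ 'n \<Rightarrow> complex ^ 'n \<Rightarrow> real"

definition smooth_two_form ::
  "('m::topological_space, 'n::finite) chart set \<Rightarrow> ('m, 'n) two_form \<Rightarrow> bool" where
  "smooth_two_form A \<omega> \<longleftrightarrow>
     (\<forall>c\<in>A. \<forall>x\<in>dom_chart c. bilinear (\<omega> c x) \<and> (\<forall>u. \<omega> c x u u = 0)) \<and>
     (\<forall>c\<in>A. \<forall>u v. smooth_on (\<lambda>y. \<omega> c (inv_coord c y) u v) (img_chart c)) \<and>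
     (\<forall>c\<in>A. \<forall>d\<in>A. \<forall>x \<in> dom_chart c \<inter> dom_chart d. \<forall>u v.
        \<omega> c x u v =
        \<omega> d x (frechet_derivative (transition c d) (at (coord c x)) u)
              (frechet_derivative (transition c d) (at (coord c x)) v))"

definition exterior_derivative ::
  "(complex ^ 'n::finite \<Rightarrow> complex ^ 'n \<Rightarrow> complex ^ 'n \<Rightarrow> real) \<Rightarrow>
   complex ^ 'n \<Rightarrow> complex ^ 'n \<Rightarrow> complex ^ 'n \<Rightarrow> complex ^ 'n \<Rightarrow> real" where
  "exterior_derivative \<beta> y u v w =
     frechet_derivative (\<lambda>y. \<beta> y v w) (at y) u
     - frechet_derivative (\<lambda>y. \<beta> y u w) (at y) v
     + frechet_derivative (\<lambda>y. \<beta> y u v) (at y) w"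

definition closed_form :: "('m, 'n::finite) chart set \<Rightarrow> ('m, 'n) two_form \<Rightarrow> bool" where
  "closed_form A \<omega> \<longleftrightarrow>
     (\<forall>c\<in>A. \<forall>y\<in>img_chart c. \<forall>u v w.
        exterior_derivative (\<lambda>y. \<omega> c (inv_coord c y)) y u v w = 0)"

definition type_1_1 :: "('m, 'n::finite) chart set \<Rightarrow> ('m, 'n) two_form \<Rightarrow> bool" where
  "type_1_1 A \<omega> \<longleftrightarrow>
     (\<forall>c\<in>A. \<forall>x\<in>dom_chart c. \<forall>u v. \<omega> c x (\<i> *s u) (\<i> *s v) = \<omega> c x u v)"

definition positive_form :: "('m, 'n::finite) chart set \<Rightarrow> ('m, 'n) two_form \<Rightarrow> bool" where
  "positive_form A \<omega> \<longleftrightarrow>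
     (\<forall>c\<in>A. \<forall>x\<in>dom_chart c. \<forall>u. u \<noteq> 0 \<longrightarrow> \<omega> c x u (\<i> *s u) > 0)"

text \<open>Manifolds are connected; second countability follows from compactness.\<close>

definition compact_kaehler_manifold ::
  "('m::t2_space, 'n::finite) chart set \<Rightarrow> ('m, 'n) two_form \<Rightarrow> bool" where
  "compact_kaehler_manifold A \<omega> \<longleftrightarrow>
     compact (UNIV :: 'm set) \<and> connected (UNIV :: 'm set) \<and> complex_atlas A \<and>
     smooth_two_form A \<omega> \<and> type_1_1 A \<omega> \<and> positive_form A \<omega> \<and> closed_form A \<omega>"


section \<open>The form \<open>\<omega>\<^sub>\<phi>\<close>\<close>

definition wirtinger :: "'n \<Rightarrow> (complex ^ 'n::finite \<Rightarrow> complex) \<Rightarrow> complex ^ 'n \<Rightarrow> complex" where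
  "wirtinger j f y =
     (frechet_derivative f (at y) (axis j 1) - \<i> * frechet_derivative f (at y) (axis j \<i>)) / 2"

definition wirtinger_bar :: "'n \<Rightarrow> (complex ^ 'n::finite \<Rightarrow> complex) \<Rightarrow> complex ^ 'n \<Rightarrow> complex" where
  "wirtinger_bar j f y =
     (frechet_derivative f (at y) (axis j 1) + \<i> * frechet_derivative f (at y) (axis j \<i>)) / 2"

text \<open>With \<open>f\<^sub>j\<^sub>k\<close> the derivative of \<open>f\<close> by \<open>\<partial>/\<partial>z\<^sub>j\<close> and the conjugate of \<open>\<partial>/\<partial>z\<^sub>k\<close>, this is
  \<open>\<i> \<Sum> f\<^sub>j\<^sub>k dz\<^sub>j \<and> cnj dz\<^sub>k\<close> evaluated on \<open>(u, v)\<close>. For real \<open>f\<close> of class \<open>C\<^sup>2\<close> the complex number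
  under \<open>Re\<close> is real.\<close>

definition i_ddbar :: "('m \<Rightarrow> real) \<Rightarrow> ('m, 'n::finite) two_form" where
  "i_ddbar f c x u v =
     Re (\<i> * (\<Sum>j\<in>UNIV. \<Sum>k\<in>UNIV.
       wirtinger j (wirtinger_bar k (\<lambda>y. of_real (f (inv_coord c y)))) (coord c x) *
       (u $ j * cnj (v $ k) - v $ j * cnj (u $ k))))"

definition omega_pot :: "('m, 'n::finite) two_form \<Rightarrow> ('m \<Rightarrow> real) \<Rightarrow> ('m, 'n) two_form" where
  "omega_pot \<omega> f c x u v = \<omega> c x u v + i_ddbar f c x u v"


section \<open>The top power \<open>\<omega>\<^sup>n\<close> and integration\<close>

text \<open>The real coordinate frame \<open>\<partial>/\<partial>x\<^sub>j\<close>, \<open>\<partial>/\<partial>y\<^sub>j\<close>, indexed by \<open>(j, False)\<close> and \<open>(j, True)\<close>.\<close>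

definition real_frame :: "'n \<times> bool \<Rightarrow> complex ^ 'n::finite" where
  "real_frame i = axis (fst i) (if snd i then \<i> else 1)"

text \<open>\<open>(\<beta> \<and> \<dots> \<and> \<beta>)(e\<^sub>1, Je\<^sub>1, \<dots>, e\<^sub>n, Je\<^sub>n)\<close> with \<open>n\<close> factors, that is, the coefficient of \<open>\<beta>\<^sup>n\<close> with
  respect to \<open>dx\<^sub>1 \<and> dy\<^sub>1 \<and> \<dots> \<and> dx\<^sub>n \<and> dy\<^sub>n\<close>. The wedge product is normalised by
  \<open>(\<alpha> \<and> \<beta>)(v\<^sub>1, \<dots>) = 1/(p! q!) \<Sum> sgn \<sigma> \<alpha>(v\<^sub>\<sigma>\<^sub>1, \<dots>) \<beta>(\<dots>)\<close>.\<close>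

definition top_power :: "(complex ^ 'n::finite \<Rightarrow> complex ^ 'n \<Rightarrow> real) \<Rightarrow> real" where
  "top_power \<beta> =
     (\<Sum>\<sigma> | \<sigma> permutes (UNIV :: ('n \<times> bool) set).
        of_int (sign \<sigma>) *
        (\<Prod>j\<in>UNIV. \<beta> (real_frame (\<sigma> (j, False))) (real_frame (\<sigma> (j, True))))) / 2 ^ CARD('n)"

text \<open>The measure \<open>B \<mapsto> \<integral>\<^sub>B \<omega>\<^sup>n\<close> of a positive (1,1)-form: the Borel measure that has density
  \<open>top_power \<omega>\<close> with respect to Lebesgue measure in every chart.\<close>

definition volume_measure ::
  "('m::topological_space, 'n::finite) chart set \<Rightarrow> ('m, 'n) two_form \<Rightarrow> 'm measure" where
  "volume_measure A \<omega> =
     (THE \<mu>. sets \<mu> = sets borel \<and>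
        (\<forall>c\<in>A. \<forall>B\<in>sets borel. B \<subseteq> dom_chart c \<longrightarrow>
           emeasure \<mu> B =
           (\<integral>\<^sup>+y\<in>coord c ` B. ennreal (top_power (\<omega> c (inv_coord c y))) \<partial>lborel)))"

definition p_entropy ::
  "('m::topological_space, 'n::finite) chart set \<Rightarrow> ('m, 'n) two_form \<Rightarrow> real \<Rightarrow>
   ('m \<Rightarrow> real) \<Rightarrow> ennreal" where
  "p_entropy A \<omega> p F =
     (\<integral>\<^sup>+x. ennreal (\<bar>F x\<bar> powr p * exp (real CARD('n) * F x)) \<partial>volume_measure A \<omega>)"

definition normalized ::
  "('m::topological_space, 'n::finite) chart set \<Rightarrow> ('m, 'n) two_form \<Rightarrow>
   ('m \<Rightarrow> real \<Rightarrow> real) \<Rightarrow> 'm \<Rightarrow> real \<Rightarrow> real" where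
  "normalized A \<omega> \<phi> x t =
     \<phi> x t - (1 / measure (volume_measure A \<omega>) UNIV) * (\<integral>x. \<phi> x t \<partial>volume_measure A \<omega>)"

definition Linf_norm :: "'a measure \<Rightarrow> ('a \<Rightarrow> real) \<Rightarrow> ereal" where
  "Linf_norm M f = esssup M (\<lambda>x. ereal \<bar>f x\<bar>)"


section \<open>The flow\<close>

definition time_interval :: "ereal \<Rightarrow> real set" where
  "time_interval T = {t. 0 \<le> t \<and> ereal t < T}"

text \<open>The quotient of the two top-degree forms is the quotient of their coefficients in any chart
  around the point.\<close>

definition C2_flow_solution ::
  "('m::topological_space, 'n::finite) chart set \<Rightarrow> ('m, 'n) two_form \<Rightarrow> ('m \<Rightarrow> real) \<Rightarrow>
   ('m \<Rightarrow> real) \<Rightarrow> ereal \<Rightarrow> ('m \<Rightarrow> real \<Rightarrow> real) \<Rightarrow> bool" where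
  "C2_flow_solution A \<omega> F \<phi>\<^sub>0 T \<phi> \<longleftrightarrow>
     (\<forall>c\<in>A. Ck_on 2 (\<lambda>(y, t). \<phi> (inv_coord c y) t) (img_chart c \<times> time_interval T)) \<and>
     (\<forall>t\<in>time_interval T. positive_form A (omega_pot \<omega> (\<lambda>x. \<phi> x t))) \<and>
     (\<forall>c\<in>A. \<forall>x\<in>dom_chart c. \<forall>t\<in>time_interval T.
        (\<phi> x has_real_derivative
           ln (top_power (omega_pot \<omega> (\<lambda>x. \<phi> x t) c x) /
               (exp (real CARD('n) * F x) * top_power (\<omega> c x))))
        (at t within time_interval T)) \<and>
     (\<forall>x. \<phi> x 0 = \<phi>\<^sub>0 x)"

end

(* Comparing phi(lambda t)/lambda with
   phi(t) and letting lambda -> 1 gives t phi_t <= phi + n t + B, so for small times phi_t <= n where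
   phi is very negative, and later phi_t is bounded above. Hence the Monge-Ampere measure of phi(t) is
   at most C e^(nF) omega_0^n near the minimum of phi(t), and an elliptic estimate bounds the
   oscillation at each fixed time. For that estimate, the sublevel sets of phi(t) + c|z|^2 in a chart
   around the minimum have volume decaying exponentially in (mass)^(-1/n) (comparison with log|z| via
   integration by parts), so the entropy bound with p > n makes De Giorgi's iteration work; the
   resulting lower mass bound contradicts a large oscillation because sup phi - phi is bounded in L^1. *)

theory Submission
  imports Defs
begin

section \<open>Linear algebra of (1,1)-forms\<close>

text \<open>A C^2 potential gives a form \<open>omega_pot\<close> with merely continuous
  coefficients, which has no exterior derivative. Closedness is therefore tested against gradients
  of bumps (\<open>weakly_closed\<close>), and integration by parts reaches such forms by
  mollification. For the volume decay no pointwise bound of the Laplacian is available. Averaging a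
  truncated potential over translates by points of the sublevel set itself gives a function whose
  Laplacian is bounded below by minus the total trace mass; a mean value inequality for it at radius
  exp (1 - L) then bounds the volume of that set by a multiple of exp (-2 L). In the scaling
  comparison F cancels because it does not depend on time. The resulting bound for the time
  derivative is useful only with an upper bound for the solution on [0,2]. That bound is where K
  enters: the integral of log (\<open>omega_pot\<close>^n / \<open>omg\<close>^n) is controlled by
  an integrated trace, so the mean of the solution grows at a bounded rate. From time 2 on, a shift
  in time replaces the scaling and carries the bound over [1,2] forward, so no constant depends on
  T.\<close>

abbreviation J :: "complex ^ 'n => complex ^ 'n::finite" where
 "J u == \<i> *s u"

definition std_form :: "complex ^ 'n::finite => complex ^ 'n => real" where
 "std_form u v = J u \<bullet> v"

lemma J_J [simp]: "J (J u) = - u"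
 by (simp add: vec_eq_iff)

lemma J_linear: "linear J"
 by (rule linearI) (simp_all add: vec_eq_iff algebra_simps scaleR_conv_of_real)

lemma J_scaleR [simp]: "J (c *\<^sub>R u) = c *\<^sub>R J u"
 and J_add [simp]: "J (u + v) = J u + J v"
 and J_diff [simp]: "J (u - v) = J u - J v"
 and J_minus [simp]: "J (- u) = - J u"
 and J_zero [simp]: "J 0 = 0"
 by (auto simp: linear_add[OF J_linear] linear_scale[OF J_linear] linear_diff[OF J_linear]
   linear_neg[OF J_linear] linear_0[OF J_linear])

lemma inner_J_J [simp]: "J u \<bullet> J v = u \<bullet> v"
 by (simp add: inner_vec_def inner_complex_def algebra_simps)

lemma inner_J_swap: "J u \<bullet> v = - (u \<bullet> J v)"
 using inner_J_J[of u "J v"] by simp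

lemma norm_J [simp]: "norm (J u) = norm u"
 by (simp add: norm_eq_sqrt_inner)

lemma inner_J_self [simp]: "J u \<bullet> u = 0" "u \<bullet> J u = 0"
 using inner_J_swap[of u u] by (simp_all add: inner_commute)

lemma std_form_J [simp]: "std_form u (J v) = u \<bullet> v"
 by (simp add: std_form_def)

lemma inner_real_frame: "real_frame a \<bullet> real_frame b = (if a = b then 1 else 0)"
 by (cases a; cases b) (auto simp: real_frame_def inner_axis_axis inner_complex_def)

lemma inj_real_frame: "inj real_frame"
 by (rule injI) (metis inner_real_frame zero_neq_one)

lemma Basis_real_frame: "(Basis :: (complex ^ 'n::finite) set) = range real_frame"
proof -
 have "Basis = (\<Union>i. \<Union>u\<in>{1, \<i>}. {axis i u :: complex ^ 'n})"
  by (simp add: Basis_vec_def Basis_complex_def)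
 also have "... = range real_frame"
 proof (intro equalityI subsetI)
  fix x :: "complex ^ 'n" assume "x \<in> (\<Union>i. \<Union>u\<in>{1, \<i>}. {axis i u})"
  then obtain i where "x = real_frame (i, False) | x = real_frame (i, True)"
   by (auto simp: real_frame_def)
  then show "x \<in> range real_frame" by auto
 qed (auto simp: real_frame_def)
 finally show ?thesis .
qed

lemma real_frame_expansion:
 fixes v :: "complex ^ 'n::finite"
 shows "(\<Sum>c\<in>UNIV. (v \<bullet> real_frame c) *\<^sub>R real_frame c) = v"
proof -
 have "(\<Sum>b\<in>Basis. (v \<bullet> b) *\<^sub>R b) = v" by (rule euclidean_representation)
 then show ?thesis
  by (simp add: Basis_real_frame sum.reindex[OF inj_real_frame] o_def)
qed

lemma std_form_real_frame:
 "std_form (real_frame a) (real_frame b) =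
  (if fst a = fst b then (if ~ snd a & snd b then 1 else if snd a & ~ snd b then -1 else 0) else 0)"
proof -
 have "J (real_frame a) = (if snd a then - real_frame (fst a, False) else real_frame (fst a, True))"
  by (auto simp: real_frame_def vec_eq_iff axis_def)
 then show ?thesis
  by (cases a; cases b) (auto simp: std_form_def inner_real_frame)
qed

text \<open>The real determinant, not the complex one: it is the factor by which top forms and
  Lebesgue measure change under \<open>B\<close>.\<close>

definition det_frame :: "(complex ^ 'n::finite => complex ^ 'n) => real" where
 "det_frame B = det ((\<chi> c a. B (real_frame a) \<bullet> real_frame c) :: real ^ ('n \<times> bool) ^ ('n \<times> bool))"

lemma prod_double_sum:
 fixes h :: "'n::finite => 'a::finite => 'a => real"
 shows "(\<Prod>j\<in>UNIV. \<Sum>c\<in>UNIV. \<Sum>d\<in>UNIV. h j c d) =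
  (\<Sum>g\<in>UNIV. \<Prod>j\<in>UNIV. h j (g (j, False)) (g (j, True)))"
proof -
 have "(\<Prod>j\<in>UNIV. \<Sum>c\<in>UNIV. \<Sum>d\<in>UNIV. h j c d) = (\<Prod>j\<in>UNIV. \<Sum>x\<in>UNIV. h j (fst x) (snd x))"
  by (simp add: sum.cartesian_product case_prod_unfold)
 also have "... = (\<Sum>f\<in>PiE UNIV (%_. UNIV). \<Prod>j\<in>UNIV. h j (fst (f j)) (snd (f j)))"
  by (rule prod_sum_PiE) auto
 also have "... = (\<Sum>g\<in>UNIV. \<Prod>j\<in>UNIV. h j (g (j, False)) (g (j, True)))"
  by (rule sum.reindex_bij_witness[where i="%g j. (g (j, False), g (j, True))"
     and j="%f (j, b). if b then snd (f j) else fst (f j)"]) (auto simp: fun_eq_iff)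
 finally show ?thesis .
qed

lemma prod_pairs:
 fixes m :: "'n::finite \<times> bool => real"
 shows "(\<Prod>j\<in>UNIV. m (j, False) * m (j, True)) = (\<Prod>i\<in>UNIV. m i)"
proof -
 have "(\<Prod>i\<in>UNIV. m i) = (\<Prod>j\<in>UNIV. \<Prod>b\<in>UNIV. m (j, b))"
  by (subst UNIV_Times_UNIV[symmetric], subst prod.cartesian_product) (simp add: case_prod_unfold)
 then show ?thesis by (simp add: UNIV_bool mult.commute)
qed

lemma bilinear_real_frame:
 fixes bt :: "complex ^ 'n::finite => complex ^ 'n => real"
 assumes "bilinear bt"
 shows "bt u v = (\<Sum>c\<in>UNIV. \<Sum>d\<in>UNIV. (u \<bullet> real_frame c) * (v \<bullet> real_frame d) *
     bt (real_frame c) (real_frame d))"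
proof -
 have "bt u v = bt (\<Sum>c\<in>UNIV. (u \<bullet> real_frame c) *\<^sub>R real_frame c) (\<Sum>c\<in>UNIV. (v \<bullet> real_frame c) *\<^sub>R real_frame c)"
  by (simp add: real_frame_expansion)
 also have "... = (\<Sum>(c,d)\<in>UNIV\<times>UNIV. bt ((u \<bullet> real_frame c) *\<^sub>R real_frame c) ((v \<bullet> real_frame d) *\<^sub>R real_frame d))"
  by (rule bilinear_sum[OF assms])
 also have "... = (\<Sum>c\<in>UNIV. \<Sum>d\<in>UNIV. (u \<bullet> real_frame c) * (v \<bullet> real_frame d) *
     bt (real_frame c) (real_frame d))"
  by (subst sum.cartesian_product[symmetric]) (simp add: bilinear_lmul[OF assms] bilinear_rmul[OF assms] mult_ac)
 finally show ?thesis .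
qed

lemma permutes_UNIV_bij: "p permutes UNIV \<longleftrightarrow> bij p"
 using permutes_bij by (auto simp: bij_iff permutes_def)

text \<open>Expanding every factor in the frame turns the product into a sum over all maps
  \<open>g\<close> of the index set. The sum over \<open>ss\<close> is then a determinant whose rows
  are selected by \<open>g\<close>; it vanishes unless \<open>g\<close> is a permutation, and
  otherwise it is the sign of \<open>g\<close> times \<open>det_frame B\<close>.\<close>

lemma top_power_linear_image:
 fixes bt :: "complex ^ 'n::finite => complex ^ 'n => real"
 assumes bt: "bilinear bt"
 shows "top_power (%u v. bt (B u) (B v)) = det_frame B * top_power bt"
proof -
 let ?P = "{ss. ss permutes (UNIV :: ('n \<times> bool) set)}"
 define m :: "'n \<times> bool => 'n \<times> bool => real" where "m c a = B (real_frame a) \<bullet> real_frame c" for c a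
 define M :: "real ^ ('n \<times> bool) ^ ('n \<times> bool)" where "M = (\<chi> c a. m c a)"
 define b where "b c d = bt (real_frame c) (real_frame d)" for c d
 have D: "det_frame B = det M" by (simp add: det_frame_def M_def m_def)
 have dg: "(\<Sum>ss\<in>?P. of_int (sign ss) * (\<Prod>i\<in>UNIV. m (g i) (ss i))) = det (\<chi> i. M $ g i)" for g
  by (simp add: det_def M_def)
 have dg0: "det (\<chi> i. M $ g i) = 0" if "g ~: ?P" for g
 proof -
  have "~ inj g"
   using that by (auto simp: permutes_UNIV_bij bij_def finite_UNIV_inj_surj)
  then obtain i j where "i ~= j" "g i = g j" unfolding inj_def by blast
  then show ?thesis
   by (intro det_identical_rows[of i j]) (auto simp: row_def)
 qed
 have "(\<Sum>ss\<in>?P. of_int (sign ss) * (\<Prod>j\<in>UNIV. bt (B (real_frame (ss (j, False)))) (B (real_frame (ss (j, True))))))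
  = (\<Sum>ss\<in>?P. of_int (sign ss) * (\<Sum>g\<in>UNIV. \<Prod>j\<in>UNIV. m (g (j, False)) (ss (j, False)) * m (g (j, True)) (ss (j, True)) * b (g (j, False)) (g (j, True))))"
  unfolding bilinear_real_frame[OF bt, of "B _" "B _"]
  by (subst prod_double_sum) (simp add: m_def b_def)
 also have "... = (\<Sum>ss\<in>?P. \<Sum>g\<in>UNIV. (\<Prod>j\<in>UNIV. b (g (j, False)) (g (j, True))) * (of_int (sign ss) * (\<Prod>i\<in>UNIV. m (g i) (ss i))))"
  unfolding prod.distrib[of _ "%j. b _ _"]
  by (subst prod.distrib) (simp add: prod_pairs[symmetric, of "%i. m (_ i) (_ i)"] sum_distrib_left mult_ac)
 also have "... = (\<Sum>g\<in>UNIV. (\<Prod>j\<in>UNIV. b (g (j, False)) (g (j, True))) * det (\<chi> i. M $ g i))"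
  by (subst sum.swap) (simp add: dg sum_distrib_left[symmetric])
 also have "... = (\<Sum>g\<in>?P. (\<Prod>j\<in>UNIV. b (g (j, False)) (g (j, True))) * det (\<chi> i. M $ g i))"
  by (rule sum.mono_neutral_right) (auto simp: dg0)
 also have "... = (\<Sum>g\<in>?P. (\<Prod>j\<in>UNIV. b (g (j, False)) (g (j, True))) * (of_int (sign g) * det M))"
  by (intro sum.cong refl) (simp add: det_permute_rows)
 also have "... = det M * (\<Sum>g\<in>?P. of_int (sign g) * (\<Prod>j\<in>UNIV. b (g (j, False)) (g (j, True))))"
  by (simp add: sum_distrib_left mult_ac)
 finally show ?thesis
  by (simp add: top_power_def D b_def)
qed

text \<open>The permutation acts in the same way on two copies of the index set, so every
  transposition occurs twice and the signs cancel.\<close>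

lemma sign_map_prod_id:
 assumes "\<kappa> permutes (UNIV :: 'n::finite set)"
 shows "map_prod \<kappa> id permutes (UNIV :: ('n \<times> bool) set) & sign (map_prod \<kappa> id :: 'n \<times> bool => _) = 1"
 using assms finite_class.finite_UNIV
proof (induction rule: permutes_induct)
 case id then show ?case by (simp only: map_prod.id permutes_id sign_id simp_thms)
next
 case (swap a b p)
 have eq: "map_prod (Transposition.transpose a b o p) id = Transposition.transpose (a, False) (b, False) o 
   (Transposition.transpose (a, True) (b, True) o (map_prod p id :: 'n \<times> bool => _))"
  by (auto simp: fun_eq_iff Transposition.transpose_def)
 have P: "permutation (map_prod p id :: 'n \<times> bool => _)"
  unfolding permutation_permutes using swap.IH finite by blast
 have T: "permutation (Transposition.transpose (a, c) (b, c))" "sign (Transposition.transpose (a, c) (b, c)) = -1"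
  "Transposition.transpose (a, c) (b, c) permutes UNIV" for c :: bool
  using swap by (auto simp: permutation_swap_id sign_swap_id intro: permutes_swap_id)
 show ?case unfolding eq using swap
  by (auto simp only: sign_compose[OF T(1) permutation_compose[OF T(1) P]] sign_compose[OF T(1) P] T
    intro!: permutes_compose[OF permutes_compose[OF _ T(3)] T(3)])
qed

definition flips :: "'n set => 'n \<times> bool => 'n \<times> bool" where
 "flips s x = (if fst x \<in> s then (fst x, ~ snd x) else x)"

lemma sign_flips:
 fixes s :: "'n::finite set"
 shows "flips s permutes UNIV & of_int (sign (flips s)) = (\<Prod>j\<in>UNIV. if j \<in> s then -1 else (1::real))"
proof (induction s rule: finite_induct[OF finite])
 case 1
 have "flips ({} :: 'n set) = id" by (auto simp: flips_def fun_eq_iff)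
 then show ?case by (simp add: permutes_id[unfolded id_def])
next
 case (2 x s)
 have eq: "flips (insert x s) = Transposition.transpose (x, False) (x, True) o flips s"
  using 2 by (auto simp: flips_def fun_eq_iff Transposition.transpose_def)
 have P: "permutation (flips s)"
  unfolding permutation_permutes using 2 finite by blast
 have "(\<Prod>j\<in>UNIV. if j \<in> insert x s then -1 else (1::real)) = (-1) * (\<Prod>j\<in>UNIV-{x}. if j \<in> insert x s then -1 else 1)"
  by (subst prod.remove[of _ x]) auto
 also have "(\<Prod>j\<in>UNIV-{x}. if j \<in> insert x s then -1 else (1::real)) = (\<Prod>j\<in>UNIV-{x}. if j \<in> s then -1 else 1)"
  by (rule prod.cong) auto
 also have "... = (\<Prod>j\<in>UNIV. if j \<in> s then -1 else 1)"
  using 2 by (subst prod.remove[of UNIV x]) auto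
 finally have e: "(\<Prod>j\<in>UNIV. if j \<in> insert x s then -1 else (1::real)) = - (\<Prod>j\<in>UNIV. if j \<in> s then -1 else 1)"
  by simp
 have T: "permutation (Transposition.transpose (x, False) (x, True))" "sign (Transposition.transpose (x, False) (x, True)) = -1"
  "Transposition.transpose (x, False) (x, True) permutes UNIV"
  by (auto simp: permutation_swap_id sign_swap_id intro: permutes_swap_id)
 show ?case unfolding eq e sign_compose[OF T(1) P] T using permutes_compose[OF _ T(3)] 2 by (simp add: o_def)
qed

text \<open>Only permutations that map every pair (j, False), (j, True) to such a pair contribute.
  Up to flips inside the pairs, such a permutation acts equally on both members, hence is even, so
  its sign cancels the signs of its factors. No term is negative, and the identity contributes
  1.\<close>

lemma top_power_std_form_pos: "top_power (std_form :: complex ^ 'n::finite => _) > 0"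
proof -
 let ?P = "{ss. ss permutes (UNIV :: ('n \<times> bool) set)}"
 let ?S = "%ss. of_int (sign ss) * (\<Prod>j\<in>UNIV. std_form (real_frame (ss (j, False)) :: complex ^ 'n) (real_frame (ss (j, True))))"
 have nn: "?S ss >= 0" if ss: "ss permutes UNIV" for ss :: "'n \<times> bool => _"
 proof (cases "(\<Prod>j\<in>UNIV. std_form (real_frame (ss (j, False)) :: complex ^ 'n) (real_frame (ss (j, True)))) = 0")
  case False
  then have nz: "std_form (real_frame (ss (j, False)) :: complex ^ 'n) (real_frame (ss (j, True))) ~= 0" for j
   by simp
  then have fs: "fst (ss (j, False)) = fst (ss (j, True))" "snd (ss (j, False)) = (~ snd (ss (j, True)))" for j
   unfolding std_form_real_frame by (metis (full_types))+
  \<comment> \<open>The pairs that \<open>ss\<close> reverses; flipping exactly these leaves a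
    permutation that acts on the first components only.\<close>
  define s where "s = {j. snd (ss (j, False))}"
  define ta where "ta = flips s"
  define \<kappa> where "\<kappa> j = fst (ss (j, False))" for j
  have ta: "ta permutes UNIV" "of_int (sign ta) = (\<Prod>j\<in>UNIV. if j \<in> s then -1 else (1::real))"
   using sign_flips[of s] by (auto simp: ta_def)
  have ssta: "ss o ta = map_prod \<kappa> id"
  proof
   fix x :: "'n \<times> bool"
   obtain j b where x: "x = (j, b)" by force
   show "(ss o ta) x = map_prod \<kappa> id x"
    using fs[of j] by (cases b) (auto simp: x ta_def flips_def s_def \<kappa>_def prod_eq_iff)
  qed
  have "bij (ss o ta)" using ss ta(1) by (meson bij_comp permutes_bij)
  then have "surj (map_prod \<kappa> id :: 'n \<times> bool => _)" unfolding ssta by (rule bij_is_surj)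
  then have "surj \<kappa>" 
   by (metis (no_types, opaque_lifting) fst_conv fst_map_prod surj_def)
  then have "\<kappa> permutes UNIV"
   by (simp add: permutes_UNIV_bij finite_UNIV_surj_inj bij_def)
  then have "sign (ss o ta) = 1" unfolding ssta using sign_map_prod_id by blast
  then have "sign ss * sign ta = 1"
   using ss ta(1) by (subst (asm) sign_compose) (auto simp: permutation_permutes)
  then have "sign ss = sign ta"
   using sign_cases[of ss] sign_cases[of ta] by fastforce
  moreover have "(\<Prod>j\<in>UNIV. std_form (real_frame (ss (j, False)) :: complex ^ 'n) (real_frame (ss (j, True)))) = (\<Prod>j\<in>UNIV. if j \<in> s then -1 else (1::real))"
   by (intro prod.cong refl) (use fs nz in \<open>auto simp: std_form_real_frame s_def\<close>)
  ultimately have "?S ss = of_int (sign ta) * of_int (sign ta)" using ta(2) by simp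
  then show ?thesis by simp
 next
  case True then show ?thesis by (simp only: mult_zero_right order_refl)
 qed
 have "?S id = 1" by (simp add: std_form_real_frame)
 moreover have "?S id <= (\<Sum>ss\<in>?P. ?S ss)"
  by (rule member_le_sum) (auto simp: nn permutes_id[unfolded id_def] finite_permutations)
 ultimately show ?thesis by (simp add: top_power_def)
qed

definition diag_form :: "('n => real) => complex ^ 'n::finite => complex ^ 'n => real" where
 "diag_form l u v = std_form (\<chi> j. l j *\<^sub>R u $ j) v"

text \<open>In a nonzero term both members of a pair go to the same first component, so the first
  components run through all indices once and every \<open>l j\<close> occurs exactly once.\<close>

lemma top_power_diag_form:
 "top_power (diag_form l :: complex ^ 'n::finite => _) = (\<Prod>j\<in>UNIV. l j) * top_power (std_form :: complex ^ 'n => _)"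
proof -
 let ?s = "%a b. std_form (real_frame a :: complex ^ 'n) (real_frame b)"
 have d: "diag_form l (real_frame a) (real_frame b) = l (fst a) * ?s a b" for a b
 proof -
  have "(\<chi> j. l j *\<^sub>R (real_frame a :: complex ^ 'n) $ j) = l (fst a) *\<^sub>R real_frame a"
   by (auto simp: vec_eq_iff real_frame_def axis_def)
  then show ?thesis by (simp add: diag_form_def std_form_def)
 qed
 have "(\<Prod>j\<in>UNIV. l (fst (ss (j, False))) * ?s (ss (j, False)) (ss (j, True)))
  = (\<Prod>j\<in>UNIV. l j) * (\<Prod>j\<in>UNIV. ?s (ss (j, False)) (ss (j, True)))" if ss: "ss permutes UNIV" for ss :: "'n \<times> bool => _"
 proof (cases "(\<Prod>j\<in>UNIV. ?s (ss (j, False)) (ss (j, True))) = 0")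
  case False
  then have nz: "?s (ss (j, False)) (ss (j, True)) ~= 0" for j
   by simp
  then have fs: "fst (ss (j, False)) = fst (ss (j, True))" for j
   unfolding std_form_real_frame by (metis (full_types))
  have "surj (%j. fst (ss (j, False)))"
   unfolding surj_def
  proof
   fix y
   obtain j b where "ss (j, b) = (y, False)" using permutes_surj[OF ss] by (metis surj_def surj_pair)
   then show "\<exists>x. y = fst (ss (x, False))" using fs[of j] by (cases b) (auto intro!: exI[of _ j])
  qed
  then have "bij (%j. fst (ss (j, False)))" by (simp add: finite_UNIV_surj_inj bij_def)
  then have "(\<Prod>j\<in>UNIV. l (fst (ss (j, False)))) = (\<Prod>j\<in>UNIV. l j)"
   by (rule prod.reindex_bij_betw)
  then show ?thesis by (simp add: prod.distrib)
 qed (simp add: prod.distrib)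
 then show ?thesis
  by (simp add: top_power_def d sum_distrib_left mult_ac)
qed

text \<open>A real (1,1)-form at one point; \<open>bt u (J v)\<close> is the associated symmetric
  bilinear form.\<close>

definition herm_form :: "(complex ^ 'n::finite => complex ^ 'n => real) => bool" where
 "herm_form bt \<longleftrightarrow> bilinear bt & (\<forall>u v. bt u v = - bt v u) & (\<forall>u v. bt (J u) (J v) = bt u v)"

definition pos_form :: "(complex ^ 'n::finite => complex ^ 'n => real) => bool" where
 "pos_form bt \<longleftrightarrow> herm_form bt & (\<forall>u. u ~= 0 --> bt u (J u) > 0)"

lemma herm_formD:
 assumes "herm_form bt"
 shows "bilinear bt" "bt u v = - bt v u" "bt (J u) (J v) = bt u v" "bt u u = 0"
  "bt (J u) v = - bt u (J v)" "bt u (J v) = bt v (J u)"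
proof -
 show b: "bilinear bt" and a: "bt u v = - bt v u" and j: "bt (J u) (J v) = bt u v" for u v
  using assms unfolding herm_form_def by blast+
 show "bt u u = 0" using a[of u u] by simp
 show c: "bt (J u) v = - bt u (J v)" for u v
  using j[of u "J v"] by (simp add: bilinear_rneg[OF b])
 show "bt u (J v) = bt v (J u)"
  using a[of u "J v"] c[of v u] by linarith
qed

lemmas herm_simps = bilinear_ladd[OF herm_formD(1)] bilinear_radd[OF herm_formD(1)]
 bilinear_lmul[OF herm_formD(1)] bilinear_rmul[OF herm_formD(1)] bilinear_lneg[OF herm_formD(1)]
 bilinear_rneg[OF herm_formD(1)] bilinear_lzero[OF herm_formD(1)] bilinear_rzero[OF herm_formD(1)]

lemma herm_form_comb:
 assumes bt: "herm_form bt" and \<gamma>: "herm_form \<gamma>"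
 shows "herm_form (%u v. a * bt u v + b * \<gamma> u v)"
proof -
 note [simp] = herm_simps[OF bt] herm_simps[OF \<gamma>]
 have "a * bt u v + b * \<gamma> u v = - (a * bt v u + b * \<gamma> v u)" for u v
  using herm_formD(2)[OF bt, of u v] herm_formD(2)[OF \<gamma>, of u v] by simp
 moreover have "bilinear (%u v. a * bt u v + b * \<gamma> u v)"
  unfolding bilinear_def
  by (auto intro!: linearI simp: algebra_simps)
 ultimately show ?thesis
  unfolding herm_form_def herm_formD(3)[OF bt] herm_formD(3)[OF \<gamma>] by blast
qed

lemma std_form_pos: "pos_form (std_form :: complex ^ 'n::finite => _)"
proof -
 have "std_form u v = - std_form v u" for u v :: "complex ^ 'n"
  unfolding std_form_def by (subst inner_J_swap) (simp add: inner_commute)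
 moreover have "bilinear (std_form :: complex ^ 'n => _)"
  by (auto simp: bilinear_def std_form_def inner_add_left inner_add_right intro!: linearI)
 moreover have "std_form (J u) (J v) = std_form u v" "u ~= 0 ==> std_form u (J u) > 0" for u v :: "complex ^ 'n"
  by (simp_all add: std_form_def inner_J_swap[of u v])
 ultimately show ?thesis
  unfolding pos_form_def herm_form_def by blast
qed

lemma pos_form_add_nonneg:
 assumes "pos_form bt" "herm_form \<gamma>" "!!u. \<gamma> u (J u) >= 0"
 shows "pos_form (%u v. bt u v + \<gamma> u v)"
 using herm_form_comb[of bt \<gamma> 1 1] assms
 by (auto simp: pos_form_def intro!: add_pos_nonneg)

lemma pos_form_convex:
 assumes "pos_form bt" "pos_form \<gamma>" "0 <= t" "t <= 1"
 shows "pos_form (%u v. (1 - t) * bt u v + t * \<gamma> u v)"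
proof -
 have "(1 - t) * bt u (J u) + t * \<gamma> u (J u) > 0" if "u ~= 0" for u
 proof (cases "t = 0")
  case False
  have "bt u (J u) > 0" "\<gamma> u (J u) > 0" using assms that by (auto simp: pos_form_def)
  then have "(1 - t) * bt u (J u) >= 0" "t * \<gamma> u (J u) > 0" using assms False by auto
  then show ?thesis by linarith
 qed (use assms that in \<open>auto simp: pos_form_def\<close>)
 then show ?thesis
  using herm_form_comb[of bt \<gamma> "1-t" t] assms by (auto simp: pos_form_def)
qed

lemma pos_form_scale:
 assumes "pos_form bt" "c > 0"
 shows "pos_form (%u v. c * bt u v)"
 using herm_form_comb[of bt bt c 0] assms by (auto simp: pos_form_def)

lemma complex_scale_eq:
 fixes b :: "complex ^ 'n::finite"
 shows "c *s b = Re c *\<^sub>R b + Im c *\<^sub>R J b"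
 by (auto simp: vec_eq_iff complex_eq_iff)

lemma herm_form_scale_pair:
 assumes "herm_form bt"
 shows "bt (c *s a) (d *s b) = (Re c * Re d + Im c * Im d) * bt a b + (Re c * Im d - Im c * Re d) * bt a (J b)"
 unfolding complex_scale_eq[of c] complex_scale_eq[of d]
 by (simp add: bilinear_ladd[OF herm_formD(1)[OF assms]] bilinear_radd[OF herm_formD(1)[OF assms]]
   bilinear_lmul[OF herm_formD(1)[OF assms]] bilinear_rneg[OF herm_formD(1)[OF assms]] bilinear_rmul[OF herm_formD(1)[OF assms]]
   herm_formD(3)[OF assms] herm_formD(5)[OF assms] algebra_simps)

lemma diag_form_eq:
 "diag_form l u v = (\<Sum>j\<in>UNIV. l j * (Re (u $ j) * Im (v $ j) - Im (u $ j) * Re (v $ j)))"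
 by (auto simp: diag_form_def std_form_def inner_vec_def inner_complex_def algebra_simps intro!: sum.cong)

lemma std_form_eq_diag: "std_form = diag_form (%_. 1)"
 by (auto simp: diag_form_def fun_eq_iff)

lemma linear_functional_inner:
 fixes f :: "'a::euclidean_space => real"
 assumes "linear f"
 shows "f v = (\<Sum>b\<in>Basis. f b *\<^sub>R b) \<bullet> v"
proof -
 have "f v = f (\<Sum>b\<in>Basis. (v \<bullet> b) *\<^sub>R b)" by (simp add: euclidean_representation)
 also have "... = (\<Sum>b\<in>Basis. (v \<bullet> b) * f b)"
  by (simp add: linear_sum[OF assms] linear_scale[OF assms])
 finally show ?thesis by (simp add: inner_sum_left inner_commute[of v] mult.commute)
qed

lemma common_kernel_nontrivial:
 fixes f :: "'i => 'a::euclidean_space => real"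
 assumes "finite I" "card I < DIM('a)" "!!i. i \<in> I ==> linear (f i)"
 shows "\<exists>v. v ~= 0 & (\<forall>i\<in>I. f i v = 0)"
proof -
 define r where "r i = (\<Sum>b\<in>Basis. f i b *\<^sub>R b)" for i
 have "dim (r ` I) <= card (r ` I)" by (rule dim_le_card') (use assms in auto)
 also have "... <= card I" by (rule card_image_le[OF assms(1)])
 finally have "dim (r ` I) < DIM('a)" using assms by simp
 then obtain x where x: "x ~= 0" "!!y. y \<in> span (r ` I) ==> orthogonal x y"
  by (rule orthogonal_to_subspace_exists) blast
 have "f i x = 0" if "i \<in> I" for i
  using x(2)[of "r i"] linear_functional_inner[OF assms(3)[OF that], of x] that
  by (auto simp: orthogonal_def r_def inner_commute span_base)
 then show ?thesis using x by auto
qed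

lemma bilinear_continuous:
 fixes bt :: "'a::euclidean_space => 'b::euclidean_space => real"
 assumes "bilinear bt" "continuous_on S f" "continuous_on S g"
 shows "continuous_on S (%x. bt (f x) (g x))"
 by (rule bounded_bilinear.continuous_on[OF _ assms(2,3)])
  (use assms(1) bilinear_conv_bounded_bilinear in blast)

lemma J_continuous: "continuous_on S f ==> continuous_on S (%x. J (f x))"
 by (rule bounded_linear.continuous_on[OF linear_conv_bounded_linear[THEN iffD1, OF J_linear]])

text \<open>One step of the simultaneous diagonalisation: a maximiser of the Rayleigh quotient of \<open>Y\<close>
 relative to \<open>X\<close> on a subspace is orthogonal, for both forms, to the rest of the subspace.\<close>

lemma rayleigh_maximiser:
 fixes X Y :: "complex ^ 'n::finite => complex ^ 'n => real"
 assumes X: "pos_form X" and Y: "herm_form Y"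
  and W: "subspace W" "!!v. v \<in> W ==> J v \<in> W" "\<exists>v\<in>W. v ~= 0"
 shows "\<exists>v\<in>W. X v (J v) = 1 & (\<forall>w\<in>W. X v w = 0 & X v (J w) = 0 --> Y v w = 0 & Y v (J w) = 0)"
proof -
 have Xh: "herm_form X" and Xp: "!!u. u ~= 0 ==> X u (J u) > 0" using X by (auto simp: pos_form_def)
 define q where "q v = Y v (J v) / X v (J v)" for v
 let ?S = "W Int sphere 0 1"
 have "compact ?S" by (intro closed_Int_compact closed_subspace W) simp
 moreover obtain v0 where v0: "v0 \<in> W" "v0 ~= 0" using W(3) by blast
 then have "(1 / norm v0) *\<^sub>R v0 \<in> ?S" by (auto simp: subspace_scale[OF W(1)])
 then have "?S ~= {}" by blast
 moreover have "continuous_on ?S q"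
  unfolding q_def
 proof (rule continuous_on_divide)
  show "continuous_on ?S (%v. Y v (J v))" "continuous_on ?S (%v. X v (J v))"
   by (rule bilinear_continuous[OF herm_formD(1)], rule Y Xh, rule continuous_on_id,
     rule J_continuous[OF continuous_on_id])+
  show "\<forall>x\<in>?S. X x (J x) ~= 0"
  proof
   fix x assume "x \<in> ?S"
   then have "x ~= 0" by auto
   from Xp[OF this] show "X x (J x) ~= 0" by simp
  qed
 qed
 ultimately obtain v where v: "v \<in> ?S" "!!w. w \<in> ?S ==> q w <= q v"
  using continuous_attains_sup by metis
 have vn: "v ~= 0" "v \<in> W" using v(1) by auto
 define m where "m = q v"
 note [simp] = herm_simps[OF Xh] herm_simps[OF Y]
 define Z where "Z u w = Y u w - m * X u w" for u w
 have Zh: "herm_form Z" unfolding Z_def using herm_form_comb[OF Y Xh, of 1 "-m"] by simp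
 note [simp] = herm_simps[OF Zh]
 have Zle: "Z w (J w) <= 0" if "w \<in> W" for w
 proof (cases "w = 0")
  case True then show ?thesis by (simp add: bilinear_lzero[OF herm_formD(1)[OF Zh]])
 next
  case False
  let ?c = "1 / norm w"
  have "q (?c *\<^sub>R w) <= m" unfolding m_def
   by (rule v(2)) (use that False in \<open>auto simp: subspace_scale[OF W(1)]\<close>)
  moreover have "q (?c *\<^sub>R w) = q w" using False by (simp add: q_def)
  ultimately have "Y w (J w) <= m * X w (J w)"
   using Xp[OF False] by (simp add: q_def divide_simps)
  then show ?thesis by (simp add: Z_def)
 qed
 have Zv: "Z v (J v) = 0" using Xp[OF vn(1)] by (simp add: Z_def m_def q_def)
 have Z0: "Z v (J w) = 0" if w: "w \<in> W" for w
 proof -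
  have *: "2 * t * Z v (J w) + t * t * Z w (J w) <= 0" for t
  proof -
   have "Z (v + t *\<^sub>R w) (J (v + t *\<^sub>R w)) <= 0"
    by (intro Zle subspace_add subspace_scale W vn w)
   moreover have "Z w (J v) = Z v (J w)" by (rule herm_formD(6)[OF Zh])
   ultimately show ?thesis using Zv by (simp add: algebra_simps)
  qed
  show ?thesis
  proof (rule ccontr)
   assume nz: "Z v (J w) ~= 0"
   define a c where "a = Z v (J w)" and "c = Z w (J w)"
   have c: "c <= 0" using Zle[OF w] by (simp add: c_def)
   \<comment> \<open>This value turns the quadratic in \<open>*\<close> into a^2 (2 - c) / (1 -
     c)^2, which is positive because c <= 0.\<close>
   define t where "t = a / (1 - c)"
   have "2 * t * a + t * t * c = a\<^sup>2 / (1 - c)\<^sup>2 * (2 - c)"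
    using c by (simp add: t_def power2_eq_square divide_simps) (simp add: algebra_simps)
   also have "... > 0" using c nz by (auto simp: a_def intro!: mult_pos_pos divide_pos_pos)
   finally show False using *[of t] by (simp add: a_def c_def)
  qed
 qed
 have Z1: "Z v w = 0" if w: "w \<in> W" for w
  using Z0[OF W(2)[OF w]] by (simp add: bilinear_rneg[OF herm_formD(1)[OF Zh]])
 define s where "s = 1 / sqrt (X v (J v))"
 have s: "s > 0" "s * s * X v (J v) = 1" using Xp[OF vn(1)] by (auto simp: s_def)
 show ?thesis
 proof (intro bexI[of _ "s *\<^sub>R v"] conjI ballI impI; (elim conjE)?)
  show "s *\<^sub>R v \<in> W" by (simp add: vn W subspace_scale)
  show "X (s *\<^sub>R v) (J (s *\<^sub>R v)) = 1" using s by simp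
 next
  fix w assume "w \<in> W" "X (s *\<^sub>R v) w = 0" "X (s *\<^sub>R v) (J w) = 0"
  then show "Y (s *\<^sub>R v) w = 0" "Y (s *\<^sub>R v) (J w) = 0"
   using Z0[of w] Z1[of w] s by (auto simp: Z_def)
 qed
qed

text \<open>Each step takes a Rayleigh maximiser on the complex \<open>X\<close>-orthogonal
  complement of the vectors already found. The third clause quantifies over all \<open>w\<close>
  orthogonal to the vectors up to \<open>i\<close>, because the later frame vectors to which it is
  applied are chosen only afterwards.\<close>

lemma simultaneous_frame:
 fixes X Y :: "complex ^ 'n::finite => complex ^ 'n => real"
 assumes X: "pos_form X" and Y: "herm_form Y" and k: "k <= CARD('n)"
 shows "\<exists>b. (\<forall>i<k. X (b i) (J (b i)) = 1) &
  (\<forall>i<k. \<forall>j<i. X (b j) (b i) = 0 & X (b j) (J (b i)) = 0) &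
  (\<forall>i<k. \<forall>w. (\<forall>j\<le>i. X (b j) w = 0 & X (b j) (J w) = 0) --> Y (b i) w = 0 & Y (b i) (J w) = 0)"
 using k
proof (induction k)
 case 0 show ?case by simp
next
 case (Suc k)
 have Xh: "herm_form X" using X by (auto simp: pos_form_def)
 note [simp] = herm_simps[OF Xh] herm_simps[OF Y]
 obtain b where bb: "(\<forall>i<k. X (b i) (J (b i)) = 1) &
  (\<forall>i<k. \<forall>j<i. X (b j) (b i) = 0 & X (b j) (J (b i)) = 0) &
  (\<forall>i<k. \<forall>w. (\<forall>j\<le>i. X (b j) w = 0 & X (b j) (J w) = 0) --> Y (b i) w = 0 & Y (b i) (J w) = 0)"
  using Suc.IH[OF Suc_leD[OF Suc.prems]] by (rule exE)
 have b: "!!i. i < k ==> X (b i) (J (b i)) = 1"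
  "!!i j. i < k ==> j < i ==> X (b j) (b i) = 0 & X (b j) (J (b i)) = 0"
  "!!i w. i < k ==> (\<forall>j\<le>i. X (b j) w = 0 & X (b j) (J w) = 0) ==> Y (b i) w = 0 & Y (b i) (J w) = 0"
  using bb by (elim conjE, blast)+
 define W where "W = {w. \<forall>j<k. X (b j) w = 0 & X (b j) (J w) = 0}"
 have sub: "subspace W" by (auto simp: W_def subspace_def)
 \<comment> \<open>The complement is cut out by 2k real equations in real dimension 2n, so it is
   nonzero as long as k < n.\<close>
 have "\<exists>v. v ~= 0 & (\<forall>i\<in>{..<k} \<times> UNIV. (%v. if snd i then X (b (fst i)) (J v) else X (b (fst i)) v) v = 0)"
 proof (rule common_kernel_nontrivial)
  show "card ({..<k} \<times> (UNIV::bool set)) < DIM(complex ^ 'n)"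
   using Suc.prems by (simp add: card_cartesian_product)
  show "linear (%v. if snd i then X (b (fst i)) (J v) else X (b (fst i)) v)" for i :: "nat \<times> bool"
   by (auto intro!: linearI)
 qed auto
 then obtain v where v0: "v ~= 0 & (\<forall>i\<in>{..<k} \<times> UNIV. (%v. if snd i then X (b (fst i)) (J v) else X (b (fst i)) v) v = 0)"
  by (rule exE)
 have "X (b j) v = 0" "X (b j) (J v) = 0" if "j < k" for j
  using that bspec[OF conjunct2[OF v0], of "(j, False)"] bspec[OF conjunct2[OF v0], of "(j, True)"]
  by auto
 then have "v \<in> W" by (simp add: W_def)
 then have ne: "\<exists>v\<in>W. v ~= 0" using v0 by blast
 obtain v where v: "v \<in> W" "X v (J v) = 1"
  "!!w. w \<in> W ==> X v w = 0 ==> X v (J w) = 0 ==> Y v w = 0 & Y v (J w) = 0"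
  using rayleigh_maximiser[OF X Y sub _ ne] by (auto simp: W_def)
 define b' where "b' = b(k := v)"
 show ?case
 proof (intro exI[of _ b'] conjI allI impI)
  fix i assume i: "i < Suc k"
  show "X (b' i) (J (b' i)) = 1" using i b(1) v(2) by (cases "i = k") (auto simp: b'_def)
  fix j assume "j < i"
  then show "X (b' j) (b' i) = 0" "X (b' j) (J (b' i)) = 0"
   using i b(2)[of i j] v(1) by (cases "i = k"; auto simp: b'_def W_def)+
 next
  fix i w assume i: "i < Suc k" and w: "\<forall>j\<le>i. X (b' j) w = 0 & X (b' j) (J w) = 0"
  have "Y (b' i) w = 0 & Y (b' i) (J w) = 0"
  proof (cases "i = k")
   case True
   have "X (b j) w = 0 & X (b j) (J w) = 0" if "j < k" for j
    using w[rule_format, of j] True that by (simp add: b'_def)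
   then have "w \<in> W" by (simp add: W_def)
   moreover have "X v w = 0" "X v (J w) = 0" using w[rule_format, of k] True by (simp_all add: b'_def)
   ultimately show ?thesis using v(3) True by (simp add: b'_def)
  next
   case False
   then have "i < k" using i by simp
   moreover have "X (b j) w = 0 & X (b j) (J w) = 0" if "j <= i" for j
    using w[rule_format, of j] \<open>i < k\<close> that by (simp add: b'_def)
   ultimately show ?thesis using b(3)[of i w] False by (simp add: b'_def)
  qed
  then show "Y (b' i) w = 0" "Y (b' i) (J w) = 0" by auto
 qed
qed

text \<open>\<open>B\<close> maps the standard complex basis to the frame. It is complex linear, so
  values on (u, J u) are transported as well, and the \<open>l j\<close> are the eigenvalues of
  \<open>Y\<close> relative to \<open>X\<close>.\<close>

lemma simultaneous_diagonalisation:
 fixes X Y :: "complex ^ 'n::finite => complex ^ 'n => real"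
 assumes X: "pos_form X" and Y: "herm_form Y"
 obtains B :: "complex ^ 'n => complex ^ 'n" and l where "linear B" "!!u. B (J u) = J (B u)" "!!u v. X (B u) (B v) = std_form u v"
  "!!u v. Y (B u) (B v) = diag_form l u v"
proof -
 have Xh: "herm_form X" using X by (auto simp: pos_form_def)
 obtain b where bb: "(\<forall>i<CARD('n). X (b i) (J (b i)) = 1) &
  (\<forall>i<CARD('n). \<forall>j<i. X (b j) (b i) = 0 & X (b j) (J (b i)) = 0) &
  (\<forall>i<CARD('n). \<forall>w. (\<forall>j\<le>i. X (b j) w = 0 & X (b j) (J w) = 0) --> Y (b i) w = 0 & Y (b i) (J w) = 0)"
  using simultaneous_frame[OF X Y order_refl] by (rule exE)
 have b: "!!i. i < CARD('n) ==> X (b i) (J (b i)) = 1"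
  "!!i j. i < CARD('n) ==> j < i ==> X (b j) (b i) = 0 & X (b j) (J (b i)) = 0"
  "!!i w. i < CARD('n) ==> (\<forall>j\<le>i. X (b j) w = 0 & X (b j) (J w) = 0) ==> Y (b i) w = 0 & Y (b i) (J w) = 0"
  using bb by (elim conjE, blast)+
 obtain h :: "'n => nat" where h: "bij_betw h UNIV {..<CARD('n)}"
  using ex_bij_betw_finite_nat[of "UNIV :: 'n set"] by (auto simp: atLeast0LessThan)
 have hl: "h j < CARD('n)" for j using h by (auto simp: bij_betw_def)
 have hi: "h i ~= h j" if "i ~= j" for i j using h that by (auto simp: bij_betw_def inj_def)
 have X0: "X (b i) (b j) = 0 & X (b i) (J (b j)) = 0" if "i < CARD('n)" "j < CARD('n)" "i ~= j" for i j
  using that b(2)[of i j] b(2)[of j i] herm_formD(2,6)[OF Xh, of "b i" "b j"]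
  by (cases "i < j") auto
 have Y1: "Y (b i) (b j) = 0 & Y (b i) (J (b j)) = 0" if "i < j" "j < CARD('n)" for i j
  by (rule b(3)) (use that b(2) in auto)
 have Y0: "Y (b i) (b j) = 0 & Y (b i) (J (b j)) = 0" if "i < CARD('n)" "j < CARD('n)" "i ~= j" for i j
  using that Y1[of i j] Y1[of j i] herm_formD(2,6)[OF Y, of "b i" "b j"]
  by (cases "i < j") auto
 define B where "B u = (\<Sum>j\<in>UNIV. u $ j *s b (h j))" for u :: "complex ^ 'n"
 have lin: "linear B"
 proof (rule linearI)
  show "B (u + v) = B u + B v" for u v
   by (simp add: B_def vector_sadd_rdistrib sum.distrib)
  have "(r *\<^sub>R c) *s v = r *\<^sub>R (c *s v)" for r c and v :: "complex ^ 'n"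
   by (simp add: vec_eq_iff)
  then show "B (r *\<^sub>R u) = r *\<^sub>R B u" for r u
   by (simp add: B_def scaleR_right.sum)
 qed
 have BJ: "B (J u) = J (B u)" for u
  by (simp add: B_def vec_eq_iff algebra_simps sum_distrib_left)
 have gen: "Z (B u) (B v) = diag_form (%j. Z (b (h j)) (J (b (h j)))) u v"
  if Z: "herm_form Z" and Z0: "!!i j. i < CARD('n) ==> j < CARD('n) ==> i ~= j ==> Z (b i) (b j) = 0 & Z (b i) (J (b j)) = 0" for Z u v
 proof -
  have "Z (B u) (B v) = (\<Sum>i\<in>UNIV. \<Sum>j\<in>UNIV. Z (u $ i *s b (h i)) (v $ j *s b (h j)))"
   unfolding B_def by (subst bilinear_sum[OF herm_formD(1)[OF Z]], subst sum.cartesian_product[symmetric]) simp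
  also have "... = (\<Sum>i\<in>UNIV. \<Sum>j\<in>UNIV. if j = i then Z (b (h i)) (J (b (h i))) * (Re (u $ i) * Im (v $ i) - Im (u $ i) * Re (v $ i)) else 0)"
   by (intro sum.cong refl)
    (use Z0[OF hl hl hi] herm_formD(4)[OF Z] in \<open>auto simp: herm_form_scale_pair[OF Z]\<close>)
  also have "... = diag_form (%j. Z (b (h j)) (J (b (h j)))) u v"
   by (simp add: diag_form_eq)
  finally show ?thesis .
 qed
 show ?thesis
 proof (rule that[OF lin BJ])
  show "X (B u) (B v) = std_form u v" for u v
   using gen[OF Xh X0, of u v] b(1)[OF hl] by (simp add: std_form_eq_diag)
  show "Y (B u) (B v) = diag_form (%j. Y (b (h j)) (J (b (h j)))) u v" for u v
   by (rule gen[OF Y Y0])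
 qed
qed

section \<open>Top powers through eigenvalues and traces\<close>

lemma pos_form_herm: "pos_form bt ==> herm_form bt"
 by (simp add: pos_form_def)

lemma std_form_herm: "herm_form std_form"
 by (rule pos_form_herm[OF std_form_pos])

text \<open>The trace over a real orthonormal frame, which counts each eigenvalue relative to
  \<open>std_form\<close> twice. For \<open>ddc\<close> of a Hessian it is the real
  Laplacian.\<close>

definition form_trace :: "(complex ^ 'n::finite => complex ^ 'n => real) => real" where
 "form_trace bt = (\<Sum>a\<in>UNIV. bt (real_frame a) (J (real_frame a)))"

text \<open>The coefficient of n X^(n-1) wedge W: one factor at a time is replaced by
  \<open>W\<close>.\<close>

definition top_power_deriv ::
 "(complex ^ 'n::finite => complex ^ 'n => real) => (complex ^ 'n => complex ^ 'n => real) => real" where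
 "top_power_deriv X W = (\<Sum>ss | ss permutes (UNIV :: ('n \<times> bool) set). of_int (sign ss) *
  (\<Sum>j\<in>UNIV. W (real_frame (ss (j, False))) (real_frame (ss (j, True))) *
   (\<Prod>k\<in>UNIV-{j}. X (real_frame (ss (k, False))) (real_frame (ss (k, True)))))) / 2 ^ CARD('n)"

lemma top_power_has_derivative:
 fixes X W :: "complex ^ 'n::finite => complex ^ 'n => real"
 shows "((%t. top_power (%u v. X u v + t * W u v)) has_real_derivative
  top_power_deriv (%u v. X u v + t * W u v) W) (at t)"
proof -
 have P: "((%t. \<Prod>k\<in>(UNIV::'n set). x k + t * w k) has_real_derivative
   (\<Sum>j\<in>UNIV. w j * (\<Prod>k\<in>UNIV-{j}. x k + t * w k))) (at t)" for x w :: "'n => real"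
 proof -
  have "((%t. \<Prod>k\<in>(UNIV::'n set). x k + t * w k) has_derivative
   (%y. \<Sum>i\<in>UNIV. (y * w i) * (\<Prod>j\<in>UNIV-{i}. x j + t * w j))) (at t)"
   by (rule has_derivative_prod) (auto intro!: derivative_eq_intros)
  moreover have "(%y. \<Sum>i\<in>UNIV. (y * w i) * (\<Prod>j\<in>UNIV-{i}. x j + t * w j)) =
    (*) (\<Sum>j\<in>UNIV. w j * (\<Prod>k\<in>UNIV-{j}. x k + t * w k))"
   by (simp add: fun_eq_iff sum_distrib_left sum_distrib_right mult_ac)
  ultimately show ?thesis by (simp add: has_field_derivative_def)
 qed
 show ?thesis
  unfolding top_power_def top_power_deriv_def
  by (intro DERIV_cdivide DERIV_sum DERIV_cmult P)
qed

lemma top_power_scale: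
 "top_power (%u v. c * bt u v) = c ^ CARD('n) * top_power (bt :: complex ^ 'n::finite => _)"
 unfolding top_power_def by (simp add: prod.distrib sum_distrib_left mult_ac)

text \<open>Pulling both forms back by the same \<open>B\<close> multiplies both top powers by
  \<open>det_frame B\<close>. Their quotient is therefore that of the diagonal forms, the product of
  the eigenvalues.\<close>

lemma eigenvalues:
 fixes X Y :: "complex ^ 'n::finite => complex ^ 'n => real"
 assumes X: "pos_form X" and Y: "herm_form Y"
 obtains B :: "complex ^ 'n => complex ^ 'n" and l where "linear B" "!!u. B (J u) = J (B u)" "!!u v. X (B u) (B v) = std_form u v"
  "!!u v. Y (B u) (B v) = diag_form l u v" "top_power Y = (\<Prod>j\<in>UNIV. l j) * top_power X"
  "top_power X ~= 0" "!!j. l j = Y (B (axis j 1)) (J (B (axis j 1)))"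
  "!!j. X (B (axis j 1)) (J (B (axis j 1))) = 1"
proof -
 obtain B :: "complex ^ 'n => complex ^ 'n" and l where B: "linear B" "!!u. B (J u) = J (B u)" "!!u v. X (B u) (B v) = std_form u v"
  "!!u v. Y (B u) (B v) = diag_form l u v"
  by (rule simultaneous_diagonalisation[OF X Y]) blast
 have bX: "bilinear X" "bilinear Y" using X Y by (simp_all add: herm_formD(1) pos_form_herm)
 have 1: "det_frame B * top_power X = top_power (std_form :: complex ^ 'n => _)"
  using top_power_linear_image[OF bX(1), of B] B(3) by simp
 have 2: "det_frame B * top_power Y = (\<Prod>j\<in>UNIV. l j) * top_power (std_form :: complex ^ 'n => _)"
  using top_power_linear_image[OF bX(2), of B] B(4) by (simp add: top_power_diag_form)
 have nz: "top_power X ~= 0" "det_frame B ~= 0" using 1 top_power_std_form_pos[where 'n='n] by auto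
 have "det_frame B * top_power Y = det_frame B * ((\<Prod>j\<in>UNIV. l j) * top_power X)"
  using 2 unfolding 1[symmetric] by (simp add: mult_ac)
 then have e: "top_power Y = (\<Prod>j\<in>UNIV. l j) * top_power X" using nz by simp
 have ax: "diag_form m (axis j 1) (J (axis j 1)) = m j" for m and j :: 'n
 proof -
  have "diag_form m (axis j 1) (J (axis j 1)) = (\<Sum>i\<in>UNIV. if i = j then m j else 0)"
   unfolding diag_form_eq by (intro sum.cong refl) (auto simp: axis_def)
  then show ?thesis by simp
 qed
 show ?thesis
 proof (rule that[OF B e nz(1)])
  show "l j = Y (B (axis j 1)) (J (B (axis j 1)))" for j
   unfolding B(2)[symmetric] B(4) by (simp only: ax)
  show "X (B (axis j 1)) (J (B (axis j 1))) = 1" for j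
   unfolding B(2)[symmetric] B(3) std_form_eq_diag by (simp only: ax)
 qed
qed

text \<open>\<open>eigenvalues\<close> only shows that the top power of a positive form is nonzero.
  The sign follows by continuity along the segment from \<open>std_form\<close>, which consists of
  positive forms.\<close>

lemma top_power_pos:
 fixes X :: "complex ^ 'n::finite => complex ^ 'n => real"
 assumes X: "pos_form X"
 shows "top_power X > 0"
proof (rule ccontr)
 assume neg: "~ top_power X > 0"
 define Z where "Z t u v = (1 - t) * std_form u v + t * X u v" for t :: real and u v
 have nz: "top_power (Z t) ~= 0" if "0 <= t" "t <= 1" for t
 proof -
  have Z: "pos_form (Z t)" unfolding Z_def by (rule pos_form_convex[OF std_form_pos X that])
  then have Zh: "herm_form (Z t)" by (simp add: pos_form_def)
  show ?thesis by (rule eigenvalues[OF Z Zh])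
 qed
 have cont: "isCont (%t. top_power (Z t)) t" for t
  unfolding Z_def top_power_def by (intro continuous_intros) auto
 have "Z 0 = std_form" "Z 1 = X" by (auto simp: Z_def fun_eq_iff)
 then have "top_power (Z 1) <= 0" "0 <= top_power (Z 0)"
  using neg top_power_std_form_pos[where 'n='n] by auto
 then have "\<exists>t. 0 <= t & t <= 1 & top_power (Z t) = 0"
  by (intro IVT2) (auto simp: cont)
 then show False using nz by blast
qed

text \<open>Relative to \<open>X\<close>, all eigenvalues of \<open>Y\<close> are at least
  1.\<close>

lemma top_power_mono:
 fixes X Y :: "complex ^ 'n::finite => complex ^ 'n => real"
 assumes X: "pos_form X" and Y: "herm_form Y" and le: "!!u. X u (J u) <= Y u (J u)"
 shows "top_power X <= top_power Y"
proof -
 obtain B :: "complex ^ 'n => complex ^ 'n" and l where B0: "linear B" "!!u. B (J u) = J (B u)" "!!u v. X (B u) (B v) = std_form u v"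
  "!!u v. Y (B u) (B v) = diag_form l u v" "top_power Y = (\<Prod>j\<in>UNIV. l j) * top_power X"
  "top_power X ~= 0" "!!j. l j = Y (B (axis j 1)) (J (B (axis j 1)))"
  "!!j. X (B (axis j 1)) (J (B (axis j 1))) = 1"
  by (rule eigenvalues[OF X Y]) blast
 note B = B0(5,7,8)
 have "l j >= 1" for j using B(2,3)[of j] le[of "B (axis j 1)"] by simp
 then have "(\<Prod>j\<in>UNIV. l j) >= 1" by (intro prod_ge_1) auto
 then show ?thesis using B(1) top_power_pos[OF X] by simp
qed

text \<open>A negative derivative would make the top power decrease along X + t Q, against
  \<open>top_power_mono\<close>.\<close>

lemma top_power_deriv_nonneg:
 fixes X Q :: "complex ^ 'n::finite => complex ^ 'n => real"
 assumes X: "pos_form X" and Q: "herm_form Q" "!!u. Q u (J u) >= 0"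
 shows "top_power_deriv X Q >= 0"
proof (rule ccontr)
 assume "~ 0 <= top_power_deriv X Q"
 moreover have "((%t. top_power (%u v. X u v + t * Q u v)) has_real_derivative top_power_deriv X Q) (at 0)"
  using top_power_has_derivative[of X Q 0] by simp
 ultimately obtain d where d: "d > 0" "!!h. 0 < h ==> h < d ==>
   top_power (%u v. X u v + (0 + h) * Q u v) < top_power (%u v. X u v + 0 * Q u v)"
  using DERIV_neg_dec_right[of "%t. top_power (%u v. X u v + t * Q u v)" _ 0] by force
 have "top_power X <= top_power (%u v. X u v + (d/2) * Q u v)"
 proof (rule top_power_mono[OF X])
  show "herm_form (%u v. X u v + d / 2 * Q u v)"
   using herm_form_comb[of X Q 1 "d/2"] X Q by (simp add: pos_form_def)
 qed (use d(1) Q in simp)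
 with d(2)[of "d/2"] d(1) show False by simp
qed

text \<open>Let \<open>l m\<close> be the largest eigenvalue relative to \<open>std_form\<close>.
  The product of all l j + c is at least c^(n-1) l m, while the trace over the 2n frame vectors is
  at most 2n l m.\<close>

lemma top_power_add_std_ge:
 fixes X :: "complex ^ 'n::finite => complex ^ 'n => real"
 assumes X: "pos_form X" and c: "c > 0"
 shows "c ^ (CARD('n) - 1) * form_trace X * top_power (std_form :: complex ^ 'n => _)
  <= 2 * real CARD('n) * top_power (%u v. X u v + c * std_form u v)"
proof -
 let ?s = "top_power (std_form :: complex ^ 'n => _)"
 have Xh: "herm_form X" and Xp: "!!u. u ~= 0 ==> X u (J u) > 0" using X by (auto simp: pos_form_def)
 obtain B :: "complex ^ 'n => complex ^ 'n" and l where B0: "linear B" "!!u. B (J u) = J (B u)" "!!u v. std_form (B u) (B v) = std_form u v"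
  "!!u v. X (B u) (B v) = diag_form l u v" "top_power X = (\<Prod>j\<in>UNIV. l j) * top_power (std_form :: complex ^ 'n => _)"
  "top_power (std_form :: complex ^ 'n => _) ~= 0" "!!j. l j = X (B (axis j 1)) (J (B (axis j 1)))"
  "!!j. std_form (B (axis j 1)) (J (B (axis j 1))) = 1"
  by (rule eigenvalues[OF std_form_pos Xh]) blast
 note B = B0(1-4,7,8)
 define Y where "Y u v = X u v + c * std_form u v" for u v
 have bY: "bilinear Y"
  unfolding Y_def using herm_form_comb[OF Xh std_form_herm, of 1 c] by (simp add: herm_formD(1))
 have "det_frame B * ?s = ?s"
  using top_power_linear_image[OF herm_formD(1)[OF std_form_herm], of B] B(3) by simp
 then have det: "det_frame B = 1" using top_power_std_form_pos[where 'n='n] by simp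
 have "Y (B u) (B v) = diag_form (%j. l j + c) u v" for u v
  unfolding Y_def B(3)[of u v] B(4)[of u v] unfolding std_form_eq_diag
  by (simp add: diag_form_eq sum_distrib_left sum.distrib[symmetric] algebra_simps)
 then have "top_power (%u v. Y (B u) (B v)) = (\<Prod>j\<in>UNIV. l j + c) * ?s"
  by (simp add: top_power_diag_form)
 then have topY: "top_power Y = (\<Prod>j\<in>UNIV. l j + c) * ?s"
  using top_power_linear_image[OF bY, of B] det by simp
 have lpos: "l j > 0" for j
 proof -
  have "B (axis j 1) ~= 0" using B(6)[of j] by (auto simp: std_form_def)
  then show ?thesis unfolding B(5) by (rule Xp)
 qed
 have prod_ge: "c ^ (CARD('n) - 1) * l m <= (\<Prod>j\<in>UNIV. l j + c)" for m
 proof -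
  have "(\<Prod>j\<in>UNIV. l j + c) = (l m + c) * (\<Prod>j\<in>UNIV-{m}. l j + c)"
   by (rule prod.remove) auto
  also have "... >= l m * (\<Prod>j\<in>UNIV-{m}. c)"
   using lpos c by (intro mult_mono prod_mono) (auto intro!: prod_nonneg simp: less_imp_le)
  finally show ?thesis by (simp add: card_Diff_singleton mult.commute)
 qed
 obtain m where m: "!!j. l j <= l m"
 proof -
  have "Max (range l) \<in> range l" by (intro Max_in) auto
  then obtain m where "l m = Max (range l)" by (metis rangeE)
  then show ?thesis using that[of m] by simp
 qed
 have nB: "norm (B u) = norm u" for u
  using B(3)[of u "J u"] by (simp add: B(2) norm_eq_sqrt_inner)
 have "inj B" using nB B(1) unfolding linear_injective_0[OF B(1)] by (metis norm_eq_zero)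
 then have "surj B" using B(1) by (simp add: linear_injective_imp_surjective)
 have Xle: "X v (J v) <= l m" if "norm v = 1" for v
 proof -
  obtain u where u: "v = B u" using \<open>surj B\<close> by (metis surjD)
  have "X v (J v) = (\<Sum>j\<in>UNIV. l j * ((Re (u $ j))\<^sup>2 + (Im (u $ j))\<^sup>2))"
   unfolding u B(2)[symmetric] B(4) diag_form_eq by (simp add: power2_eq_square algebra_simps)
  also have "... <= (\<Sum>j\<in>UNIV. l m * ((Re (u $ j))\<^sup>2 + (Im (u $ j))\<^sup>2))"
   by (intro sum_mono mult_right_mono m) simp
  also have "... = l m * (norm u)\<^sup>2"
   unfolding power2_norm_eq_inner inner_vec_def sum_distrib_left
   by (simp add: inner_complex_def power2_eq_square)
  finally show ?thesis using that nB[of u] u by simp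
 qed
 have "form_trace X <= (\<Sum>a\<in>(UNIV :: ('n \<times> bool) set). l m)"
  unfolding form_trace_def
  by (intro sum_mono Xle) (simp add: norm_eq_sqrt_inner inner_real_frame)
 then have "form_trace X <= 2 * real CARD('n) * l m" by simp
 then have "c ^ (CARD('n) - 1) * form_trace X * ?s <= c ^ (CARD('n) - 1) * (2 * real CARD('n) * l m) * ?s"
  using c top_power_std_form_pos[where 'n='n] by (intro mult_right_mono mult_left_mono) auto
 also have "... = 2 * real CARD('n) * (c ^ (CARD('n) - 1) * l m) * ?s" by (simp add: mult_ac)
 also have "... <= 2 * real CARD('n) * (\<Prod>j\<in>UNIV. l j + c) * ?s"
  using top_power_std_form_pos[where 'n='n] by (intro mult_right_mono mult_left_mono prod_ge) auto
 finally show ?thesis using topY unfolding Y_def by (simp add: mult_ac)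
qed

text \<open>Positivity on the sum and on the difference of two frame vectors bounds the mixed terms
  by the diagonal ones. The constant is not sharp.\<close>

lemma form_le_trace:
 fixes X :: "complex ^ 'n::finite => complex ^ 'n => real"
 assumes X: "pos_form X" and v: "norm v = 1"
 shows "X v (J v) <= 2 * real CARD('n) * form_trace X"
proof -
 have Xh: "herm_form X" and Xp: "!!u. u ~= 0 ==> X u (J u) > 0" using X by (auto simp: pos_form_def)
 note [simp] = herm_simps[OF Xh]
 define q where "q a = X (real_frame a) (J (real_frame a))" for a
 have nn: "X u (J u) >= 0" for u using Xp[of u] by (cases "u = 0") auto
 have "form_trace X = sum q UNIV" by (simp add: form_trace_def q_def)
 have cr: "2 * \<bar>X (real_frame a) (J (real_frame b))\<bar> <= q a + q b" for a b
  using nn[of "real_frame a + real_frame b"] nn[of "real_frame a - real_frame b"]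
   herm_formD(6)[OF Xh, of "real_frame a" "real_frame b"]
  by (simp add: q_def bilinear_lsub[OF herm_formD(1)[OF Xh]] bilinear_rsub[OF herm_formD(1)[OF Xh]])
 define c where "c a = v \<bullet> real_frame a" for a
 have c1: "\<bar>c a\<bar> <= 1" for a
  using Cauchy_Schwarz_ineq2[of v "real_frame a"] v by (simp add: c_def norm_eq_sqrt_inner inner_real_frame)
 have "bilinear (%u v. X u (J v))"
  by (auto simp: bilinear_def intro!: linearI)
 from bilinear_real_frame[OF this, of v v]
 have "X v (J v) = (\<Sum>a\<in>UNIV. \<Sum>b\<in>UNIV. c a * c b * X (real_frame a) (J (real_frame b)))"
  by (simp add: c_def)
 also have "... <= (\<Sum>a\<in>UNIV. \<Sum>b\<in>UNIV. (q a + q b) / 2)"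
 proof (intro sum_mono)
  fix a b
  have "c a * c b * X (real_frame a) (J (real_frame b)) <= \<bar>c a * c b\<bar> * \<bar>X (real_frame a) (J (real_frame b))\<bar>"
   by (metis abs_ge_self abs_mult)
  also have "... <= 1 * ((q a + q b) / 2)"
   using c1[of a] c1[of b] cr[of a b] by (intro mult_mono) (auto simp: abs_mult mult_le_one)
  finally show "c a * c b * X (real_frame a) (J (real_frame b)) <= (q a + q b) / 2" by simp
 qed
 also have "... = 2 * real CARD('n) * sum q UNIV"
  by (simp add: add_divide_distrib sum.distrib sum_divide_distrib[symmetric] sum_distrib_left[symmetric])
 finally show ?thesis by (simp add: form_trace_def q_def)
qed

text \<open>Every eigenvalue satisfies ln l <= l - 1 and is at most 2n times the trace. This
  converts a logarithm of a volume ratio into a trace, which can be integrated by parts.\<close>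

lemma ln_top_power_le_trace:
 fixes X :: "complex ^ 'n::finite => complex ^ 'n => real"
 assumes X: "pos_form X"
 shows "ln (top_power X) <= ln (top_power (std_form :: complex ^ 'n => _)) + 2 * (real CARD('n))\<^sup>2 * form_trace X"
proof -
 let ?s = "top_power (std_form :: complex ^ 'n => _)"
 have Xh: "herm_form X" and Xp: "!!u. u ~= 0 ==> X u (J u) > 0" using X by (auto simp: pos_form_def)
 obtain B :: "complex ^ 'n => complex ^ 'n" and l where B0: "linear B" "!!u. B (J u) = J (B u)" "!!u v. std_form (B u) (B v) = std_form u v"
  "!!u v. X (B u) (B v) = diag_form l u v" "top_power X = (\<Prod>j\<in>UNIV. l j) * top_power (std_form :: complex ^ 'n => _)"
  "top_power (std_form :: complex ^ 'n => _) ~= 0" "!!j. l j = X (B (axis j 1)) (J (B (axis j 1)))"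
  "!!j. std_form (B (axis j 1)) (J (B (axis j 1))) = 1"
  by (rule eigenvalues[OF std_form_pos Xh]) blast
 note B = B0(5,7,8)
 have l: "0 < l j" "l j <= 2 * real CARD('n) * form_trace X" for j
 proof -
  have n1: "norm (B (axis j 1)) = 1" using B(3)[of j] by (simp add: norm_eq_sqrt_inner)
  then show "l j <= 2 * real CARD('n) * form_trace X" unfolding B(2) by (rule form_le_trace[OF X])
  show "0 < l j" unfolding B(2) using n1 by (intro Xp) auto
 qed
 have "ln (top_power X) = ln (\<Prod>j\<in>UNIV. l j) + ln ?s"
  unfolding B(1) using l(1) top_power_std_form_pos[where 'n='n] by (intro ln_mult_pos prod_pos) auto
 also have "ln (\<Prod>j\<in>UNIV. l j) = (\<Sum>j\<in>UNIV. ln (l j))"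
  by (intro ln_prod) (use l(1) in \<open>force simp: less_le\<close>)+
 also have "... <= (\<Sum>j\<in>(UNIV::'n set). 2 * real CARD('n) * form_trace X)"
 proof (rule sum_mono)
  fix j show "ln (l j) <= 2 * real CARD('n) * form_trace X"
   using ln_le_minus_one[OF l(1)[of j]] l(2)[of j] by linarith
 qed
 finally show ?thesis by (simp add: power2_eq_square mult_ac)
qed

section \<open>Calculus with directional derivatives\<close>

text \<open>The derivative is taken within a convex set, so that closed intervals with one-sided
  derivatives at their ends are covered. The mean value inequality makes \<open>B\<close> dominate
  all difference quotients.\<close>

lemma deriv_under_integral:
 fixes f :: "real => 'a => real"
 assumes S: "convex S" "t0 \<in> S"
  and int: "!!t. t \<in> S ==> integrable M (f t)"
  and der: "!!t x. t \<in> S ==> x \<in> space M ==> ((%t. f t x) has_real_derivative f' t x) (at t within S)"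
  and bnd: "!!t x. t \<in> S ==> x \<in> space M ==> \<bar>f' t x\<bar> <= B x"
  and B: "integrable M B" and meas: "f' t0 \<in> borel_measurable M"
 shows "((%t. \<integral>x. f t x \<partial>M) has_real_derivative (\<integral>x. f' t0 x \<partial>M)) (at t0 within S)"
 unfolding has_field_derivative_iff tendsto_at_iff_sequentially
proof (intro allI impI)
 fix X :: "nat => real" assume X: "\<forall>i. X i \<in> S - {t0}" "X \<longlonglongrightarrow> t0"
 define s where "s i x = (f (X i) x - f t0 x) / (X i - t0)" for i x
 have lim: "(%i. \<integral>x. s i x \<partial>M) \<longlonglongrightarrow> (\<integral>x. f' t0 x \<partial>M)"
 proof (rule integral_dominated_convergence[OF meas _ B])
  show "s i \<in> borel_measurable M" for i
   using int[of "X i"] int[OF S(2)] X(1) unfolding s_def by (auto intro!: borel_measurable_divide)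
  show "AE x in M. (%i. s i x) \<longlonglongrightarrow> f' t0 x"
  proof (rule AE_I2)
   fix x assume x: "x \<in> space M"
   from der[OF S(2) x] X show "(%i. s i x) \<longlonglongrightarrow> f' t0 x"
    unfolding has_field_derivative_iff tendsto_at_iff_sequentially s_def
    by (auto simp: o_def dest!: spec[of _ X])
  qed
  show "AE x in M. norm (s i x) <= B x" for i
  proof (rule AE_I2)
   fix x assume x: "x \<in> space M"
   have "norm (f (X i) x - f t0 x) <= B x * norm (X i - t0)"
    by (rule field_differentiable_bound[OF S(1), where f'="%t. f' t x"]) (use der bnd x X S in auto)
   moreover have "\<bar>X i - t0\<bar> > 0" using X(1)[rule_format, of i] by auto
   ultimately show "norm (s i x) <= B x" by (simp add: s_def abs_divide pos_divide_le_eq)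
  qed
 qed
 have "(\<integral>x. s i x \<partial>M) = ((\<integral>x. f (X i) x \<partial>M) - (\<integral>x. f t0 x \<partial>M)) / (X i - t0)" for i
  unfolding s_def using int[of "X i"] int[OF S(2)] X(1) by simp
 then show "((%y. ((\<integral>x. f y x \<partial>M) - (\<integral>x. f t0 x \<partial>M)) / (y - t0)) o X) \<longlonglongrightarrow> (\<integral>x. f' t0 x \<partial>M)"
  using lim by (simp add: o_def)
qed

lemma integrable_compact_support:
 fixes f :: "'a::euclidean_space => real"
 assumes "compact K" "continuous_on K f" "!!z. z ~: K ==> f z = 0"
 shows "integrable lborel f"
proof -
 have "integrable lborel (%x. indicator K x *\<^sub>R f x)"
  by (rule borel_integrable_compact[OF assms(1,2)])
 also have "(%x. indicator K x *\<^sub>R f x) = f" using assms(3) by (auto simp: fun_eq_iff indicator_def)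
 finally show ?thesis .
qed

lemma integral_translate:
 fixes f :: "'a::euclidean_space => real"
 shows "(LBINT z. f (z + c)) = (LBINT z. f z)"
proof -
 have "(LBINT z. f z) = (\<integral>z. f z \<partial>(distr lborel borel ((+) c)))" by (simp add: lborel_distr_plus)
 also have "... = (LBINT z. f (c + z))"
 proof (cases "f \<in> borel_measurable borel")
  case True then show ?thesis by (intro integral_distr) auto
 next
  \<comment> \<open>Without measurability both integrals take the default value 0.\<close>
  case False
  have "(%z. f (c + z)) ~: borel_measurable lborel"
  proof
   assume "(%z. f (c + z)) \<in> borel_measurable lborel"
   then have "(%z. f (c + (z - c))) \<in> borel_measurable borel" by measurable
   with False show False by simp
  qed
  then have "~ integrable lborel (%z. f (c + z))" "~ integrable (distr lborel borel ((+) c)) f"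
   using False by (auto dest: borel_measurable_integrable)
  then show ?thesis by (simp add: not_integrable_integral_eq)
 qed
 finally show ?thesis by (simp add: add.commute)
qed

lemma line_derivative_shift:
 fixes z :: "'a::real_normed_vector"
 assumes "((%t. f (z + s *\<^sub>R v + t *\<^sub>R v)) has_real_derivative d) (at 0)"
 shows "((%t. f (z + t *\<^sub>R v)) has_real_derivative d) (at s)"
proof -
 have "((%t. f (z + (s + t) *\<^sub>R v)) has_real_derivative d) (at 0)"
  using assms by (simp add: algebra_simps)
 then show ?thesis using DERIV_shift[of "%t. f (z + t *\<^sub>R v)" d 0 s] by (simp add: add.commute)
qed

lemma eventually_line:
 fixes z v :: "'a::real_normed_vector"
 assumes "open U" "z \<in> U"
 shows "eventually (%t::real. z + t *\<^sub>R v \<in> U) (nhds 0)"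
proof -
 have "((%t. z + t *\<^sub>R v) \<longlongrightarrow> z + 0 *\<^sub>R v) (nhds 0)" by (intro tendsto_intros filterlim_ident)
 then show ?thesis using assms by (auto dest: topological_tendstoD)
qed

lemma DERIV_unique_within_Icc:
 assumes "(f has_real_derivative a) (at 0 within {-1..1::real})" "(f has_real_derivative b) (at 0 within {-1..1})"
 shows "a = b"
proof -
 have "at (0::real) within {-1..1} = at 0" by (rule at_within_interior) simp
 with assms show ?thesis by (simp add: DERIV_unique)
qed

lemma DERIV_continuous_on_set:
 fixes h :: "real => real"
 assumes "!!x. x \<in> S ==> (h has_real_derivative h' x) (at x)"
 shows "continuous_on S h"
 using assms by (intro continuous_at_imp_continuous_on) (auto intro: DERIV_isCont)

text \<open>The integral of the translates of \<open>p\<close> in direction \<open>v\<close> is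
  constant, so its derivative, the integral of \<open>p'\<close>, vanishes. The integrations by
  parts below all reduce to this.\<close>

lemma integral_directional_derivative:
 fixes p :: "'a::euclidean_space => real"
 assumes U: "open U" and K: "compact K" "K <= U"
  and der: "!!z. z \<in> U ==> ((%t. p (z + t *\<^sub>R v)) has_real_derivative p' z) (at 0)"
  and cont: "continuous_on U p" "continuous_on U p'"
  and out: "!!z. z ~: K ==> p z = 0" "!!z. z ~: K ==> p' z = 0"
 shows "integrable lborel p'" "(LBINT z. p' z) = 0"
proof -
 have oK: "open (- K)" using K(1) by (simp add: compact_imp_closed open_Compl)
 have UK: "U Un - K = UNIV" using K(2) by auto
 have D: "((%t. p (z + t *\<^sub>R v)) has_real_derivative p' z) (at 0)" for z
 proof (cases "z \<in> U")
  case False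
  then have z: "z \<in> - K" using K(2) by auto
  have "eventually (%t. p (z + t *\<^sub>R v) = 0) (nhds 0)"
   using eventually_line[OF oK z] by eventually_elim (use out in auto)
  then have "((%t. p (z + t *\<^sub>R v)) has_real_derivative 0) (at 0)"
   by (subst DERIV_cong_ev[OF refl _ refl]) auto
  then show ?thesis using out(2) z by simp
 qed (rule der)
 have cont_all: "continuous_on UNIV q" if "continuous_on U q" "!!z. z ~: K ==> q z = 0" for q :: "'a => real"
 proof -
  have "continuous_on (-K) q" using that(2) by (subst continuous_on_cong[OF refl, of _ _ "%_. 0"]) auto
  then show ?thesis using continuous_on_open_Un[OF U oK that(1)] UK by simp
 qed
 have cp: "continuous_on UNIV p" "continuous_on UNIV p'" using cont_all cont out by blast+
 show int: "integrable lborel p'"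
  by (rule integrable_compact_support[OF K(1) continuous_on_subset[OF cp(2) subset_UNIV] out(2)])
 have intp: "integrable lborel p"
  by (rule integrable_compact_support[OF K(1) continuous_on_subset[OF cp(1) subset_UNIV] out(1)])
 \<comment> \<open>This compact set contains the support of every translate with parameter in
   [-1,1], so its indicator, times a bound of \<open>p'\<close>, dominates.\<close>
 define K' where "K' = (%(x, t). x - t *\<^sub>R v) ` (K \<times> {-1..1::real})"
 have cK': "compact K'" unfolding K'_def
  by (intro compact_continuous_image compact_Times K(1) compact_Icc)
   (auto simp: case_prod_unfold intro!: continuous_intros)
 obtain M where M: "!!z. \<bar>p' z\<bar> <= M"
 proof -
  have "bounded (p' ` K)" using compact_continuous_image[OF continuous_on_subset[OF cp(2)] K(1)]
   by (simp add: compact_imp_bounded)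
  then obtain M where "!!z. z \<in> K ==> \<bar>p' z\<bar> <= M" by (auto simp: bounded_iff)
  then have "\<bar>p' z\<bar> <= max M 0" for z using out(2) by (cases "z \<in> K") (auto simp: le_max_iff_disj)
  then show ?thesis using that by blast
 qed
 have tint: "integrable lborel (%z. p (z + t *\<^sub>R v))" for t
  using integrable_distr_eq[of "(%z. z + t *\<^sub>R v)" lborel borel p] intp 
  by (simp add: add.commute[of _ "t *\<^sub>R v"] lborel_distr_plus borel_measurable_continuous_onI[OF cp(1)])
 have "((%t. \<integral>z. p (z + t *\<^sub>R v) \<partial>lborel) has_real_derivative (LBINT z. p' (z + 0 *\<^sub>R v))) (at 0 within {-1..1})"
 proof (rule deriv_under_integral[where B="%z. M * indicator K' z"])
  show "((%t. p (x + t *\<^sub>R v)) has_real_derivative p' (x + t *\<^sub>R v)) (at t within {-1..1})" for t x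
   by (rule DERIV_subset[OF line_derivative_shift[OF D]]) simp
  show "\<bar>p' (x + t *\<^sub>R v)\<bar> <= M * indicator K' x" if t: "t \<in> {-1..1}" for t x
  proof (cases "x + t *\<^sub>R v \<in> K")
   case True
   then have "(x + t *\<^sub>R v) - t *\<^sub>R v \<in> K'" unfolding K'_def using t by (intro image_eqI[of _ _ "(x + t *\<^sub>R v, t)"]) auto
   then show ?thesis using M by simp
  next
   case False
   have "0 <= M" using M[of 0] by linarith
   then show ?thesis using out(2)[OF False] by simp
  qed
  show "integrable lborel (%z. M * indicator K' z)"
   using emeasure_compact_finite[OF cK'] borel_closed[OF compact_imp_closed[OF cK']]
   by (intro integrable_mult_right integrable_real_indicator) auto
  show "(%z. p' (z + 0 *\<^sub>R v)) \<in> borel_measurable lborel"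
   using borel_measurable_continuous_onI[OF cp(2)] by simp
 qed (use tint in auto)
 then have "((%t. \<integral>z. p z \<partial>lborel) has_real_derivative (LBINT z. p' z)) (at 0 within {-1..1})"
  by (simp add: integral_translate)
 moreover have "((%t. \<integral>z. p z \<partial>lborel) has_real_derivative 0) (at 0 within {-1..1})"
  by (rule DERIV_const)
 ultimately show "(LBINT z. p' z) = 0"
  by (rule DERIV_unique_within_Icc)
qed

text \<open>Derivatives are given as data, along lines only, and continuous for each fixed
  direction. This is what integration by parts needs, and it is easily checked for mollifications
  and averages.\<close>

definition C1_on :: "'a::euclidean_space set => ('a => real) => ('a => 'a => real) => bool" where
 "C1_on U f D \<longleftrightarrow> continuous_on U f & (\<forall>v. continuous_on U (%z. D z v)) & (\<forall>z\<in>U. linear (D z)) &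
  (\<forall>z\<in>U. \<forall>v. ((%t. f (z + t *\<^sub>R v)) has_real_derivative D z v) (at 0))"

text \<open>Symmetry of \<open>H\<close> is made part of the notion; for functions of class C^2 in
  the sense of \<open>Ck_on\<close> it is derived by testing against bumps.\<close>

definition C2_on :: "'a::euclidean_space set => ('a => real) => ('a => 'a => real) => ('a => 'a => 'a => real) => bool" where
 "C2_on U f D H \<longleftrightarrow> C1_on U f D & (\<forall>v. C1_on U (%z. D z v) (%z u. H z u v)) &
  (\<forall>z\<in>U. \<forall>u v. H z u v = H z v u)"

lemma C1_onD:
 assumes "C1_on U f D"
 shows "continuous_on U f" "continuous_on U (%z. D z v)" "z \<in> U ==> linear (D z)"
  "z \<in> U ==> ((%t. f (z + t *\<^sub>R v)) has_real_derivative D z v) (at 0)"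
  "z + s *\<^sub>R v \<in> U ==> ((%t. f (z + t *\<^sub>R v)) has_real_derivative D (z + s *\<^sub>R v) v) (at s)"
 using assms line_derivative_shift[of f z s v "D (z + s *\<^sub>R v) v"] unfolding C1_on_def by auto

lemma C2_onD:
 assumes "C2_on U f D H"
 shows "C1_on U f D" "C1_on U (%z. D z v) (%z u. H z u v)" "z \<in> U ==> H z u v = H z v u"
  "z \<in> U ==> bilinear (H z)" "continuous_on U (%z. H z u v)"
proof -
 show "C1_on U f D" "z \<in> U ==> H z u v = H z v u" for z u v
  using assms unfolding C2_on_def by blast+
 show 1: "C1_on U (%z. D z v) (%z u. H z u v)" for v
  using assms unfolding C2_on_def by blast
 show "continuous_on U (%z. H z u v)" using C1_onD(2)[OF 1] .
 show "bilinear (H z)" if z: "z \<in> U"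
 proof -
  have "H z u = (%v. H z v u)" for u by (rule ext) (use assms z in \<open>unfold C2_on_def, blast\<close>)
  from this[symmetric] have "linear (H z u)" for u using C1_onD(3)[OF 1 z, of u] by simp
  then show ?thesis unfolding bilinear_def using C1_onD(3)[OF 1 z] by simp
 qed
qed

lemma C1_on_subset: "C1_on U f D ==> V <= U ==> C1_on V f D"
 unfolding C1_on_def using continuous_on_subset[of U _ V] by blast

lemma C2_on_subset: "C2_on U f D H ==> V <= U ==> C2_on V f D H"
 unfolding C2_on_def using C1_on_subset[of U _ _ V] by blast

lemma C1_on_add:
 assumes "C1_on U f D" "C1_on U g E"
 shows "C1_on U (%z. a * f z + b * g z) (%z v. a * D z v + b * E z v)"
 unfolding C1_on_def
proof (intro conjI ballI allI)
 note f = C1_onD[OF assms(1)] and g = C1_onD[OF assms(2)]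
 show "continuous_on U (%z. a * f z + b * g z)" by (intro continuous_intros f g)
 show "continuous_on U (%z. a * D z v + b * E z v)" for v by (intro continuous_intros f g)
 show "linear (%v. a * D z v + b * E z v)" if "z \<in> U" for z
  using f(3)[OF that] g(3)[OF that] by (auto intro!: linearI simp: linear_add linear_scale algebra_simps)
 show "((%t. a * f (z + t *\<^sub>R v) + b * g (z + t *\<^sub>R v)) has_real_derivative a * D z v + b * E z v) (at 0)"
  if "z \<in> U" for z v
  by (intro DERIV_add DERIV_cmult f(4) g(4) that)
qed

lemma C2_on_add:
 assumes "C2_on U f D H" "C2_on U g E G"
 shows "C2_on U (%z. a * f z + b * g z) (%z v. a * D z v + b * E z v) (%z u v. a * H z u v + b * G z u v)"
 using assms unfolding C2_on_def by (simp add: C1_on_add)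

lemma C1_on_const: "C1_on U (%_. c) (%_ _. 0)"
 unfolding C1_on_def by (auto intro!: continuous_intros linearI)

lemma C2_on_const: "C2_on U (%_. c) (%_ _. 0) (%_ _ _. 0)"
 unfolding C2_on_def using C1_on_const by blast

lemma C1_on_compose:
 fixes h h' :: "real => real"
 assumes f: "C1_on U f D" and h: "!!x. x \<in> f ` U ==> (h has_real_derivative h' x) (at x)" "continuous_on (f ` U) h'"
 shows "C1_on U (%z. h (f z)) (%z v. h' (f z) * D z v)"
proof -
 note f' = f[unfolded C1_on_def]
 have ch: "continuous_on (f ` U) h"
  by (rule DERIV_continuous_on_set[OF h(1)])
 have "continuous_on U (%z. h (f z))" "continuous_on U (%z. h' (f z))"
  using continuous_on_compose[OF conjunct1[OF f'] ch] continuous_on_compose[OF conjunct1[OF f'] h(2)]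
  by (auto simp: o_def)
 moreover have "((%t. h (f (z + t *\<^sub>R v))) has_real_derivative h' (f z) * D z v) (at 0)" if "z \<in> U" for z v
  using DERIV_chain2[of h "h' (f z)" "%t. f (z + t *\<^sub>R v)" 0, OF _ C1_onD(4)[OF f that]] h(1)[of "f z"] that by simp
 moreover have "linear (%v. h' (f z) * D z v)" if "z \<in> U" for z
  using C1_onD(3)[OF f that] by (auto intro!: linearI simp: linear_add linear_scale algebra_simps)
 ultimately show ?thesis unfolding C1_on_def
  using C1_onD(2)[OF f] by (auto intro!: continuous_on_mult)
qed

lemma C1_on_mult:
 assumes "C1_on U f D" "C1_on U g E"
 shows "C1_on U (%z. f z * g z) (%z v. D z v * g z + E z v * f z)"
 unfolding C1_on_def
proof (intro conjI ballI allI)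
 note f = C1_onD[OF assms(1)] and g = C1_onD[OF assms(2)]
 show "continuous_on U (%z. f z * g z)" by (intro continuous_intros f g)
 show "continuous_on U (%z. D z v * g z + E z v * f z)" for v by (intro continuous_intros f g)
 show "linear (%v. D z v * g z + E z v * f z)" if "z \<in> U" for z
  using f(3)[OF that] g(3)[OF that] by (auto intro!: linearI simp: linear_add linear_scale algebra_simps)
 show "((%t. f (z + t *\<^sub>R v) * g (z + t *\<^sub>R v)) has_real_derivative D z v * g z + E z v * f z) (at 0)"
  if "z \<in> U" for z v
  using DERIV_mult[OF f(4)[OF that] g(4)[OF that]] by simp
qed

lemma C2_on_compose:
 fixes h h' h'' :: "real => real"
 assumes f: "C2_on U f D H"
  and h: "!!x. x \<in> f ` U ==> (h has_real_derivative h' x) (at x)"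
   "!!x. x \<in> f ` U ==> (h' has_real_derivative h'' x) (at x)" "continuous_on (f ` U) h''"
 shows "C2_on U (%z. h (f z)) (%z v. h' (f z) * D z v)
     (%z u v. h'' (f z) * D z u * D z v + h' (f z) * H z u v)"
proof -
 note 1 = C2_onD[OF f]
 have ch: "continuous_on (f ` U) h'"
  by (rule DERIV_continuous_on_set[OF h(2)])
 have "C1_on U (%z. h' (f z) * D z v) (%z u. h'' (f z) * D z u * D z v + H z u v * h' (f z))" for v
  by (rule C1_on_mult[OF C1_on_compose[OF 1(1) h(2,3)] 1(2)])
 then show ?thesis unfolding C2_on_def
  using C1_on_compose[OF 1(1) h(1) ch] 1(3) by (auto simp: mult_ac)
qed

section \<open>Polynomial bumps and kernel means\<close>

lemma max_power_has_derivative: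
 assumes "k >= 1"
 shows "((%x. (max 0 x) ^ Suc k) has_real_derivative real (Suc k) * (max 0 x) ^ k) (at x)"
proof -
 consider "x > 0" | "x < 0" | "x = 0" by linarith
 then show ?thesis
 proof cases
  case 1
  have d: "((%x. x ^ Suc k) has_real_derivative real (Suc k) * x ^ k) (at x)"
   using DERIV_pow[of "Suc k" x UNIV] by simp
  have ev: "eventually (%y. (max 0 y) ^ Suc k = y ^ Suc k) (nhds x)"
   using eventually_nhds_in_open[of "{0<..}" x] 1 by (auto elim!: eventually_mono simp: max_def)
  show ?thesis using DERIV_cong_ev[OF refl ev refl, THEN iffD2, OF d] 1 by (simp add: max_absorb2)
 next
  case 2
  have ev: "eventually (%y. (max 0 y) ^ Suc k = 0) (nhds x)"
   using eventually_nhds_in_open[of "{..<0}" x] 2 by (auto elim!: eventually_mono simp: max_def)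
  have "((%x. (max 0 x) ^ Suc k) has_real_derivative 0) (at x)"
   by (rule DERIV_cong_ev[OF refl ev refl, THEN iffD2]) simp
  then show ?thesis using 2 assms by (simp add: max_absorb1 power_0_left)
 next
  case 3
  have "((%y::real. (max 0 y) ^ Suc k / y) \<longlongrightarrow> 0) (at 0)"
  proof (rule Lim_null_comparison[where g="%y. \<bar>y\<bar> ^ k"])
   show "eventually (%y::real. norm ((max 0 y) ^ Suc k / y) <= \<bar>y\<bar> ^ k) (at 0)"
    by (auto simp: eventually_at_filter max_def)
   have "((%y::real. \<bar>y\<bar> ^ k) \<longlongrightarrow> \<bar>0\<bar> ^ k) (at 0)" by (intro tendsto_intros)
   then show "((%y::real. \<bar>y\<bar> ^ k) \<longlongrightarrow> 0) (at 0)" using assms by (simp add: power_0_left)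
  qed
  then show ?thesis using 3 assms by (simp add: has_field_derivative_iff power_0_left)
 qed
qed

text \<open>A polynomial in the squared distance on the ball of radius \<open>r\<close>, cut off
  outside. Differentiation lowers the exponent by one and produces a linear factor, so the
  derivatives are explicit and are again bumps with coefficients.\<close>

definition bump :: "nat => 'a::euclidean_space => real => 'a => real" where
 "bump k c r z = (max 0 (r\<^sup>2 - (z - c) \<bullet> (z - c))) ^ k"

lemma bump_nonneg [simp]: "bump k c r z >= 0"
 by (simp add: bump_def)

lemma bump_outside: "k >= 1 ==> r >= 0 ==> z ~: cball c r ==> bump k c r z = 0"
proof -
 assume "k >= 1" "r >= 0" "z ~: cball c r"
 then have "r < norm (z - c)" by (simp add: dist_norm norm_minus_commute)
 then have "r\<^sup>2 <= (norm (z - c))\<^sup>2" using \<open>r >= 0\<close> by (intro power_mono) auto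
 then show ?thesis using \<open>k >= 1\<close> by (simp add: bump_def power2_norm_eq_inner max_def power_0_left)
qed

lemma bump_continuous: "continuous_on S (bump k c r)"
 unfolding bump_def by (intro continuous_intros)

lemma bump_measurable [measurable]: "bump k c r \<in> borel_measurable borel"
 by (rule borel_measurable_continuous_onI[OF bump_continuous])

lemma bump_le: "r >= 0 ==> bump k c r z <= (r\<^sup>2) ^ k"
 unfolding bump_def by (intro power_mono) auto

lemma C1_on_bump:
 assumes "k >= 1"
 shows "C1_on UNIV (bump (Suc k) c r) (%z v. - 2 * real (Suc k) * ((z - c) \<bullet> v) * bump k c r z)"
 unfolding C1_on_def
proof (intro conjI ballI allI)
 fix z v :: 'a
 let ?q = "%t. r\<^sup>2 - (z + t *\<^sub>R v - c) \<bullet> (z + t *\<^sub>R v - c)"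
 have q: "?q t = (r\<^sup>2 - (z - c) \<bullet> (z - c)) - 2 * t * ((z - c) \<bullet> v) - t * t * (v \<bullet> v)" for t
  by (simp add: inner_add_left inner_add_right inner_diff_left inner_diff_right algebra_simps inner_commute)
 have "(?q has_real_derivative - 2 * ((z - c) \<bullet> v)) (at 0)"
  unfolding q by (auto intro!: derivative_eq_intros)
 note d = this
 show "((%t. bump (Suc k) c r (z + t *\<^sub>R v)) has_real_derivative - 2 * real (Suc k) * ((z - c) \<bullet> v) * bump k c r z) (at 0)"
  unfolding bump_def
  by (rule DERIV_cong[OF DERIV_chain2[OF max_power_has_derivative[OF assms] d]]) (simp add: algebra_simps)
qed (auto intro!: linearI bump_continuous continuous_intros simp: inner_add_right algebra_simps)

lemma C1_on_cong:
 "C1_on U f D ==> (!!z. f z = f' z) ==> (!!z v. D z v = D' z v) ==> C1_on U f' D'"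
 proof -
 assume a: "C1_on U f D" "!!z. f z = f' z" "!!z v. D z v = D' z v"
 have "f = f'" "D = D'" using a(2,3) by (auto intro!: ext)
 with a(1) show ?thesis by simp
qed

lemma C2_on_bump:
 assumes "k >= 2"
 shows "C2_on UNIV (bump (Suc k) c r) (%z v. - 2 * real (Suc k) * ((z - c) \<bullet> v) * bump k c r z)
  (%z u v. - 2 * real (Suc k) * ((u \<bullet> v) * bump k c r z - 2 * real k * ((z - c) \<bullet> u) * ((z - c) \<bullet> v) * bump (k - 1) c r z))"
proof -
 obtain m where m: "k = Suc m" "m >= 1" using assms by (cases k) auto
 have "C1_on UNIV (%z. - 2 * real (Suc k) * ((z - c) \<bullet> v)) (%z u. - 2 * real (Suc k) * (u \<bullet> v))" for v :: 'a
  unfolding C1_on_def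
  by (auto intro!: continuous_intros linearI derivative_eq_intros simp: inner_add_left inner_diff_left algebra_simps)
 note d = C1_on_mult[OF this C1_on_bump[OF m(2), of c r]]
 have "C1_on UNIV (%z. - 2 * real (Suc k) * ((z - c) \<bullet> v) * bump k c r z)
  (%z u. - 2 * real (Suc k) * ((u \<bullet> v) * bump k c r z - 2 * real k * ((z - c) \<bullet> u) * ((z - c) \<bullet> v) * bump (k - 1) c r z))" for v
  by (rule C1_on_cong[OF d]) (simp_all add: m algebra_simps inner_commute)
 then show ?thesis unfolding C2_on_def using C1_on_bump[of k c r] assms by (simp add: inner_commute mult_ac)
qed

lemma bump_integrable: "r >= 0 ==> k >= 1 ==> integrable lborel (bump k c r)"
 by (rule integrable_compact_support[of "cball c r"]) (auto simp: bump_outside intro: bump_continuous)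

lemma integral_pos_compact_support:
 fixes f :: "'a::euclidean_space => real"
 assumes f: "integrable lborel f" "!!z. f z >= 0" and U: "open U" "y \<in> U" "continuous_on U f" "f y > 0"
 shows "(LBINT z. f z) > 0"
proof -
 have h: "f y / 2 < f y" using U by simp
 have "(f \<longlongrightarrow> f y) (at y)"
  using U(1-3) continuous_on_eq_continuous_at[of U f] by (simp add: isCont_def)
 from order_tendstoD(1)[OF this h] have "eventually (%z. f z > f y / 2) (at y)" .
 then obtain e where e: "e > 0" "!!z. z ~= y ==> dist z y < e ==> f z > f y / 2"
  unfolding eventually_at by blast
 have ge: "f y / 2 * indicator (ball y e) z <= f z" for z
  using e(2)[of z] f(2)[of z] U(4) by (cases "z = y") (auto simp: indicator_def dist_commute)
 have fin: "emeasure lborel (ball y e) < \<infinity>" by (rule emeasure_lborel_ball_finite)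
 have "0 < f y / 2 * measure lborel (ball y e)"
  using content_ball_pos[OF e(1), of y] U(4) by simp
 also have "... = (LBINT z. f y / 2 * indicator (ball y e) z)" by simp
 also have "... <= (LBINT z. f z)"
  using fin by (intro integral_mono f(1) ge integrable_mult_right integrable_real_indicator) auto
 finally show ?thesis .
qed

lemma bump_integral_pos: "r > 0 ==> k >= 1 ==> (LBINT z. bump k c r z) > 0"
 by (rule integral_pos_compact_support[OF bump_integrable _ open_UNIV UNIV_I[of c] bump_continuous])
  (auto simp: bump_def)

lemma integral_parts:
 assumes U: "open U" and K: "compact K" "K <= U"
  and f: "C1_on U f D" and g: "C1_on U g E" "!!z. z ~: K ==> g z = 0" "!!z. z ~: K ==> E z v = 0"
 shows "integrable lborel (%z. D z v * g z)" "integrable lborel (%z. f z * E z v)"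
  "(LBINT z. D z v * g z) = - (LBINT z. f z * E z v)"
proof -
 note fD = C1_onD[OF f] and gD = C1_onD[OF g(1)]
 show i1: "integrable lborel (%z. D z v * g z)"
  by (rule integrable_compact_support[OF K(1)])
   (auto intro!: continuous_intros continuous_on_subset[OF _ K(2)] fD gD simp: g)
 show i2: "integrable lborel (%z. f z * E z v)"
  by (rule integrable_compact_support[OF K(1)])
   (auto intro!: continuous_intros continuous_on_subset[OF _ K(2)] fD gD simp: g)
 have "(LBINT z. D z v * g z + E z v * f z) = 0"
  by (rule integral_directional_derivative(2)[OF U K, where p="%z. f z * g z" and v=v])
   (use C1_onD[OF C1_on_mult[OF f g(1)]] in \<open>auto simp: g\<close>)
 then show "(LBINT z. D z v * g z) = - (LBINT z. f z * E z v)"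
  using i1 i2 by (simp add: mult.commute)
qed

text \<open>The second derivatives are symmetric because they are so when tested against bumps.\<close>

lemma second_derivative_symmetric:
 assumes U: "open U" and f: "C1_on U f D" and D: "!!v. C1_on U (%z. D z v) (%z u. H z u v)"
  and y: "y \<in> U"
 shows "H y u v = H y v u"
proof -
 have le: "H y u v <= H y v u" for u v
 proof (rule ccontr)
  assume "~ H y u v <= H y v u"
  define q where "q z = H z u v - H z v u" for z
  have qy: "q y > 0" using \<open>~ _\<close> by (simp add: q_def)
  have qc: "continuous_on U q" unfolding q_def by (intro continuous_intros C1_onD(2)[OF D])
  have "isCont q y" using qc U y continuous_on_eq_continuous_at by blast
  then have "(q \<longlongrightarrow> q y) (nhds y)" by (simp add: isCont_def tendsto_at_iff_tendsto_nhds)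
  from order_tendstoD(1)[OF this qy] have "eventually (%z. q z > 0 & z \<in> U) (nhds y)"
   using eventually_nhds_in_open[OF U y] by (rule eventually_conj)
  then obtain e where e: "e > 0" "!!z. dist z y < e ==> q z > 0 & z \<in> U"
   unfolding eventually_nhds_metric by blast
  define r where "r = e / 2"
  have r: "r > 0" "cball y r <= U" "!!z. z \<in> cball y r ==> q z > 0"
   using e by (auto simp: r_def dist_commute)
  let ?b = "bump 4 y r"
  define b1 where "b1 = (%z v. - 8 * ((z - y) \<bullet> v) * bump 3 y r z)"
  define b2 where "b2 = (%z u v. - 8 * ((u \<bullet> v) * bump 3 y r z - 6 * ((z - y) \<bullet> u) * ((z - y) \<bullet> v) * bump 2 y r z))"
  have b: "C2_on UNIV ?b b1 b2" using C2_on_bump[of 3 y r] by (simp add: b1_def b2_def)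
  have out: "?b z = 0" "b1 z v = 0" "b2 z u v = 0" if "z ~: cball y r" for z u v
   using bump_outside[OF _ _ that, of 4] bump_outside[OF _ _ that, of 3] bump_outside[OF _ _ that, of 2] r(1)
   by (simp_all add: b1_def b2_def)
  have sub: "C1_on U ?b b1" "C1_on U (%z. b1 z w) (%z u. b2 z u w)" for w
   using C1_on_subset[OF C2_onD(1)[OF b]] C1_on_subset[OF C2_onD(2)[OF b]] by auto
  have "(LBINT z. H z u v * ?b z) = (LBINT z. f z * b2 z v u)" for u v
  proof -
   have "(LBINT z. H z u v * ?b z) = - (LBINT z. D z v * b1 z u)"
    by (rule integral_parts(3)[OF U compact_cball r(2) D sub(1)]) (simp_all add: out)
   also have "(LBINT z. D z v * b1 z u) = - (LBINT z. f z * b2 z v u)"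
    by (rule integral_parts(3)[OF U compact_cball r(2) f sub(2)]) (simp_all add: out)
   finally show ?thesis by simp
  qed
  moreover have "b2 z u v = b2 z v u" for z by (simp add: b2_def inner_commute mult_ac)
  ultimately have "(LBINT z. H z u v * ?b z) = (LBINT z. H z v u * ?b z)" by simp
  moreover have int: "integrable lborel (%z. H z u v * ?b z)" for u v
   by (rule integral_parts(1)[OF U compact_cball r(2) D sub(1)]) (simp_all add: out)
  ultimately have "(LBINT z. q z * ?b z) = 0" by (simp add: q_def left_diff_distrib)
  moreover have "(LBINT z. q z * ?b z) > 0"
  proof (rule integral_pos_compact_support[OF _ _ U y])
   show "integrable lborel (%z. q z * ?b z)" using int by (simp add: q_def left_diff_distrib)
   show "0 <= q z * ?b z" for z using r(3)[of z] out(1)[of z] by (cases "z \<in> cball y r") (auto simp: less_imp_le)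
   show "continuous_on U (%z. q z * ?b z)" by (intro continuous_intros qc bump_continuous)
   show "0 < q y * ?b y" using qy r by (simp add: bump_def)
  qed
  ultimately show False by simp
 qed
 show ?thesis using le[of u v] le[of v u] by simp
qed

section \<open>From \<open>Ck_on\<close> to derivatives along lines\<close>

lemma Ck_on_slice:
 fixes f :: "'a::euclidean_space \<times> real => real"
 shows "Ck_on k f (V \<times> I) ==> t \<in> I ==> Ck_on k (%y. f (y, t)) V"
proof (induction k arbitrary: f)
 case 0 then show ?case
  by (auto intro!: continuous_on_compose2[of "V \<times> I" f] continuous_intros)
next
 case (Suc k)
 then obtain f' where f': "!!y. y \<in> V \<times> I ==> (f has_derivative f' y) (at y within V \<times> I)"
  "!!v. Ck_on k (%y. f' y v) (V \<times> I)" by auto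
 have "((%y. f (y, t)) has_derivative (%v. f' (y, t) (v, 0))) (at y within V)" if "y \<in> V" for y
 proof (rule has_derivative_in_compose2[where g=f and f="%y. (y, t)" and t="V \<times> I" and g'="f'" and f'="%v. (v, 0)"])
  show "((%y. (y, t)) has_derivative (%v. (v, 0))) (at y within V)"
   by (auto intro!: derivative_eq_intros)
 qed (use f'(1) Suc.prems that in auto)
 moreover have "Ck_on k (%y. f' (y, t) (v, 0)) V" for v
  using Suc.IH[OF f'(2) Suc.prems(2)] .
 ultimately show ?case
  unfolding Ck_on.simps by (intro exI[of _ "%y v. f' (y, t) (v, 0)"] conjI ballI allI) auto
qed

lemma has_derivative_line:
 fixes f :: "'a::real_normed_vector => real"
 assumes "(f has_derivative f') (at z)"
 shows "((%t. f (z + t *\<^sub>R v)) has_real_derivative f' v) (at 0)"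
proof -
 have "((%t. z + t *\<^sub>R v) has_derivative (%h. h *\<^sub>R v)) (at 0)"
  by (auto intro!: derivative_eq_intros)
 from has_derivative_compose[OF this, of f f'] assms
 have "((%t. f (z + t *\<^sub>R v)) has_derivative (%h. f' (h *\<^sub>R v))) (at 0)" by simp
 moreover have "f' (h *\<^sub>R v) = f' v * h" for h
  using linear_scale[OF has_derivative_linear[OF assms]] by simp
 ultimately show ?thesis by (simp add: has_field_derivative_def)
qed

lemma Ck_on_2_C2_on:
 fixes f :: "'a::euclidean_space => real"
 assumes U: "open U" and f: "Ck_on 2 f U"
 obtains D H where "C2_on U f D H" "!!z. z \<in> U ==> (f has_derivative D z) (at z)"
  "!!z v. z \<in> U ==> ((%y. D y v) has_derivative (%u. H z u v)) (at z)"
proof -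
 have "Ck_on (Suc (Suc 0)) f U" using f by (simp add: numeral_2_eq_2)
 then obtain D where D': "(\<forall>z\<in>U. (f has_derivative D z) (at z within U)) & (\<forall>v. Ck_on (Suc 0) (%y. D y v) U)"
  unfolding Ck_on.simps(2)[of "Suc 0"] by (rule exE)
 have D: "z \<in> U ==> (f has_derivative D z) (at z)" for z
  using D' at_within_open[OF _ U, of z] by auto
 have "\<forall>v. \<exists>E. (\<forall>z\<in>U. ((%y. D y v) has_derivative E z) (at z)) & (\<forall>u. continuous_on U (%z. E z u))"
 proof
  fix v
  have "Ck_on (Suc 0) (%y. D y v) U" using D' by blast
  then obtain E where E: "(\<forall>z\<in>U. ((%y. D y v) has_derivative E z) (at z within U)) & (\<forall>u. Ck_on 0 (%y. E y u) U)"
   unfolding Ck_on.simps(2)[of 0] by (rule exE)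
  have "((%y. D y v) has_derivative E z) (at z)" if "z \<in> U" for z
   using E at_within_open[OF that U] that by auto
  moreover have "continuous_on U (%z. E z u)" for u using E by simp
  ultimately show "\<exists>E. (\<forall>z\<in>U. ((%y. D y v) has_derivative E z) (at z)) & (\<forall>u. continuous_on U (%z. E z u))"
   by blast
 qed
 then obtain E where E0: "\<forall>v. (\<forall>z\<in>U. ((%y. D y v) has_derivative E v z) (at z)) & (\<forall>u. continuous_on U (%z. E v z u))"
  by (rule choice[THEN exE])
 have E: "z \<in> U ==> ((%y. D y v) has_derivative E v z) (at z)" "continuous_on U (%z. E v z u)" for v z u
  using E0 by auto
 have cD: "continuous_on U (%z. D z v)" for v
  by (intro continuous_at_imp_continuous_on ballI has_derivative_continuous[OF E(1)])
 have cf: "continuous_on U f"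
  by (intro continuous_at_imp_continuous_on ballI has_derivative_continuous[OF D])
 have 1: "C1_on U f D" unfolding C1_on_def
  by (intro conjI ballI allI cf cD has_derivative_line D has_derivative_linear[OF D])
 have 2: "C1_on U (%z. D z v) (%z u. E v z u)" for v unfolding C1_on_def
  by (intro conjI ballI allI cD E(2) has_derivative_line E(1) has_derivative_linear[OF E(1)])
 have "C2_on U f D (%z u v. E v z u)"
  unfolding C2_on_def by (intro conjI allI ballI 1 2 second_derivative_symmetric[OF U 1 2])
 from that[OF this D E(1)] show ?thesis .
qed

lemma DERIV_within_nonneg_mono:
 fixes f :: "real => real"
 assumes "a <= b" "!!x. x \<in> {a..b} ==> (f has_real_derivative f' x) (at x within {a..b})"
  "!!x. x \<in> {a..b} ==> f' x >= 0"
 shows "f a <= f b"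
proof -
 have "\<exists>x\<in>{a..b}. f b - f a = f' x * (b - a)"
  by (rule mvt_very_simple[OF assms(1)])
   (use assms(2) in \<open>auto simp: has_field_derivative_def\<close>)
 then show ?thesis using assms(1,3) by (metis diff_ge_0_iff_ge mult_nonneg_nonneg)
qed

section \<open>Kernel means and the Laplacian\<close>

definition laplacian :: "('a::euclidean_space => 'a => 'a => real) => 'a => real" where
 "laplacian H z = (\<Sum>b\<in>Basis. H z b b)"

text \<open>The gradient of \<open>bump 4 0 1\<close> is -8 z \<open>bump 3 0 1\<close>. The radial
  derivative of the mean pairs the gradient of \<open>f\<close> with z \<open>bump 3 0 1\<close>, so
  one integration by parts turns it into the Laplacian, with a factor \<open>r\<close> from the
  scaling. No boundary terms arise, unlike for means over balls or spheres.\<close>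

lemma kernel_mean_deriv:
 fixes f :: "'a::euclidean_space => real"
 assumes U: "open U" "cball y r0 <= U" and f: "C2_on U f D H" and r: "r \<in> {0..r0}"
 shows "((%r. \<integral>z. f (y + r *\<^sub>R z) * bump 3 0 1 z \<partial>lborel) has_real_derivative
  (r / 8 * (LBINT z. laplacian H (y + r *\<^sub>R z) * bump 4 0 1 z))) (at r within {0..r0})"
  and "integrable lborel (%z. f (y + r *\<^sub>R z) * bump 3 0 1 z)"
  and "integrable lborel (%z. laplacian H (y + r *\<^sub>R z) * bump 4 0 1 z)"
proof -
 let ?B = "cball (0::'a) 1"
 have U1: "y + t *\<^sub>R z \<in> U" if "z \<in> ?B" "t \<in> {0..r0}" for t z
 proof -
  have "t * norm z <= t * 1" using that by (intro mult_left_mono) auto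
  then have "t * norm z <= r0" using that by simp
  then have "y + t *\<^sub>R z \<in> cball y r0" using that by (simp add: dist_norm)
  then show ?thesis using U(2) by blast
 qed
 have out: "bump 3 0 1 z = 0" "bump 4 0 1 z = 0" if "z ~: ?B" for z :: 'a
  using that bump_outside[of 3 1 z 0] bump_outside[of 4 1 z 0] by auto
 note fD = C1_onD[OF C2_onD(1)[OF f]]
 have comp: "continuous_on ?B (%z. g (y + t *\<^sub>R z))" if "continuous_on U g" "t \<in> {0..r0}" for g :: "'a => real" and t
  by (rule continuous_on_compose2[OF that(1)]) (use U1 that(2) in \<open>auto intro!: continuous_intros\<close>)
 have int0: "integrable lborel (%z. f (y + t *\<^sub>R z) * bump 3 0 1 z)" if "t \<in> {0..r0}" for t
  by (rule integrable_compact_support[of ?B]) (auto intro!: continuous_on_mult comp fD bump_continuous that simp: out)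
 then show "integrable lborel (%z. f (y + r *\<^sub>R z) * bump 3 0 1 z)" using r by blast
 have lap_cont: "continuous_on U (laplacian H)"
  unfolding laplacian_def by (intro continuous_intros C2_onD(5)[OF f])
 show int2: "integrable lborel (%z. laplacian H (y + r *\<^sub>R z) * bump 4 0 1 z)"
  by (rule integrable_compact_support[of ?B]) (auto intro!: continuous_on_mult comp lap_cont bump_continuous r simp: out)
 have Dexp: "D w z = (\<Sum>b\<in>Basis. (z \<bullet> b) * D w b)" if "w \<in> U" for w z
 proof -
  have "D w z = D w (\<Sum>b\<in>Basis. (z \<bullet> b) *\<^sub>R b)" by (simp add: euclidean_representation)
  then show ?thesis by (simp add: linear_sum[OF fD(3)[OF that]] linear_scale[OF fD(3)[OF that]])
 qed
 \<comment> \<open>For z outside the unit ball the point y + t z may leave \<open>U\<close>, where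
   nothing is known about \<open>D\<close>; the kernel is zero there.\<close>
 define F' where "F' t z = (if z \<in> ?B then (\<Sum>b\<in>Basis. (z \<bullet> b) * D (y + t *\<^sub>R z) b) * bump 3 0 1 z else 0)" for t z
 have cF: "continuous_on ({0..r0} \<times> ?B) (%p. (\<Sum>b\<in>Basis. (snd p \<bullet> b) * D (y + fst p *\<^sub>R snd p) b) * bump 3 0 1 (snd p))"
 proof (intro continuous_on_mult continuous_on_sum)
  show "continuous_on ({0..r0} \<times> ?B) (%p. D (y + fst p *\<^sub>R snd p) b)" for b
   by (rule continuous_on_compose2[OF fD(2)]) (use U1 in \<open>auto intro!: continuous_intros\<close>)
  show "continuous_on ({0..r0} \<times> ?B) (%p. bump 3 0 1 (snd p))"
   by (rule continuous_on_compose2[OF bump_continuous[of UNIV]]) (auto intro!: continuous_intros)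
 qed (auto intro!: continuous_intros)
 have "compact ({0..r0} \<times> ?B)" by (intro compact_Times) auto
 from compact_imp_bounded[OF compact_continuous_image[OF cF this]]
 obtain M where M: "!!t z. t \<in> {0..r0} ==> z \<in> ?B ==> \<bar>F' t z\<bar> <= M"
  unfolding bounded_iff F'_def by fastforce
 have cF1: "continuous_on ?B (F' t)" if "t \<in> {0..r0}" for t
 proof -
  have "continuous_on ?B (%z. (\<Sum>b\<in>Basis. (z \<bullet> b) * D (y + t *\<^sub>R z) b) * bump 3 0 1 z)"
   by (intro continuous_intros comp fD bump_continuous that)
  then show ?thesis by (rule continuous_on_eq) (simp add: F'_def)
 qed
 have intF: "integrable lborel (F' r)"
  by (rule integrable_compact_support[OF compact_cball cF1[OF r]]) (simp add: F'_def)
 have der: "((%r. \<integral>z. f (y + r *\<^sub>R z) * bump 3 0 1 z \<partial>lborel) has_real_derivative (LBINT z. F' r z)) (at r within {0..r0})"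
 proof (rule deriv_under_integral[where B="%z. M * indicator ?B z"])
  show "((%t. f (y + t *\<^sub>R z) * bump 3 0 1 z) has_real_derivative F' t z) (at t within {0..r0})" if "t \<in> {0..r0}" for t z
  proof (cases "z \<in> ?B")
   case True
   have "((%t. f (y + t *\<^sub>R z)) has_real_derivative D (y + t *\<^sub>R z) z) (at t within {0..r0})"
    by (rule has_field_derivative_at_within[OF fD(5)[OF U1[OF True that]]])
   from DERIV_cmult_right[OF this, of "bump 3 0 1 z"] show ?thesis
    using True Dexp[OF U1[OF True that], of z] by (simp add: F'_def)
  qed (simp add: out F'_def)
  show "\<bar>F' t z\<bar> <= M * indicator ?B z" if "t \<in> {0..r0}" for t z
   using M[OF that, of z] by (cases "z \<in> ?B") (auto simp: F'_def)
  show "integrable lborel (%z. M * indicator ?B z)"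
   using emeasure_compact_finite[OF compact_cball[of "0::'a" 1]] by (intro integrable_mult_right integrable_real_indicator) auto
  show "F' r \<in> borel_measurable lborel" using borel_measurable_integrable[OF intF] .
 qed (use int0 r in auto)
 have parts: "integrable lborel (%z. (z \<bullet> b) * D (y + r *\<^sub>R z) b * bump 3 0 1 z)"
   "integrable lborel (%z. H (y + r *\<^sub>R z) b b * bump 4 0 1 z)"
   "8 * (LBINT z. (z \<bullet> b) * D (y + r *\<^sub>R z) b * bump 3 0 1 z) = r * (LBINT z. H (y + r *\<^sub>R z) b b * bump 4 0 1 z)"
  for b
 proof -
  let ?V = "{z. y + r *\<^sub>R z \<in> U}"
  have V: "open ?V" "?B <= ?V"
  proof -
   have "open ((%z. y + r *\<^sub>R z) -` U)" by (rule open_vimage[OF U(1)]) (intro continuous_intros)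
   then show "open ?V" by (simp add: vimage_def)
   show "?B <= ?V" using U1 r by auto
  qed
  have cV: "continuous_on ?V (%z. g (y + r *\<^sub>R z))" if "continuous_on U g" for g :: "'a => real"
   by (rule continuous_on_compose2[OF that]) (auto intro!: continuous_intros)
  show i1: "integrable lborel (%z. (z \<bullet> b) * D (y + r *\<^sub>R z) b * bump 3 0 1 z)"
   by (rule integrable_compact_support[of ?B]) (auto intro!: continuous_intros comp fD bump_continuous r simp: out)
  show i2: "integrable lborel (%z. H (y + r *\<^sub>R z) b b * bump 4 0 1 z)"
   by (rule integrable_compact_support[of ?B]) (auto intro!: continuous_intros comp C2_onD(5)[OF f] bump_continuous r simp: out)
  have "(LBINT z. r * (H (y + r *\<^sub>R z) b b * bump 4 0 1 z) - 8 * ((z \<bullet> b) * D (y + r *\<^sub>R z) b * bump 3 0 1 z)) = 0"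
  proof (rule integral_directional_derivative(2)[OF V(1) compact_cball V(2), where p="%z. D (y + r *\<^sub>R z) b * bump 4 0 1 z" and v=b])
   fix z assume "z \<in> ?V"
   then have zU: "y + r *\<^sub>R z \<in> U" by simp
   have "((%s. D ((y + r *\<^sub>R z) + s *\<^sub>R b) b) has_real_derivative H (y + r *\<^sub>R z) b b) (at (r * 0))"
    using C1_onD(4)[OF C2_onD(2)[OF f] zU] by simp
   moreover have "((%t. r * t) has_real_derivative r) (at 0)" by (auto intro!: derivative_eq_intros)
   ultimately have "((%t. D ((y + r *\<^sub>R z) + (r * t) *\<^sub>R b) b) has_real_derivative H (y + r *\<^sub>R z) b b * r) (at 0)"
    by (rule DERIV_chain2[where g="%t. r * t" and x=0])
   then have d1: "((%t. D (y + r *\<^sub>R (z + t *\<^sub>R b)) b) has_real_derivative H (y + r *\<^sub>R z) b b * r) (at 0)"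
    by (simp add: algebra_simps)
   have d2: "((%t. bump 4 0 1 (z + t *\<^sub>R b)) has_real_derivative - 8 * (z \<bullet> b) * bump 3 0 1 z) (at 0)"
    using C1_onD(4)[OF C1_on_bump[of 3 0 1], of z b] by simp
   show "((%t. D (y + r *\<^sub>R (z + t *\<^sub>R b)) b * bump 4 0 1 (z + t *\<^sub>R b)) has_real_derivative
    r * (H (y + r *\<^sub>R z) b b * bump 4 0 1 z) - 8 * ((z \<bullet> b) * D (y + r *\<^sub>R z) b * bump 3 0 1 z)) (at 0)"
    by (rule DERIV_cong[OF DERIV_mult[OF d1 d2]]) (simp add: algebra_simps)
  qed (auto intro!: continuous_intros cV fD C2_onD(5)[OF f] bump_continuous simp: out)
  then show "8 * (LBINT z. (z \<bullet> b) * D (y + r *\<^sub>R z) b * bump 3 0 1 z) = r * (LBINT z. H (y + r *\<^sub>R z) b b * bump 4 0 1 z)"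
   using i1 i2 by simp
 qed
 have "(LBINT z. F' r z) = (LBINT z. (\<Sum>b\<in>Basis. (z \<bullet> b) * D (y + r *\<^sub>R z) b * bump 3 0 1 z))"
  by (intro Bochner_Integration.integral_cong refl) (auto simp: F'_def out sum_distrib_right)
 also have "... = (\<Sum>b\<in>Basis. (LBINT z. (z \<bullet> b) * D (y + r *\<^sub>R z) b * bump 3 0 1 z))"
  by (rule Bochner_Integration.integral_sum) (rule parts)
 also have "... = (\<Sum>b\<in>Basis. r / 8 * (LBINT z. H (y + r *\<^sub>R z) b b * bump 4 0 1 z))"
  by (intro sum.cong refl) (use parts(3) in \<open>simp add: field_simps\<close>)
 also have "... = r / 8 * (LBINT z. (\<Sum>b\<in>Basis. H (y + r *\<^sub>R z) b b * bump 4 0 1 z))"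
  unfolding sum_distrib_left[symmetric]
  by (subst Bochner_Integration.integral_sum) (auto intro: parts)
 also have "... = r / 8 * (LBINT z. laplacian H (y + r *\<^sub>R z) * bump 4 0 1 z)"
  by (simp add: laplacian_def sum_distrib_right)
 finally show "((%r. \<integral>z. f (y + r *\<^sub>R z) * bump 3 0 1 z \<partial>lborel) has_real_derivative
  (r / 8 * (LBINT z. laplacian H (y + r *\<^sub>R z) * bump 4 0 1 z))) (at r within {0..r0})"
  using DERIV_cong[OF der] by blast
qed

text \<open>By \<open>kernel_mean_deriv\<close>, the mean plus c r^2 / 16 times the integral of
  \<open>bump 4 0 1\<close> is nondecreasing in r; its value at r = 0 is the left-hand side.\<close>

lemma kernel_mean_ge:
 fixes f :: "'a::euclidean_space => real"
 assumes U: "open U" "cball y r0 <= U" "r0 >= 0" and f: "C2_on U f D H"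
  and c: "!!z. z \<in> cball y r0 ==> laplacian H z >= - c"
 shows "f y * (LBINT z. bump 3 (0::'a) 1 z) \<le>
  (LBINT z. f (y + r0 *\<^sub>R z) * bump 3 0 1 z) + c * r0\<^sup>2 / 16 * (LBINT z. bump 4 (0::'a) 1 z)"
proof -
 let ?Z = "\<integral>z. bump 4 (0::'a) 1 z \<partial>lborel"
 define A where "A r = (LBINT z. f (y + r *\<^sub>R z) * bump 3 0 1 z)" for r
 define L where "L r = (LBINT z. laplacian H (y + r *\<^sub>R z) * bump 4 0 1 z)" for r
 have "A 0 + c * 0\<^sup>2 / 16 * ?Z <= A r0 + c * r0\<^sup>2 / 16 * ?Z"
 proof (rule DERIV_within_nonneg_mono[OF U(3), where f'="%r. r / 8 * L r + c * r / 8 * ?Z"])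
  fix r assume r: "r \<in> {0..r0}"
  show "((%r. A r + c * r\<^sup>2 / 16 * ?Z) has_real_derivative r / 8 * L r + c * r / 8 * ?Z) (at r within {0..r0})"
   unfolding A_def L_def
   by (rule DERIV_add[OF kernel_mean_deriv(1)[OF U(1,2) f r]]) (auto intro!: derivative_eq_intros)
  have "- c * ?Z = (LBINT z. - c * bump 4 (0::'a) 1 z)" by simp
  also have "... <= L r" unfolding L_def
  proof (rule integral_mono)
   show "- c * bump 4 0 1 z <= laplacian H (y + r *\<^sub>R z) * bump 4 0 1 z" for z
   proof (cases "z \<in> cball 0 1")
    case True
    have "r * norm z <= r * 1" using True r by (intro mult_left_mono) auto
    then have "y + r *\<^sub>R z \<in> cball y r0" using r by (simp add: dist_norm)
    then show ?thesis using c by (intro mult_right_mono) auto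
   qed (use bump_outside[of 4 1 z 0] in simp)
  qed (auto intro!: integrable_mult_right bump_integrable kernel_mean_deriv(3)[OF U(1,2) f r])
  finally have "0 <= r / 8 * (L r + c * ?Z)" using r by (intro mult_nonneg_nonneg) auto
  then show "0 <= r / 8 * L r + c * r / 8 * ?Z" by (simp add: algebra_simps)
 qed
 then show ?thesis by (simp add: A_def)
qed

section \<open>Integration by parts against powers of closed forms\<close>

lemma DERIV_prod_set:
 fixes f :: "'i => real => real"
 assumes "finite S" "!!k. k \<in> S ==> (f k has_real_derivative f' k) (at t)"
 shows "((%t. \<Prod>k\<in>S. f k t) has_real_derivative (\<Sum>m\<in>S. f' m * (\<Prod>k\<in>S-{m}. f k t))) (at t)"
proof -
 have "((%t. \<Prod>k\<in>S. f k t) has_derivative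
   (%y. \<Sum>m\<in>S. (f' m * y) * (\<Prod>k\<in>S-{m}. f k t))) (at t)"
  by (rule has_derivative_prod) (use assms in \<open>auto simp: has_field_derivative_def\<close>)
 moreover have "(%y. \<Sum>m\<in>S. (f' m * y) * (\<Prod>k\<in>S-{m}. f k t)) = (*) (\<Sum>m\<in>S. f' m * (\<Prod>k\<in>S-{m}. f k t))"
  by (simp add: fun_eq_iff sum_distrib_left sum_distrib_right mult_ac)
 ultimately show ?thesis by (simp add: has_field_derivative_def)
qed

lemma C1_on_prod:
 assumes "finite S" "!!k. k \<in> S ==> C1_on U (f k) (D k)"
 shows "C1_on U (%z. \<Prod>k\<in>S. f k z) (%z v. \<Sum>m\<in>S. D m z v * (\<Prod>k\<in>S-{m}. f k z))"
 unfolding C1_on_def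
proof (intro conjI ballI allI)
 note f = C1_onD[OF assms(2)]
 show "continuous_on U (%z. \<Prod>k\<in>S. f k z)" by (intro continuous_intros f)
 show "continuous_on U (%z. \<Sum>m\<in>S. D m z v * (\<Prod>k\<in>S-{m}. f k z))" for v
  by (intro continuous_intros f) auto
 show "linear (%v. \<Sum>m\<in>S. D m z v * (\<Prod>k\<in>S-{m}. f k z))" if z: "z \<in> U" for z
  using f(3)[OF _ z] by (auto intro!: linearI simp: linear_add linear_scale sum.distrib[symmetric] sum_distrib_left algebra_simps intro!: sum.cong)
 show "((%t. \<Prod>k\<in>S. f k (z + t *\<^sub>R v)) has_real_derivative (\<Sum>m\<in>S. D m z v * (\<Prod>k\<in>S-{m}. f k z))) (at 0)"
  if z: "z \<in> U" for z v
  using DERIV_prod_set[OF assms(1), of "%k t. f k (z + t *\<^sub>R v)" "%k. D k z v" 0] f(4)[OF _ z] by simp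
qed

text \<open>Up to the factor 2^n this is \<open>top_power_deriv\<close>, read on arrays of values at
  frame vectors. The array \<open>w\<close> may fail to be antisymmetric, which lets the terms of a
  product rule be treated one by one.\<close>

definition perm_deriv :: "('n::finite \<times> bool => 'n \<times> bool => real) => ('n \<times> bool => 'n \<times> bool => real) => real" where
 "perm_deriv x w = (\<Sum>ss | ss permutes (UNIV :: ('n \<times> bool) set). of_int (sign ss) *
  (\<Sum>j\<in>UNIV. w (ss (j, False)) (ss (j, True)) * (\<Prod>k\<in>UNIV-{j}. x (ss (k, False)) (ss (k, True)))))"

lemma perm_sum_compose:
 fixes f :: "('i::finite => 'i) => real"
 assumes q: "q permutes UNIV"
 shows "(\<Sum>ss | ss permutes UNIV. of_int (sign ss) * f ss) =
  of_int (sign q) * (\<Sum>ss | ss permutes UNIV. of_int (sign ss) * f (ss o q))"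
proof -
 have "(\<Sum>ss | ss permutes UNIV. of_int (sign ss) * f ss) =
  (\<Sum>ss | ss permutes UNIV. of_int (sign (ss o q)) * f (ss o q))"
  by (rule sum_permutations_compose_right[OF q])
 also have "... = (\<Sum>ss | ss permutes UNIV. of_int (sign q) * (of_int (sign ss) * f (ss o q)))"
 proof (rule sum.cong[OF refl])
  fix ss :: "'i => 'i" assume "ss \<in> {ss. ss permutes UNIV}"
  then have "permutation ss" "permutation q" using q finite unfolding permutation_permutes by blast+
  then show "of_int (sign (ss o q)) * f (ss o q) = of_int (sign q) * (of_int (sign ss) * f (ss o q))"
   by (simp add: sign_compose)
 qed
 finally show ?thesis by (simp add: sum_distrib_left)
qed

text \<open>Exchanging (j, False) and (j, True) is odd and fixes the other factors, so the
  transposed array contributes the negative of the original one.\<close>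

lemma perm_deriv_antisym:
 "perm_deriv x (%a b. w a b - w b a) = 2 * perm_deriv x (w :: 'n::finite \<times> bool => _)"
proof -
 have sw: "(\<Sum>ss | ss permutes (UNIV :: ('n \<times> bool) set). of_int (sign ss) *
   (w (ss (j, True)) (ss (j, False)) * (\<Prod>k\<in>UNIV-{j}. x (ss (k, False)) (ss (k, True))))) =
  - (\<Sum>ss | ss permutes (UNIV :: ('n \<times> bool) set). of_int (sign ss) *
   (w (ss (j, False)) (ss (j, True)) * (\<Prod>k\<in>UNIV-{j}. x (ss (k, False)) (ss (k, True)))))" for j
 proof -
  let ?q = "Transposition.transpose (j, False) (j, True)"
  have q: "?q permutes UNIV" by (rule permutes_swap_id) auto
  have "(\<Prod>k\<in>UNIV-{j}. x ((ss o ?q) (k, False)) ((ss o ?q) (k, True))) = (\<Prod>k\<in>UNIV-{j}. x (ss (k, False)) (ss (k, True)))" for ss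
   by (intro prod.cong refl) (auto simp: Transposition.transpose_def)
  then show ?thesis
   by (subst perm_sum_compose[OF q]) (simp add: sign_swap_id)
 qed
 have ex: "perm_deriv x w = (\<Sum>j\<in>UNIV. \<Sum>ss | ss permutes (UNIV :: ('n \<times> bool) set). of_int (sign ss) *
   (w (ss (j, False)) (ss (j, True)) * (\<Prod>k\<in>UNIV-{j}. x (ss (k, False)) (ss (k, True)))))" for w
  unfolding perm_deriv_def sum_distrib_left by (rule sum.swap)
 have "perm_deriv x (%a b. w a b - w b a) = perm_deriv x w - perm_deriv x (%a b. w b a)"
  unfolding perm_deriv_def by (simp add: left_diff_distrib sum_subtractf right_diff_distrib)
 also have "perm_deriv x (%a b. w b a) = - perm_deriv x w"
  unfolding ex sw by (simp add: sum_negf)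
 finally show ?thesis by simp
qed

text \<open>The 3-cycle of (j, False), (m, False), (m, True) is even and fixes all other arguments,
  so the three rotations of \<open>d\<close> have equal sums. Their total vanishes by
  \<open>cyc\<close>, which expresses that the form is closed.\<close>

lemma perm_closed_cancel:
 fixes d :: "'n::finite \<times> bool => 'n \<times> bool => 'n \<times> bool => real"
 assumes cyc: "!!a b c. d a b c + d b c a + d c a b = 0" and jm: "j ~= m"
 shows "(\<Sum>ss | ss permutes (UNIV :: ('n \<times> bool) set). of_int (sign ss) *
   (al (ss (j, True)) * (d (ss (j, False)) (ss (m, False)) (ss (m, True)) *
   (\<Prod>k\<in>UNIV-{j}-{m}. x (ss (k, False)) (ss (k, True)))))) = 0"
proof -
 let ?t1 = "Transposition.transpose (j, False) (m, False)" and ?t2 = "Transposition.transpose (m, False) (m, True)"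
 define q where "q = ?t1 o ?t2"
 let ?g = "%ss. \<Prod>k\<in>UNIV-{j}-{m}. x (ss (k, False)) (ss (k, True))"
 let ?S = "%F. \<Sum>ss | ss permutes (UNIV :: ('n \<times> bool) set). of_int (sign ss) * (al (ss (j, True)) * (F ss * ?g ss))"
 have t: "?t1 permutes UNIV" "?t2 permutes UNIV" by (auto intro: permutes_swap_id)
 then have q: "q permutes UNIV" unfolding q_def by (intro permutes_compose)
 have "sign q = sign ?t1 * sign ?t2" unfolding q_def by (intro sign_compose permutation_swap_id)
 then have sq: "sign q = 1" using jm by (simp add: sign_swap_id)
 have g: "?g (ss o q) = ?g ss" for ss
  by (intro prod.cong refl) (auto simp: q_def Transposition.transpose_def)
 have v: "q (j, True) = (j, True)" "q (j, False) = (m, False)" "q (m, False) = (m, True)" "q (m, True) = (j, False)"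
  using jm by (auto simp: q_def Transposition.transpose_def)
 have rot: "?S F = ?S (%ss. F (ss o q))" for F
  by (subst perm_sum_compose[OF q]) (simp add: sq v g[unfolded o_apply])
 let ?F = "%ss. d (ss (j, False)) (ss (m, False)) (ss (m, True))"
 have r1: "?S ?F = ?S (%ss. d (ss (m, False)) (ss (m, True)) (ss (j, False)))"
  by (subst rot) (simp only: o_apply v)
 have r2: "?S ?F = ?S (%ss. d (ss (m, True)) (ss (j, False)) (ss (m, False)))"
  unfolding r1 by (subst rot) (simp only: o_apply v)
 have "3 * ?S ?F = ?S ?F + ?S (%ss. d (ss (m, False)) (ss (m, True)) (ss (j, False))) + ?S (%ss. d (ss (m, True)) (ss (j, False)) (ss (m, False)))"
  using r1 r2 by linarith
 also have "... = ?S (%ss. d (ss (j, False)) (ss (m, False)) (ss (m, True)) + d (ss (m, False)) (ss (m, True)) (ss (j, False)) + d (ss (m, True)) (ss (j, False)) (ss (m, False)))"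
  unfolding sum.distrib[symmetric] by (intro sum.cong refl) (simp add: algebra_simps)
 also have "... = 0" by (simp add: cyc)
 finally show ?thesis by simp
qed

text \<open>Stokes' theorem for the compactly supported form ch al wedge x^(n-1). Where the
  derivative falls on a factor of \<open>x\<close>, the terms cancel because \<open>x\<close> is
  closed.\<close>

lemma smooth_form_parts:
 fixes x :: "complex ^ 'n::finite => 'n \<times> bool => 'n \<times> bool => real"
 assumes V: "open V" and K: "compact K" "K <= V"
  and x: "!!a b. C1_on V (%z. x z a b) (%z v. dx z v a b)"
  and cyc: "!!z a b c. z \<in> V ==> dx z (real_frame a) b c + dx z (real_frame b) c a + dx z (real_frame c) a b = 0"
  and al: "!!b. C1_on V (%z. al z b) (%z v. dal z v b)"
  and ch: "C1_on V ch dch" "!!z. z ~: K ==> ch z = 0" "!!z v. z ~: K ==> dch z v = 0"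
 shows "(LBINT z. ch z * perm_deriv (x z) (%a b. dal z (real_frame a) b - dal z (real_frame b) a)) =
  - (LBINT z. perm_deriv (x z) (%a b. dch z (real_frame a) * al z b - dch z (real_frame b) * al z a))"
proof -
 let ?P = "{ss. ss permutes (UNIV :: ('n \<times> bool) set)}"
 define pr where "pr j ss z = (\<Prod>k\<in>UNIV-{j}. x z (ss (k, False)) (ss (k, True)))" for j :: 'n and ss :: "'n \<times> bool => 'n \<times> bool" and z
 define dpr where "dpr j ss z v = (\<Sum>m\<in>UNIV-{j}. dx z v (ss (m, False)) (ss (m, True)) *
   (\<Prod>k\<in>UNIV-{j}-{m}. x z (ss (k, False)) (ss (k, True))))" for j :: 'n and ss :: "'n \<times> bool => 'n \<times> bool" and z v
 \<comment> \<open>The full derivative of the product of \<open>ch\<close>, \<open>al\<close> and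
   \<open>pr\<close> in the direction of the frame vector at (j, False); its integral is zero. Its
   third line is what \<open>cancel\<close> removes.\<close>
 define Q where "Q j ss z = dch z (real_frame (ss (j, False))) * al z (ss (j, True)) * pr j ss z
   + ch z * dal z (real_frame (ss (j, False))) (ss (j, True)) * pr j ss z
   + ch z * al z (ss (j, True)) * dpr j ss z (real_frame (ss (j, False)))" for j :: 'n and ss :: "'n \<times> bool => 'n \<times> bool" and z
 have C: "C1_on V (pr j ss) (dpr j ss)" for j :: 'n and ss :: "'n \<times> bool => 'n \<times> bool"
  unfolding pr_def dpr_def by (rule C1_on_prod) (auto intro: x)
 have Qint: "integrable lborel (Q j ss)" "(LBINT z. Q j ss z) = 0" for j :: 'n and ss :: "'n \<times> bool => 'n \<times> bool"
 proof -
  let ?p = "%z. ch z * al z (ss (j, True)) * pr j ss z"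
  have "C1_on V ?p (%z v. (dch z v * al z (ss (j, True)) + dal z v (ss (j, True)) * ch z) * pr j ss z +
    dpr j ss z v * (ch z * al z (ss (j, True))))"
   by (rule C1_on_mult[OF C1_on_mult[OF ch(1) al] C])
  note c = C1_onD[OF this]
  have e: "Q j ss = (%z. (dch z (real_frame (ss (j, False))) * al z (ss (j, True)) +
    dal z (real_frame (ss (j, False))) (ss (j, True)) * ch z) * pr j ss z +
    dpr j ss z (real_frame (ss (j, False))) * (ch z * al z (ss (j, True))))"
   by (auto simp: Q_def algebra_simps)
  show "integrable lborel (Q j ss)" "(LBINT z. Q j ss z) = 0"
   unfolding e
   by (rule integral_directional_derivative[OF V K, where p="?p" and v="real_frame (ss (j, False))"];
     use c ch(2,3) in \<open>simp_all\<close>)+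
 qed
 have cancel: "(\<Sum>ss\<in>?P. of_int (sign ss) * (\<Sum>j\<in>UNIV. ch z * al z (ss (j, True)) * dpr j ss z (real_frame (ss (j, False))))) = 0" for z
 proof (cases "z \<in> V")
  case False
  then have "ch z = 0" using ch(2) K(2) by auto
  then show ?thesis by simp
 next
  case True
  let ?T = "%ss j m. of_int (sign ss) * (al z (ss (j, True)) * (dx z (real_frame (ss (j, False))) (ss (m, False)) (ss (m, True)) *
   (\<Prod>k\<in>UNIV-{j}-{m}. x z (ss (k, False)) (ss (k, True)))))"
  have "(\<Sum>ss\<in>?P. of_int (sign ss) * (\<Sum>j\<in>UNIV. ch z * al z (ss (j, True)) * dpr j ss z (real_frame (ss (j, False)))))
   = (\<Sum>ss\<in>?P. \<Sum>j\<in>UNIV. \<Sum>m\<in>UNIV-{j}. ch z * ?T ss j m)"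
   unfolding dpr_def by (simp add: sum_distrib_left mult_ac)
  also have "... = (\<Sum>j\<in>UNIV. \<Sum>ss\<in>?P. \<Sum>m\<in>UNIV-{j}. ch z * ?T ss j m)" by (rule sum.swap)
  also have "... = (\<Sum>j\<in>UNIV. \<Sum>m\<in>UNIV-{j}. \<Sum>ss\<in>?P. ch z * ?T ss j m)"
   by (intro sum.cong refl sum.swap)
  also have "... = (\<Sum>j\<in>UNIV. \<Sum>m\<in>UNIV-{j}. ch z * (\<Sum>ss\<in>?P. ?T ss j m))"
   by (simp add: sum_distrib_left)
  also have "... = 0"
   by (intro sum.neutral ballI) (use perm_closed_cancel[where d="%a. dx z (real_frame a)"] cyc[OF True] in auto)
  finally show ?thesis .
 qed
 have pt: "2 * (\<Sum>ss\<in>?P. of_int (sign ss) * (\<Sum>j\<in>UNIV. Q j ss z)) =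
   perm_deriv (x z) (%a b. dch z (real_frame a) * al z b - dch z (real_frame b) * al z a)
   + ch z * perm_deriv (x z) (%a b. dal z (real_frame a) b - dal z (real_frame b) a)" for z
 proof -
  have "(\<Sum>ss\<in>?P. of_int (sign ss) * (\<Sum>j\<in>UNIV. Q j ss z)) =
   perm_deriv (x z) (%a b. dch z (real_frame a) * al z b) + ch z * perm_deriv (x z) (%a b. dal z (real_frame a) b)
   + (\<Sum>ss\<in>?P. of_int (sign ss) * (\<Sum>j\<in>UNIV. ch z * al z (ss (j, True)) * dpr j ss z (real_frame (ss (j, False)))))"
   unfolding perm_deriv_def Q_def pr_def
   by (simp add: sum.distrib sum_distrib_left algebra_simps)
  then show ?thesis unfolding cancel
   using perm_deriv_antisym[of "x z" "%a b. dch z (real_frame a) * al z b"]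
    perm_deriv_antisym[of "x z" "%a b. dal z (real_frame a) b"] by (simp add: algebra_simps)
 qed
 have cx: "continuous_on K (%z. x z a b)" for a b
  by (rule continuous_on_subset[OF C1_onD(1)[OF x] K(2)])
 have cperm: "continuous_on K (%z. perm_deriv (x z) (w z))" if "!!a b. continuous_on K (%z. w z a b)" for w
  unfolding perm_deriv_def
  by (intro continuous_intros that cx)
 have i1: "integrable lborel (%z. ch z * perm_deriv (x z) (%a b. dal z (real_frame a) b - dal z (real_frame b) a))"
  by (rule integrable_compact_support[OF K(1)])
   (auto intro!: continuous_on_mult cperm continuous_intros continuous_on_subset[OF C1_onD(1)[OF ch(1)] K(2)]
    continuous_on_subset[OF C1_onD(2)[OF al] K(2)] simp: ch(2))
 have i2: "integrable lborel (%z. perm_deriv (x z) (%a b. dch z (real_frame a) * al z b - dch z (real_frame b) * al z a))"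
  by (rule integrable_compact_support[OF K(1)])
   (auto intro!: cperm continuous_intros cx continuous_on_subset[OF C1_onD(2)[OF ch(1)] K(2)]
    continuous_on_subset[OF C1_onD(1)[OF al] K(2)] simp: ch(3) perm_deriv_def)
 have "(LBINT z. 2 * (\<Sum>ss\<in>?P. of_int (sign ss) * (\<Sum>j\<in>UNIV. Q j ss z))) = 0"
  using Qint by (simp add: integrable_sum integral_sum)
 then show ?thesis unfolding pt using i1 i2 by simp
qed

text \<open>The gradient of \<open>bump 3 y r\<close> is -6 (z - y) \<open>bump 2 y r\<close>, so
  the integral says that the exterior derivative of \<open>X\<close>, moved to the test function,
  vanishes on every bump. Only continuity of the coefficients enters, since a C^2 potential provides
  no more.\<close>

definition weakly_closed :: "(complex ^ 'n::finite) set => (complex ^ 'n => complex ^ 'n => complex ^ 'n => real) => bool" where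
 "weakly_closed U X \<longleftrightarrow> (\<forall>u v. continuous_on U (%z. X z u v)) &
  (\<forall>y r u v w. r > 0 --> cball y r <= U -->
   (LBINT z. (X z v w * ((z - y) \<bullet> u) + X z w u * ((z - y) \<bullet> v) + X z u v * ((z - y) \<bullet> w)) * bump 2 y r z) = 0)"

lemma bump_commute: "bump k c r z = bump k z r c"
proof -
 have "(z - c) \<bullet> (z - c) = (c - z) \<bullet> (c - z)"
  using inner_minus_left[of "z - c"] by (simp add: inner_diff_left inner_diff_right inner_commute)
 then show ?thesis by (simp add: bump_def)
qed

lemma bump_center: "(%x. bump k x r y) = bump k y r"
 by (rule ext) (rule bump_commute)

lemma continuous_integral_param:
 fixes g :: "'a::euclidean_space => real" and k :: "'a => 'b::euclidean_space => real"
 assumes g: "integrable lborel g" and k: "!!x. continuous_on UNIV (k x)" "!!x y. \<bar>k x y\<bar> <= M"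
  and meas: "!!y. (%x. k x y) \<in> borel_measurable borel"
 shows "continuous_on UNIV (%y. \<integral>x. g x * k x y \<partial>lborel)" "integrable lborel (%x. g x * k x y)"
proof -
 have b: "\<bar>g x * k x y\<bar> <= M * \<bar>g x\<bar>" for x y
  using k(2)[of x y] by (simp add: abs_mult mult.commute[of M] mult_left_mono)
 have gm [measurable]: "g \<in> borel_measurable borel" using borel_measurable_integrable[OF g] by simp
 note [measurable] = meas
 have iM: "integrable lborel (%x. M * \<bar>g x\<bar>)" using g by auto
 show "integrable lborel (%x. g x * k x y)"
  by (rule Bochner_Integration.integrable_bound[OF iM]) (use b in \<open>auto intro: order_trans[OF _ abs_ge_self]\<close>)
 show "continuous_on UNIV (%y. \<integral>x. g x * k x y \<partial>lborel)"
  unfolding continuous_on_sequentially o_def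
 proof (intro ballI allI impI; elim conjE)
  fix X a assume X: "X \<longlonglongrightarrow> (a::'b)"
  show "(%n. \<integral>x. g x * k x (X n) \<partial>lborel) \<longlonglongrightarrow> (LBINT x. g x * k x a)"
  proof (rule integral_dominated_convergence[OF _ _ iM])
   show "AE x in lborel. (%n. g x * k x (X n)) \<longlonglongrightarrow> g x * k x a"
    using k(1) X by (intro AE_I2 tendsto_mult tendsto_const)
     (auto simp: continuous_on_sequentially o_def)
  qed (use b in auto)
 qed
qed

text \<open>Convolution with the normalised \<open>bump 3\<close>. With this exponent the gradient
  of the kernel is the weight of \<open>weakly_closed\<close>, so that mollifying a weakly closed
  form yields a form that is closed in the ordinary sense.\<close>

definition mollify :: "real => ('a::euclidean_space => real) => 'a => real" where
 "mollify r g y = (LBINT x. g x * bump 3 x r y) / (LBINT x. bump 3 (0::'a) r x)"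

definition mollify_deriv :: "real => ('a::euclidean_space => real) => 'a => 'a => real" where
 "mollify_deriv r g y v = (LBINT x. g x * (- 6 * ((y - x) \<bullet> v) * bump 2 x r y)) / (LBINT x. bump 3 (0::'a) r x)"

lemma bump_translate: "bump k c r z = bump k 0 r (z - c)"
 by (simp add: bump_def)

lemma bump_integral_translate:
 fixes c :: "'a::euclidean_space"
 shows "(LBINT x. bump k c r x) = (LBINT x. bump k (0::'a) r x)"
 using integral_translate[of "bump k 0 r" "-c"] by (simp add: bump_translate[of k c])

lemma mollify_C1:
 fixes g :: "'a::euclidean_space => real"
 assumes g: "integrable lborel g" and r: "r > 0"
 shows "C1_on UNIV (mollify r g) (mollify_deriv r g)"
proof -
 let ?Z = "\<integral>x. bump 3 (0::'a) r x \<partial>lborel"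
 let ?k = "%v x y. - 6 * ((y - x) \<bullet> v) * bump 2 x r y :: real"
 have kb: "\<bar>?k v x y\<bar> <= 6 * r * norm v * (r\<^sup>2) ^ 2" for v x y :: 'a
 proof (cases "y \<in> cball x r")
  case True
  have "\<bar>(y - x) \<bullet> v\<bar> <= r * norm v"
   using Cauchy_Schwarz_ineq2[of "y - x" v] mult_right_mono[of "norm (y - x)" r "norm v"] True
   by (simp add: dist_norm norm_minus_commute)
  then have "\<bar>(y - x) \<bullet> v\<bar> * bump 2 x r y <= (r * norm v) * (r\<^sup>2)^2"
   using bump_le[of r 2 x y] r by (intro mult_mono) auto
  then show ?thesis by (simp add: abs_mult mult_ac)
 next
  case False
  then show ?thesis using bump_outside[of 2 r y x] r by simp
 qed
 have kc: "continuous_on UNIV (?k v x)" "(%x. ?k v x y) \<in> borel_measurable borel" for v x y :: 'a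
  unfolding bump_commute[of _ _ _ y]
  by (auto intro!: continuous_intros bump_continuous borel_measurable_continuous_onI)
 have b3: "\<bar>bump 3 x r y\<bar> <= (r\<^sup>2) ^ 3" for x y :: 'a using bump_le[of r 3 x y] r by simp
 have c3: "continuous_on UNIV (bump 3 x r)" "(%x. bump 3 x r y) \<in> borel_measurable borel" for x y :: 'a
  unfolding bump_commute[of _ _ _ y] by (auto intro!: bump_continuous)
 have i3: "integrable lborel (%x. g x * bump 3 x r y)" for y
  by (rule continuous_integral_param(2)[OF g c3(1) b3 c3(2)])
 have ik: "integrable lborel (%x. g x * ?k v x y)" for v y
  by (rule continuous_integral_param(2)[OF g kc(1) kb kc(2)])
 show ?thesis
  unfolding C1_on_def
 proof (intro conjI ballI allI)
  show "continuous_on UNIV (mollify r g)" unfolding mollify_def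
   using continuous_integral_param(1)[OF g c3(1) b3 c3(2)] by (intro continuous_on_divide continuous_on_const) (use bump_integral_pos[OF r, of 3 "0::'a"] in auto)
  show "continuous_on UNIV (%y. mollify_deriv r g y v)" for v unfolding mollify_deriv_def
   using continuous_integral_param(1)[OF g kc(1) kb kc(2)] by (intro continuous_on_divide continuous_on_const) (use bump_integral_pos[OF r, of 3 "0::'a"] in auto)
  show "linear (mollify_deriv r g y)" for y
  proof (rule linearI)
   fix u v :: 'a and c :: real
   have "g x * ?k (u + v) x y = g x * ?k u x y + g x * ?k v x y" for x
    by (simp add: inner_add_right algebra_simps)
   then show "mollify_deriv r g y (u + v) = mollify_deriv r g y u + mollify_deriv r g y v"
    unfolding mollify_deriv_def using ik[of y u] ik[of y v] by (simp only: Bochner_Integration.integral_add add_divide_distrib)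
   have "g x * ?k (c *\<^sub>R u) x y = c * (g x * ?k u x y)" for x by simp
   then show "mollify_deriv r g y (c *\<^sub>R u) = c *\<^sub>R mollify_deriv r g y u"
    unfolding mollify_deriv_def by (simp only: integral_mult_right_zero real_scaleR_def times_divide_eq_right)
  qed
  fix y v
  have "((%t. \<integral>x. g x * bump 3 x r (y + t *\<^sub>R v) \<partial>lborel) has_real_derivative (LBINT x. g x * ?k v x (y + 0 *\<^sub>R v))) (at 0 within UNIV)"
  proof (rule deriv_under_integral[where B="%x. (6 * r * norm v * (r\<^sup>2) ^ 2) * \<bar>g x\<bar>"])
   show "((%t. g x * bump 3 x r (y + t *\<^sub>R v)) has_real_derivative g x * ?k v x (y + t *\<^sub>R v)) (at t within UNIV)" for t x
    by (rule DERIV_cmult) (use C1_onD(5)[OF C1_on_bump[of 2 x r], of y t v] in simp)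
   show "\<bar>g x * ?k v x (y + t *\<^sub>R v)\<bar> <= (6 * r * norm v * (r\<^sup>2) ^ 2) * \<bar>g x\<bar>" for t x
    using mult_right_mono[OF kb[of "y + t *\<^sub>R v" x v], of "\<bar>g x\<bar>"] by (simp add: abs_mult mult_ac)
   show "integrable lborel (%x. (6 * r * norm v * (r\<^sup>2) ^ 2) * \<bar>g x\<bar>)" using g by auto
   show "(%x. g x * ?k v x (y + 0 *\<^sub>R v)) \<in> borel_measurable lborel" by (rule borel_measurable_integrable[OF ik])
  qed (use i3 in auto)
  then show "((%t. mollify r g (y + t *\<^sub>R v)) has_real_derivative mollify_deriv r g y v) (at 0)"
   unfolding mollify_def mollify_deriv_def by (intro DERIV_cdivide) simp
 qed
qed

lemma mollify_bound:
 fixes g :: "'a::euclidean_space => real"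
 assumes g: "integrable lborel g" and r: "r > 0" and M: "!!x. x \<in> cball y r ==> \<bar>g x - c\<bar> <= M"
 shows "\<bar>mollify r g y - c\<bar> <= M"
proof -
 let ?Z = "\<integral>x. bump 3 (0::'a) r x \<partial>lborel"
 have Z: "?Z > 0" by (rule bump_integral_pos[OF r]) simp
 have Zy: "(LBINT x. bump 3 x r y) = ?Z" "integrable lborel (%x. bump 3 x r y)"
  using bump_integral_translate[of 3 y r] bump_integrable[of r 3 y] r by (simp_all add: bump_commute[of 3 _ r y])
 have i3: "integrable lborel (%x. g x * bump 3 x r y)"
 proof (rule continuous_integral_param(2)[OF g bump_continuous])
  show "\<bar>bump 3 x r y\<bar> <= (r\<^sup>2) ^ 3" for x y :: 'a using bump_le[of r 3 x y] r by simp
  show "(%x. bump 3 x r y) \<in> borel_measurable borel" for y :: 'a unfolding bump_center by simp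
 qed
 have "mollify r g y - c = ((LBINT x. g x * bump 3 x r y) - c * (LBINT x. bump 3 x r y)) / ?Z"
  using Z Zy by (simp add: mollify_def diff_divide_distrib)
 also have "(LBINT x. g x * bump 3 x r y) - c * (LBINT x. bump 3 x r y) = (LBINT x. (g x - c) * bump 3 x r y)"
  using i3 Zy by (simp add: left_diff_distrib)
 finally have e: "mollify r g y - c = (LBINT x. (g x - c) * bump 3 x r y) / ?Z" .
 have "\<bar>\<integral>x. (g x - c) * bump 3 x r y \<partial>lborel\<bar> <= (LBINT x. M * bump 3 x r y)"
 proof (rule integral_abs_bound_integral)
  show "integrable lborel (%x. (g x - c) * bump 3 x r y)" using i3 Zy by (simp add: left_diff_distrib)
  show "\<bar>(g x - c) * bump 3 x r y\<bar> <= M * bump 3 x r y" for x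
  proof (cases "x \<in> cball y r")
   case True then show ?thesis using M by (simp add: abs_mult mult_right_mono)
  next
   case False then show ?thesis using bump_outside[of 3 r x y] r by (simp add: bump_commute[of 3 x])
  qed
 qed (use Zy in auto)
 also have "... = M * ?Z" using Zy by simp
 finally show ?thesis unfolding e using Z by (simp add: abs_divide pos_divide_le_eq)
qed

lemma perm_deriv_bound:
 fixes x w :: "'n::finite \<times> bool => 'n \<times> bool => real"
 assumes "!!a b. \<bar>x a b\<bar> <= M"
 shows "\<bar>perm_deriv x w\<bar> <= (\<Sum>ss | ss permutes (UNIV :: ('n \<times> bool) set). \<Sum>j\<in>UNIV. \<bar>w (ss (j, False)) (ss (j, True))\<bar> * M ^ (CARD('n) - 1))"
 unfolding perm_deriv_def
proof (rule order_trans[OF sum_abs], rule sum_mono)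
 fix ss :: "'n \<times> bool => _"
 have "\<bar>of_int (sign ss) * (\<Sum>j\<in>UNIV. w (ss (j, False)) (ss (j, True)) * (\<Prod>k\<in>UNIV - {j}. x (ss (k, False)) (ss (k, True))))\<bar>
  = \<bar>\<Sum>j\<in>UNIV. w (ss (j, False)) (ss (j, True)) * (\<Prod>k\<in>UNIV - {j}. x (ss (k, False)) (ss (k, True)))\<bar>"
  by (cases ss rule: sign_cases) (auto simp: abs_mult)
 also have "... <= (\<Sum>j\<in>UNIV. \<bar>w (ss (j, False)) (ss (j, True))\<bar> * M ^ (CARD('n) - 1))"
 proof (rule order_trans[OF sum_abs], rule sum_mono)
  fix j
  have "\<bar>\<Prod>k\<in>UNIV - {j}. x (ss (k, False)) (ss (k, True))\<bar> <= (\<Prod>k\<in>UNIV - {j}. M)"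
   unfolding abs_prod by (intro prod_mono) (use assms in auto)
  then show "\<bar>w (ss (j, False)) (ss (j, True)) * (\<Prod>k\<in>UNIV - {j}. x (ss (k, False)) (ss (k, True)))\<bar> <= \<bar>w (ss (j, False)) (ss (j, True))\<bar> * M ^ (CARD('n) - 1)"
   by (simp add: abs_mult mult_left_mono card_Diff_singleton)
 qed
 finally show "\<bar>of_int (sign ss) * (\<Sum>j\<in>UNIV. w (ss (j, False)) (ss (j, True)) * (\<Prod>k\<in>UNIV - {j}. x (ss (k, False)) (ss (k, True))))\<bar>
  <= (\<Sum>j\<in>UNIV. \<bar>w (ss (j, False)) (ss (j, True))\<bar> * M ^ (CARD('n) - 1))" .
qed

lemma perm_deriv_limit:
 fixes x :: "'a::euclidean_space => 'n::finite \<times> bool => 'n \<times> bool => real"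
 assumes K: "compact K"
  and x: "!!a b. continuous_on K (%z. x z a b)" and xm: "!!m a b. continuous_on K (%z. xm m z a b)"
  and lim: "!!z a b. z \<in> K ==> (%m. xm m z a b) \<longlonglongrightarrow> x z a b"
  and M: "!!m z a b. z \<in> K ==> \<bar>xm m z a b\<bar> <= M"
  and w: "!!a b. continuous_on K (%z. w z a b)" and out: "!!z a b. z ~: K ==> w z a b = 0"
 shows "(%m. \<integral>z. perm_deriv (xm m z) (w z) \<partial>lborel) \<longlonglongrightarrow> (LBINT z. perm_deriv (x z) (w z))"
proof -
 let ?B = "%z. \<Sum>ss | ss permutes (UNIV :: ('n \<times> bool) set). \<Sum>j\<in>UNIV. \<bar>w z (ss (j, False)) (ss (j, True))\<bar> * M ^ (CARD('n) - 1)"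
 have pz: "perm_deriv y (w z) = 0" if "z ~: K" for y z using out[OF that] by (simp add: perm_deriv_def)
 have int: "integrable lborel (%z. perm_deriv (y z) (w z))" if "!!a b. continuous_on K (%z. y z a b)" for y
  by (rule integrable_compact_support[OF K])
   (auto simp: perm_deriv_def out intro!: continuous_intros that w)
 show ?thesis
 proof (rule integral_dominated_convergence[where w="?B"])
  show "(%z. perm_deriv (x z) (w z)) \<in> borel_measurable lborel" by (rule borel_measurable_integrable[OF int[OF x]])
  show "(%z. perm_deriv (xm m z) (w z)) \<in> borel_measurable lborel" for m by (rule borel_measurable_integrable[OF int[OF xm]])
  show "integrable lborel ?B"
   by (rule integrable_compact_support[OF K]) (auto simp: out intro!: continuous_intros w)
  show "AE z in lborel. (%m. perm_deriv (xm m z) (w z)) \<longlonglongrightarrow> perm_deriv (x z) (w z)"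
  proof (rule AE_I2)
   fix z show "(%m. perm_deriv (xm m z) (w z)) \<longlonglongrightarrow> perm_deriv (x z) (w z)"
    by (cases "z \<in> K") (auto simp: pz, auto simp: perm_deriv_def intro!: tendsto_intros lim)
  qed
  show "AE z in lborel. norm (perm_deriv (xm m z) (w z)) <= ?B z" for m
  proof (rule AE_I2)
   fix z show "norm (perm_deriv (xm m z) (w z)) <= ?B z"
    using perm_deriv_bound[of "xm m z" M "w z"] M by (cases "z \<in> K") (auto simp: pz out)
  qed
 qed
qed

text \<open>The mollified coefficients are C^1 and closed, so \<open>smooth_form_parts\<close>
  applies to them. As the radius tends to 0 they converge boundedly on \<open>K\<close>, and
  dominated convergence gives the formula for \<open>X\<close>.\<close>

lemma weak_form_parts:
 fixes X :: "complex ^ 'n::finite => complex ^ 'n => complex ^ 'n => real"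
 assumes U: "open U" and K: "compact K" "K <= U" and X: "weakly_closed U X"
  and al: "!!b. C1_on U (%z. al z b) (%z v. dal z v b)"
  and ch: "C1_on U ch dch" "!!z. z ~: K ==> ch z = 0" "!!z v. z ~: K ==> dch z v = 0"
 defines "x == %z a b. X z (real_frame a) (real_frame b)"
 shows "(LBINT z. perm_deriv (x z) (%a b. ch z * (dal z (real_frame a) b - dal z (real_frame b) a))) =
  - (LBINT z. perm_deriv (x z) (%a b. dch z (real_frame a) * al z b - dch z (real_frame b) * al z a))"
proof -
 obtain e where e: "e > 0" "(\<Union>y\<in>K. cball y e) <= U"
  using compact_subset_open_imp_cball_epsilon_subset[OF K(1) U K(2)] by blast
 define L where "L = {y + z | y z. y \<in> K & z \<in> cball 0 e}"
 have cL: "compact L" unfolding L_def by (rule compact_sums[OF K(1) compact_cball])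
 have Lin: "z \<in> L" if "y \<in> K" "z \<in> cball y e" for y z
  unfolding L_def using that by (intro CollectI exI[of _ y] exI[of _ "z - y"]) (auto simp: dist_norm norm_minus_commute)
 have LU: "L <= U"
 proof
  fix q assume "q \<in> L"
  then obtain y z where "q = y + z" "y \<in> K" "z \<in> cball 0 e" by (auto simp: L_def)
  then have "q \<in> cball y e" by (simp add: dist_norm)
  then show "q \<in> U" using e(2) \<open>y \<in> K\<close> by blast
 qed
 \<comment> \<open>\<open>L\<close> is the closed \<open>e\<close>-neighbourhood of
   \<open>K\<close>. Balls of radius at most e/2 around points of \<open>V\<close> stay in
   \<open>L\<close>, hence in \<open>U\<close>.\<close>
 define V where "V = (\<Union>y\<in>K. ball y (e/2))"
 have V: "open V" "K <= V" using e(1) by (auto simp: V_def intro!: bexI)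
 have VL: "cball y r <= L" if "y \<in> V" "r <= e / 2" for y r
 proof
  fix q assume q: "q \<in> cball y r"
  obtain k where k: "k \<in> K" "dist k y < e/2" using \<open>y \<in> V\<close> by (auto simp: V_def)
  have "dist k q <= e" using dist_triangle[of k q y] k q that(2) by simp
  then show "q \<in> L" using Lin[OF k(1)] by simp
 qed
 have VU: "V <= U"
 proof
  fix y assume "y \<in> V"
  from VL[OF this, of 0] e(1) LU show "y \<in> U" by auto
 qed
 have Xc: "continuous_on U (%z. x z a b)" for a b using X by (simp add: weakly_closed_def x_def)
 \<comment> \<open>Extension by zero makes the coefficients integrable on the whole space. At points
   of \<open>V\<close>, mollifications with radius at most e/2 see only values inside
   \<open>L\<close>.\<close>
 define g where "g a b z = (if z \<in> L then x z a b else 0)" for a b z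
 have gc: "continuous_on L (g a b)" for a b
  by (rule continuous_on_eq[OF continuous_on_subset[OF Xc LU]]) (simp add: g_def)
 have gi: "integrable lborel (g a b)" for a b
  by (rule integrable_compact_support[OF cL gc]) (simp add: g_def)
 define r where "r m = e / 2 / real (Suc m)" for m :: nat
 have r: "r m > 0" "r m <= e / 2" for m using e(1) by (auto simp: r_def divide_simps mult_ge1_I)
 have rlim: "r \<longlonglongrightarrow> 0" unfolding r_def by (rule real_tendsto_divide_at_top[OF tendsto_const])
   (rule filterlim_compose[OF filterlim_real_sequentially filterlim_Suc])
 define xm where "xm m z a b = mollify (r m) (g a b) z" for m z a b
 define dxm where "dxm m z v a b = mollify_deriv (r m) (g a b) z v" for m z v a b
 have C: "C1_on V (%z. xm m z a b) (%z v. dxm m z v a b)" for m a b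
  unfolding xm_def dxm_def by (rule C1_on_subset[OF mollify_C1[OF gi r(1)]]) simp
 \<comment> \<open>The cyclic sum of derivatives is six times the integral in
   \<open>weakly_closed\<close> at the ball around \<open>z\<close>, divided by the mass of the
   kernel.\<close>
 have cyc: "dxm m z (real_frame a) b c + dxm m z (real_frame b) c a + dxm m z (real_frame c) a b = 0" if z: "z \<in> V" for m z a b c
 proof -
  let ?h = "%a b c y. x y b c * ((y - z) \<bullet> real_frame a) * bump 2 z (r m) y"
  have e1: "g b c y * (- 6 * ((z - y) \<bullet> real_frame a) * bump 2 y (r m) z) = 6 * ?h a b c y" for a b c y
  proof (cases "y \<in> cball z (r m)")
   case True
   then have "y \<in> L" using VL[OF z r(2)] by blast
   then show ?thesis by (simp add: g_def bump_commute[of 2 y] inner_diff_left algebra_simps)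
  next
   case False
   then show ?thesis using bump_outside[of 2 "r m" y z] r(1)[of m] by (simp add: bump_commute[of 2 y])
  qed
  have ih: "integrable lborel (?h a b c)" for a b c
  proof (rule integrable_compact_support[OF compact_cball[of z "r m"]])
   show "continuous_on (cball z (r m)) (?h a b c)"
    using VL[OF z r(2)] LU by (intro continuous_intros continuous_on_subset[OF Xc] bump_continuous) blast
   show "?h a b c y = 0" if "y ~: cball z (r m)" for y using bump_outside[OF _ _ that, of 2] r(1)[of m] by simp
  qed
  define I where "I a b c = (LBINT y. ?h a b c y)" for a b c
  have d: "dxm m z (real_frame a) b c = 6 * I a b c / (LBINT y. bump 3 (0 :: complex ^ 'n) (r m) y)" for a b c
   unfolding dxm_def mollify_deriv_def e1 I_def by simp
  have "I a b c + I b c a + I c a b =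
   (LBINT y. (X y (real_frame b) (real_frame c) * ((y - z) \<bullet> real_frame a) + X y (real_frame c) (real_frame a) * ((y - z) \<bullet> real_frame b)
    + X y (real_frame a) (real_frame b) * ((y - z) \<bullet> real_frame c)) * bump 2 z (r m) y)"
   unfolding I_def using ih[of a b c] ih[of b c a] ih[of c a b] by (simp add: x_def distrib_right)
  also have "... = 0" using X VL[OF z r(2)[of m]] LU r(1)[of m] unfolding weakly_closed_def by blast
  finally have "I a b c + I b c a + I c a b = 0" .
  moreover have "dxm m z (real_frame a) b c + dxm m z (real_frame b) c a + dxm m z (real_frame c) a b =
    6 * (I a b c + I b c a + I c a b) / (LBINT y. bump 3 (0 :: complex ^ 'n) (r m) y)"
   unfolding d by (simp only: add_divide_distrib distrib_left)
  ultimately show ?thesis by simp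
 qed
 obtain M where M: "!!a b z. \<bar>g a b z\<bar> <= M"
 proof -
  have "bounded (\<Union>p\<in>UNIV. g (fst p) (snd p) ` L)"
   by (intro bounded_UN ballI compact_imp_bounded compact_continuous_image gc cL) simp
  then obtain M where M: "!!q. q \<in> (\<Union>p\<in>UNIV. g (fst p) (snd p) ` L) ==> \<bar>q\<bar> <= M"
   unfolding bounded_iff real_norm_def by blast
  have "\<bar>g a b z\<bar> <= max M 0" for a b z
  proof (cases "z \<in> L")
   case True
   then have "g a b z \<in> (\<Union>p\<in>UNIV. g (fst p) (snd p) ` L)" by (intro UN_I[of "(a, b)"]) auto
   from M[OF this] show ?thesis by simp
  qed (simp add: g_def)
  then show ?thesis by (rule that)
 qed
 have xmb: "\<bar>xm m z a b\<bar> <= M" for m z a b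
  using mollify_bound[OF gi r(1), of z m a b 0 M] M by (simp add: xm_def)
 have xlim: "(%m. xm m z a b) \<longlonglongrightarrow> x z a b" if z: "z \<in> K" for z a b
 proof (rule LIMSEQ_I)
  fix \<epsilon> :: real assume \<epsilon>: "\<epsilon> > 0"
  have zU: "z \<in> U" using z K by blast
  then have "isCont (%z. x z a b) z" using Xc U continuous_on_eq_continuous_at by blast
  from this[unfolded continuous_at_eps_delta, rule_format, of "\<epsilon>/2"] \<epsilon>
  obtain d where d: "d > 0" "!!y. dist y z < d ==> dist (x y a b) (x z a b) < \<epsilon>/2"
   by auto
  obtain m0 where m0': "!!m. m >= m0 ==> norm (r m - 0) < d"
   using LIMSEQ_D[OF rlim d(1)] by blast
  have m0: "!!m. m >= m0 ==> r m < d" using m0' by force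
  show "\<exists>no. \<forall>n\<ge>no. norm (xm n z a b - x z a b) < \<epsilon>"
  proof (intro exI[of _ m0] allI impI)
   fix m assume m: "m >= m0"
   have "\<bar>xm m z a b - x z a b\<bar> <= \<epsilon> / 2" unfolding xm_def
   proof (rule mollify_bound[OF gi r(1)])
    fix y assume y: "y \<in> cball z (r m)"
    then have "y \<in> L" using VL[OF _ r(2)] V(2) z by blast
    moreover have "dist y z < d" using y m0[OF m] by (simp add: dist_commute)
    ultimately show "\<bar>g a b y - x z a b\<bar> <= \<epsilon> / 2" using d(2)[of y] by (simp add: g_def dist_real_def)
   qed
   then show "norm (xm m z a b - x z a b) < \<epsilon>" using \<epsilon> by simp
  qed
 qed
 have cK: "continuous_on K h" if "continuous_on U h" for h :: "complex ^ 'n => real"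
  by (rule continuous_on_subset[OF that K(2)])
 have cm: "continuous_on K (%z. xm m z a b)" for m a b
  by (rule continuous_on_subset[OF C1_onD(1)[OF C] V(2)])
 have L1: "(%m. \<integral>z. perm_deriv (xm m z) (%a b. ch z * (dal z (real_frame a) b - dal z (real_frame b) a)) \<partial>lborel)
  \<longlonglongrightarrow> (LBINT z. perm_deriv (x z) (%a b. ch z * (dal z (real_frame a) b - dal z (real_frame b) a)))"
  by (rule perm_deriv_limit[OF K(1) cK[OF Xc] cm xlim xmb])
   (auto intro!: continuous_intros cK C1_onD(1)[OF ch(1)] C1_onD(2)[OF al] simp: ch(2))
 have L2: "(%m. \<integral>z. perm_deriv (xm m z) (%a b. dch z (real_frame a) * al z b - dch z (real_frame b) * al z a) \<partial>lborel)
  \<longlonglongrightarrow> (LBINT z. perm_deriv (x z) (%a b. dch z (real_frame a) * al z b - dch z (real_frame b) * al z a))"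
  by (rule perm_deriv_limit[OF K(1) cK[OF Xc] cm xlim xmb])
   (auto intro!: continuous_intros cK C1_onD(2)[OF ch(1)] C1_onD(1)[OF al] simp: ch(3))
 have pm: "perm_deriv y (%a b. c * w a b) = c * perm_deriv y w" for y w and c :: real
  unfolding perm_deriv_def by (simp add: sum_distrib_left mult_ac)
 have "(LBINT z. perm_deriv (xm m z) (%a b. ch z * (dal z (real_frame a) b - dal z (real_frame b) a))) =
  - (LBINT z. perm_deriv (xm m z) (%a b. dch z (real_frame a) * al z b - dch z (real_frame b) * al z a))" for m
  unfolding pm
  by (rule smooth_form_parts[OF V(1) K(1) V(2) C cyc C1_on_subset[OF al VU] C1_on_subset[OF ch(1) VU] ch(2,3)])
 with L1 have "(%m. - (LBINT z. perm_deriv (xm m z) (%a b. dch z (real_frame a) * al z b - dch z (real_frame b) * al z a)))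
  \<longlonglongrightarrow> (LBINT z. perm_deriv (x z) (%a b. ch z * (dal z (real_frame a) b - dal z (real_frame b) a)))" by simp
 from LIMSEQ_unique[OF this tendsto_minus[OF L2]] show ?thesis .
qed

section \<open>The comparison principle\<close>

text \<open>The form i times ddbar of a function with real Hessian \<open>h\<close>. On (u, J u) it
  is the average of \<open>h\<close> over u and J u.\<close>

definition ddc :: "(complex ^ 'n::finite => complex ^ 'n => real) => complex ^ 'n => complex ^ 'n => real" where
 "ddc h u v = (h v (J u) - h u (J v)) / 2"

lemma ddc_herm:
 assumes "bilinear h" "!!u v. h u v = h v u"
 shows "herm_form (ddc h)" "ddc h u (J u) = (h u u + h (J u) (J u)) / 2"
proof -
 note [simp] = bilinear_ladd[OF assms(1)] bilinear_radd[OF assms(1)] bilinear_lmul[OF assms(1)]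
  bilinear_rmul[OF assms(1)] bilinear_lneg[OF assms(1)] bilinear_rneg[OF assms(1)]
 have "bilinear (ddc h)" unfolding bilinear_def ddc_def
  by (auto intro!: linearI simp: algebra_simps add_divide_distrib diff_divide_distrib)
 moreover have "ddc h u v = - ddc h v u" for u v by (simp add: ddc_def field_simps)
 moreover have "ddc h (J u) (J v) = ddc h u v" for u v
  using assms(2)[of u "J v"] assms(2)[of v "J u"] by (simp add: ddc_def)
 ultimately show "herm_form (ddc h)" unfolding herm_form_def by blast
 show "ddc h u (J u) = (h u u + h (J u) (J u)) / 2" by (simp add: ddc_def)
qed

lemma top_power_deriv_perm:
 "top_power_deriv X W = perm_deriv (%a b. X (real_frame a) (real_frame b)) (%a b. W (real_frame a) (real_frame b)) / 2 ^ CARD('n)"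
 for X W :: "complex ^ 'n::finite => complex ^ 'n => real"
 by (simp add: top_power_deriv_def perm_deriv_def)

lemma C1_on_cong_open:
 assumes U: "open U" and f: "C1_on U f D" and eq: "!!z. z \<in> U ==> f z = g z" "!!z v. z \<in> U ==> D z v = E z v"
 shows "C1_on U g E"
 unfolding C1_on_def
proof (intro conjI ballI allI)
 show "continuous_on U g" by (rule continuous_on_eq[OF C1_onD(1)[OF f] eq(1)])
 show "continuous_on U (%z. E z v)" for v by (rule continuous_on_eq[OF C1_onD(2)[OF f] eq(2)])
 fix z assume z: "z \<in> U"
 have "D z = E z" using eq(2)[OF z] by (rule ext)
 then show "linear (E z)" using C1_onD(3)[OF f z] by simp
 fix v
 have ev: "eventually (%t. f (z + t *\<^sub>R v) = g (z + t *\<^sub>R v)) (nhds 0)"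
  using eventually_line[OF U z, of v] by eventually_elim (rule eq(1))
 show "((%t. g (z + t *\<^sub>R v)) has_real_derivative E z v) (at 0)"
  using DERIV_cong_ev[OF refl ev refl] C1_onD(4)[OF f z, of v] eq(2)[OF z, of v] by simp
qed

text \<open>A step from 0 to 1 on [d, 2d]; the two nested truncated squares make it continuously
  differentiable at both ends.\<close>

definition cutoff :: "real => real => real" where
 "cutoff d x = 1 - (max 0 (1 - (max 0 ((x - d) / d))\<^sup>2))\<^sup>2"

definition cutoff' :: "real => real => real" where
 "cutoff' d x = 4 / d * max 0 (1 - (max 0 ((x - d) / d))\<^sup>2) * max 0 ((x - d) / d)"

lemma cutoff_props:
 assumes "d > 0"
 shows "(cutoff d has_real_derivative cutoff' d x) (at x)" "continuous_on S (cutoff' d)" "cutoff' d x >= 0"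
  "0 <= cutoff d x" "cutoff d x <= 1" "x <= d ==> cutoff d x = 0" "x <= d ==> cutoff' d x = 0" "x >= 2 * d ==> cutoff d x = 1"
proof -
 have m: "((%x. (max 0 x)\<^sup>2) has_real_derivative 2 * max 0 x) (at x)" for x :: real
  using max_power_has_derivative[of 1 x] by (simp add: numeral_2_eq_2)
 have 1: "((%x. (max 0 ((x - d) / d))\<^sup>2) has_real_derivative 2 * max 0 ((x - d) / d) * (1 / d)) (at x)" for x
  by (rule DERIV_chain2[OF m]) (use assms in \<open>auto intro!: derivative_eq_intros\<close>)
 have 2: "((%x. 1 - (max 0 ((x - d) / d))\<^sup>2) has_real_derivative - (2 * max 0 ((x - d) / d) * (1 / d))) (at x)" for x
  by (rule DERIV_cong[OF DERIV_diff[OF DERIV_const 1]]) simp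
 have 3: "((%x. (max 0 (1 - (max 0 ((x - d) / d))\<^sup>2))\<^sup>2) has_real_derivative 
  2 * max 0 (1 - (max 0 ((x - d) / d))\<^sup>2) * - (2 * max 0 ((x - d) / d) * (1 / d))) (at x)"
  by (rule DERIV_chain2[OF m 2])
 show "(cutoff d has_real_derivative cutoff' d x) (at x)"
  unfolding cutoff_def[abs_def] by (rule DERIV_cong[OF DERIV_diff[OF DERIV_const 3]]) (simp add: cutoff'_def)
 show "continuous_on S (cutoff' d)" unfolding cutoff'_def[abs_def] by (intro continuous_intros) (use assms in auto)
 show "cutoff' d x >= 0" using assms by (simp add: cutoff'_def)
 have "(max 0 (1 - (max 0 ((x - d) / d))\<^sup>2))\<^sup>2 <= 1\<^sup>2" by (intro power_mono) auto
 then show "0 <= cutoff d x" by (simp add: cutoff_def)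
 show "cutoff d x <= 1" by (simp add: cutoff_def)
 show "cutoff d x = 0" "cutoff' d x = 0" if "x <= d"
  using that assms by (simp_all add: cutoff_def cutoff'_def max_absorb1 divide_nonpos_pos)
 show "cutoff d x = 1" if "x >= 2 * d"
 proof -
  have "(x - d) / d >= 1" using that assms by (simp add: le_divide_eq)
  then have "(max 0 ((x - d) / d))\<^sup>2 >= 1\<^sup>2" by (intro power_mono) auto
  then show ?thesis by (simp add: cutoff_def)
 qed
qed

lemma weakly_closed_comb:
 assumes X: "weakly_closed U X" and Y: "weakly_closed U Y"
 shows "weakly_closed U (%z u v. a * X z u v + b * Y z u v)"
 unfolding weakly_closed_def
proof (intro conjI allI impI)
 show "continuous_on U (%z. a * X z u v + b * Y z u v)" for u v
  using X Y by (auto simp: weakly_closed_def intro!: continuous_intros)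
 fix y :: "complex ^ 'a" and r :: real and u v w assume r: "r > 0" "cball y r <= U"
 let ?I = "%X z. (X z v w * ((z - y) \<bullet> u) + X z w u * ((z - y) \<bullet> v) + X z u v * ((z - y) \<bullet> w)) * bump 2 y r z"
 have i: "integrable lborel (?I Z)" if "weakly_closed U Z" for Z
  by (rule integrable_compact_support[OF compact_cball[of y r]])
   (use that r bump_outside[of 2 r _ y] in \<open>auto intro!: continuous_intros bump_continuous continuous_on_subset[OF _ r(2)] simp: weakly_closed_def\<close>)
 have z: "(LBINT z. ?I Z z) = 0" if "weakly_closed U Z" for Z
  using that r unfolding weakly_closed_def by blast
 have "(LBINT z. ?I (%z u v. a * X z u v + b * Y z u v) z) = (LBINT z. a * ?I X z + b * ?I Y z)"
  by (intro Bochner_Integration.integral_cong refl) (simp add: algebra_simps)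
 also have "... = 0" using i[OF X] i[OF Y] z[OF X] z[OF Y] by simp
 finally show "(LBINT z. ?I (%z u v. a * X z u v + b * Y z u v) z) = 0" .
qed

text \<open>One integration by parts turns each of the six terms into an integral of
  \<open>al\<close> against a second derivative of \<open>bump 3\<close>. That derivative is
  symmetric, so the terms cancel in pairs.\<close>

lemma exact_weakly_closed:
 fixes al :: "complex ^ 'n::finite => complex ^ 'n => real"
 assumes U: "open U" and al: "!!v. C1_on U (%z. al z v) (%z u. dal z u v)"
 shows "weakly_closed U (%z u v. dal z u v - dal z v u)"
 unfolding weakly_closed_def
proof (intro conjI allI impI)
 show "continuous_on U (%z. dal z u v - dal z v u)" for u v
  by (intro continuous_intros C1_onD(2)[OF al])
 fix y :: "complex ^ 'n" and r :: real and u v w assume r: "r > 0" "cball y r <= U"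
 define b1 where "b1 = (%z v. - 6 * ((z - y) \<bullet> v) * bump 2 y r z)"
 define b2 where "b2 = (%z u v. - 6 * ((u \<bullet> v) * bump 2 y r z - 4 * ((z - y) \<bullet> u) * ((z - y) \<bullet> v) * bump 1 y r z))"
 have b: "C2_on UNIV (bump 3 y r) b1 b2" using C2_on_bump[of 2 y r] by (simp add: b1_def b2_def)
 have out: "b1 z v = 0" "b2 z u v = 0" if "z ~: cball y r" for z u v
  using bump_outside[OF _ _ that, of 2] bump_outside[OF _ _ that, of 1] r(1) by (simp_all add: b1_def b2_def)
 have sub: "C1_on U (%z. b1 z w) (%z u. b2 z u w)" for w
  using C1_on_subset[OF C2_onD(2)[OF b]] by simp
 define I where "I p q s = (LBINT z. dal z p q * b1 z s)" for p q s
 have parts: "integrable lborel (%z. dal z p q * b1 z s)" "I p q s = - (LBINT z. al z q * b2 z p s)" for p q s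
  unfolding I_def by (rule integral_parts[OF U compact_cball r(2) al sub]; simp add: out)+
 have sym: "I p q s = I s q p" for p q s
  unfolding parts(2) by (simp add: b2_def inner_commute mult_ac)
 have "(LBINT z. ((dal z v w - dal z w v) * ((z - y) \<bullet> u) + (dal z w u - dal z u w) * ((z - y) \<bullet> v) + (dal z u v - dal z v u) * ((z - y) \<bullet> w)) * bump 2 y r z)
  = (LBINT z. - 1/6 * (dal z v w * b1 z u - dal z w v * b1 z u + (dal z w u * b1 z v - dal z u w * b1 z v) + (dal z u v * b1 z w - dal z v u * b1 z w)))"
  by (intro Bochner_Integration.integral_cong refl) (simp add: b1_def algebra_simps)
 also have "... = -1/6 * (I v w u - I w v u + (I w u v - I u w v) + (I u v w - I v u w))"
  unfolding I_def integral_mult_right_zero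
  by (simp add: parts(1) Bochner_Integration.integral_add Bochner_Integration.integral_diff)
 also have "... = 0" using sym[of v w u] sym[of w v u] sym[of w u v] by simp
 finally show "(LBINT z. ((dal z v w - dal z w v) * ((z - y) \<bullet> u) + (dal z w u - dal z u w) * ((z - y) \<bullet> v) + (dal z u v - dal z v u) * ((z - y) \<bullet> w)) * bump 2 y r z) = 0" .
qed

text \<open>\<open>ddc (H z)\<close> is the exterior derivative of the 1-form whose value at v is -
  D z (J v) / 2.\<close>

lemma ddc_weakly_closed:
 fixes f :: "complex ^ 'n::finite => real"
 assumes U: "open U" and f: "C2_on U f D H"
 shows "weakly_closed U (%z. ddc (H z))"
proof -
 have "C1_on U (%z. - D z (J v) / 2) (%z u. - H z u (J v) / 2)" for v
  using C1_on_add[OF C2_onD(2)[OF f, of "J v"] C1_on_const[of _ 0], where a="-1/2" and b=0] by simp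
 from exact_weakly_closed[OF U this] show ?thesis
  by (simp add: ddc_def[abs_def] diff_divide_distrib[symmetric] add.commute)
qed

text \<open>Integrating \<open>ddc\<close> of \<open>w\<close> by parts leaves the negative of
  cutoff' (w) dw wedge d^c w wedge Y^(n-1). The cutoff is nondecreasing, so that form is
  nonnegative. Positivity of \<open>Y\<close> matters only where w > 0, because the cutoff vanishes
  elsewhere.\<close>

lemma comparison_deriv:
 fixes w :: "complex ^ 'n::finite => real"
 assumes U: "open U" and d: "d > 0" and K: "compact {z\<in>U. w z >= d}" and w: "C2_on U w D H"
  and Y: "weakly_closed U Y" and pos: "!!z. z \<in> U ==> w z > 0 ==> pos_form (Y z)"
 shows "(LBINT z. (if z \<in> U then cutoff d (w z) else 0) * top_power_deriv (Y z) (ddc (H z))) <= 0"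
proof -
 let ?K = "{z\<in>U. w z >= d}"
 define ch where "ch z = (if z \<in> U then cutoff d (w z) else 0)" for z
 define dch where "dch z v = (if z \<in> U then cutoff' d (w z) * D z v else 0)" for z v
 define al where "al z b = - D z (J (real_frame b)) / 2" for z b
 define dal where "dal z v b = - H z v (J (real_frame b)) / 2" for z v b
 have c0: "C1_on U (%z. cutoff d (w z)) (%z v. cutoff' d (w z) * D z v)"
  by (rule C1_on_compose[OF C2_onD(1)[OF w]]) (use cutoff_props[OF d] in auto)
 have C: "C1_on U ch dch"
  by (rule C1_on_cong_open[OF U c0]) (simp_all add: ch_def dch_def)
 have out: "ch z = 0" "dch z v = 0" if "z ~: ?K" for z v
  using that cutoff_props(6,7)[OF d, of "w z"] by (auto simp: ch_def dch_def)
 have A: "C1_on U (%z. al z b) (%z v. dal z v b)" for b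
  unfolding al_def dal_def
  using C1_on_add[OF C2_onD(2)[OF w, of "J (real_frame b)"] C1_on_const[of _ 0], where a="-1/2" and b=0] by simp
 let ?x = "%z a b. Y z (real_frame a) (real_frame b)"
 have main: "(LBINT z. perm_deriv (?x z) (%a b. ch z * (dal z (real_frame a) b - dal z (real_frame b) a))) =
  - (LBINT z. perm_deriv (?x z) (%a b. dch z (real_frame a) * al z b - dch z (real_frame b) * al z a))"
  by (rule weak_form_parts[OF U K _ Y A C out]) auto
 have pm: "perm_deriv y (%a b. c * g a b) = c * perm_deriv y g" for y g and c :: real
  unfolding perm_deriv_def by (simp add: sum_distrib_left mult_ac)
 have 1: "perm_deriv (?x z) (%a b. ch z * (dal z (real_frame a) b - dal z (real_frame b) a)) =
   2 ^ CARD('n) * (ch z * top_power_deriv (Y z) (ddc (H z)))" for z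
  unfolding top_power_deriv_perm pm
  by (simp add: ddc_def dal_def diff_divide_distrib[symmetric] add.commute)
 have 2: "perm_deriv (?x z) (%a b. dch z (real_frame a) * al z b - dch z (real_frame b) * al z a) >= 0" for z
 proof (cases "z \<in> U & w z > 0")
  case False
  then have "dch z v = 0" for v using out[of z] d by auto
  then show ?thesis by (simp add: perm_deriv_def)
 next
  case True
  \<comment> \<open>A nonnegative multiple of dw wedge d^c w: its value on (u, J u) is
    \<open>k\<close> times a sum of two squares.\<close>
  define Q where "Q u v = dch z u * (- D z (J v) / 2) - dch z v * (- D z (J u) / 2)" for u v
  define k where "k = cutoff' d (w z) / 2"
  have k: "k >= 0" using cutoff_props(3)[OF d] by (simp add: k_def)
  have lin: "linear (D z)" using C1_onD(3)[OF C2_onD(1)[OF w]] True by blast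
  note [simp] = linear_add[OF lin] linear_scale[OF lin] linear_neg[OF lin]
  have Qe: "Q u v = k * (D z v * D z (J u) - D z u * D z (J v))" for u v
   using True by (simp add: Q_def dch_def k_def field_simps)
  have "bilinear Q" unfolding bilinear_def Qe by (auto intro!: linearI simp: algebra_simps)
  moreover have "Q u v = - Q v u" for u v by (simp add: Qe algebra_simps)
  moreover have "Q (J u) (J v) = Q u v" for u v by (simp add: Qe algebra_simps)
  ultimately have Qh: "herm_form Q" unfolding herm_form_def by blast
  have "Q u (J u) = k * ((D z (J u))\<^sup>2 + (D z u)\<^sup>2)" for u by (simp add: Qe power2_eq_square)
  then have "Q u (J u) >= 0" for u using k by simp
  from top_power_deriv_nonneg[OF pos Qh this] True have "top_power_deriv (Y z) Q >= 0" by blast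
  moreover have "perm_deriv (?x z) (%a b. dch z (real_frame a) * al z b - dch z (real_frame b) * al z a) = 2 ^ CARD('n) * top_power_deriv (Y z) Q"
   unfolding top_power_deriv_perm by (simp add: Q_def al_def)
  ultimately show ?thesis by simp
 qed
 have "(2::real) ^ CARD('n) > 0" by simp
 moreover have "2 ^ CARD('n) * (LBINT z. ch z * top_power_deriv (Y z) (ddc (H z))) <= 0"
  using main Bochner_Integration.integral_nonneg[OF 2] unfolding 1 by simp
 ultimately have "(LBINT z. ch z * top_power_deriv (Y z) (ddc (H z))) <= 0"
  by (meson mult_le_0_iff not_less)
 then show ?thesis unfolding ch_def .
qed

text \<open>The integral of cutoff (w) (X + t ddc w)^n does not increase for t in [0,1], by
  \<open>comparison_deriv\<close>; all forms on the segment are positive where w > 0 because both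
  ends are. The step of the cutoff between d and 2d accounts for the two superlevel sets.\<close>

theorem comparison_principle:
 fixes w :: "complex ^ 'n::finite => real"
 assumes U: "open U" and d: "d > 0" and K: "compact {z\<in>U. w z >= d}" and w: "C2_on U w D H"
  and X: "weakly_closed U X" and pos: "!!z. z \<in> U ==> pos_form (X z)"
  and pos': "!!z. z \<in> U ==> w z > 0 ==> pos_form (%u v. X z u v + ddc (H z) u v)"
 shows "(\<integral>\<^sup>+z. ennreal (top_power (%u v. X z u v + ddc (H z) u v)) * indicator {z\<in>U. w z >= 2 * d} z \<partial>lborel)
  <= (\<integral>\<^sup>+z. ennreal (top_power (X z)) * indicator {z\<in>U. w z >= d} z \<partial>lborel)"
proof -
 let ?K = "{z\<in>U. w z >= d}"
 define ch where "ch z = (if z \<in> U then cutoff d (w z) else 0)" for z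
 define Y where "Y t z u v = X z u v + t * ddc (H z) u v" for t :: real and z u v
 have KU: "?K <= U" by auto
 have out: "ch z = 0" if "z ~: ?K" for z using that cutoff_props(6)[OF d, of "w z"] by (auto simp: ch_def)
 have Y1: "Y 1 z = (%u v. X z u v + ddc (H z) u v)" "Y 0 z = X z" for z
  by (auto simp: Y_def fun_eq_iff)
 have W: "weakly_closed U (%z. ddc (H z))" by (rule ddc_weakly_closed[OF U w])
 have cX: "continuous_on ?K (%z. X z u v)" "continuous_on ?K (%z. ddc (H z) u v)" for u v
  using X W unfolding weakly_closed_def by (auto intro: continuous_on_subset[OF _ KU])
 have cch: "continuous_on ?K ch"
 proof -
  have "continuous_on U (%z. cutoff d (w z))"
   by (rule continuous_on_compose2[OF DERIV_continuous_on_set[OF cutoff_props(1)[OF d], of UNIV] C1_onD(1)[OF C2_onD(1)[OF w]]]) auto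
  from continuous_on_subset[OF this KU] show ?thesis by (rule continuous_on_eq) (auto simp: ch_def)
 qed
 have Yc: "weakly_closed U (Y t)" for t
  unfolding Y_def using weakly_closed_comb[OF X W, of 1 t] by simp
 have Ypos: "pos_form (Y t z)" if "z \<in> U" "w z > 0" "t \<in> {0..1}" for t z
  using pos_form_convex[OF pos pos', of z z t] that unfolding Y_def by (simp add: algebra_simps)
 have cont2: "continuous_on ({0..1} \<times> ?K) (%p. Y (fst p) (snd p) u v)" for u v
  unfolding Y_def
  by (intro continuous_intros continuous_on_compose2[OF cX(1)] continuous_on_compose2[OF cX(2)]) auto
 have cT: "continuous_on ({0..1} \<times> ?K) (%p. ch (snd p) * top_power_deriv (Y (fst p) (snd p)) (ddc (H (snd p))))"
  unfolding top_power_deriv_def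
  by (intro continuous_intros cont2 continuous_on_compose2[OF cX(2)] continuous_on_compose2[OF cch]) auto
 have "compact ({0..1::real} \<times> ?K)" by (intro compact_Times K) auto
 from compact_imp_bounded[OF compact_continuous_image[OF cT this]]
 obtain M where M: "!!t z. t \<in> {0..1} ==> z \<in> ?K ==> \<bar>ch z * top_power_deriv (Y t z) (ddc (H z))\<bar> <= M"
  unfolding bounded_iff by fastforce
 have ct: "continuous_on ?K (%z. top_power (Y t z))" for t
  unfolding top_power_def Y_def by (intro continuous_intros cX) auto
 have ctd: "continuous_on ?K (%z. top_power_deriv (Y t z) (ddc (H z)))" for t
  unfolding top_power_deriv_def Y_def by (intro continuous_intros cX) auto
 have int: "integrable lborel (%z. ch z * top_power (Y t z))" for t
  by (rule integrable_compact_support[OF K]) (auto simp: out intro!: continuous_on_mult cch ct)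
 have intd: "integrable lborel (%z. ch z * top_power_deriv (Y t z) (ddc (H z)))" for t
  by (rule integrable_compact_support[OF K]) (auto simp: out intro!: continuous_on_mult cch ctd)
 define G where "G t = (LBINT z. ch z * top_power (Y t z))" for t
 have der: "(G has_real_derivative (LBINT z. ch z * top_power_deriv (Y t z) (ddc (H z)))) (at t within {0..1})"
  if t: "t \<in> {0..1}" for t
  unfolding G_def
 proof (rule deriv_under_integral[where B="%z. M * indicator ?K z"])
  show "((%t. ch z * top_power (Y t z)) has_real_derivative ch z * top_power_deriv (Y t z) (ddc (H z))) (at t within {0..1})" for t z
   unfolding Y_def by (rule has_field_derivative_at_within[OF DERIV_cmult[OF top_power_has_derivative]])
  show "\<bar>ch z * top_power_deriv (Y t z) (ddc (H z))\<bar> <= M * indicator ?K z" if "t \<in> {0..1}" for t z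
   using M[OF that, of z] out[of z] by (cases "z \<in> ?K") (auto simp: indicator_def)
  show "integrable lborel (%z. M * indicator ?K z)"
   using emeasure_compact_finite[OF K] borel_closed[OF compact_imp_closed[OF K]] by (intro integrable_mult_right integrable_real_indicator) auto
  show "(%z. ch z * top_power_deriv (Y t z) (ddc (H z))) \<in> borel_measurable lborel"
   by (rule borel_measurable_integrable[OF intd])
 qed (use t int in auto)
 have le0: "(LBINT z. ch z * top_power_deriv (Y t z) (ddc (H z))) <= 0" if "t \<in> {0..1}" for t
  unfolding ch_def by (rule comparison_deriv[OF U d K w Yc]) (use Ypos that in auto)
 have "- G 0 <= - G 1"
  by (rule DERIV_within_nonneg_mono[OF _ DERIV_minus[OF der]]) (use le0 in auto)
 then have G: "G 1 <= G 0" by simp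
 have nn: "0 <= ch z * top_power (Y t z)" if "t \<in> {0..1}" for z t
 proof (cases "z \<in> ?K")
  case True
  then have "top_power (Y t z) > 0" using Ypos[of z t] that d by (intro top_power_pos) auto
  then show ?thesis using cutoff_props(4)[OF d] by (auto simp: ch_def less_imp_le)
 qed (simp add: out)
 have eG: "(\<integral>\<^sup>+z. ennreal (ch z * top_power (Y t z)) \<partial>lborel) = ennreal (G t)" if "t \<in> {0..1}" for t
  unfolding G_def by (rule nn_integral_eq_integral[OF int]) (use nn[OF that] in auto)
 have "(\<integral>\<^sup>+z. ennreal (top_power (%u v. X z u v + ddc (H z) u v)) * indicator {z\<in>U. w z >= 2 * d} z \<partial>lborel)
  <= (\<integral>\<^sup>+z. ennreal (ch z * top_power (Y 1 z)) \<partial>lborel)"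
  by (rule nn_integral_mono) (auto simp: indicator_def ch_def Y1 cutoff_props(8)[OF d])
 also have "... <= (\<integral>\<^sup>+z. ennreal (ch z * top_power (Y 0 z)) \<partial>lborel)"
  using G by (simp add: eG ennreal_leI)
 also have "... <= (\<integral>\<^sup>+z. ennreal (top_power (X z)) * indicator ?K z \<partial>lborel)"
 proof (rule nn_integral_mono)
  fix z show "ennreal (ch z * top_power (Y 0 z)) <= ennreal (top_power (X z)) * indicator ?K z"
  proof (cases "z \<in> ?K")
   case True
   then have "top_power (X z) > 0" using pos by (intro top_power_pos) auto
   then have "ch z * top_power (Y 0 z) <= 1 * top_power (X z)"
    using cutoff_props(5)[OF d, of "w z"] True unfolding Y1 by (intro mult_mono) (auto simp: ch_def)
   then show ?thesis using True by (simp add: ennreal_leI)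
  qed (simp add: out)
 qed
 finally show ?thesis .
qed

section \<open>Decay of sublevel sets\<close>

lemma bessel_J: "(zt \<bullet> v)\<^sup>2 + (zt \<bullet> J v)\<^sup>2 <= (zt \<bullet> zt) * (v \<bullet> v)" for zt v :: "complex ^ 'n::finite"
proof (cases "v = 0")
 case False
 define p where "p = (v \<bullet> v) *\<^sub>R zt - (zt \<bullet> v) *\<^sub>R v - (zt \<bullet> J v) *\<^sub>R J v"
 have "0 <= p \<bullet> p" by simp
 also have "p \<bullet> p = (v \<bullet> v) * ((v \<bullet> v) * (zt \<bullet> zt) - ((zt \<bullet> v)\<^sup>2 + (zt \<bullet> J v)\<^sup>2))"
  unfolding p_def inner_diff_left inner_diff_right inner_scaleR_left inner_scaleR_right inner_J_self inner_J_J
   inner_commute[of v zt] inner_commute[of "J v" zt]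
  by (simp add: power2_eq_square algebra_simps)
 finally have "0 <= (v \<bullet> v) * ((v \<bullet> v) * (zt \<bullet> zt) - ((zt \<bullet> v)\<^sup>2 + (zt \<bullet> J v)\<^sup>2))" .
 moreover have "v \<bullet> v > 0" using False by simp
 ultimately show ?thesis by (simp add: zero_le_mult_iff mult.commute)
qed simp

text \<open>A logarithmic potential with its pole at \<open>y\<close> smoothed at scale
  \<open>r\<close>.\<close>

definition log_pole :: "complex ^ 'n::finite => real => complex ^ 'n => real" where
 "log_pole y r z = ln ((z - y) \<bullet> (z - y) + r\<^sup>2)"

definition log_pole_D where
 "log_pole_D y r z v = 1 / ((z - y) \<bullet> (z - y) + r\<^sup>2) * (2 * ((z - y) \<bullet> v))"

definition log_pole_H where
 "log_pole_H y r z u v = - 1 / ((z - y) \<bullet> (z - y) + r\<^sup>2)\<^sup>2 * (2 * ((z - y) \<bullet> u)) * (2 * ((z - y) \<bullet> v))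
  + 1 / ((z - y) \<bullet> (z - y) + r\<^sup>2) * (2 * (u \<bullet> v))"

lemma C2_on_sqdist: "C2_on U (%z. (z - y) \<bullet> (z - y) + k) (%z v. 2 * ((z - y) \<bullet> v)) (%z u v. 2 * (u \<bullet> v))"
 unfolding C2_on_def
proof (intro conjI allI ballI)
 show "C1_on U (%z. (z - y) \<bullet> (z - y) + k) (%z v. 2 * ((z - y) \<bullet> v))"
  unfolding C1_on_def
 proof (intro conjI allI ballI)
  fix z v
  have "(%t. (z + t *\<^sub>R v - y) \<bullet> (z + t *\<^sub>R v - y) + k) = (%t. ((z - y) \<bullet> (z - y) + k) + 2 * t * ((z - y) \<bullet> v) + t * t * (v \<bullet> v))"
   by (auto simp: fun_eq_iff inner_add_left inner_add_right inner_diff_left inner_diff_right inner_commute algebra_simps)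
  then show "((%t. (z + t *\<^sub>R v - y) \<bullet> (z + t *\<^sub>R v - y) + k) has_real_derivative 2 * ((z - y) \<bullet> v)) (at 0)"
   by (simp only:) (auto intro!: derivative_eq_intros)
 qed (auto intro!: continuous_intros linearI simp: inner_add_right algebra_simps)
 show "C1_on U (%z. 2 * ((z - y) \<bullet> v)) (%z u. 2 * (u \<bullet> v))" for v
  unfolding C1_on_def
  by (auto intro!: continuous_intros linearI derivative_eq_intros simp: inner_add_left inner_diff_left algebra_simps)
qed (simp add: inner_commute)

lemma C2_on_log_pole:
 assumes "r > 0"
 shows "C2_on U (log_pole y r) (log_pole_D y r) (log_pole_H y r)"
proof -
 have p: "x > 0" if "x \<in> (%z. (z - y) \<bullet> (z - y) + r\<^sup>2) ` U" for x
  using that assms by (auto intro!: add_nonneg_pos)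
 show ?thesis
  unfolding log_pole_def[abs_def] log_pole_D_def[abs_def] log_pole_H_def[abs_def]
 proof (rule C2_on_compose[OF C2_on_sqdist, where h'="%x. 1 / x" and h''="%x. - 1 / x\<^sup>2"])
  fix x assume "x \<in> (%z. (z - y) \<bullet> (z - y) + r\<^sup>2) ` U"
  from p[OF this] show "(ln has_real_derivative 1 / x) (at x)" "((%x. 1 / x) has_real_derivative - 1 / x\<^sup>2) (at x)"
   by (auto intro!: derivative_eq_intros simp: power2_eq_square divide_simps)
 next
  show "continuous_on ((%z. (z - y) \<bullet> (z - y) + r\<^sup>2) ` U) (%x. - 1 / x\<^sup>2)"
   using p by (intro continuous_intros) force
 qed
qed

text \<open>By Bessel's inequality for the orthogonal pair v, J v, the negative term of the Hessian
  leaves at least 2 r^2 |v|^2 / q^2 with q = |z - y|^2 + r^2, and q <= 2 r^2 on the ball. This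
  positivity at scale r is what the logarithm contributes to the comparison.\<close>

lemma ddc_log_pole:
 assumes "r > 0"
 shows "ddc (log_pole_H y r z) v (J v) >= 0"
  "z \<in> cball y r ==> ddc (log_pole_H y r z) v (J v) >= (v \<bullet> v) / (2 * r\<^sup>2)"
proof -
 let ?zt = "z - y"
 define q where "q = ?zt \<bullet> ?zt + r\<^sup>2"
 have q: "q > 0" "q >= r\<^sup>2" using assms by (auto simp: q_def intro!: add_nonneg_pos)
 have h: "bilinear (log_pole_H y r z)" "log_pole_H y r z u v = log_pole_H y r z v u" for u v
  using C2_onD(3,4)[OF C2_on_log_pole[OF assms, of UNIV y]] by auto
 have e: "ddc (log_pole_H y r z) v (J v) = 2 * (v \<bullet> v) / q - 2 * ((?zt \<bullet> v)\<^sup>2 + (?zt \<bullet> J v)\<^sup>2) / q\<^sup>2"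
  unfolding ddc_herm(2)[OF h] log_pole_H_def q_def[symmetric] by (simp add: power2_eq_square field_simps add_divide_distrib)
 have "((?zt \<bullet> v)\<^sup>2 + (?zt \<bullet> J v)\<^sup>2) / q\<^sup>2 <= (q - r\<^sup>2) * (v \<bullet> v) / q\<^sup>2"
  using bessel_J[of ?zt v] by (intro divide_right_mono) (auto simp: q_def)
 also have "... = (v \<bullet> v) / q - r\<^sup>2 * (v \<bullet> v) / q\<^sup>2"
  using q by (simp add: field_simps power2_eq_square)
 finally have B: "((?zt \<bullet> v)\<^sup>2 + (?zt \<bullet> J v)\<^sup>2) / q\<^sup>2 <= (v \<bullet> v) / q - r\<^sup>2 * (v \<bullet> v) / q\<^sup>2" .
 have "ddc (log_pole_H y r z) v (J v) = 2 * ((v \<bullet> v) / q) - 2 * (((?zt \<bullet> v)\<^sup>2 + (?zt \<bullet> J v)\<^sup>2) / q\<^sup>2)"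
  unfolding e by simp
 moreover have "2 * r\<^sup>2 * (v \<bullet> v) / q\<^sup>2 = 2 * (r\<^sup>2 * (v \<bullet> v) / q\<^sup>2)" by simp
 ultimately have ge: "ddc (log_pole_H y r z) v (J v) >= 2 * r\<^sup>2 * (v \<bullet> v) / q\<^sup>2"
  using B by linarith
 then show "ddc (log_pole_H y r z) v (J v) >= 0"
  by (rule order_trans[rotated]) (auto intro!: divide_nonneg_nonneg)
 assume "z \<in> cball y r"
 then have "(norm ?zt)\<^sup>2 <= r\<^sup>2" by (intro power_mono) (auto simp: dist_norm norm_minus_commute)
 then have "q <= 2 * r\<^sup>2" by (simp add: q_def power2_norm_eq_inner)
 then have "q\<^sup>2 <= (2 * r\<^sup>2)\<^sup>2" using q by (intro power_mono) auto
 then have "2 * r\<^sup>2 * (v \<bullet> v) / (2 * r\<^sup>2)\<^sup>2 <= 2 * r\<^sup>2 * (v \<bullet> v) / q\<^sup>2"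
  using q assms by (intro divide_left_mono mult_pos_pos) auto
 moreover have "2 * r\<^sup>2 * (v \<bullet> v) / (2 * r\<^sup>2)\<^sup>2 = (v \<bullet> v) / (2 * r\<^sup>2)"
  using assms by (simp add: power2_eq_square field_simps)
 ultimately show "ddc (log_pole_H y r z) v (J v) >= (v \<bullet> v) / (2 * r\<^sup>2)" using ge by linarith
qed

text \<open>On the unit ball the smoothed logarithm lies between 2 ln r and ln 2, an interval of
  length \<open>m\<close>. The normalisation costs at most 1/2 in value and keeps a
  \<open>ddc\<close> of order 1 / (m r^2) on the ball of radius r.\<close>

lemma log_pole_range:
 assumes r: "0 < r" "r <= 1" and z: "dist z y <= 1"
 defines "m == ln 2 - 2 * ln r"
 shows "m > 0" "(log_pole y r z - ln 2) / (2 * m) <= 0" "(log_pole y r z - ln 2) / (2 * m) >= - 1 / 2"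
proof -
 let ?q = "(z - y) \<bullet> (z - y) + r\<^sup>2"
 have lr: "ln r <= 0" using r by simp
 show m: "m > 0" using lr ln_gt_zero[of 2] unfolding m_def by linarith
 have "(norm (z - y))\<^sup>2 <= 1\<^sup>2" "r\<^sup>2 <= 1\<^sup>2" using r z by (intro power_mono; simp add: dist_norm)+
 then have q: "r\<^sup>2 <= ?q" "?q <= 2" "0 < r\<^sup>2" using r by (auto simp: power2_norm_eq_inner)
 have "0 < ?q" using q by linarith
 note q = q this
 have "ln (r\<^sup>2) <= ln ?q" using q by (subst ln_le_cancel_iff) auto
 then have lo: "2 * ln r <= log_pole y r z" using r by (simp add: log_pole_def ln_realpow)
 have "ln ?q <= ln 2" using q by (subst ln_le_cancel_iff) auto
 then have hi: "log_pole y r z <= ln 2" by (simp add: log_pole_def)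
 show "(log_pole y r z - ln 2) / (2 * m) <= 0" using hi m by (intro divide_nonpos_pos) auto
 show "(log_pole y r z - ln 2) / (2 * m) >= - 1 / 2" using lo m by (simp add: field_simps m_def)
qed

lemma herm_quad_le_top_power:
 fixes X Y :: "complex ^ 'n::finite => complex ^ 'n => real"
 assumes X: "pos_form X" and Y: "herm_form Y" and c: "c > 0"
  and ge: "!!v. Y v (J v) >= X v (J v) / 2 + c * (v \<bullet> v)"
 shows "c ^ (CARD('n) - 1) * form_trace X * top_power (std_form :: complex ^ 'n => _) <= 4 * real CARD('n) * top_power Y"
proof -
 define X2 where "X2 u v = (1/2) * X u v" for u v
 have hX: "pos_form X2" unfolding X2_def by (rule pos_form_scale[OF X]) simp
 have hZ: "pos_form (%u v. X2 u v + c * std_form u v)"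
  using pos_form_add_nonneg[OF hX herm_form_comb[OF std_form_herm std_form_herm, of c 0]] c by simp
 have tr: "form_trace X = 2 * form_trace X2"
  by (simp add: form_trace_def X2_def sum_distrib_left)
 have "c ^ (CARD('n) - 1) * form_trace X2 * top_power (std_form :: complex ^ 'n => _)
  <= 2 * real CARD('n) * top_power (%u v. X2 u v + c * std_form u v)"
  by (rule top_power_add_std_ge[OF hX c])
 also have "... <= 2 * real CARD('n) * top_power Y"
  by (intro mult_left_mono top_power_mono[OF hZ Y]) (use ge in \<open>auto simp: X2_def\<close>)
 finally show ?thesis unfolding tr by (simp add: mult_ac)
qed

lemma compact_superlevel:
 fixes w :: "'a::euclidean_space => real"
 assumes K: "compact K" and w: "continuous_on K w"
 shows "compact {z\<in>K. d <= w z}"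
proof -
 have "closed {z\<in>K. d <= w z}"
  by (rule continuous_on_closed_Collect_le[OF continuous_on_const w compact_imp_closed[OF K]])
 from compact_Int_closed[OF K this] show ?thesis by (simp add: Int_absorb1 Collect_conj_eq Int_assoc[symmetric])
qed

lemma ddc_comb: "ddc (%a b. p * h a b + q * g a b) u v = p * ddc h u v + q * ddc g u v"
 unfolding ddc_def by (simp add: algebra_simps add_divide_distrib diff_divide_distrib)

lemma form_trace_nonneg: "pos_form X ==> form_trace X >= 0" for X :: "complex ^ 'n::finite => _"
 unfolding form_trace_def
proof (rule sum_nonneg)
 fix a :: "'n \<times> bool" assume "pos_form X"
 moreover have "real_frame a ~= 0" using inner_real_frame[of a a] by auto
 ultimately show "X (real_frame a) (J (real_frame a)) >= 0" by (simp add: pos_form_def less_imp_le)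
qed

text \<open>In the application \<open>X\<close> is \<open>omega_pot\<close> in a chart and
  \<open>u\<close> is the potential plus a multiple of the squared distance to its minimum
  \<open>y0\<close>, which makes the low sublevel sets compact in \<open>U\<close>. The radius 1/2
  keeps distances between points of the ball below 1.\<close>

locale sublevel =
 fixes U :: "(complex ^ 'n::finite) set" and X u D H s y0
 assumes U: "open U" "U <= ball y0 (1/2)" and X: "weakly_closed U X" "!!z. z \<in> U ==> pos_form (X z)"
  and u: "C2_on U u D H" and le: "!!z v. z \<in> U ==> ddc (H z) v (J v) <= X z v (J v)"
  and K: "compact {z\<in>U. u z <= s}"
begin

definition mass :: ennreal where
 "mass = (\<integral>\<^sup>+z. ennreal (top_power (X z)) * indicator {z\<in>U. u z < s} z \<partial>lborel)"

lemma cont_u: "continuous_on U u"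
 using C1_onD(1)[OF C2_onD(1)[OF u]] .

lemma compact_sub: "t >= 0 ==> compact {z\<in>U. u z <= s - t}"
proof -
 assume t: "t >= 0"
 have "continuous_on {z\<in>U. u z <= s} (%z. - u z)"
  by (intro continuous_intros continuous_on_subset[OF cont_u]) auto
 from compact_superlevel[OF K this, of "t - s"]
 have "compact {z \<in> {z\<in>U. u z <= s}. t - s <= - u z}" .
 moreover have "{z \<in> {z\<in>U. u z <= s}. t - s <= - u z} = {z\<in>U. u z <= s - t}" using t by auto
 ultimately show ?thesis by simp
qed

text \<open>The function \<open>w\<close> combines -u/2 with a small multiple of the logarithm with
  pole at \<open>y\<close>, so that X + ddc w is at least X/2 plus \<open>c\<close> times the
  standard form on the ball of radius r. Its top power there dominates the trace of
  \<open>X\<close>, and the comparison principle bounds its integral by \<open>mass\<close>. Without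
  the power of the logarithm, the result has the growth r^(2n-2).\<close>

lemma trace_mass:
 assumes y: "y \<in> ball y0 (1/2)" and r: "0 < r" "r <= 1" and t: "t > 0"
 shows "(\<integral>\<^sup>+z. ennreal (form_trace (X z)) * indicator {z\<in>U. u z <= s - t} z * indicator (cball y r) z \<partial>lborel)
  <= ennreal (4 * real CARD('n) / top_power (std_form :: complex ^ 'n => _) * (8 * (ln 2 - 2 * ln r) * r\<^sup>2 / t) ^ (CARD('n) - 1)) * mass"
proof -
 let ?n = "CARD('n)"
 define m where "m = ln 2 - 2 * ln r"
 have S: "top_power (std_form :: complex ^ 'n => _) > 0" by (rule top_power_std_form_pos)
 \<comment> \<open>On \<open>U\<close> the values of \<open>p\<close> lie in [-1/2, 0], and
   \<open>w\<close> below equals (s + t p - u) / 2.\<close>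
 define p where "p z = (log_pole y r z - ln 2) / (2 * m)" for z
 have dz: "dist z y <= 1" if "z \<in> U" for z
  using that U(2) y dist_triangle2[of z y y0] by (force simp: dist_commute)
 note pr = log_pole_range[OF r dz, folded m_def, folded p_def]
 define w where "w z = 1 * ((s / 2 - t * ln 2 / (4 * m)) * 1 + (t / (4 * m)) * log_pole y r z) + (-1/2) * u z" for z
 define Hw where "Hw z a b = 1 * ((s / 2 - t * ln 2 / (4 * m)) * 0 + (t / (4 * m)) * log_pole_H y r z a b) + (-1/2) * H z a b" for z a b
 have "\<exists>Dw. C2_on U w Dw Hw"
  unfolding w_def Hw_def by (rule exI, rule C2_on_add[OF C2_on_add[OF C2_on_const[of U 1] C2_on_log_pole[OF r(1)]] u])
 then obtain Dw where w2: "C2_on U w Dw Hw" by blast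
 define d where "d = t / 8"
 have d: "d > 0" using t by (simp add: d_def)
 \<comment> \<open>From p <= 0, the inequality w >= d forces u < s. From p >= -1/2, the inequality u
   <= s - t forces w >= t/4 = 2 d.\<close>
 have sub: "{z\<in>U. w z >= d} <= {z\<in>U. u z < s}" and sup: "{z\<in>U. u z <= s - t} <= {z\<in>U. w z >= 2 * d}"
 proof -
  have we: "w z = (s + t * p z - u z) / 2" if "z \<in> U" for z
   using pr(1)[OF that] by (simp add: w_def p_def field_simps)
  show "{z\<in>U. w z >= d} <= {z\<in>U. u z < s}"
  proof safe
   fix z assume z: "z \<in> U" "d <= w z"
   have "t * p z <= 0" using pr(2)[OF z(1)] t by (simp add: mult_nonneg_nonpos)
   then show "u z < s" using z(2) d unfolding we[OF z(1)] by (simp add: field_simps)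
  qed
  show "{z\<in>U. u z <= s - t} <= {z\<in>U. w z >= 2 * d}"
  proof safe
   fix z assume z: "z \<in> U" "u z <= s - t"
   have "t * p z >= t * (- 1 / 2)" using pr(3)[OF z(1)] t by (intro mult_left_mono) auto
   then show "2 * d <= w z" using z(2) unfolding we[OF z(1)] d_def by (simp add: field_simps)
  qed
 qed
 have Kd: "compact {z\<in>U. w z >= d}"
 proof -
  have "{z\<in>U. w z >= d} = {z\<in>{z\<in>U. u z <= s}. d <= w z}" using sub by auto
  moreover have "continuous_on {z\<in>U. u z <= s} w"
   by (rule continuous_on_subset[OF C1_onD(1)[OF C2_onD(1)[OF w2]]]) auto
  ultimately show ?thesis using compact_superlevel[OF K] by simp
 qed
 \<comment> \<open>The coefficient t / (4 m) of the logarithm in \<open>w\<close> times its lower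
   bound 1 / (2 r^2) on the ball.\<close>
 define c where "c = t / (8 * m * r\<^sup>2)"
 have Yherm: "herm_form (%a b. X z a b + ddc (Hw z) a b)" if "z \<in> U" for z
  using herm_form_comb[OF pos_form_herm[OF X(2)[OF that]] ddc_herm(1)[OF C2_onD(4)[OF w2 that] C2_onD(3)[OF w2 that]], of 1 1] by simp
 have Yval: "X z v (J v) + ddc (Hw z) v (J v) = X z v (J v) + (t / (4 * m) * ddc (log_pole_H y r z) v (J v) + (- 1 / 2) * ddc (H z) v (J v))" for z v
 proof -
  have "Hw z = (%a b. (t / (4 * m)) * log_pole_H y r z a b + (- 1 / 2) * H z a b)" by (simp add: Hw_def fun_eq_iff)
  then show ?thesis by (simp only: ddc_comb)
 qed
 have mp: "m > 0" using log_pole_range(1)[OF r, of y y] by (simp add: m_def)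
 have cpos: "c > 0" using t mp r by (simp add: c_def)
 have Yge: "X z v (J v) + ddc (Hw z) v (J v) >= X z v (J v) / 2" if "z \<in> U" for z v
 proof -
  have "t / (4 * m) * ddc (log_pole_H y r z) v (J v) >= 0"
   using t mp ddc_log_pole(1)[OF r(1), of y z v] by simp
  then show ?thesis unfolding Yval using le[OF that, of v] by linarith
 qed
 have Ypos: "pos_form (%a b. X z a b + ddc (Hw z) a b)" if "z \<in> U" for z
  unfolding pos_form_def
 proof (intro conjI Yherm[OF that] allI impI)
  fix v :: "complex ^ 'n" assume "v ~= 0"
  then have "X z v (J v) > 0" using X(2)[OF that] by (simp add: pos_form_def)
  then show "0 < X z v (J v) + ddc (Hw z) v (J v)" using Yge[OF that, of v] by linarith
 qed
 have Ygec: "X z v (J v) + ddc (Hw z) v (J v) >= X z v (J v) / 2 + c * (v \<bullet> v)" if "z \<in> U" "z \<in> cball y r" for z v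
 proof -
  have "t / (4 * m) * ddc (log_pole_H y r z) v (J v) >= t / (4 * m) * ((v \<bullet> v) / (2 * r\<^sup>2))"
   using t mp ddc_log_pole(2)[OF r(1) that(2), of v] by (intro mult_left_mono) auto
  moreover have "t / (4 * m) * ((v \<bullet> v) / (2 * r\<^sup>2)) = c * (v \<bullet> v)" by (simp add: c_def)
  ultimately show ?thesis unfolding Yval using le[OF that(1), of v] by linarith
 qed
 let ?T = "%z. top_power (%a b. X z a b + ddc (Hw z) a b)"
 let ?C = "4 * real ?n / (top_power (std_form :: complex ^ 'n => _) * c ^ (?n - 1))"
 have C0: "?C >= 0" using S cpos by simp
 have pt: "form_trace (X z) <= ?C * ?T z" if "z \<in> U" "z \<in> cball y r" for z
  using herm_quad_le_top_power[OF X(2)[OF that(1)] Yherm[OF that(1)] cpos Ygec[OF that]] S cpos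
  by (simp add: field_simps)
 have "(\<integral>\<^sup>+z. ennreal (form_trace (X z)) * indicator {z\<in>U. u z <= s - t} z * indicator (cball y r) z \<partial>lborel)
  <= (\<integral>\<^sup>+z. ennreal ?C * (ennreal (?T z) * indicator {z\<in>U. w z >= 2 * d} z) \<partial>lborel)"
 proof (rule nn_integral_mono)
  fix z show "ennreal (form_trace (X z)) * indicator {z\<in>U. u z <= s - t} z * indicator (cball y r) z
   <= ennreal ?C * (ennreal (?T z) * indicator {z\<in>U. w z >= 2 * d} z)"
   using sup pt[of z] C0 top_power_pos[OF Ypos, of z]
   by (auto simp: indicator_def ennreal_mult''[symmetric] ennreal_mult'[symmetric] intro!: ennreal_leI)
 qed
 also have "... = ennreal ?C * (\<integral>\<^sup>+z. ennreal (?T z) * indicator {z\<in>U. w z >= 2 * d} z \<partial>lborel)"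
 proof (rule nn_integral_cmult)
  have W: "weakly_closed U (%z a b. 1 * X z a b + 1 * ddc (Hw z) a b)"
   by (rule weakly_closed_comb[OF X(1) ddc_weakly_closed[OF U(1) w2]])
  have c2: "continuous_on {z\<in>U. w z >= 2 * d} ?T"
   unfolding top_power_def
   by (intro continuous_intros continuous_on_subset[OF W[unfolded weakly_closed_def, THEN conjunct1, rule_format, simplified mult_1]]) auto
  have "{z\<in>U. w z >= 2 * d} = {z\<in>{z\<in>U. w z >= d}. 2 * d <= w z}" using d by auto
  then have "compact {z\<in>U. w z >= 2 * d}"
   using compact_superlevel[OF Kd continuous_on_subset[OF C1_onD(1)[OF C2_onD(1)[OF w2]]]] by auto
  then have b: "{z\<in>U. w z >= 2 * d} \<in> sets borel" by (intro borel_closed compact_imp_closed)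
  have "(%z. ennreal (indicator {z\<in>U. w z >= 2 * d} z *\<^sub>R ?T z)) \<in> borel_measurable borel"
   by (intro measurable_compose[OF _ measurable_ennreal] borel_measurable_continuous_on_indicator b c2)
  also have "(%z. ennreal (indicator {z\<in>U. w z >= 2 * d} z *\<^sub>R ?T z)) = (%z. ennreal (?T z) * indicator {z\<in>U. w z >= 2 * d} z)"
   by (auto simp: indicator_def fun_eq_iff)
  finally show "(%z. ennreal (?T z) * indicator {z\<in>U. w z >= 2 * d} z) \<in> borel_measurable lborel" by simp
 qed
 also have "... <= ennreal ?C * (\<integral>\<^sup>+z. ennreal (top_power (X z)) * indicator {z\<in>U. w z >= d} z \<partial>lborel)"
  by (intro mult_left_mono comparison_principle[OF U(1) d Kd w2 X(1) X(2) Ypos]) auto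
 also have "... <= ennreal ?C * mass"
  unfolding mass_def using sub by (intro mult_left_mono nn_integral_mono) (auto simp: indicator_def)
 also have "?C = 4 * real ?n / top_power (std_form :: complex ^ 'n => _) * (8 * m * r\<^sup>2 / t) ^ (?n - 1)"
  by (simp add: c_def power_divide)
 finally show ?thesis by (simp add: m_def)
qed

end

section \<open>Change of variables and the volume measure\<close>

text \<open>The change of variables theorem of the library is stated for well-ordered index types, so the
 real coordinates are indexed by a well-ordered copy of \<open>'n \<times> bool\<close>.\<close>

typedef 'n real_index = "UNIV :: ('n \<times> bool) set" by auto

lemma Abs_real_index_bij: "bij Rep_real_index" "bij Abs_real_index"
 by (rule bij_betw_byWitness[where f'=Abs_real_index], auto simp: Rep_real_index_inverse Abs_real_index_inverse)
  (rule bij_betw_byWitness[where f'=Rep_real_index], auto simp: Rep_real_index_inverse Abs_real_index_inverse)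

instance real_index :: (finite) finite
proof
 have "finite (range (Abs_real_index :: 'a \<times> bool => _))" by simp
 then show "finite (UNIV :: 'a real_index set)"
  unfolding bij_is_surj[OF Abs_real_index_bij(2)] .
qed

definition real_index_number :: "'n::finite real_index => nat" where
 "real_index_number = (SOME f. inj f)"

lemma inj_real_index_number: "inj (real_index_number :: 'n::finite real_index => nat)"
proof -
 have "\<exists>f :: 'n real_index => nat. inj f"
  using finite_imp_inj_to_nat_seg[of "UNIV :: 'n real_index set"] by auto
 from someI_ex[OF this] show ?thesis unfolding real_index_number_def .
qed

instantiation real_index :: (finite) wellorder
begin

definition less_eq_real_index :: "'a real_index => 'a real_index => bool" where
 "less_eq_real_index x y \<longleftrightarrow> real_index_number x <= real_index_number y"

definition less_real_index :: "'a real_index => 'a real_index => bool" where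
 "less_real_index x y \<longleftrightarrow> real_index_number x < real_index_number y"

instance
proof
 fix P :: "'a real_index => bool" and a
 assume step: "!!x. (!!y. y < x ==> P y) ==> P x"
 show "P a"
 proof (induction a rule: measure_induct_rule[of real_index_number])
  case (less x)
  show ?case by (rule step, rule less) (simp add: less_real_index_def)
 qed
next
 fix x y :: "'a real_index" assume "x <= y" "y <= x"
 then have "real_index_number x = real_index_number y" by (simp add: less_eq_real_index_def)
 then show "x = y" by (rule injD[OF inj_real_index_number])
qed (auto simp: less_eq_real_index_def less_real_index_def)

end

definition to_vec :: "complex ^ 'n::finite => real ^ 'n real_index" where
 "to_vec z = (\<chi> i. z \<bullet> real_frame (Rep_real_index i))"

definition of_vec :: "real ^ 'n real_index => complex ^ 'n::finite" where
 "of_vec x = (\<Sum>a\<in>UNIV. (x $ Abs_real_index a) *\<^sub>R real_frame a)"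

lemma of_vec_to_vec [simp]: "of_vec (to_vec z) = z"
 by (simp add: of_vec_def to_vec_def Abs_real_index_inverse real_frame_expansion)

lemma to_vec_of_vec [simp]: "to_vec (of_vec x) = x"
 by (simp add: of_vec_def to_vec_def vec_eq_iff inner_sum_left inner_real_frame Rep_real_index_inverse
   if_distrib sum.delta cong: if_cong)

lemma linear_to_vec: "linear to_vec" and linear_of_vec: "linear of_vec"
 by (auto intro!: linearI simp: to_vec_def of_vec_def vec_eq_iff inner_add_left scaleR_add_left sum.distrib scaleR_sum_right)

lemma bounded_linear_to_vec: "bounded_linear to_vec" and bounded_linear_of_vec: "bounded_linear of_vec"
 using linear_to_vec linear_of_vec linear_conv_bounded_linear by blast+

lemma to_vec_measurable [measurable]: "to_vec \<in> borel_measurable borel"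
 and of_vec_measurable [measurable]: "of_vec \<in> borel_measurable borel"
 using linear_continuous_on[OF bounded_linear_to_vec] linear_continuous_on[OF bounded_linear_of_vec]
 by (auto intro!: borel_measurable_continuous_onI)

lemma to_vec_inner_axis: "to_vec z \<bullet> axis i 1 = z \<bullet> real_frame (Rep_real_index i)"
 by (simp add: to_vec_def inner_axis)

text \<open>\<open>of_vec\<close> only renames orthonormal coordinates, so it maps boxes to boxes of
  the same volume, and these determine Lebesgue measure.\<close>

lemma lborel_of_vec: "(lborel :: (complex ^ 'n::finite) measure) = distr lborel borel of_vec"
proof (rule lborel_eqI)
 fix l u :: "complex ^ 'n"
 assume le: "!!b. b \<in> Basis ==> l \<bullet> b <= u \<bullet> b"
 have Bv: "(Basis :: (real ^ 'n real_index) set) = (%i. axis i 1) ` UNIV"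
  by (auto simp: Basis_vec_def)
 have inj: "inj (%i :: 'n real_index. axis i (1::real))" by (auto intro!: injI simp: axis_eq_axis)
 have m: "of_vec -` box l u = box (to_vec l) (to_vec u)"
 proof (intro set_eqI)
  fix x :: "real ^ 'n real_index"
  have "x \<in> box (to_vec l) (to_vec u) \<longleftrightarrow> (\<forall>i. l \<bullet> real_frame (Rep_real_index i) < of_vec x \<bullet> real_frame (Rep_real_index i) & of_vec x \<bullet> real_frame (Rep_real_index i) < u \<bullet> real_frame (Rep_real_index i))"
   using to_vec_inner_axis[of "of_vec x"] by (simp add: mem_box Bv to_vec_inner_axis)
  also have "... \<longleftrightarrow> (\<forall>a. l \<bullet> real_frame a < of_vec x \<bullet> real_frame a & of_vec x \<bullet> real_frame a < u \<bullet> real_frame a)"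
   by (metis Abs_real_index_inverse UNIV_I)
  finally show "x \<in> of_vec -` box l u \<longleftrightarrow> x \<in> box (to_vec l) (to_vec u)"
   by (simp add: mem_box Basis_real_frame)
 qed
 have "emeasure (distr lborel borel of_vec) (box l u) = emeasure lborel (box (to_vec l) (to_vec u))"
  by (subst emeasure_distr) (auto simp: m)
 also have "... = ennreal (\<Prod>b\<in>Basis. (to_vec u - to_vec l) \<bullet> b)"
  by (rule emeasure_lborel_box) (use le in \<open>auto simp: Bv to_vec_inner_axis Basis_real_frame\<close>)
 also have "(\<Prod>b\<in>Basis. (to_vec u - to_vec l) \<bullet> b) = (\<Prod>i\<in>UNIV. (u - l) \<bullet> real_frame (Rep_real_index i))"
  unfolding Bv by (subst prod.reindex[OF inj]) (simp add: inner_diff_left to_vec_inner_axis)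
 also have "... = (\<Prod>a\<in>UNIV. (u - l) \<bullet> real_frame a)"
  using prod.reindex_bij_betw[OF Abs_real_index_bij(1), of "%a. (u - l) \<bullet> real_frame a"] by simp
 also have "... = (\<Prod>b\<in>Basis. (u - l) \<bullet> b)"
  unfolding Basis_real_frame by (subst prod.reindex[OF inj_real_frame]) simp
 finally show "emeasure (distr lborel borel of_vec) (box l u) = ennreal (\<Prod>b\<in>Basis. (u - l) \<bullet> b)"
  by simp
qed simp

lemma nn_integral_of_vec:
 fixes f :: "complex ^ 'n::finite => ennreal"
 assumes "f \<in> borel_measurable borel"
 shows "(\<integral>\<^sup>+z. f z \<partial>lborel) = (\<integral>\<^sup>+x. f (of_vec x) \<partial>lborel)"
 by (subst lborel_of_vec) (use assms in \<open>simp add: nn_integral_distr\<close>)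

lemma det_frame_matrix:
 "det_frame B = det (matrix (%x. to_vec (B (of_vec x))))" for B :: "complex ^ 'n::finite => complex ^ 'n"
proof -
 let ?R = "Rep_real_index :: 'n real_index => 'n \<times> bool" and ?A = "Abs_real_index :: 'n \<times> bool => 'n real_index"
 define m where "m c a = B (real_frame a) \<bullet> real_frame c" for a c
 have ov: "of_vec (axis j 1) = real_frame (?R j)" for j
 proof -
  have "of_vec (axis j 1) = (\<Sum>a\<in>UNIV. if a = ?R j then real_frame a else 0)"
   unfolding of_vec_def by (intro sum.cong refl) (auto simp: axis_def Abs_real_index_inverse Rep_real_index_inverse)
  then show ?thesis by simp
 qed
 have M: "matrix (%x. to_vec (B (of_vec x))) = (\<chi> i j. m (?R i) (?R j))"
  by (simp add: matrix_def ov to_vec_def m_def)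
 have bR: "bij ?R" by (rule Abs_real_index_bij(1))
 have "inv ?R = ?A" by (rule inv_equality) (simp_all add: Rep_real_index_inverse Abs_real_index_inverse)
 then have mp: "map_permutation UNIV ?R p = ?R o p o ?A" for p
  using bij_is_surj[OF bR] by (simp add: map_permutation_def fun_eq_iff restrict_id_def)
 have sg: "sign (?R o p o ?A) = sign p" if "p permutes UNIV" for p
  using sign_map_permutation[of ?R UNIV p] that bR by (simp add: mp bij_def)
 have "det (\<chi> i j. m (?R i) (?R j)) = (\<Sum>p | p permutes UNIV. of_int (sign p) * (\<Prod>i\<in>UNIV. m (?R i) (?R (p i))))"
  by (simp add: det_def)
 also have "... = (\<Sum>q | q permutes (UNIV :: ('n \<times> bool) set). of_int (sign q) * (\<Prod>a\<in>UNIV. m a (q a)))"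
 proof (rule sum.reindex_bij_witness[where i="%q. ?A o q o ?R" and j="%p. ?R o p o ?A"])
  fix p assume p: "p \<in> {p. p permutes (UNIV :: 'n real_index set)}"
  show "?A o (?R o p o ?A) o ?R = p" by (simp add: fun_eq_iff Rep_real_index_inverse)
  show "?R o p o ?A \<in> {q. q permutes UNIV}"
   using p Abs_real_index_bij by (auto simp: permutes_UNIV_bij intro!: bij_comp)
  have "(\<Prod>a\<in>UNIV. m a ((?R o p o ?A) a)) = (\<Prod>i\<in>UNIV. m (?R i) ((?R o p o ?A) (?R i)))"
   using prod.reindex_bij_betw[OF bR, of "%a. m a ((?R o p o ?A) a)"] by simp
  then show "of_int (sign (?R o p o ?A)) * (\<Prod>a\<in>UNIV. m a ((?R o p o ?A) a)) = of_int (sign p) * (\<Prod>i\<in>UNIV. m (?R i) (?R (p i)))"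
   using p by (simp add: sg Rep_real_index_inverse)
 next
  fix q assume q: "q \<in> {q. q permutes (UNIV :: ('n \<times> bool) set)}"
  show "?R o (?A o q o ?R) o ?A = q" by (simp add: fun_eq_iff Abs_real_index_inverse)
  show "?A o q o ?R \<in> {p. p permutes UNIV}"
   using q Abs_real_index_bij by (auto simp: permutes_UNIV_bij intro!: bij_comp)
 qed
 also have "... = det_frame B" by (simp add: det_frame_def det_def m_def)
 finally show ?thesis using M by simp
qed

lemma nn_integral_change_of_variables_vec:
 fixes g :: "real ^ 'm::{finite,wellorder} => real ^ 'm::_" and f h :: "real ^ 'm::_ => real"
 assumes S: "S \<in> sets borel" "g ` S \<in> sets borel"
  and der: "!!x. x \<in> S ==> (g has_derivative g' x) (at x within S)" and inj: "inj_on g S"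
  and f: "f \<in> borel_measurable borel" "!!y. f y >= 0" and h: "h \<in> borel_measurable borel" "!!x. h x >= 0"
  and eq: "!!x. x \<in> S ==> h x = \<bar>det (matrix (g' x))\<bar> * f (g x)"
 shows "(\<integral>\<^sup>+y. ennreal (f y * indicator (g ` S) y) \<partial>lborel) = (\<integral>\<^sup>+x. ennreal (h x * indicator S x) \<partial>lborel)"
proof -
 let ?F = "%y. f y * indicator (g ` S) y" and ?H = "%x. h x * indicator S x"
 have SL: "S \<in> sets lebesgue" using S(1) by simp
 have conv: "((%x. \<bar>det (matrix (g' x))\<bar> * f (g x)) has_integral b) S \<longleftrightarrow> (f has_integral b) (g ` S)" for b
  using has_absolute_integral_change_of_variables[OF SL der inj, of "%x. (vec (f x) :: real^1)" "vec b"]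
  unfolding absolutely_integrable_on_1_iff integral_on_1_eq integrable_on_1_iff
  by (auto simp: has_integral_iff absolutely_integrable_on_iff_nonneg f(2) vec_eq_iff)
 have hH: "((%x. \<bar>det (matrix (g' x))\<bar> * f (g x)) has_integral b) S \<longleftrightarrow> (?H has_integral b) UNIV" for b
 proof -
  have "((%x. \<bar>det (matrix (g' x))\<bar> * f (g x)) has_integral b) S \<longleftrightarrow> (h has_integral b) S"
   by (rule has_integral_cong) (simp add: eq)
  also have "... \<longleftrightarrow> ((%x. if x \<in> S then h x else 0) has_integral b) UNIV" by (simp add: has_integral_restrict_UNIV)
  also have "(%x. if x \<in> S then h x else 0) = ?H" by (auto simp: fun_eq_iff)
  finally show ?thesis .
 qed
 have fF: "(f has_integral b) (g ` S) \<longleftrightarrow> (?F has_integral b) UNIV" for b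
 proof -
  have "(f has_integral b) (g ` S) \<longleftrightarrow> ((%x. if x \<in> g ` S then f x else 0) has_integral b) UNIV" by (simp add: has_integral_restrict_UNIV)
  also have "(%x. if x \<in> g ` S then f x else 0) = ?F" by (auto simp: fun_eq_iff)
  finally show ?thesis .
 qed
 have mF: "?F \<in> borel_measurable borel" "?H \<in> borel_measurable borel"
  using S f(1) h(1) by (auto intro!: borel_measurable_times borel_measurable_indicator)
 have iff: "(?F has_integral b) UNIV \<longleftrightarrow> (?H has_integral b) UNIV" for b
  using conv hH fF by blast
 have nnF: "0 <= ?F y" "0 <= ?H y" for y using f(2) h(2) by auto
 have "nn_integral lborel (%x. ennreal (?F x)) = ennreal r \<longleftrightarrow> nn_integral lborel (%x. ennreal (?H x)) = ennreal r" if "r >= 0" for r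
  using iff[of r] nn_integral_has_integral[OF mF(1) nnF(1) _ that] nn_integral_has_integral[OF mF(2) nnF(2) _ that]
   nn_integral_has_integral_lborel[OF mF(1) nnF(1), of r] nn_integral_has_integral_lborel[OF mF(2) nnF(2), of r]
  by blast
 note r = this
 \<comment> \<open>Agreement on all finite values also settles the infinite case: if one side is
   finite, so is the other.\<close>
 show ?thesis
 proof (cases "nn_integral lborel (%x. ennreal (?F x))")
  case (real a)
  with r[of a] show ?thesis by simp
 next
  case top
  show ?thesis
  proof (cases "nn_integral lborel (%x. ennreal (?H x))")
   case (real a)
   with r[of a] show ?thesis by simp
  qed (use top in simp)
 qed
qed

lemma nn_integral_change_of_variables:
 fixes g :: "complex ^ 'n::finite => complex ^ 'n" and f h :: "complex ^ 'n => real"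
 assumes S: "S \<in> sets borel" "g ` S \<in> sets borel"
  and der: "!!x. x \<in> S ==> (g has_derivative g' x) (at x)" and inj: "inj_on g S"
  and f: "f \<in> borel_measurable borel" "!!y. f y >= 0" and h: "h \<in> borel_measurable borel" "!!x. h x >= 0"
  and eq: "!!x. x \<in> S ==> h x = \<bar>det_frame (g' x)\<bar> * f (g x)"
 shows "(\<integral>\<^sup>+y. ennreal (f y * indicator (g ` S) y) \<partial>lborel) = (\<integral>\<^sup>+x. ennreal (h x * indicator S x) \<partial>lborel)"
proof -
 let ?G = "%x. to_vec (g (of_vec x))"
 have img: "to_vec ` T = of_vec -` T" for T :: "(complex ^ 'n) set"
  by (auto simp: image_iff) (metis to_vec_of_vec)
 have Gim: "?G ` (to_vec ` S) = to_vec ` (g ` S)" by (auto simp: image_image)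
 have meas: "to_vec ` T \<in> sets borel" if "T \<in> sets borel" for T :: "(complex ^ 'n) set"
  unfolding img using measurable_sets[OF of_vec_measurable that] by simp
 have "(\<integral>\<^sup>+y. ennreal ((f o of_vec) y * indicator (?G ` (to_vec ` S)) y) \<partial>lborel) =
  (\<integral>\<^sup>+x. ennreal ((h o of_vec) x * indicator (to_vec ` S) x) \<partial>lborel)"
 proof (rule nn_integral_change_of_variables_vec[where g'="%x v. to_vec (g' (of_vec x) (of_vec v))"])
  show "to_vec ` S \<in> sets borel" "?G ` to_vec ` S \<in> sets borel" unfolding Gim by (intro meas S)+
  show "(?G has_derivative (%v. to_vec (g' (of_vec x) (of_vec v)))) (at x within to_vec ` S)" if "x \<in> to_vec ` S" for x
  proof (rule has_derivative_at_withinI)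
   have "of_vec x \<in> S" using that by auto
   from has_derivative_compose[OF bounded_linear_imp_has_derivative[OF bounded_linear_of_vec] der[OF this]]
   have "((%x. g (of_vec x)) has_derivative (%v. g' (of_vec x) (of_vec v))) (at x)" .
   from bounded_linear.has_derivative[OF bounded_linear_to_vec this]
   show "(?G has_derivative (%v. to_vec (g' (of_vec x) (of_vec v)))) (at x)" .
  qed
  show "inj_on ?G (to_vec ` S)"
   using inj by (auto simp: inj_on_def) (metis of_vec_to_vec)
  show "(h o of_vec) x = \<bar>det (matrix (%v. to_vec (g' (of_vec x) (of_vec v))))\<bar> * (f o of_vec) (?G x)" if "x \<in> to_vec ` S" for x
   using that eq by (auto simp: det_frame_matrix)
 qed (use f h in \<open>auto intro: measurable_compose[OF of_vec_measurable]\<close>)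
 moreover have "indicator (to_vec ` T) x = (indicator T (of_vec x) :: real)" for x and T :: "(complex ^ 'n) set"
  unfolding img by (simp add: indicator_def)
 ultimately have "(\<integral>\<^sup>+y. ennreal (f (of_vec y) * indicator (g ` S) (of_vec y)) \<partial>lborel) =
  (\<integral>\<^sup>+x. ennreal (h (of_vec x) * indicator S (of_vec x)) \<partial>lborel)"
  unfolding Gim by simp
 moreover have "(%y. ennreal (f y * indicator (g ` S) y)) \<in> borel_measurable borel" "(%x. ennreal (h x * indicator S x)) \<in> borel_measurable borel"
  using f(1) h(1) S by (auto intro!: borel_measurable_times borel_measurable_indicator measurable_compose[OF _ measurable_ennreal])
 ultimately show ?thesis by (simp add: nn_integral_of_vec)
qed

section \<open>Truncations, affine changes of variables and averages of translates\<close>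

lemma C1_on_Un:
 assumes "open A" "open B" "C1_on A f D" "C1_on B f D"
 shows "C1_on (A Un B) f D"
 using assms(3,4) unfolding C1_on_def by (auto intro!: continuous_on_open_Un assms(1,2))

lemma C1_on_extend_zero:
 assumes U: "open U" and K: "compact K" "K <= U" and f: "C1_on U f D"
  and out: "!!z. z \<in> U - K ==> f z = 0" "!!z v. z \<in> U - K ==> D z v = 0"
 shows "C1_on UNIV (%z. if z \<in> U then f z else 0) (%z v. if z \<in> U then D z v else 0)"
proof -
 have o: "open (- K)" using K(1) by (simp add: compact_imp_closed open_Compl)
 have 1: "C1_on U (%z. if z \<in> U then f z else 0) (%z v. if z \<in> U then D z v else 0)"
  by (rule C1_on_cong_open[OF U f]) simp_all
 have 2: "C1_on (- K) (%z. if z \<in> U then f z else 0) (%z v. if z \<in> U then D z v else 0)"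
  by (rule C1_on_cong_open[OF o C1_on_const[of _ 0]]) (use out in auto)
 have "U Un - K = UNIV" using K(2) by auto
 then show ?thesis using C1_on_Un[OF U o 1 2] by simp
qed

text \<open>A convex C^2 substitute for the positive part of x - t, with slope in [0,1].\<close>

definition ramp :: "real => real => real" where
 "ramp t x = integral {0..x} (cutoff t)"

lemma ramp_props:
 assumes t: "t > 0"
 shows "x <= t ==> ramp t x = 0" "(ramp t has_real_derivative cutoff t x) (at x)" "ramp t x >= 0" "ramp t x >= x - 2 * t"
proof -
 have cont: "continuous_on S (cutoff t)" for S
  by (rule DERIV_continuous_on_set[OF cutoff_props(1)[OF t]])
 show z: "ramp t x = 0" if "x <= t" for x
 proof -
  have "integral {0..x} (cutoff t) = integral {0..x} (%_. 0)"
   by (rule integral_cong) (use cutoff_props(6)[OF t] that in auto)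
  then show ?thesis by (simp add: ramp_def)
 qed
 show d: "(ramp t has_real_derivative cutoff t x) (at x)" for x
 proof (cases "x < t")
  case True
  have ev: "eventually (%y. ramp t y = 0) (nhds x)"
   using eventually_nhds_in_open[of "{..<t}" x] True by (auto elim!: eventually_mono intro: z)
  have "(ramp t has_real_derivative 0) (at x)"
   by (rule DERIV_cong_ev[OF refl ev refl, THEN iffD2]) simp
  then show ?thesis using cutoff_props(6)[OF t, of x] True by simp
 next
  case False
  have "(ramp t has_real_derivative cutoff t x) (at x within {0..x+1})"
   unfolding ramp_def[abs_def]
   by (rule integral_has_real_derivative[OF cont]) (use False t in auto)
  moreover have "at x within {0..x+1} = at x" by (rule at_within_interior) (use False t in auto)
  ultimately show ?thesis by simp
 qed
 show nn: "ramp t x >= 0" for x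
  unfolding ramp_def by (rule integral_nonneg[OF integrable_continuous_interval[OF cont]]) (rule cutoff_props(4)[OF t])
 show "ramp t x >= x - 2 * t"
 proof (cases "x >= 2 * t")
  case True
  have "ramp t (2*t) - 2 * t <= ramp t x - x"
   by (rule DERIV_within_nonneg_mono[where f="%x. ramp t x - x" and f'="%x. cutoff t x - 1", OF True])
    (auto intro!: derivative_eq_intros has_field_derivative_at_within[OF d] simp: cutoff_props(8)[OF t])
  then show ?thesis using nn[of "2*t"] by linarith
 qed (use nn[of x] in linarith)
qed

lemma lborel_integral_affine:
 fixes f :: "'a::euclidean_space => real"
 assumes f: "f \<in> borel_measurable borel" and c: "c > 0"
 shows "(LBINT z. f z) = c ^ DIM('a) * (LBINT z. f (y + c *\<^sub>R z))"
proof -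
 have "(LBINT z. f z) = (\<integral>z. f z \<partial>density (distr lborel borel (%x. y + c *\<^sub>R x)) (%_. ennreal (\<bar>c\<bar> ^ DIM('a))))"
  using lborel_affine[of c y] c by simp
 also have "... = (\<integral>z. \<bar>c\<bar> ^ DIM('a) *\<^sub>R f z \<partial>distr lborel borel (%x. y + c *\<^sub>R x))"
  by (rule integral_density) (use f in auto)
 also have "... = (LBINT z. \<bar>c\<bar> ^ DIM('a) *\<^sub>R f (y + c *\<^sub>R z))"
  by (rule integral_distr) (use f in auto)
 finally show ?thesis using c by simp
qed

lemma lborel_integrable_affine:
 fixes f :: "'a::euclidean_space => real"
 assumes f: "integrable lborel f" and c: "c > 0"
 shows "integrable lborel (%z. f (y + c *\<^sub>R z))"
proof -
 have "integrable (density (distr lborel borel (%x. y + c *\<^sub>R x)) (%_. ennreal (\<bar>c\<bar> ^ DIM('a)))) f"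
  using lborel_affine[of c y] c f by simp
 then have "integrable (distr lborel borel (%x. y + c *\<^sub>R x)) (%z. \<bar>c\<bar> ^ DIM('a) *\<^sub>R f z)"
  by (subst (asm) integrable_density) (use borel_measurable_integrable[OF f] in auto)
 then have "integrable lborel (%z. \<bar>c\<bar> ^ DIM('a) *\<^sub>R f (y + c *\<^sub>R z))"
  by (subst (asm) integrable_distr_eq) (use borel_measurable_integrable[OF f] in auto)
 then show ?thesis using c by simp
qed

lemma compact_support_bounded:
 fixes f :: "'a::euclidean_space => real"
 assumes "compact K" "continuous_on UNIV f" "!!z. z ~: K ==> f z = 0"
 shows "\<exists>M. \<forall>z. \<bar>f z\<bar> <= M"
proof -
 have "bounded (f ` K)" by (intro compact_imp_bounded compact_continuous_image continuous_on_subset[OF assms(2)] assms(1)) auto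
 then obtain M where M: "!!z. z \<in> K ==> \<bar>f z\<bar> <= M" unfolding bounded_iff by auto
 have "\<bar>f z\<bar> <= max M 0" for z using M[of z] assms(3)[of z] by (cases "z \<in> K") auto
 then show ?thesis by blast
qed

text \<open>Line derivatives pass under the integral because \<open>K\<close> has finite measure and
  \<open>f\<close> and \<open>D\<close> are bounded. With a sublevel set as \<open>K\<close>, the
  average has a better Laplacian than \<open>f\<close> itself.\<close>

lemma C1_on_average:
 fixes f :: "'a::euclidean_space => real"
 assumes f: "C1_on UNIV f D" and K: "K \<in> sets borel" "emeasure lborel K < \<infinity>"
  and M: "\<exists>M. \<forall>z. \<bar>f z\<bar> <= M" "!!v. \<exists>M. \<forall>z. \<bar>D z v\<bar> <= M"
 shows "C1_on UNIV (%x. \<integral>y. indicator K y * f (y + x) \<partial>lborel) (%x v. \<integral>y. indicator K y * D (y + x) v \<partial>lborel)"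
  "integrable lborel (%y. indicator K y * f (y + x))" "integrable lborel (%y. indicator K y * D (y + x) v)"
proof -
 note fD = C1_onD[OF f]
 have iK: "integrable lborel (indicator K :: 'a => real)" using K by (intro integrable_real_indicator) auto
 obtain M0 where M0: "!!z. \<bar>f z\<bar> <= M0" using M(1) by blast
 have sh: "continuous_on UNIV (%x. h (y + x))" "(%y. h (y + x)) \<in> borel_measurable borel" if "continuous_on UNIV h" for h :: "'a => real" and x y
  by (rule continuous_on_compose2[OF that]; auto intro!: continuous_intros)
   (rule borel_measurable_continuous_onI, rule continuous_on_compose2[OF that]; auto intro!: continuous_intros)
 note P = continuous_integral_param[OF iK sh(1)[OF fD(1)] M0 sh(2)[OF fD(1)]]
 show i1: "integrable lborel (%y. indicator K y * f (y + x))" for x by (rule P(2))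
 have Q: "continuous_on UNIV (%x. \<integral>y. indicator K y * D (y + x) v \<partial>lborel)" "integrable lborel (%y. indicator K y * D (y + x) v)" for v x
 proof -
  obtain M1 where M1: "!!z. \<bar>D z v\<bar> <= M1" using M(2) by blast
  show "continuous_on UNIV (%x. \<integral>y. indicator K y * D (y + x) v \<partial>lborel)" "integrable lborel (%y. indicator K y * D (y + x) v)"
   using continuous_integral_param[OF iK sh(1)[OF fD(2)] M1 sh(2)[OF fD(2)]] by auto
 qed
 show "integrable lborel (%y. indicator K y * D (y + x) v)" by (rule Q)
 show "C1_on UNIV (%x. \<integral>y. indicator K y * f (y + x) \<partial>lborel) (%x v. \<integral>y. indicator K y * D (y + x) v \<partial>lborel)"
  unfolding C1_on_def
 proof (intro conjI allI ballI P(1) Q(1))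
  fix x :: 'a
  note lin = fD(3)[OF UNIV_I]
  show "linear (%v. \<integral>y. indicator K y * D (y + x) v \<partial>lborel)"
   by (rule linearI)
    (simp_all add: linear_add[OF lin] linear_scale[OF lin] distrib_left Bochner_Integration.integral_add[OF Q(2) Q(2)] mult.left_commute)
  fix v :: 'a
  obtain M1 where M1: "!!z. \<bar>D z v\<bar> <= M1" using M(2) by blast
  have "((%t. \<integral>y. indicator K y * f (y + (x + t *\<^sub>R v)) \<partial>lborel) has_real_derivative (LBINT y. indicator K y * D (y + (x + 0 *\<^sub>R v)) v)) (at 0 within UNIV)"
  proof (rule deriv_under_integral[where B="%y. M1 * indicator K y"])
   show "((%t. indicator K y * f (y + (x + t *\<^sub>R v))) has_real_derivative indicator K y * D (y + (x + t *\<^sub>R v)) v) (at t within UNIV)" for t y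
    using DERIV_cmult[OF fD(5)[OF UNIV_I, where z="y + x" and s=t and v=v], of "indicator K y"] by (simp add: add.assoc)
   show "\<bar>indicator K y * D (y + (x + t *\<^sub>R v)) v\<bar> <= M1 * indicator K y" for t y
    using M1[of "y + (x + t *\<^sub>R v)"] by (auto simp: indicator_def)
   show "integrable lborel (%y. M1 * indicator K y)" using iK by auto
   show "(%y. indicator K y * D (y + (x + 0 *\<^sub>R v)) v) \<in> borel_measurable lborel" by (rule borel_measurable_integrable[OF Q(2)])
  qed (auto intro: i1)
  then show "((%t. \<integral>y. indicator K y * f (y + (x + t *\<^sub>R v)) \<partial>lborel) has_real_derivative (LBINT y. indicator K y * D (y + x) v)) (at 0)"
   by simp
 qed
qed

lemma sum_frame_J:
 fixes h :: "complex ^ 'n::finite => complex ^ 'n => real"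
 assumes "bilinear h"
 shows "(\<Sum>a\<in>UNIV. h (J (real_frame a)) (J (real_frame a))) = (\<Sum>a\<in>UNIV. h (real_frame a) (real_frame a))"
proof -
 let ?f = "%a :: 'n \<times> bool. (fst a, ~ snd a)"
 have e: "J (real_frame a) = real_frame (?f a) | J (real_frame a) = - real_frame (?f a)" for a :: "'n \<times> bool"
  by (auto simp: real_frame_def vec_eq_iff axis_def)
 have "h (J (real_frame a)) (J (real_frame a)) = h (real_frame (?f a)) (real_frame (?f a))" for a
  using e[of a] by (auto simp: bilinear_lneg[OF assms] bilinear_rneg[OF assms])
 then have "(\<Sum>a\<in>UNIV. h (J (real_frame a)) (J (real_frame a))) = (\<Sum>a\<in>UNIV. h (real_frame (?f a)) (real_frame (?f a)))" by simp
 also have "... = (\<Sum>a\<in>UNIV. h (real_frame a) (real_frame a))"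
  by (rule sum.reindex_bij_witness[where i="?f" and j="?f"]) auto
 finally show ?thesis .
qed

lemma laplacian_frame: "laplacian H z = (\<Sum>a\<in>UNIV. H z (real_frame a) (real_frame a))"
 for H :: "complex ^ 'n::finite => _"
 unfolding laplacian_def Basis_real_frame by (subst sum.reindex[OF inj_real_frame]) simp

text \<open>\<open>J\<close> permutes the real frame up to signs, so both halves of
  \<open>ddc\<close> sum to the same Laplacian.\<close>

lemma form_trace_ddc:
 fixes H :: "complex ^ 'n::finite => _"
 assumes "bilinear (H z)" "!!u v. H z u v = H z v u"
 shows "form_trace (ddc (H z)) = laplacian H z"
 unfolding form_trace_def ddc_herm(2)[OF assms] laplacian_frame
 using sum_frame_J[OF assms(1)] by (simp add: sum_divide_distrib[symmetric] sum.distrib)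

section \<open>The truncated potential and the volume of sublevel sets\<close>

context sublevel
begin

context
 fixes t :: real and \<mu> :: real
 assumes t: "t > 0" and \<mu>: "\<mu> >= 0" "mass <= ennreal \<mu>"
begin

definition Kt where "Kt = {z\<in>U. u z <= s - t}"

definition rho where "rho z = (if z \<in> Kt then form_trace (X z) else 0)"

text \<open>The ramp is zero outside the compact set \<open>Kt\<close>, so the extension by zero is
  C^2 on the whole space.\<close>

definition g where "g z = (if z \<in> U then ramp t (s - u z) else 0)"

definition gD where "gD z v = (if z \<in> U then cutoff t (s - u z) * - D z v else 0)"

definition gH where "gH z a b = (if z \<in> U then cutoff' t (s - u z) * - D z a * - D z b + cutoff t (s - u z) * - H z a b else 0)"

lemma Kt: "compact Kt" "Kt <= U"
 using compact_sub[of t] t by (auto simp: Kt_def)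

lemma rho_props: "rho z >= 0" "integrable lborel rho" "rho \<in> borel_measurable borel"
proof -
 show "rho z >= 0" using form_trace_nonneg X(2) Kt(2) by (auto simp: rho_def)
 have "continuous_on Kt (%z. form_trace (X z))" unfolding form_trace_def
  using X(1) by (auto simp: weakly_closed_def intro!: continuous_intros continuous_on_subset[OF _ Kt(2)])
 then have "continuous_on Kt rho" by (rule continuous_on_eq) (simp add: rho_def)
 then show i: "integrable lborel rho" by (rule integrable_compact_support[OF Kt(1)]) (simp add: rho_def)
 show "rho \<in> borel_measurable borel" using borel_measurable_integrable[OF i] by simp
qed

lemma rho_mass:
 assumes y: "y \<in> ball y0 (1/2)" and r: "0 < r" "r <= 1"
 shows "(LBINT z. rho z * indicator (cball y r) z) \<le>
  4 * real CARD('n) / top_power (std_form :: complex ^ 'n => _) * (8 * (ln 2 - 2 * ln r) * r\<^sup>2 / t) ^ (CARD('n) - 1) * \<mu>"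
  (is "_ <= ?C * \<mu>")
proof -
 have S: "top_power (std_form :: complex ^ 'n => _) > 0" by (rule top_power_std_form_pos)
 have "ln r <= 0" using r by simp
 then have m: "ln 2 - 2 * ln r >= 0" using ln_gt_zero[of 2] by linarith
 have C: "?C >= 0" using S m r t by auto
 have i: "integrable lborel (%z. rho z * indicator (cball y r) z)"
  using integrable_mult_indicator[OF _ rho_props(2), of "cball y r"] by (simp add: mult.commute)
 have "ennreal (LBINT z. rho z * indicator (cball y r) z) = (\<integral>\<^sup>+z. ennreal (rho z * indicator (cball y r) z) \<partial>lborel)"
  by (rule nn_integral_eq_integral[OF i, symmetric]) (simp add: rho_props)
 also have "... = (\<integral>\<^sup>+z. ennreal (form_trace (X z)) * indicator {z\<in>U. u z <= s - t} z * indicator (cball y r) z \<partial>lborel)"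
  by (intro nn_integral_cong) (auto simp: rho_def Kt_def indicator_def)
 also have "... <= ennreal ?C * mass" by (rule trace_mass[OF y r t])
 also have "... <= ennreal ?C * ennreal \<mu>" by (intro mult_left_mono \<mu>) auto
 also have "... = ennreal (?C * \<mu>)" by (rule ennreal_mult[symmetric, OF C \<mu>(1)])
 finally show ?thesis using mult_nonneg_nonneg[OF C \<mu>(1)] by (subst (asm) ennreal_le_iff)
qed

lemma g_C2: "C2_on UNIV g gD gH"
proof -
 have su: "C2_on U (%z. s - u z) (%z v. - D z v) (%z a b. - H z a b)"
  using C2_on_add[OF C2_on_const[of U s] u, of 1 "-1"] by simp
 have "C2_on U (%z. ramp t (s - u z)) (%z v. cutoff t (s - u z) * - D z v)
   (%z a b. cutoff' t (s - u z) * - D z a * - D z b + cutoff t (s - u z) * - H z a b)"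
  by (rule C2_on_compose[OF su ramp_props(2)[OF t] cutoff_props(1)[OF t] cutoff_props(2)[OF t]])
 note c = C2_onD[OF this]
 have out: "s - u z <= t" if "z \<in> U - Kt" for z using that by (auto simp: Kt_def)
 note o = ramp_props(1)[OF t out] cutoff_props(6,7)[OF t out]
 have 1: "C1_on UNIV g gD"
  unfolding g_def[abs_def] gD_def[abs_def]
  by (rule C1_on_extend_zero[OF U(1) Kt c(1)]) (use o in auto)
 have 2: "C1_on UNIV (%z. gD z v) (%z a. gH z a v)" for v
  unfolding gH_def[abs_def] gD_def[abs_def]
  by (rule C1_on_extend_zero[OF U(1) Kt c(2)]) (use o in auto)
 have "gH z a b = gH z b a" for z a b using C2_onD(3)[OF u, of z a b] by (simp add: gH_def)
 then show ?thesis unfolding C2_on_def using 1 2 by blast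
qed

lemma g_out: "z ~: Kt ==> g z = 0" "z ~: Kt ==> gD z v = 0" "z ~: Kt ==> gH z a b = 0"
proof -
 have out: "s - u z <= t" if "z \<in> U" "z ~: Kt" for z using that by (auto simp: Kt_def)
 show "z ~: Kt ==> g z = 0" "z ~: Kt ==> gD z v = 0" "z ~: Kt ==> gH z a b = 0"
  using ramp_props(1)[OF t out, of z] cutoff_props(6,7)[OF t out, of z] by (auto simp: g_def gD_def gH_def)
qed

lemma g_nonneg: "g z >= 0"
 using ramp_props(3)[OF t] by (simp add: g_def)

lemma g_bounds: "\<exists>M. \<forall>z. \<bar>g z\<bar> <= M" "\<exists>M. \<forall>z. \<bar>gD z v\<bar> <= M" "\<exists>M. \<forall>z. \<bar>gH z a b\<bar> <= M"
 by (rule compact_support_bounded[OF Kt(1)];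
   use C1_onD(1)[OF C2_onD(1)[OF g_C2]] C1_onD(2)[OF C2_onD(1)[OF g_C2]] C2_onD(5)[OF g_C2] g_out in blast)+

text \<open>Convexity of the ramp makes the gradient term nonnegative. Its slope lies in [0,1] and
  the Laplacian of \<open>u\<close> is at most the trace of \<open>X\<close>, so at most
  \<open>rho\<close> is lost.\<close>

lemma g_laplacian: "laplacian gH z >= - rho z" "z ~: Kt ==> laplacian gH z = 0"
proof -
 show "z ~: Kt ==> laplacian gH z = 0" for z by (simp add: laplacian_def g_out)
 then show "laplacian gH z >= - rho z"
 proof (cases "z \<in> Kt")
  case True
  then have zU: "z \<in> U" using Kt by auto
  have "laplacian gH z = cutoff' t (s - u z) * (\<Sum>b\<in>Basis. (D z b)\<^sup>2) - cutoff t (s - u z) * laplacian H z"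
   using zU by (simp add: laplacian_def gH_def sum.distrib sum_distrib_left power2_eq_square sum_negf sum_subtractf mult.assoc)
  moreover have "cutoff' t (s - u z) * (\<Sum>b\<in>Basis. (D z b)\<^sup>2) >= 0"
   using cutoff_props(3)[OF t] by (simp add: sum_nonneg)
  moreover have "laplacian H z <= form_trace (X z)"
   unfolding form_trace_ddc[where H=H and z=z, OF C2_onD(4)[OF u zU] C2_onD(3)[OF u zU], symmetric] form_trace_def
   by (intro sum_mono le zU)
  then have "cutoff t (s - u z) * laplacian H z <= cutoff t (s - u z) * form_trace (X z)"
   using cutoff_props(4)[OF t] by (intro mult_left_mono) auto
  moreover have "cutoff t (s - u z) * form_trace (X z) <= 1 * form_trace (X z)"
   using cutoff_props(5)[OF t] form_trace_nonneg[OF X(2)[OF zU]] by (intro mult_right_mono) auto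
  ultimately show ?thesis using True by (simp add: rho_def)
 qed (simp add: rho_props)
qed

text \<open>The function |z - y0|^2 - 1/4 has the constant Laplacian 2 DIM, so the integral of
  \<open>g\<close> becomes one of its Laplacian.\<close>

lemma g_integral: "integrable lborel g" "(LBINT z. g z) <= (LBINT z. rho z)"
proof -
 note C = C2_onD[OF g_C2]
 show ig: "integrable lborel g"
  by (rule integrable_compact_support[OF Kt(1)]) (auto simp: g_out intro: continuous_on_subset[OF C1_onD(1)[OF C(1)]])
 \<comment> \<open>The constant -1/4 makes \<open>q\<close> nonpositive on \<open>U\<close>, with
   values in [-1, 0], so that the lower bound of \<open>g_laplacian\<close> gives an upper
   bound.\<close>
 define q where "q z = (z - y0) \<bullet> (z - y0) + (- 1/4)" for z :: "complex ^ 'n"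
 have q2: "C2_on UNIV q (%z v. 2 * ((z - y0) \<bullet> v)) (%z u v. 2 * (u \<bullet> v))"
  unfolding q_def by (rule C2_on_sqdist)
 have p: "(LBINT z. 2 * (b \<bullet> b) * g z) = (LBINT z. q z * gH z b b)" "integrable lborel (%z. q z * gH z b b)" for b
 proof -
  have "(LBINT z. 2 * (b \<bullet> b) * g z) = - (LBINT z. 2 * ((z - y0) \<bullet> b) * gD z b)"
   by (rule integral_parts(3)[OF open_UNIV Kt(1) subset_UNIV C2_onD(2)[OF q2] C(1)]) (auto simp: g_out)
  also have "(LBINT z. 2 * ((z - y0) \<bullet> b) * gD z b) = - (LBINT z. q z * gH z b b)"
   by (rule integral_parts(3)[OF open_UNIV Kt(1) subset_UNIV C2_onD(1)[OF q2] C(2)]) (auto simp: g_out)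
  finally show "(LBINT z. 2 * (b \<bullet> b) * g z) = (LBINT z. q z * gH z b b)" by simp
  show "integrable lborel (%z. q z * gH z b b)"
   by (rule integral_parts(2)[OF open_UNIV Kt(1) subset_UNIV C2_onD(1)[OF q2] C(2)]) (auto simp: g_out)
 qed
 have "2 * real DIM(complex ^ 'n) * (LBINT z. g z) = (\<Sum>b\<in>(Basis :: (complex ^ 'n) set). (LBINT z. 2 * (b \<bullet> b) * g z))"
  by simp
 also have "... = (\<Sum>b\<in>Basis. (LBINT z. q z * gH z b b))" unfolding p(1) ..
 also have "... = (LBINT z. q z * laplacian gH z)"
  unfolding laplacian_def sum_distrib_left by (rule Bochner_Integration.integral_sum[symmetric]) (rule p(2))
 also have "... <= (LBINT z. rho z)"
 proof (rule integral_mono)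
  show "integrable lborel (%z. q z * laplacian gH z)"
   unfolding laplacian_def sum_distrib_left by (rule Bochner_Integration.integrable_sum) (rule p(2))
  show "q z * laplacian gH z <= rho z" for z
  proof (cases "z \<in> Kt")
   case True
   then have "norm (z - y0) <= 1/2" using Kt(2) U(2) by (force simp: dist_norm norm_minus_commute)
   then have "(norm (z - y0))\<^sup>2 <= (1/2)\<^sup>2" by (intro power_mono) auto
   then have "(z - y0) \<bullet> (z - y0) <= 1/4" "(z - y0) \<bullet> (z - y0) >= 0" by (simp_all add: dot_square_norm power2_eq_square)
   then have q: "- q z >= 0" "- q z <= 1" unfolding q_def by linarith+
   have "q z * laplacian gH z = (- q z) * (- laplacian gH z)" by simp
   also have "... <= (- q z) * rho z" using g_laplacian(1)[of z] q by (intro mult_left_mono) auto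
   also have "... <= 1 * rho z" using q rho_props(1) by (intro mult_right_mono) auto
   finally show ?thesis by simp
  qed (simp add: g_laplacian rho_props)
 qed (rule rho_props)
 finally have 1: "2 * real DIM(complex ^ 'n) * (LBINT z. g z) <= (LBINT z. rho z)" .
 have "0 <= (LBINT z. g z)" by (rule Bochner_Integration.integral_nonneg) (rule g_nonneg)
 then have "1 * (LBINT z. g z) <= 2 * real DIM(complex ^ 'n) * (LBINT z. g z)"
  by (intro mult_right_mono) (auto simp: Suc_le_eq intro: order_trans[of 1 "real CARD('n)"])
 with 1 show "(LBINT z. g z) <= (LBINT z. rho z)" by simp
qed

lemma g_continuous: "continuous_on S g"
 by (rule continuous_on_subset[OF C1_onD(1)[OF C2_onD(1)[OF g_C2]]]) simp

lemma g_measurable [measurable]: "g \<in> borel_measurable borel"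
 by (rule borel_measurable_continuous_onI[OF g_continuous])

text \<open>For radii down to exp (1 - L) the factor ln 2 - 2 ln r of \<open>trace_mass\<close> is
  at most 2 L. What remains is a pure power of r.\<close>

lemma rho_mass_scale:
 assumes y: "y \<in> ball y0 (1/2)" and L: "L >= 1" and r: "exp (1 - L) <= r" "r <= 1"
  and M0: "M0 = 4 * real CARD('n) / top_power (std_form :: complex ^ 'n => _) * (16 * L / t) ^ (CARD('n) - 1) * \<mu>"
 shows "(LBINT z. rho z * indicator (cball y r) z) <= M0 * r ^ (2 * CARD('n) - 2)"
proof -
 let ?n = "CARD('n)"
 have S: "top_power (std_form :: complex ^ 'n => _) > 0" by (rule top_power_std_form_pos)
 have r0: "r > 0" using r(1) exp_gt_zero[of "1 - L"] by linarith
 have "ln (exp (1 - L)) <= ln r" by (rule ln_mono) (use r r0 in auto)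
 then have l: "ln 2 - 2 * ln r <= 2 * L" using ln_2_less_1 by simp
 have "ln r <= 0" using r r0 by simp
 then have l0: "ln 2 - 2 * ln r >= 0" using ln_gt_zero[of 2] by linarith
 have "8 * (ln 2 - 2 * ln r) * r\<^sup>2 / t <= 8 * (2 * L) * r\<^sup>2 / t"
  using l t by (intro divide_right_mono mult_right_mono mult_left_mono) auto
 then have "(8 * (ln 2 - 2 * ln r) * r\<^sup>2 / t) ^ (?n - 1) <= (16 * L / t * r\<^sup>2) ^ (?n - 1)"
  using l0 t by (intro power_mono) auto
 also have "... = (16 * L / t) ^ (?n - 1) * r ^ (2 * ?n - 2)"
  by (simp only: power_mult_distrib power_mult[symmetric]) (simp add: right_diff_distrib')
 finally have "4 * real ?n / top_power (std_form :: complex ^ 'n => _) * (8 * (ln 2 - 2 * ln r) * r\<^sup>2 / t) ^ (?n - 1) * \<mu>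
   <= 4 * real ?n / top_power (std_form :: complex ^ 'n => _) * ((16 * L / t) ^ (?n - 1) * r ^ (2 * ?n - 2)) * \<mu>"
  using S \<mu> by (intro mult_right_mono mult_left_mono) auto
 also have "... = M0 * r ^ (2 * ?n - 2)" by (simp add: M0)
 finally show ?thesis using rho_mass[OF y r0 r(2)] by linarith
qed

lemma rho_total:
 assumes y: "y \<in> ball y0 (1/2)" and L: "L >= 1"
  and M0: "M0 = 4 * real CARD('n) / top_power (std_form :: complex ^ 'n => _) * (16 * L / t) ^ (CARD('n) - 1) * \<mu>"
 shows "(LBINT z. rho z) <= M0"
proof -
 have "rho z * indicator (cball y 1) z = rho z" for z
 proof (cases "z \<in> Kt")
  case True
  then have "dist y0 z < 1/2" using Kt U by auto
  moreover have "dist y0 y < 1/2" using y by auto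
  ultimately have "dist y z <= 1" using dist_triangle[of y z y0] by (simp add: dist_commute)
  then show ?thesis by simp
 qed (simp add: rho_def)
 then have "(LBINT z. rho z * indicator (cball y 1) z) = (LBINT z. rho z)" by presburger
 then show ?thesis using rho_mass_scale[OF y L _ order_refl M0] L by simp
qed

text \<open>As the radius shrinks from 1 to exp (1 - L), the kernel mean of \<open>g\<close> grows
  by at most the integral of M0 / (8 r), because the trace mass of a ball is at most M0 r^(2n-2). At
  radius 1 the mean is at most the total mass, hence at most M0.\<close>

lemma mean_le:
 assumes y: "y \<in> ball y0 (1/2)" and L: "L >= 1"
  and M0: "M0 = 4 * real CARD('n) / top_power (std_form :: complex ^ 'n => _) * (16 * L / t) ^ (CARD('n) - 1) * \<mu>"
 shows "(LBINT z. g (y + exp (1 - L) *\<^sub>R z) * bump 3 0 1 z) <= M0 * L"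
proof -
 let ?n = "CARD('n)"
 define r0 where "r0 = exp (1 - L)"
 have r0: "0 < r0" "r0 <= 1" "ln r0 = 1 - L" using L by (auto simp: r0_def)
 have S: "top_power (std_form :: complex ^ 'n => _) > 0" by (rule top_power_std_form_pos)
 have M0n: "M0 >= 0" unfolding M0 using S t L \<mu> by auto
 define A where "A r = (LBINT z. g (y + r *\<^sub>R z) * bump 3 0 1 z)" for r
 define A' where "A' r = r / 8 * (LBINT z. laplacian gH (y + r *\<^sub>R z) * bump 4 0 1 z)" for r
 have d: "(A has_real_derivative A' r) (at r within {0..1})" if "r \<in> {0..1}" for r
  unfolding A_def[abs_def] A'_def by (rule kernel_mean_deriv(1)[OF open_UNIV subset_UNIV g_C2 that])
 have A': "A' r + M0 / 8 * (1 / r) >= 0" if r: "r \<in> {r0..1}" for r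
 proof -
  have rp: "r > 0" "r <= 1" "exp (1 - L) <= r" using r r0(1) unfolding r0_def atLeastAtMost_iff by linarith+
  define I where "I = (LBINT z. rho z * indicator (cball y r) z)"
  have "I = r ^ DIM(complex ^ 'n) * (LBINT z. rho (y + r *\<^sub>R z) * indicator (cball y r) (y + r *\<^sub>R z))"
   unfolding I_def by (rule lborel_integral_affine) (use rp in \<open>auto intro!: borel_measurable_times rho_props(3) borel_measurable_indicator\<close>)
  also have "(%z. indicator (cball y r) (y + r *\<^sub>R z) :: real) = indicator (cball 0 1)"
   using rp by (auto simp: indicator_def fun_eq_iff dist_norm)
  finally have I: "I = r ^ (2 * ?n) * (LBINT z. rho (y + r *\<^sub>R z) * indicator (cball 0 1) z)"
   by (simp add: mult.commute)
  have ir: "integrable lborel (%z. rho (y + r *\<^sub>R z) * indicator (cball 0 1) z)"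
  proof -
   have "integrable lborel (%z. rho (y + r *\<^sub>R z))"
    by (rule lborel_integrable_affine[OF rho_props(2) rp(1)])
   then show ?thesis using integrable_mult_indicator[of "cball 0 1" lborel "%z. rho (y + r *\<^sub>R z)"] by (simp add: mult.commute)
  qed
  have "- (LBINT z. laplacian gH (y + r *\<^sub>R z) * bump 4 0 1 z) = (LBINT z. - (laplacian gH (y + r *\<^sub>R z) * bump 4 0 1 z))"
   by simp
  also have "... <= (LBINT z. rho (y + r *\<^sub>R z) * indicator (cball 0 1) z)"
  proof (rule integral_mono[OF _ ir])
   show "integrable lborel (%z. - (laplacian gH (y + r *\<^sub>R z) * bump 4 0 1 z))"
    using kernel_mean_deriv(3)[OF open_UNIV subset_UNIV g_C2, of r 1 y] rp by auto
   fix z :: "complex ^ 'n"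
   show "- (laplacian gH (y + r *\<^sub>R z) * bump 4 0 1 z) <= rho (y + r *\<^sub>R z) * indicator (cball 0 1) z"
   proof (cases "z \<in> cball 0 1")
    case True
    have "- laplacian gH (y + r *\<^sub>R z) * bump 4 0 1 z <= rho (y + r *\<^sub>R z) * bump 4 0 1 z"
     using g_laplacian(1)[of "y + r *\<^sub>R z"] by (intro mult_right_mono) auto
    also have "... <= rho (y + r *\<^sub>R z) * 1" using bump_le[of 1 4 0 z] rho_props(1) by (intro mult_left_mono) auto
    finally show ?thesis using True by simp
   qed (simp add: bump_outside)
  qed
  also have "... = I / r ^ (2 * ?n)" using I rp by simp
  also have "... <= M0 * r ^ (2 * ?n - 2) / r ^ (2 * ?n)"
   unfolding I_def using rho_mass_scale[OF y L rp(3,2) M0] rp by (intro divide_right_mono) auto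
  also have "r ^ (2 * ?n) = r ^ (2 * ?n - 2) * r\<^sup>2"
   unfolding power_add[symmetric] using zero_less_card_finite[where 'a='n] by (intro arg_cong[where f="power r"]) linarith
  also have "M0 * r ^ (2 * ?n - 2) / (r ^ (2 * ?n - 2) * r\<^sup>2) = M0 / r\<^sup>2" using rp by simp
  finally have "r / 8 * - (LBINT z. laplacian gH (y + r *\<^sub>R z) * bump 4 0 1 z) <= r / 8 * (M0 / r\<^sup>2)"
   using rp by (intro mult_left_mono) auto
  also have "r / 8 * (M0 / r\<^sup>2) = M0 / 8 * (1 / r)" using rp by (simp add: power2_eq_square)
  finally show ?thesis by (simp add: A'_def)
 qed
 have "A r0 + M0 / 8 * ln r0 <= A 1 + M0 / 8 * ln 1"
 proof (rule DERIV_within_nonneg_mono[OF r0(2) _ A'])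
  fix r assume r: "r \<in> {r0..1}"
  have "(A has_real_derivative A' r) (at r within {r0..1})"
   by (rule DERIV_subset[OF d]) (use r r0 in auto)
  then show "((%r. A r + M0 / 8 * ln r) has_real_derivative A' r + M0 / 8 * (1 / r)) (at r within {r0..1})"
   using r r0 by (intro DERIV_add DERIV_cmult DERIV_ln_divide[THEN has_field_derivative_at_within]) auto
 qed
 moreover have "A 1 <= M0"
 proof -
  have ig: "integrable lborel (%z. g (y + z))"
   using lborel_integrable_affine[OF g_integral(1), of 1 y] by simp
  have "A 1 <= (LBINT z. g (y + z))"
   unfolding A_def
  proof (rule integral_mono[OF _ ig])
   show "integrable lborel (%z. g (y + 1 *\<^sub>R z) * bump 3 0 1 z)"
    by (rule kernel_mean_deriv(2)[OF open_UNIV subset_UNIV g_C2, of 1 1]) simp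
   show "g (y + 1 *\<^sub>R z) * bump 3 0 1 z <= g (y + z)" for z
    using mult_left_mono[OF bump_le[of 1 3 0 z] g_nonneg[of "y + z"]] by simp
  qed
  also have "... = (LBINT z. g z)" using lborel_integral_affine[of g 1 y] by simp
  also have "... <= M0" using g_integral(2) rho_total[OF y L M0] by linarith
  finally show ?thesis .
 qed
 ultimately have "A r0 <= M0 + M0 / 8 * (L - 1)" unfolding r0(3) by (simp add: field_simps)
 also have "... <= M0 + M0 * (L - 1)" using M0n L by (intro add_left_mono mult_right_mono) auto
 also have "... = M0 * L" by (simp add: algebra_simps)
 finally show ?thesis by (simp add: A_def r0_def)
qed

text \<open>The Laplacian of \<open>g\<close> has no useful pointwise bound, but the average
  \<open>G\<close> of the translates of \<open>g\<close> over the sublevel set \<open>K\<close> has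
  Laplacian at least -M0. The mean value inequality for \<open>G\<close> at radius exp (1 - L)
  bounds t |K| by |K| times the means of \<open>mean_le\<close>, plus a term of size M0 exp (2 - 2
  L). Under the smallness assumption the first summand is at most half of t |K| and can be
  absorbed.\<close>

lemma decay:
 fixes L :: real
 defines "Z == (LBINT z. bump 3 (0 :: complex ^ 'n) 1 z)"
 assumes L: "L >= 1"
  and small: "8 * real CARD('n) * 16 ^ (CARD('n) - 1) / (top_power (std_form :: complex ^ 'n => _) * Z) * \<mu> * L ^ CARD('n) <= t ^ CARD('n)"
 shows "measure lborel {z\<in>U. u z < s - 3 * t} <= exp (2 - 2 * L) * (LBINT z. bump 4 (0 :: complex ^ 'n) 1 z) / 16"
proof (cases "{z\<in>U. u z < s - 3 * t} = {}")
 case False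
 let ?n = "CARD('n)" and ?S = "top_power (std_form :: complex ^ 'n => _)" and ?r = "exp (1 - L)"
 define K where "K = {z\<in>U. u z < s - 3 * t}"
 define Z4 where "Z4 = (LBINT z. bump 4 (0 :: complex ^ 'n) 1 z)"
 obtain y1 where y1: "y1 \<in> ball y0 (1/2)" using False U by auto
 have S: "?S > 0" by (rule top_power_std_form_pos)
 have Z: "Z > 0" unfolding Z_def by (rule bump_integral_pos) auto
 have Z4: "Z4 > 0" unfolding Z4_def by (rule bump_integral_pos) auto
 define M0 where "M0 = 4 * real CARD('n) / ?S * (16 * L / t) ^ (?n - 1) * \<mu>"
 have M0n: "M0 >= 0" unfolding M0_def using S t L \<mu> by auto
 have "open K"
  unfolding K_def using continuous_open_preimage[OF cont_u U(1), of "{..<s - 3*t}"]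
  by (simp add: vimage_def Int_def conj_commute)
 then have Kb [measurable]: "K \<in> sets borel" by simp
 have KU: "K <= ball y0 (1/2)" using U by (auto simp: K_def)
 have Kf: "emeasure lborel K < \<infinity>"
  by (rule order_le_less_trans[OF emeasure_mono[OF KU]]) (use emeasure_bounded_finite[OF bounded_ball] in auto)
 have iK: "integrable lborel (indicator K :: _ => real)" using Kf by (intro integrable_real_indicator) auto
 \<comment> \<open>On \<open>K\<close> the value s - u exceeds 3 t, and the ramp is at least its
   argument minus 2 t.\<close>
 have gt: "g z >= t" if "z \<in> K" for z
  using that ramp_props(4)[OF t, of "s - u z"] by (auto simp: K_def g_def)
 note GC = C2_onD[OF g_C2]
 define G where "G x = (LBINT y. indicator K y * g (y + x))" for x
 define GD where "GD x v = (LBINT y. indicator K y * gD (y + x) v)" for x v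
 define GH where "GH x a b = (LBINT y. indicator K y * gH (y + x) a b)" for x a b
 have av1: "C1_on UNIV G GD" "integrable lborel (%y. indicator K y * g (y + x))" for x
  unfolding G_def[abs_def] GD_def[abs_def]
  by (rule C1_on_average(1,2)[OF GC(1) Kb Kf g_bounds(1,2)])+
 have av2: "C1_on UNIV (%x. GD x v) (%x a. GH x a v)" "integrable lborel (%y. indicator K y * gH (y + x) a v)" for x a v
  unfolding GD_def[abs_def] GH_def[abs_def]
  by (rule C1_on_average(1,3)[OF GC(2) Kb Kf g_bounds(2,3)])+
 have GC2: "C2_on UNIV G GD GH"
  unfolding C2_on_def using av1(1) av2(1) GC(3) by (auto simp: GH_def)
 \<comment> \<open>Integration over the translates replaces the pointwise values of
   \<open>rho\<close> by its total integral, whatever the position \<open>x\<close>.\<close>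
 have lapG: "laplacian GH x >= - M0" for x
 proof -
  have irho: "integrable lborel (%y. rho (y + x))"
   using lborel_integrable_affine[OF rho_props(2), of 1 x] by (simp add: add.commute)
  have "- laplacian GH x = - (LBINT y. indicator K y * laplacian gH (y + x))"
   unfolding laplacian_def GH_def sum_distrib_left by (subst Bochner_Integration.integral_sum) (auto intro: av2(2))
  also have "... = (LBINT y. - (indicator K y * laplacian gH (y + x)))" by simp
  also have "... <= (LBINT y. rho (y + x))"
  proof (rule integral_mono[OF _ irho])
   show "integrable lborel (%y. - (indicator K y * laplacian gH (y + x)))"
    unfolding laplacian_def sum_distrib_left by (intro integrable_minus Bochner_Integration.integrable_sum av2(2))
   show "- (indicator K y * laplacian gH (y + x)) <= rho (y + x)" for y
    using g_laplacian(1)[of "y + x"] rho_props(1)[of "y + x"] by (auto simp: indicator_def)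
  qed
  also have "... = (LBINT y. rho y)"
   using lborel_integral_affine[OF rho_props(3), of 1 x] by (simp add: add.commute)
  also have "... <= M0" by (rule rho_total[OF y1 L M0_def])
  finally show ?thesis by simp
 qed
 have km: "G 0 * Z <= (LBINT z. G (0 + ?r *\<^sub>R z) * bump 3 0 1 z) + M0 * ?r\<^sup>2 / 16 * Z4"
  unfolding Z_def Z4_def by (rule kernel_mean_ge[OF open_UNIV subset_UNIV _ GC2 lapG]) simp
 have G0: "t * measure lborel K <= G 0"
 proof -
  have "t * measure lborel K = (LBINT y. t * indicator K y)" by simp
  also have "... <= G 0" unfolding G_def
  proof (rule integral_mono[OF _ av1(2)])
   show "integrable lborel (%y. t * indicator K y)" by (rule integrable_mult_right[OF iK])
   show "t * indicator K y <= indicator K y * g (y + 0)" for y using gt[of y] by (cases "y \<in> K") auto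
  qed
  finally show ?thesis .
 qed
 \<comment> \<open>By Fubini the mean of \<open>G\<close> is an integral over y in \<open>K\<close>
   of kernel means of \<open>g\<close> at y, to which \<open>mean_le\<close> applies.\<close>
 have fub: "(LBINT z. G (0 + ?r *\<^sub>R z) * bump 3 0 1 z) <= M0 * L * measure lborel K"
 proof -
  have iG: "integrable lborel (%z. G (0 + ?r *\<^sub>R z) * bump 3 0 1 z)"
   by (rule kernel_mean_deriv(2)[OF open_UNIV subset_UNIV GC2, of "?r" "?r"]) simp
  have Gn: "G x >= 0" for x unfolding G_def by (rule Bochner_Integration.integral_nonneg) (simp add: g_nonneg)
  have "ennreal (LBINT z. G (0 + ?r *\<^sub>R z) * bump 3 0 1 z) = (\<integral>\<^sup>+z. ennreal (G (0 + ?r *\<^sub>R z) * bump 3 0 1 z) \<partial>lborel)"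
   by (rule nn_integral_eq_integral[OF iG, symmetric]) (simp add: Gn)
  also have "... = (\<integral>\<^sup>+z. (\<integral>\<^sup>+y. ennreal (indicator K y * g (y + ?r *\<^sub>R z) * bump 3 0 1 z) \<partial>lborel) \<partial>lborel)"
  proof (rule nn_integral_cong)
   fix z :: "complex ^ 'n"
   have "G (0 + ?r *\<^sub>R z) * bump 3 0 1 z = (LBINT y. indicator K y * g (y + ?r *\<^sub>R z) * bump 3 0 1 z)"
    unfolding G_def by simp
   moreover have "(\<integral>\<^sup>+y. ennreal (indicator K y * g (y + ?r *\<^sub>R z) * bump 3 0 1 z) \<partial>lborel) = ennreal (LBINT y. indicator K y * g (y + ?r *\<^sub>R z) * bump 3 0 1 z)"
    by (rule nn_integral_eq_integral[OF integrable_mult_left[OF av1(2)]]) (simp add: g_nonneg)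
   ultimately show "ennreal (G (0 + ?r *\<^sub>R z) * bump 3 0 1 z) = (\<integral>\<^sup>+y. ennreal (indicator K y * g (y + ?r *\<^sub>R z) * bump 3 0 1 z) \<partial>lborel)"
    by presburger
  qed
  also have "... = (\<integral>\<^sup>+y. (\<integral>\<^sup>+z. ennreal (indicator K y * g (y + ?r *\<^sub>R z) * bump 3 0 1 z) \<partial>lborel) \<partial>lborel)"
   by (rule lborel_pair.Fubini') measurable
  also have "... <= (\<integral>\<^sup>+y. ennreal (M0 * L) * indicator K y \<partial>lborel)"
  proof (rule nn_integral_mono)
   fix y :: "complex ^ 'n"
   show "(\<integral>\<^sup>+z. ennreal (indicator K y * g (y + ?r *\<^sub>R z) * bump 3 0 1 z) \<partial>lborel) <= ennreal (M0 * L) * indicator K y"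
   proof (cases "y \<in> K")
    case True
    have "(\<integral>\<^sup>+z. ennreal (g (y + ?r *\<^sub>R z) * bump 3 0 1 z) \<partial>lborel) = ennreal (LBINT z. g (y + ?r *\<^sub>R z) * bump 3 0 1 z)"
     by (rule nn_integral_eq_integral[OF kernel_mean_deriv(2)[OF open_UNIV subset_UNIV g_C2, of "?r" "?r"]]) (auto simp: g_nonneg)
    also have "... <= ennreal (M0 * L)" using mean_le[OF _ L M0_def, of y] True KU by (intro ennreal_leI) auto
    finally show ?thesis using True by simp
   qed simp
  qed
  also have "... = ennreal (M0 * L) * emeasure lborel K" by (rule nn_integral_cmult_indicator) simp
  also have "... = ennreal (M0 * L * measure lborel K)"
   using Kf M0n L by (subst emeasure_eq_ennreal_measure) (auto simp: ennreal_mult[symmetric] top.not_eq_extremum)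
  finally show ?thesis using M0n L by (subst (asm) ennreal_le_iff) auto
 qed
 \<comment> \<open>M0 is proportional to (L / t)^(n-1), so this is the hypothesis
   \<open>small\<close> divided by t^(n-1).\<close>
 have M0L: "M0 * L <= t * Z / 2"
 proof -
  have n: "t ^ ?n = t * t ^ (?n - 1)" "L ^ ?n = L * L ^ (?n - 1)"
   using zero_less_card_finite[where 'a='n] by (auto simp: power_eq_if)
  have "M0 * L = (8 * real ?n * 16 ^ (?n - 1) / (?S * Z) * \<mu> * L ^ ?n) * Z / 2 / t ^ (?n - 1)"
   using S Z t by (simp add: M0_def n power_divide power_mult_distrib field_simps)
  also have "... <= t ^ ?n * Z / 2 / t ^ (?n - 1)"
   using small Z t by (intro divide_right_mono mult_right_mono) auto
  also have "... = t * Z / 2" using t by (simp add: n)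
  finally show ?thesis .
 qed
 have "t * measure lborel K * Z <= G 0 * Z" using G0 Z by (intro mult_right_mono) auto
 also have "... <= M0 * L * measure lborel K + M0 * ?r\<^sup>2 / 16 * Z4" using km fub by linarith
 also have "M0 * L * measure lborel K <= t * Z / 2 * measure lborel K" using M0L by (intro mult_right_mono) auto
 finally have 1: "t * Z / 2 * measure lborel K <= M0 * ?r\<^sup>2 / 16 * Z4" by (simp add: field_simps)
 have "M0 * 1 <= M0 * L" using M0n L by (intro mult_left_mono) auto
 then have "M0 * (?r\<^sup>2 / 16 * Z4) <= t * Z / 2 * (?r\<^sup>2 / 16 * Z4)" using M0L Z4 by (intro mult_right_mono) auto
 with 1 have "(t * Z / 2) * measure lborel K <= (t * Z / 2) * (?r\<^sup>2 / 16 * Z4)" by (simp add: ac_simps)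
 then have "measure lborel K <= ?r\<^sup>2 / 16 * Z4" using t Z by (subst (asm) mult_le_cancel_left_pos) auto
 moreover have "?r\<^sup>2 = exp (2 - 2 * L)" by (simp add: exp_double[symmetric] right_diff_distrib')
 ultimately show ?thesis by (simp add: K_def Z4_def)
next
 case True
 have "(LBINT z. bump 4 (0 :: complex ^ 'n) 1 z) > 0" by (rule bump_integral_pos) auto
 then show ?thesis unfolding True by simp
qed

end

end

section \<open>The volume measure of a compact Kaehler manifold\<close>

locale kaehler =
 fixes A :: "('m::t2_space, 'n::finite) chart set" and omg :: "('m, 'n) two_form"
 assumes ck: "compact_kaehler_manifold A omg"
begin

lemma compact_M: "compact (UNIV :: 'm set)" and connected_M: "connected (UNIV :: 'm set)"
 using ck unfolding compact_kaehler_manifold_def by blast+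

lemma cover: "(\<Union>c\<in>A. dom_chart c) = UNIV"
 using ck unfolding compact_kaehler_manifold_def complex_atlas_def by blast

lemma chart_exists: obtains c where "c \<in> A" "x \<in> dom_chart c"
 using cover by blast

context
 fixes c :: "('m, 'n) chart"
 assumes c: "c \<in> A"
begin

lemma open_dom: "open (dom_chart c)" and open_img: "open (img_chart c)"
 using c ck unfolding compact_kaehler_manifold_def complex_atlas_def by blast+

lemma homeo: "homeomorphism (dom_chart c) (img_chart c) (coord c) (inv_coord c)"
 using c ck unfolding compact_kaehler_manifold_def complex_atlas_def by blast

lemma inv_coord_coord: "x \<in> dom_chart c ==> inv_coord c (coord c x) = x"
 and coord_inv_coord: "y \<in> img_chart c ==> coord c (inv_coord c y) = y"
 and inv_coord_dom: "y \<in> img_chart c ==> inv_coord c y \<in> dom_chart c"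
 and continuous_coord: "continuous_on (dom_chart c) (coord c)"
 and continuous_inv_coord: "continuous_on (img_chart c) (inv_coord c)"
 using homeo unfolding homeomorphism_def by auto

lemma coord_image: "coord c ` (B Int dom_chart c) = inv_coord c -` B Int img_chart c"
 using inv_coord_coord coord_inv_coord inv_coord_dom by (force simp: image_iff)

lemma open_coord_image: "open B ==> open (coord c ` (B Int dom_chart c))"
 unfolding coord_image using continuous_open_preimage[OF continuous_inv_coord open_img, of B] by (simp add: Int_commute)

lemma open_inv_image: "open S ==> S <= img_chart c ==> open (inv_coord c ` S)"
proof -
 assume S: "open S" "S <= img_chart c"
 have "inv_coord c ` S = dom_chart c Int coord c -` S"
  using S(2) inv_coord_coord coord_inv_coord inv_coord_dom by (force simp: image_iff)
 then show ?thesis using continuous_open_preimage[OF continuous_coord open_dom S(1)] by simp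
qed

lemma borel_coord_image: "B \<in> sets borel ==> coord c ` (B Int dom_chart c) \<in> sets borel"
proof -
 assume B: "B \<in> sets borel"
 have "inv_coord c \<in> measurable (restrict_space borel (img_chart c)) borel"
  by (rule borel_measurable_continuous_on_restrict[OF continuous_inv_coord])
 from measurable_sets[OF this B] show ?thesis
  using open_img unfolding coord_image by (auto simp: sets_restrict_space_iff space_restrict_space)
qed

lemma form_pos: "x \<in> dom_chart c ==> pos_form (omg c x)"
proof -
 assume x: "x \<in> dom_chart c"
 have 1: "bilinear (omg c x)" "!!u. omg c x u u = 0" "!!u v. omg c x (J u) (J v) = omg c x u v" "!!u. u ~= 0 ==> omg c x u (J u) > 0"
  using ck c x unfolding compact_kaehler_manifold_def smooth_two_form_def type_1_1_def positive_form_def by blast+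
 have "omg c x u v = - omg c x v u" for u v
 proof -
  have "omg c x (u + v) (u + v) = omg c x u u + omg c x u v + (omg c x v u + omg c x v v)"
   unfolding bilinear_ladd[OF 1(1)] bilinear_radd[OF 1(1)] by linarith
  then show ?thesis unfolding 1(2) by linarith
 qed
 then show ?thesis unfolding pos_form_def herm_form_def using 1 by blast
qed

lemma form_smooth: "smooth_on (%y. omg c (inv_coord c y) u v) (img_chart c)"
 using ck c unfolding compact_kaehler_manifold_def smooth_two_form_def by blast

lemma form_continuous: "continuous_on (img_chart c) (%y. omg c (inv_coord c y) u v)"
proof -
 have "Ck_on 0 (%y. omg c (inv_coord c y) u v) (img_chart c)" using form_smooth unfolding smooth_on_def by blast
 then show ?thesis by simp
qed

text \<open>The value 0 outside the image makes this a Borel function on the whole of C^n.\<close>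

definition vol_density :: "complex ^ 'n => real" where
 "vol_density y = (if y \<in> img_chart c then top_power (omg c (inv_coord c y)) else 0)"

lemma vol_density_pos: "y \<in> img_chart c ==> vol_density y > 0"
 using top_power_pos[OF form_pos[OF inv_coord_dom]] by (simp add: vol_density_def)

lemma vol_density_nonneg: "vol_density y >= 0"
 using vol_density_pos[of y] by (cases "y \<in> img_chart c") (auto simp: vol_density_def)

lemma vol_density_continuous: "continuous_on (img_chart c) vol_density"
proof -
 have "continuous_on (img_chart c) (%y. top_power (omg c (inv_coord c y)))"
  unfolding top_power_def by (intro continuous_intros form_continuous) auto
 then show ?thesis by (rule continuous_on_eq) (simp add: vol_density_def)
qed

lemma vol_density_measurable [measurable]: "vol_density \<in> borel_measurable borel"
proof -
 have "(%y. indicator (img_chart c) y *\<^sub>R vol_density y) \<in> borel_measurable borel"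
  by (rule borel_measurable_continuous_on_indicator[OF _ vol_density_continuous]) (use open_img in auto)
 also have "(%y. indicator (img_chart c) y *\<^sub>R vol_density y) = vol_density"
  by (auto simp: vol_density_def indicator_def)
 finally show ?thesis .
qed

text \<open>A total Borel map; it takes the arbitrary value only where \<open>vol_density\<close> is
  zero.\<close>

definition extend_inv :: "complex ^ 'n => 'm" where
 "extend_inv y = (if y \<in> img_chart c then inv_coord c y else undefined)"

lemma extend_inv_measurable [measurable]: "extend_inv \<in> measurable borel borel"
proof (rule measurableI)
 fix B :: "'m set" assume B: "B \<in> sets borel"
 have "extend_inv -` B Int space borel = coord c ` (B Int dom_chart c) Un (if undefined \<in> B then - img_chart c else {})"
  unfolding coord_image by (auto simp: extend_inv_def split: if_splits)
 then show "extend_inv -` B Int space borel \<in> sets borel" using borel_coord_image[OF B] open_img by auto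
qed simp

definition chart_measure :: "'m measure" where
 "chart_measure = distr (density lborel (%y. ennreal (vol_density y))) borel extend_inv"

lemma emeasure_chart_measure:
 assumes B [measurable]: "B \<in> sets borel"
 shows "emeasure chart_measure B = (\<integral>\<^sup>+y. ennreal (vol_density y * indicator (coord c ` (B Int dom_chart c)) y) \<partial>lborel)"
proof -
 have "emeasure chart_measure B = (\<integral>\<^sup>+y. ennreal (vol_density y) * indicator (extend_inv -` B) y \<partial>lborel)"
  using B measurable_sets[OF extend_inv_measurable B] unfolding chart_measure_def by (simp add: emeasure_distr emeasure_density)
 also have "... = (\<integral>\<^sup>+y. ennreal (vol_density y * indicator (coord c ` (B Int dom_chart c)) y) \<partial>lborel)"
  unfolding coord_image by (intro nn_integral_cong) (auto simp: indicator_def extend_inv_def vol_density_def)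
 finally show ?thesis .
qed

lemma nn_integral_chart_measure:
 assumes [measurable]: "h \<in> borel_measurable borel"
 shows "(\<integral>\<^sup>+x. h x \<partial>chart_measure) = (\<integral>\<^sup>+y. ennreal (vol_density y) * h (inv_coord c y) \<partial>lborel)"
proof -
 have "(\<integral>\<^sup>+x. h x \<partial>chart_measure) = (\<integral>\<^sup>+y. ennreal (vol_density y) * h (extend_inv y) \<partial>lborel)"
  unfolding chart_measure_def by (simp add: nn_integral_distr nn_integral_density)
 also have "... = (\<integral>\<^sup>+y. ennreal (vol_density y) * h (inv_coord c y) \<partial>lborel)"
  by (intro nn_integral_cong) (auto simp: extend_inv_def vol_density_def)
 finally show ?thesis .
qed

lemma sets_chart_measure [simp]: "sets chart_measure = sets borel"
 by (simp add: chart_measure_def)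

end

lemma transition_deriv:
 assumes c: "c \<in> A" and d: "d \<in> A" and y: "y \<in> coord c ` (dom_chart c Int dom_chart d)"
 shows "(transition c d has_derivative frechet_derivative (transition c d) (at y)) (at y)"
  "frechet_derivative (transition c d) (at y) (a *s v) = a *s frechet_derivative (transition c d) (at y) v"
  "omg c (inv_coord c y) = (%u v. omg d (inv_coord d (transition c d y)) (frechet_derivative (transition c d) (at y) u) (frechet_derivative (transition c d) (at y) v))"
proof -
 have "holomorphic_map_on (transition c d) (coord c ` (dom_chart c Int dom_chart d))"
  using ck c d unfolding compact_kaehler_manifold_def complex_atlas_def by blast
 then obtain D where D: "(transition c d has_derivative D) (at y)" "!!a v. D (a *s v) = a *s D v"
  unfolding holomorphic_map_on_def using y by blast
 have e: "frechet_derivative (transition c d) (at y) = D" using frechet_derivative_at[OF D(1)] by simp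
 show "(transition c d has_derivative frechet_derivative (transition c d) (at y)) (at y)" using D(1) e by simp
 show "frechet_derivative (transition c d) (at y) (a *s v) = a *s frechet_derivative (transition c d) (at y) v" using D(2) e by simp
 obtain x where x: "x \<in> dom_chart c" "x \<in> dom_chart d" "y = coord c x" using y by (elim imageE) blast
 have xi: "inv_coord c y = x" "inv_coord d (transition c d y) = x"
  using x inv_coord_coord[OF c] inv_coord_coord[OF d] by (simp_all add: transition_def)
 show "omg c (inv_coord c y) = (%u v. omg d (inv_coord d (transition c d y)) (frechet_derivative (transition c d) (at y) u) (frechet_derivative (transition c d) (at y) v))"
 proof -
  have st: "\<forall>c\<in>A. \<forall>d\<in>A. \<forall>x \<in> dom_chart c Int dom_chart d. \<forall>u v. omg c x u v =
    omg d x (frechet_derivative (transition c d) (at (coord c x)) u) (frechet_derivative (transition c d) (at (coord c x)) v)"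
   using ck unfolding compact_kaehler_manifold_def smooth_two_form_def by blast
  have "omg c x u v = omg d x (frechet_derivative (transition c d) (at y) u) (frechet_derivative (transition c d) (at y) v)" for u v
   unfolding x(3) using st[rule_format, OF c d, of x u v] x(1,2) by blast
  then show ?thesis unfolding xi by (intro ext)
 qed
qed

text \<open>The transition map pulls one form back to the other, so the densities differ by its real
  determinant, and the change of variables theorem applies.\<close>

lemma chart_measure_eq:
 assumes c: "c \<in> A" and d: "d \<in> A" and B: "B \<in> sets borel" "B <= dom_chart c" "B <= dom_chart d"
 shows "emeasure (chart_measure c) B = emeasure (chart_measure d) B"
proof -
 let ?S = "coord c ` (B Int dom_chart c)"
 define D where "D y = frechet_derivative (transition c d) (at y)" for y
 have im: "transition c d ` ?S = coord d ` (B Int dom_chart d)"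
 proof -
  have "transition c d ` ?S = (%x. coord d (inv_coord c (coord c x))) ` (B Int dom_chart c)" by (simp add: transition_def image_image)
  also have "... = coord d ` (B Int dom_chart c)" by (intro image_cong) (simp_all add: inv_coord_coord[OF c])
  also have "coord d ` (B Int dom_chart c) = coord d ` (B Int dom_chart d)"
   using B by (intro arg_cong[where f="%X. coord d ` X"]) blast
  finally show ?thesis .
 qed
 have sub: "?S <= coord c ` (dom_chart c Int dom_chart d)" using B by blast
 have inj: "inj_on (transition c d) ?S"
 proof (rule inj_onI)
  fix y y' assume "y \<in> ?S" "y' \<in> ?S" and e: "transition c d y = transition c d y'"
  then obtain x x' where x: "x \<in> B" "x' \<in> B" "y = coord c x" "y' = coord c x'" by (elim imageE) blast
  have xd: "x \<in> dom_chart c" "x' \<in> dom_chart c" "x \<in> dom_chart d" "x' \<in> dom_chart d" using x B by blast+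
  have "coord d x = coord d x'" using e inv_coord_coord[OF c xd(1)] inv_coord_coord[OF c xd(2)] by (simp add: transition_def x(3,4))
  then have "x = x'" using inv_coord_coord[OF d xd(3)] inv_coord_coord[OF d xd(4)] by metis
  then show "y = y'" using x by simp
 qed
 have "(\<integral>\<^sup>+y. ennreal (vol_density d y * indicator (transition c d ` ?S) y) \<partial>lborel) = (\<integral>\<^sup>+y. ennreal (vol_density c y * indicator ?S y) \<partial>lborel)"
 proof (rule nn_integral_change_of_variables[where g'=D])
  show "?S \<in> sets borel" by (rule borel_coord_image[OF c B(1)])
  show "transition c d ` ?S \<in> sets borel" unfolding im by (rule borel_coord_image[OF d B(1)])
  fix y assume y: "y \<in> ?S"
  note T = transition_deriv[OF c d subsetD[OF sub y]]
  show "(transition c d has_derivative D y) (at y)" unfolding D_def by (rule T(1))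
  have yc: "y \<in> img_chart c" using y by blast
  have yd: "transition c d y \<in> img_chart d" using y im by blast
  have "vol_density c y = det_frame (D y) * vol_density d (transition c d y)"
   using yc yd top_power_linear_image[OF herm_formD(1)[OF pos_form_herm[OF form_pos[OF d inv_coord_dom[OF d yd]]]], of "D y"]
   by (simp add: vol_density_def[OF c] vol_density_def[OF d] T(3) D_def)
  \<comment> \<open>Both densities are positive, so the determinant relating them is positive and
    equals its absolute value.\<close>
  moreover have "det_frame (D y) > 0"
   by (rule zero_less_mult_pos2[OF _ vol_density_pos[OF d yd]]) (use calculation vol_density_pos[OF c yc] in simp)
  ultimately show "vol_density c y = \<bar>det_frame (D y)\<bar> * vol_density d (transition c d y)" by simp
 qed (rule inj vol_density_measurable[OF c] vol_density_measurable[OF d] vol_density_nonneg[OF c] vol_density_nonneg[OF d])+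
 then show ?thesis unfolding emeasure_chart_measure[OF c B(1)] emeasure_chart_measure[OF d B(1)] im by simp
qed

text \<open>A finite cover by charts, encoded as an enumeration and its length; the order is used to
  cut the manifold into disjoint Borel pieces, each inside one chart.\<close>

definition partition_charts :: "(nat => ('m, 'n) chart) \<times> nat => bool" where
 "partition_charts e \<longleftrightarrow> (\<forall>i<snd e. fst e i \<in> A) & (\<Union>i<snd e. dom_chart (fst e i)) = UNIV"

lemma partition_charts_exists: "\<exists>e. partition_charts e"
proof -
 obtain C where C: "C <= A" "finite C" "UNIV <= (\<Union>c\<in>C. dom_chart c)"
  by (rule compactE_image[OF compact_M, of A dom_chart]) (use open_dom cover in auto)
 obtain f :: "nat => ('m, 'n) chart" where f: "f ` {..<card C} = C"
  using ex_bij_betw_nat_finite[OF C(2)] by (auto simp: bij_betw_def atLeast0LessThan)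
 have "partition_charts (f, card C)"
  unfolding partition_charts_def fst_conv snd_conv
 proof (intro conjI allI impI)
  show "f i \<in> A" if "i < card C" for i using f C that by blast
  have "(\<Union>i<card C. dom_chart (f i)) = (\<Union>c\<in>f ` {..<card C}. dom_chart c)" by blast
  then show "(\<Union>i<card C. dom_chart (f i)) = UNIV" using f C by auto
 qed
 then show ?thesis by blast
qed

definition "ecover = (SOME e. partition_charts e)"
definition "ch = fst ecover"
definition "N = snd ecover"
definition "piece i = dom_chart (ch i) - (\<Union>j<i. dom_chart (ch j))"

lemma ch: "i < N ==> ch i \<in> A" and ch_cover: "(\<Union>i<N. dom_chart (ch i)) = UNIV"
proof -
 have "partition_charts ecover" unfolding ecover_def by (rule someI_ex[OF partition_charts_exists])
 then show "i < N ==> ch i \<in> A" "(\<Union>i<N. dom_chart (ch i)) = UNIV"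
  unfolding partition_charts_def ch_def N_def by blast+
qed

lemma piece_dom: "piece i <= dom_chart (ch i)"
 by (auto simp: piece_def)

lemma piece_borel: "i < N ==> piece i \<in> sets borel"
 unfolding piece_def using open_dom[OF ch] by (intro sets.Diff sets.finite_UN) auto

lemma piece_disjoint: "disjoint_family_on piece {..<N}"
 unfolding disjoint_family_on_def
proof (intro ballI impI)
 fix i j :: nat assume "i ~= j"
 then consider "i < j" | "j < i" by linarith
 then show "piece i Int piece j = {}" by cases (auto simp: piece_def)
qed

lemma piece_cover: "(\<Union>i<N. piece i) = UNIV"
proof -
 have "x \<in> (\<Union>i<N. piece i)" for x
 proof -
  define i where "i = (LEAST i. x \<in> dom_chart (ch i))"
  obtain k where k: "k < N" "x \<in> dom_chart (ch k)" using ch_cover by blast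
  have "x \<in> dom_chart (ch i)" "i <= k" "!!j. j < i ==> x ~: dom_chart (ch j)"
   unfolding i_def using k(2) by (auto intro: LeastI Least_le dest: not_less_Least)
  then show ?thesis using k by (auto simp: piece_def)
 qed
 then show ?thesis by blast
qed

lemma emeasure_pieces:
 assumes "sets M = sets borel" "B \<in> sets borel"
 shows "(\<Sum>i<N. emeasure M (B Int piece i)) = emeasure M B"
proof -
 have "(\<Sum>i<N. emeasure M (B Int piece i)) = emeasure M (\<Union>i<N. B Int piece i)"
 proof (rule sum_emeasure)
  show "(%i. B Int piece i) ` {..<N} <= sets M" using assms piece_borel by auto
  show "disjoint_family_on (%i. B Int piece i) {..<N}" using piece_disjoint unfolding disjoint_family_on_def by blast
 qed simp
 also have "(\<Union>i<N. B Int piece i) = B" using piece_cover by blast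
 finally show ?thesis .
qed

definition is_volume :: "'m measure => bool" where
 "is_volume \<mu> \<longleftrightarrow> sets \<mu> = sets borel &
    (\<forall>c\<in>A. \<forall>B\<in>sets borel. B <= dom_chart c -->
     emeasure \<mu> B = (\<integral>\<^sup>+y\<in>coord c ` B. ennreal (top_power (omg c (inv_coord c y))) \<partial>lborel))"

lemma chart_measure_spec:
 assumes "c \<in> A" "B \<in> sets borel" "B <= dom_chart c"
 shows "(\<integral>\<^sup>+y\<in>coord c ` B. ennreal (top_power (omg c (inv_coord c y))) \<partial>lborel) = emeasure (chart_measure c) B"
proof -
 have "B Int dom_chart c = B" using assms by blast
 then show ?thesis
  unfolding emeasure_chart_measure[OF assms(1,2)]
  using assms(3) by (intro nn_integral_cong) (auto simp: indicator_def vol_density_def[OF assms(1)])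
qed

text \<open>The measure is the sum of the chart measures over the pieces. That it has the right
  density in every chart, not only in those of the cover, follows from
  \<open>chart_measure_eq\<close>.\<close>

lemma volume_exists: "\<exists>\<mu>. is_volume \<mu>"
proof -
 define m where "m B = (\<Sum>i<N. emeasure (chart_measure (ch i)) (B Int piece i))" for B
 define \<mu> where "\<mu> = measure_of UNIV (sets (borel :: 'm measure)) m"
 have em: "emeasure \<mu> B = m B" if "B \<in> sets borel" for B
  unfolding \<mu>_def
 proof (rule emeasure_measure_of_sigma)
  show "sigma_algebra UNIV (sets (borel :: 'm measure))" using sets.sigma_algebra_axioms[of "borel :: 'm measure"] by simp
  show "positive (sets borel) m" by (simp add: positive_def m_def)
  show "countably_additive (sets borel) m"
   unfolding countably_additive_def
  proof (intro allI impI)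
   fix F :: "nat => 'm set" assume F: "range F <= sets borel" "disjoint_family F"
   have "(\<Sum>k. m (F k)) = (\<Sum>i<N. \<Sum>k. emeasure (chart_measure (ch i)) (F k Int piece i))"
    unfolding m_def by (rule suminf_sum) auto
   also have "... = (\<Sum>i<N. emeasure (chart_measure (ch i)) (\<Union>k. F k Int piece i))"
   proof (rule sum.cong[OF refl])
    fix i assume "i \<in> {..<N}"
    then show "(\<Sum>k. emeasure (chart_measure (ch i)) (F k Int piece i)) = emeasure (chart_measure (ch i)) (\<Union>k. F k Int piece i)"
     using F piece_borel by (intro suminf_emeasure) (auto simp: sets_chart_measure[OF ch] disjoint_family_on_def)
   qed
   also have "... = m (\<Union>k. F k)" by (simp add: m_def)
   finally show "(\<Sum>k. m (F k)) = m (\<Union>k. F k)" .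
  qed
 qed (use that in auto)
 have s: "sets \<mu> = sets borel" unfolding \<mu>_def using sets.sigma_sets_eq[of "borel :: 'm measure"] by (subst sets_measure_of) auto
 have "emeasure \<mu> B = emeasure (chart_measure c) B" if c: "c \<in> A" and B: "B \<in> sets borel" "B <= dom_chart c" for c B
 proof -
  have "emeasure \<mu> B = (\<Sum>i<N. emeasure (chart_measure c) (B Int piece i))"
   unfolding em[OF B(1)] m_def
  proof (rule sum.cong[OF refl])
   fix i assume i: "i \<in> {..<N}"
   show "emeasure (chart_measure (ch i)) (B Int piece i) = emeasure (chart_measure c) (B Int piece i)"
    using i by (intro chart_measure_eq ch c) (use B piece_borel[of i] piece_dom[of i] in auto)
  qed
  also have "... = emeasure (chart_measure c) B" by (rule emeasure_pieces[OF sets_chart_measure[OF c] B(1)])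
  finally show ?thesis .
 qed
 then have "is_volume \<mu>" unfolding is_volume_def using s chart_measure_spec by auto
 then show ?thesis by blast
qed

lemma is_volumeD:
 assumes v: "is_volume \<mu>" and c: "c \<in> A" and B: "B \<in> sets borel" "B <= dom_chart c"
 shows "emeasure \<mu> B = emeasure (chart_measure c) B"
proof -
 have "emeasure \<mu> B = (\<integral>\<^sup>+y\<in>coord c ` B. ennreal (top_power (omg c (inv_coord c y))) \<partial>lborel)"
  using v c B unfolding is_volume_def by blast
 also have "... = emeasure (chart_measure c) B" by (rule chart_measure_spec[OF c B])
 finally show ?thesis .
qed

lemma volume_unique: "is_volume \<mu> ==> is_volume \<nu> ==> \<mu> = \<nu>"
proof (rule measure_eqI)
 assume v: "is_volume \<mu>" "is_volume \<nu>"
 then have s: "sets \<mu> = sets borel" "sets \<nu> = sets borel" unfolding is_volume_def by auto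
 then show "sets \<mu> = sets \<nu>" by simp
 fix B assume "B \<in> sets \<mu>"
 then have B: "B \<in> sets borel" using s by simp
 have "emeasure \<mu> (B Int piece i) = emeasure \<nu> (B Int piece i)" if i: "i < N" for i
 proof -
  have b: "B Int piece i \<in> sets borel" "B Int piece i <= dom_chart (ch i)" using B piece_borel[OF i] piece_dom[of i] by auto
  show ?thesis using is_volumeD[OF v(1) ch[OF i] b] is_volumeD[OF v(2) ch[OF i] b] by (rule trans[OF _ sym])
 qed
 then show "emeasure \<mu> B = emeasure \<nu> B"
  unfolding emeasure_pieces[OF s(1) B, symmetric] emeasure_pieces[OF s(2) B, symmetric] by (intro sum.cong) auto
qed

definition vol :: "'m measure" where "vol = volume_measure A omg"

lemma is_volume_vol: "is_volume vol"
proof -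
 obtain \<mu> where "is_volume \<mu>" using volume_exists by blast
 then have "(THE \<mu>. is_volume \<mu>) = \<mu>" using volume_unique by blast
 moreover have "volume_measure A omg = (THE \<mu>. is_volume \<mu>)" unfolding volume_measure_def is_volume_def ..
 ultimately show ?thesis using \<open>is_volume \<mu>\<close> by (simp add: vol_def)
qed

lemma sets_vol [simp, measurable_cong]: "sets vol = sets borel"
 using is_volume_vol by (simp add: is_volume_def)

lemma space_vol [simp]: "space vol = UNIV"
 using sets_eq_imp_space_eq[OF sets_vol] by simp

lemma emeasure_vol: "c \<in> A ==> B \<in> sets borel ==> B <= dom_chart c ==> emeasure vol B = emeasure (chart_measure c) B"
 by (rule is_volumeD[OF is_volume_vol])

lemma nn_integral_vol:
 assumes c: "c \<in> A" and h: "h \<in> borel_measurable borel" "!!x. x ~: dom_chart c ==> h x = 0"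
 shows "(\<integral>\<^sup>+x. h x \<partial>vol) = (\<integral>\<^sup>+y. ennreal (vol_density c y) * h (inv_coord c y) \<partial>lborel)"
proof -
 have [measurable]: "dom_chart c \<in> sets borel" using open_dom[OF c] by simp
 have "chart_measure c = density vol (indicator (dom_chart c))"
 proof (rule measure_eqI)
  fix B assume "B \<in> sets (chart_measure c)"
  then have B [measurable]: "B \<in> sets borel" using sets_chart_measure[OF c] by simp
  have "emeasure (density vol (indicator (dom_chart c))) B = emeasure vol (dom_chart c Int B)"
   by (subst emeasure_density) (auto simp: indicator_inter_arith[symmetric])
  also have "... = emeasure (chart_measure c) (dom_chart c Int B)" by (rule emeasure_vol[OF c]) auto
  also have "... = emeasure (chart_measure c) B"
   by (simp add: emeasure_chart_measure[OF c] Int_ac)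
  finally show "emeasure (chart_measure c) B = emeasure (density vol (indicator (dom_chart c))) B" by simp
 qed (simp add: sets_chart_measure[OF c])
 then have "(\<integral>\<^sup>+x. h x \<partial>chart_measure c) = (\<integral>\<^sup>+x. indicator (dom_chart c) x * h x \<partial>vol)"
  using h by (simp add: nn_integral_density)
 also have "... = (\<integral>\<^sup>+x. h x \<partial>vol)" using h(2) by (intro nn_integral_cong) (auto simp: indicator_def)
 finally show ?thesis using nn_integral_chart_measure[OF c h(1)] by simp
qed

lemma compact_bounds:
 assumes c: "c \<in> A" and K: "compact K" "K <= img_chart c"
 obtains m M where "0 < m" "m <= M" "!!y. y \<in> K ==> m <= vol_density c y" "!!y. y \<in> K ==> vol_density c y <= M"
proof (cases "K = {}")
 case False
 note cont = continuous_on_subset[OF vol_density_continuous[OF c] K(2)]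
 obtain a b where ab: "a \<in> K" "!!y. y \<in> K ==> vol_density c a <= vol_density c y"
  "b \<in> K" "!!y. y \<in> K ==> vol_density c y <= vol_density c b"
  using continuous_attains_inf[OF K(1) False cont] continuous_attains_sup[OF K(1) False cont] by blast
 show ?thesis by (rule that[of "vol_density c a" "vol_density c b"]) (use ab K(2) vol_density_pos[OF c] in auto)
qed (rule that[of 1 1], auto)

lemma chart_ball:
 fixes x :: 'm
 obtains c r where "c \<in> A" "x \<in> dom_chart c" "r > 0" "cball (coord c x) r <= img_chart c"
proof -
 obtain c where c: "c \<in> A" "x \<in> dom_chart c" by (rule chart_exists)
 then obtain r where "r > 0" "cball (coord c x) r <= img_chart c"
  using open_contains_cball[of "img_chart c"] open_img by blast
 then show ?thesis using c that by blast
qed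

lemma inv_image_borel: "c \<in> A ==> open S ==> S <= img_chart c ==> inv_coord c ` S \<in> sets borel"
 using open_inv_image by auto

lemma inv_image_iff:
 assumes c: "c \<in> A" and S: "S <= img_chart c" and y: "y \<in> img_chart c"
 shows "inv_coord c y \<in> inv_coord c ` S \<longleftrightarrow> y \<in> S"
proof
 assume "inv_coord c y \<in> inv_coord c ` S"
 then obtain s where s: "s \<in> S" "inv_coord c y = inv_coord c s" by (rule imageE) blast
 have "y = coord c (inv_coord c y)" by (rule coord_inv_coord[OF c y, symmetric])
 also have "... = s" unfolding s(2) using s(1) S by (intro coord_inv_coord[OF c]) blast
 finally show "y \<in> S" using s(1) by simp
qed simp

lemma emeasure_inv_image:
 assumes c: "c \<in> A" and S: "open S" "S <= img_chart c"
 shows "emeasure vol (inv_coord c ` S) = (\<integral>\<^sup>+y. ennreal (vol_density c y * indicator S y) \<partial>lborel)"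
proof -
 have e: "coord c ` (inv_coord c ` S Int dom_chart c) = S"
  unfolding coord_image[OF c] using inv_image_iff[OF c S(2)] S(2) by blast
 have "inv_coord c ` S <= dom_chart c" using S inv_coord_dom[OF c] by blast
 then show ?thesis using emeasure_vol[OF c inv_image_borel[OF c S]] emeasure_chart_measure[OF c inv_image_borel[OF c S]] e by simp
qed

lemma finite_measure_vol: "finite_measure vol"
proof -
 have "\<exists>W. open W & x \<in> W & emeasure vol W < \<infinity>" for x :: 'm
 proof -
  obtain c r where c: "c \<in> A" "x \<in> dom_chart c" "r > 0" "cball (coord c x) r <= img_chart c" by (rule chart_ball)
  obtain m M where M: "!!y. y \<in> cball (coord c x) r ==> vol_density c y <= M"
   by (rule compact_bounds[OF c(1) compact_cball c(4)]) blast
  let ?B = "ball (coord c x) r"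
  have B: "open ?B" "?B <= img_chart c" using c(4) by auto
  have "emeasure vol (inv_coord c ` ?B) = (\<integral>\<^sup>+y. ennreal (vol_density c y * indicator ?B y) \<partial>lborel)"
   by (rule emeasure_inv_image[OF c(1) B])
  also have "... <= (\<integral>\<^sup>+y. ennreal M * indicator ?B y \<partial>lborel)"
   using M by (intro nn_integral_mono) (auto simp: indicator_def intro!: ennreal_leI)
  also have "... = ennreal M * emeasure lborel ?B" by (rule nn_integral_cmult_indicator) simp
  also have "... < \<infinity>" using emeasure_bounded_finite[OF bounded_ball, of "coord c x" r] by (simp add: ennreal_mult_less_top)
  finally have "emeasure vol (inv_coord c ` ?B) < \<infinity>" .
  moreover have "x \<in> inv_coord c ` ?B" using c inv_coord_coord[OF c(1,2)] by (intro image_eqI[of _ _ "coord c x"]) auto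
  ultimately show ?thesis using open_inv_image[OF c(1) B] by blast
 qed
 then obtain W where W: "!!x. open (W x)" "!!x. x \<in> W x" "!!x. emeasure vol (W x) < \<infinity>" by metis
 obtain C where C: "finite C" "UNIV <= (\<Union>x\<in>C. W x)"
  by (rule compactE_image[OF compact_M, of UNIV W]) (use W in auto)
 have "emeasure vol UNIV <= emeasure vol (\<Union>x\<in>C. W x)" by (rule emeasure_mono[OF C(2)]) (use W C in auto)
 also have "... <= (\<Sum>x\<in>C. emeasure vol (W x))" by (rule emeasure_subadditive_finite) (use W C in auto)
 also have "... < \<infinity>" using W(3) C(1) by (simp add: ennreal_sum_less_top)
 finally show ?thesis by (intro finite_measureI) auto
qed

end

section \<open>The complex Hessian and closed forms in charts\<close>

lemma complex_vec_expansion: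
 "(x :: complex ^ 'n::finite) = (\<Sum>j\<in>UNIV. Re (x $ j) *\<^sub>R axis j 1 + Im (x $ j) *\<^sub>R axis j \<i>)"
proof -
 have "(\<Sum>j\<in>UNIV. Re (x $ j) *\<^sub>R axis j 1 + Im (x $ j) *\<^sub>R axis j \<i>) $ k = x $ k" for k
 proof -
  have "(\<Sum>j\<in>UNIV. Re (x $ j) *\<^sub>R axis j 1 + Im (x $ j) *\<^sub>R axis j \<i>) $ k
    = (\<Sum>j\<in>UNIV. if k = j then Re (x $ j) *\<^sub>R 1 + Im (x $ j) *\<^sub>R \<i> else 0)"
   unfolding sum_component by (intro sum.cong) (auto simp: axis_def)
  also have "... = x $ k" by (simp add: complex_eq_iff)
  finally show ?thesis .
 qed
 then show ?thesis by (simp add: vec_eq_iff)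
qed

lemma bilinear_complex_expansion:
 fixes h :: "complex ^ 'n::finite => complex ^ 'n => real"
 assumes h: "bilinear h"
 shows "h x y = (\<Sum>j\<in>UNIV. \<Sum>k\<in>UNIV.
  Re (x $ j) * Re (y $ k) * h (axis j 1) (axis k 1) + Re (x $ j) * Im (y $ k) * h (axis j 1) (axis k \<i>)
  + Im (x $ j) * Re (y $ k) * h (axis j \<i>) (axis k 1) + Im (x $ j) * Im (y $ k) * h (axis j \<i>) (axis k \<i>))"
proof -
 have "h x y = h (\<Sum>j\<in>UNIV. Re (x $ j) *\<^sub>R axis j 1 + Im (x $ j) *\<^sub>R axis j \<i>) (\<Sum>k\<in>UNIV. Re (y $ k) *\<^sub>R axis k 1 + Im (y $ k) *\<^sub>R axis k \<i>)"
  using complex_vec_expansion[of x] complex_vec_expansion[of y] by simp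
 also have "... = (\<Sum>j\<in>UNIV. \<Sum>k\<in>UNIV. h (Re (x $ j) *\<^sub>R axis j 1 + Im (x $ j) *\<^sub>R axis j \<i>) (Re (y $ k) *\<^sub>R axis k 1 + Im (y $ k) *\<^sub>R axis k \<i>))"
  unfolding bilinear_sum[OF h] sum.cartesian_product ..
 finally show ?thesis
  by (simp add: bilinear_ladd[OF h] bilinear_radd[OF h] bilinear_lmul[OF h] bilinear_rmul[OF h] algebra_simps)
qed

text \<open>Both sides are expanded in real coordinates of \<open>u\<close> and \<open>v\<close>.
  The two halves of \<open>i_ddbar\<close> are exchanged by swapping j and k, since \<open>H\<close>
  is symmetric, and therefore have the same sum.\<close>

lemma i_ddbar_eq_ddc:
 fixes f :: "'m => real" and c :: "('m, 'n::finite) chart"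
 assumes U: "open U" "coord c x \<in> U" and f: "C2_on U (%y. f (inv_coord c y)) D H"
  and d1: "!!z. z \<in> U ==> ((%y. f (inv_coord c y)) has_derivative D z) (at z)"
  and d2: "!!z v. z \<in> U ==> ((%y. D y v) has_derivative (%u. H z u v)) (at z)"
 shows "i_ddbar f c x u v = ddc (H (coord c x)) u v"
proof -
 let ?y = "coord c x"
 define h where "h = H ?y"
 have hb: "bilinear h" and hs: "!!a b. h a b = h b a"
  unfolding h_def using C2_onD(4)[OF f U(2)] C2_onD(3)[OF f U(2)] by blast+
 define wb where "wb k = wirtinger_bar k (%y. complex_of_real (f (inv_coord c y)))" for k
 have wb: "(complex_of_real (D z (axis k 1)) + \<i> * complex_of_real (D z (axis k \<i>))) / 2 = wb k z" if "z \<in> U" for z k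
 proof -
  have "((%y. complex_of_real (f (inv_coord c y))) has_derivative (%v. complex_of_real (D z v))) (at z)"
   by (rule bounded_linear.has_derivative[OF bounded_linear_of_real d1[OF that]])
  from frechet_derivative_at[OF this, symmetric] show ?thesis unfolding wb_def wirtinger_bar_def by simp
 qed
 have dwb: "frechet_derivative (wb k) (at ?y) w = (complex_of_real (h w (axis k 1)) + \<i> * complex_of_real (h w (axis k \<i>))) / 2" for k w
 proof -
  have d: "((%y. complex_of_real (D y a)) has_derivative (%w. complex_of_real (h w a))) (at ?y)" for a
   unfolding h_def by (rule bounded_linear.has_derivative[OF bounded_linear_of_real d2[OF U(2)]])
  have "((%z. (complex_of_real (D z (axis k 1)) + \<i> * complex_of_real (D z (axis k \<i>))) / 2) has_derivative
   (%w. (complex_of_real (h w (axis k 1)) + \<i> * complex_of_real (h w (axis k \<i>))) / 2)) (at ?y)"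
   by (rule bounded_linear.has_derivative[OF bounded_linear_divide]) (intro has_derivative_add has_derivative_mult_right d)
  then have "(wb k has_derivative (%w. (complex_of_real (h w (axis k 1)) + \<i> * complex_of_real (h w (axis k \<i>))) / 2)) (at ?y)"
   by (rule has_derivative_transform_within_open[OF _ U]) (rule wb)
  from frechet_derivative_at[OF this, symmetric] show ?thesis by simp
 qed
 define a b cc d where "a j k = h (axis j 1) (axis k 1)" and "b j k = h (axis j 1) (axis k \<i>)"
  and "cc j k = h (axis j \<i>) (axis k 1)" and "d j k = h (axis j \<i>) (axis k \<i>)" for j k
 define p q r s where "p j = Re (u $ j)" and "q j = Im (u $ j)" and "r j = Re (v $ j)" and "s j = Im (v $ j)" for j
 have W: "wirtinger j (wb k) ?y = Complex ((a j k + d j k) / 4) ((b j k - cc j k) / 4)" for j k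
  unfolding wirtinger_def dwb a_def b_def cc_def d_def by (simp add: complex_eq_iff)
 define T where "T j k = - ((a j k + d j k) * (q j * r k - p j * s k) + (b j k - cc j k) * (p j * r k + q j * s k)) / 4" for j k
 define T2 where "T2 j k = - ((a j k + d j k) * (r j * q k - s j * p k) - (b j k - cc j k) * (r j * p k + s j * q k)) / 4" for j k
 have sw: "a k j = a j k" "d k j = d j k" "cc k j = b j k" for j k
  unfolding a_def b_def cc_def d_def by (rule hs)+
 have T2: "T2 k j = T j k" for j k
  unfolding T_def T2_def
 proof (rule arg_cong[where f="%x. - x / 4"])
  have e: "a k j = a j k" "d k j = d j k" "b k j = cc j k" "cc k j = b j k" unfolding a_def b_def cc_def d_def by (rule hs)+
  show "(a k j + d k j) * (r k * q j - s k * p j) - (b k j - cc k j) * (r k * p j + s k * q j) =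
   (a j k + d j k) * (q j * r k - p j * s k) + (b j k - cc j k) * (p j * r k + q j * s k)" unfolding e by (simp add: algebra_simps)
 qed
 have "i_ddbar f c x u v = (\<Sum>j\<in>UNIV. \<Sum>k\<in>UNIV. T j k + T2 j k)"
  unfolding i_ddbar_def wb_def[symmetric] W sum_distrib_left Re_sum
  by (intro sum.cong refl) (simp add: T_def T2_def p_def q_def r_def s_def field_simps)
 also have "... = (\<Sum>j\<in>UNIV. \<Sum>k\<in>UNIV. T j k) + (\<Sum>j\<in>UNIV. \<Sum>k\<in>UNIV. T2 j k)" by (simp add: sum.distrib)
 also have "(\<Sum>j\<in>UNIV. \<Sum>k\<in>UNIV. T2 j k) = (\<Sum>j\<in>UNIV. \<Sum>k\<in>UNIV. T2 k j)" by (rule sum.swap)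
 finally have L: "i_ddbar f c x u v = (\<Sum>j\<in>UNIV. \<Sum>k\<in>UNIV. 2 * T j k)" by (simp add: T2 sum_distrib_left)
 have 1: "h v (J u) = (\<Sum>j\<in>UNIV. \<Sum>k\<in>UNIV. - r k * q j * a j k + r k * p j * cc j k - s k * q j * b j k + s k * p j * d j k)"
 proof -
  have "h v (J u) = (\<Sum>j\<in>UNIV. \<Sum>k\<in>UNIV. - r j * q k * a j k + r j * p k * b j k - s j * q k * cc j k + s j * p k * d j k)"
   unfolding bilinear_complex_expansion[OF hb, of v "J u"] by (simp add: a_def b_def cc_def d_def p_def q_def r_def s_def)
  also have "... = (\<Sum>j\<in>UNIV. \<Sum>k\<in>UNIV. - r k * q j * a k j + r k * p j * b k j - s k * q j * cc k j + s k * p j * d k j)"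
   by (rule sum.swap)
  finally show ?thesis by (simp add: sw)
 qed
 have 2: "h u (J v) = (\<Sum>j\<in>UNIV. \<Sum>k\<in>UNIV. - p j * s k * a j k + p j * r k * b j k - q j * s k * cc j k + q j * r k * d j k)"
  unfolding bilinear_complex_expansion[OF hb, of u "J v"] by (simp add: a_def b_def cc_def d_def p_def q_def r_def s_def)
 have "ddc h u v = (\<Sum>j\<in>UNIV. \<Sum>k\<in>UNIV. 2 * T j k)"
  unfolding ddc_def 1 2 sum_subtractf[symmetric] sum_divide_distrib
  by (intro sum.cong refl) (simp add: T_def field_simps)
 then show ?thesis using L by (simp add: h_def)
qed

lemma Ck_on_1_C1_on:
 fixes f :: "'a::euclidean_space => real"
 assumes U: "open U" and f: "Ck_on 1 f U"
 obtains D where "C1_on U f D" "!!z. z \<in> U ==> (f has_derivative D z) (at z)"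
proof -
 obtain D where D0: "(\<forall>z\<in>U. (f has_derivative D z) (at z within U)) & (\<forall>v. Ck_on 0 (%y. D y v) U)"
  using f unfolding One_nat_def Ck_on.simps(2)[of 0] by blast
 have D: "(f has_derivative D z) (at z)" if "z \<in> U" for z
  using D0 that at_within_open[OF that U] by auto
 have "C1_on U f D" unfolding C1_on_def
 proof (intro conjI ballI allI)
  show "continuous_on U f" using D by (meson differentiable_imp_continuous_on differentiable_on_def differentiableI differentiable_at_withinI)
  show "continuous_on U (%z. D z v)" for v using D0 by simp
  show "linear (D z)" if "z \<in> U" for z using D[OF that] has_derivative_linear by blast
  show "((%t. f (z + t *\<^sub>R v)) has_real_derivative D z v) (at 0)" if "z \<in> U" for z v by (rule has_derivative_line[OF D[OF that]])
 qed
 then show ?thesis using that D by blast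
qed

text \<open>The classical identity dX = 0 is multiplied by \<open>bump 3\<close> and integrated by
  parts.\<close>

lemma closed_weakly_closed:
 fixes X :: "complex ^ 'n::finite => complex ^ 'n => complex ^ 'n => real"
 assumes U: "open U" and X: "!!u v. Ck_on 1 (%y. X y u v) U" and anti: "!!y u v. y \<in> U ==> X y u v = - X y v u"
  and closed: "!!y u v w. y \<in> U ==> exterior_derivative X y u v w = 0"
 shows "weakly_closed U X"
 unfolding weakly_closed_def
proof (intro conjI allI impI)
 have "\<exists>D. C1_on U (%y. X y (fst p) (snd p)) D & (\<forall>z\<in>U. ((%y. X y (fst p) (snd p)) has_derivative D z) (at z))" for p
  by (rule Ck_on_1_C1_on[OF U X[of "fst p" "snd p"]]) blast
 then obtain D where D0: "!!p. C1_on U (%y. X y (fst p) (snd p)) (D p) & (\<forall>z\<in>U. ((%y. X y (fst p) (snd p)) has_derivative D p z) (at z))"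
  using choice[of "%p D. C1_on U (%y. X y (fst p) (snd p)) D & (\<forall>z\<in>U. ((%y. X y (fst p) (snd p)) has_derivative D z) (at z))"] by blast
 have D1: "C1_on U (%y. X y u v) (D (u, v))" and D2: "z \<in> U ==> ((%y. X y u v) has_derivative D (u, v) z) (at z)" for u v z
  using D0[of "(u, v)"] by auto
 show "continuous_on U (%z. X z u v)" for u v by (rule C1_onD(1)[OF D1])
 have asym: "D (u, w) z v = - D (w, u) z v" if z: "z \<in> U" for u w v z
 proof -
  have "((%y. X y u w) has_derivative (%v. - D (w, u) z v)) (at z)"
   by (rule has_derivative_transform_within_open[OF has_derivative_minus[OF D2[OF z]] U z]) (use anti in metis)
  then have "D (u, w) z = (%v. - D (w, u) z v)" by (rule has_derivative_unique[OF D2[OF z]])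
  then show ?thesis by simp
 qed
 have cyc: "D (v, w) z u + D (w, u) z v + D (u, v) z w = 0" if z: "z \<in> U" for u v w z
  using closed[OF z, of u v w] asym[OF z, of u w v] unfolding exterior_derivative_def
   frechet_derivative_at[OF D2[OF z], symmetric] by simp
 fix y :: "complex ^ 'n" and r :: real and u v w assume r: "r > 0" "cball y r <= U"
 let ?b3 = "bump 3 y r" and ?b2 = "bump 2 y r"
 have b: "C1_on U ?b3 (%z v. - 6 * ((z - y) \<bullet> v) * ?b2 z)"
  using C1_on_subset[OF C1_on_bump[of 2 y r], of U] by (simp add: numeral_3_eq_3 numeral_2_eq_2)
 have p: "integrable lborel (%z. D (v, w) z u * ?b3 z)" "integrable lborel (%z. X z v w * (- 6 * ((z - y) \<bullet> u) * ?b2 z))"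
  "(LBINT z. D (v, w) z u * ?b3 z) = - (LBINT z. X z v w * (- 6 * ((z - y) \<bullet> u) * ?b2 z))" for u v w
  using integral_parts[OF U compact_cball r(2) D1[of v w] b, of u] r(1) by (simp_all add: bump_outside)
 define G where "G v w u z = X z v w * ((z - y) \<bullet> u) * ?b2 z" for v w u z
 have G: "integrable lborel (G v w u)" "(LBINT z. D (v, w) z u * ?b3 z) = 6 * (LBINT z. G v w u z)" for u v w
 proof -
  have e: "X z v w * (- 6 * ((z - y) \<bullet> u) * ?b2 z) = -6 * G v w u z" for z by (simp add: G_def)
  show "integrable lborel (G v w u)" using p(2)[of v w u] unfolding e by simp
  show "(LBINT z. D (v, w) z u * ?b3 z) = 6 * (LBINT z. G v w u z)" unfolding p(3) e by simp
 qed
 have "(LBINT z. (X z v w * ((z - y) \<bullet> u) + X z w u * ((z - y) \<bullet> v) + X z u v * ((z - y) \<bullet> w)) * ?b2 z)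
  = (LBINT z. G v w u z + G w u v z + G u v w z)"
  by (intro Bochner_Integration.integral_cong refl) (simp add: G_def algebra_simps)
 also have "... = (LBINT z. G v w u z) + (LBINT z. G w u v z) + (LBINT z. G u v w z)" (is "_ = ?A")
  by (simp add: G(1))
 finally have E1: "(LBINT z. (X z v w * ((z - y) \<bullet> u) + X z w u * ((z - y) \<bullet> v) + X z u v * ((z - y) \<bullet> w)) * ?b2 z) = ?A" .
 have "6 * ?A = (LBINT z. D (v, w) z u * ?b3 z + D (w, u) z v * ?b3 z + D (u, v) z w * ?b3 z)"
  using G(2)[of v w u] G(2)[of w u v] G(2)[of u v w] by (simp add: p(1))
 also have "... = (\<integral>z. 0 \<partial>(lborel :: (complex ^ 'n) measure))"
 proof (rule Bochner_Integration.integral_cong[OF refl])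
  fix z
  show "D (v, w) z u * ?b3 z + D (w, u) z v * ?b3 z + D (u, v) z w * ?b3 z = 0"
  proof (cases "z \<in> cball y r")
   case True
   have "D (v, w) z u * ?b3 z + D (w, u) z v * ?b3 z + D (u, v) z w * ?b3 z = (D (v, w) z u + D (w, u) z v + D (u, v) z w) * ?b3 z"
    by (simp only: distrib_right)
   then show ?thesis using cyc[OF subsetD[OF r(2) True], of v w u] by simp
  qed (use r(1) in \<open>simp add: bump_outside\<close>)
 qed
 finally have "6 * ?A = 0" by simp
 then show "(LBINT z. (X z v w * ((z - y) \<bullet> u) + X z w u * ((z - y) \<bullet> v) + X z u v * ((z - y) \<bullet> w)) * ?b2 z) = 0"
  unfolding E1 by simp
qed

text \<open>A continuous positive function on the compact product of \<open>K\<close> with the unit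
  sphere has a positive minimum; homogeneity does the rest.\<close>

lemma pos_form_lower_bound:
 fixes X :: "'a::euclidean_space => complex ^ 'n::finite => complex ^ 'n => real"
 assumes K: "compact K" and cont: "!!u v. continuous_on K (%y. X y u v)" and pos: "!!y. y \<in> K ==> pos_form (X y)"
 shows "\<exists>\<delta>>0. \<forall>y\<in>K. \<forall>v. \<delta> * (v \<bullet> v) <= X y v (J v)"
proof (cases "K = {}")
 case False
 let ?S = "K \<times> sphere (0 :: complex ^ 'n) 1"
 define q where "q p = (\<Sum>(a, b)\<in>Basis \<times> Basis. (snd p \<bullet> a) * (J (snd p) \<bullet> b) * X (fst p) a b)" for p
 have X: "X y v (J v) = q (y, v)" if "y \<in> K" for y v
 proof -
  have bl: "bilinear (X y)" by (rule herm_formD(1)[OF pos_form_herm[OF pos[OF that]]])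
  have "X y v (J v) = X y (\<Sum>a\<in>Basis. (v \<bullet> a) *\<^sub>R a) (\<Sum>b\<in>Basis. (J v \<bullet> b) *\<^sub>R b)"
   unfolding euclidean_representation ..
  also have "... = q (y, v)" unfolding bilinear_sum[OF bl] q_def
   by (intro sum.cong refl) (auto simp: bilinear_lmul[OF bl] bilinear_rmul[OF bl])
  finally show ?thesis .
 qed
 have "continuous_on ?S q" unfolding q_def case_prod_unfold
  by (intro continuous_intros continuous_on_compose2[OF cont, of _ fst] continuous_on_compose2[OF J_continuous, of _ snd]) auto
 moreover have "compact ?S" by (intro compact_Times K compact_sphere)
 moreover have "sphere (0 :: complex ^ 'n) 1 ~= {}" using vector_choose_size[of 1, where 'a="complex ^ 'n"] by (auto simp: dist_norm)
 then have "?S ~= {}" using False by blast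
 ultimately obtain p where p: "p \<in> ?S" "!!p'. p' \<in> ?S ==> q p <= q p'"
  using continuous_attains_inf[of ?S q] by blast
 have qp: "q p > 0"
 proof -
  have k: "fst p \<in> K" "snd p ~= 0" using p(1) by auto
  then have "X (fst p) (snd p) (J (snd p)) > 0" using pos[OF k(1)] unfolding pos_form_def by blast
  then show ?thesis unfolding X[OF k(1)] by simp
 qed
 have "q p * (v \<bullet> v) <= X y v (J v)" if y: "y \<in> K" for y v
 proof (cases "v = 0")
  case True
  then show ?thesis using bilinear_lzero[OF herm_formD(1)[OF pos_form_herm[OF pos[OF y]]]] by simp
 next
  case False
  define w where "w = v /\<^sub>R norm v"
  have bl: "bilinear (X y)" by (rule herm_formD(1)[OF pos_form_herm[OF pos[OF y]]])
  have v: "v = norm v *\<^sub>R w" "J v = norm v *\<^sub>R J w" using False by (auto simp: w_def vec_eq_iff)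
  have "q p <= q (y, w)" by (rule p(2)) (use y False in \<open>simp add: w_def\<close>)
  then have "q p * (norm v)\<^sup>2 <= X y w (J w) * (norm v)\<^sup>2" using X[OF y] by (intro mult_right_mono) auto
  also have "... = X y (norm v *\<^sub>R w) (norm v *\<^sub>R J w)"
   unfolding bilinear_lmul[OF bl] bilinear_rmul[OF bl] by (simp add: power2_eq_square)
  finally show ?thesis unfolding v(1)[symmetric] v(2)[symmetric] dot_square_norm .
 qed
 then show ?thesis using qp by blast
qed (auto intro: exI[of _ 1])

section \<open>Potentials on the manifold and uniform chart balls\<close>

context kaehler
begin

text \<open>Strictly \<open>omg\<close>-plurisubharmonic functions of class C^2.\<close>

definition psh :: "('m => real) => bool" where
 "psh f \<longleftrightarrow> (\<forall>c\<in>A. Ck_on 2 (%y. f (inv_coord c y)) (img_chart c)) & positive_form A (omega_pot omg f)"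

lemma form_weakly_closed: "c \<in> A ==> weakly_closed (img_chart c) (%y. omg c (inv_coord c y))"
proof (rule closed_weakly_closed)
 assume c: "c \<in> A"
 show "open (img_chart c)" by (rule open_img[OF c])
 show "Ck_on 1 (%y. omg c (inv_coord c y) u v) (img_chart c)" for u v
  using form_smooth[OF c] unfolding smooth_on_def by blast
 show "omg c (inv_coord c y) u v = - omg c (inv_coord c y) v u" if "y \<in> img_chart c" for y u v
  using form_pos[OF c inv_coord_dom[OF c that]] unfolding pos_form_def herm_form_def by blast
 show "exterior_derivative (%y. omg c (inv_coord c y)) y u v w = 0" if "y \<in> img_chart c" for y u v w
  using ck c that unfolding compact_kaehler_manifold_def closed_form_def by blast
qed

lemma chart_C2:
 assumes c: "c \<in> A" and f: "Ck_on 2 (%y. f (inv_coord c y)) (img_chart c)"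
 obtains D H where "C2_on (img_chart c) (%y. f (inv_coord c y)) D H"
  "!!y. y \<in> img_chart c ==> i_ddbar f c (inv_coord c y) = ddc (H y)"
  "!!y. y \<in> img_chart c ==> omega_pot omg f c (inv_coord c y) = (%u v. 1 * omg c (inv_coord c y) u v + 1 * ddc (H y) u v)"
  "!!y. y \<in> img_chart c ==> herm_form (omega_pot omg f c (inv_coord c y))"
proof -
 obtain D H where D: "C2_on (img_chart c) (%y. f (inv_coord c y)) D H"
  "!!z. z \<in> img_chart c ==> ((%y. f (inv_coord c y)) has_derivative D z) (at z)"
  "!!z v. z \<in> img_chart c ==> ((%y. D y v) has_derivative (%u. H z u v)) (at z)"
  by (rule Ck_on_2_C2_on[OF open_img[OF c] f]) blast
 have 1: "i_ddbar f c (inv_coord c y) = ddc (H y)" if y: "y \<in> img_chart c" for y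
 proof (intro ext)
  fix u v
  have e: "coord c (inv_coord c y) = y" by (rule coord_inv_coord[OF c y])
  show "i_ddbar f c (inv_coord c y) u v = ddc (H y) u v"
   using i_ddbar_eq_ddc[where c=c and x="inv_coord c y" and f=f and U="img_chart c" and D=D and H=H and u=u and v=v, OF open_img[OF c]] D y
   unfolding e by blast
 qed
 have 2: "omega_pot omg f c (inv_coord c y) = (%u v. 1 * omg c (inv_coord c y) u v + 1 * ddc (H y) u v)" if y: "y \<in> img_chart c" for y
  by (intro ext) (simp add: omega_pot_def 1[OF y])
 have 3: "herm_form (omega_pot omg f c (inv_coord c y))" if y: "y \<in> img_chart c" for y
  unfolding 2[OF y]
  by (rule herm_form_comb[OF pos_form_herm[OF form_pos[OF c inv_coord_dom[OF c y]]] ddc_herm(1)])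
   (rule C2_onD(4)[OF D(1) y], rule C2_onD(3)[OF D(1) y])
 show ?thesis by (rule that[OF D(1) 1 2 3])
qed

lemma psh_pos:
 assumes f: "psh f" and c: "c \<in> A" and x: "x \<in> dom_chart c"
 shows "pos_form (omega_pot omg f c x)"
proof -
 have C: "Ck_on 2 (%y. f (inv_coord c y)) (img_chart c)" using f c unfolding psh_def by blast
 obtain D H where "!!y. y \<in> img_chart c ==> herm_form (omega_pot omg f c (inv_coord c y))"
  by (rule chart_C2[OF c C]) blast
 from this[of "coord c x"] have "herm_form (omega_pot omg f c x)" using x inv_coord_coord[OF c x] by simp
 then show ?thesis using f c x unfolding psh_def positive_form_def pos_form_def by blast
qed

lemma psh_chart:
 assumes f: "psh f" and c: "c \<in> A"
 obtains D H where "C2_on (img_chart c) (%y. f (inv_coord c y)) D H"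
  "!!y. y \<in> img_chart c ==> omega_pot omg f c (inv_coord c y) = (%u v. 1 * omg c (inv_coord c y) u v + 1 * ddc (H y) u v)"
  "!!y. y \<in> img_chart c ==> pos_form (omega_pot omg f c (inv_coord c y))"
  "weakly_closed (img_chart c) (%y. omega_pot omg f c (inv_coord c y))"
  "!!y. y \<in> img_chart c ==> form_trace (omega_pot omg f c (inv_coord c y)) = form_trace (omg c (inv_coord c y)) + laplacian H y"
proof -
 have C: "Ck_on 2 (%y. f (inv_coord c y)) (img_chart c)" using f c unfolding psh_def by blast
 obtain D H where D: "C2_on (img_chart c) (%y. f (inv_coord c y)) D H"
  "!!y. y \<in> img_chart c ==> omega_pot omg f c (inv_coord c y) = (%u v. 1 * omg c (inv_coord c y) u v + 1 * ddc (H y) u v)"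
  by (rule chart_C2[OF c C]) blast
 have w: "weakly_closed (img_chart c) (%y u v. 1 * omg c (inv_coord c y) u v + 1 * ddc (H y) u v)"
  by (rule weakly_closed_comb[OF form_weakly_closed[OF c] ddc_weakly_closed[OF open_img[OF c] D(1)]])
 \<comment> \<open>The formula for \<open>omega_pot\<close> holds only inside the chart image, so
   weak closedness is transferred along equality on \<open>V\<close>; outside the test ball the bump
   removes the difference.\<close>
 have cong: "weakly_closed V X" if Y: "weakly_closed V Y" and e: "!!y. y \<in> V ==> X y = Y y" for V X and Y :: "complex ^ 'n => complex ^ 'n => complex ^ 'n => real"
  unfolding weakly_closed_def
 proof (intro conjI allI impI)
  show "continuous_on V (%z. X z u v)" for u v
  proof (rule continuous_on_eq)
   show "continuous_on V (%z. Y z u v)" using Y unfolding weakly_closed_def by blast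
  qed (simp add: e)
  fix y r u v w assume r: "r > 0" "cball y r <= V"
  have "(LBINT z. (X z v w * ((z - y) \<bullet> u) + X z w u * ((z - y) \<bullet> v) + X z u v * ((z - y) \<bullet> w)) * bump 2 y r z)
   = (LBINT z. (Y z v w * ((z - y) \<bullet> u) + Y z w u * ((z - y) \<bullet> v) + Y z u v * ((z - y) \<bullet> w)) * bump 2 y r z)"
  proof (rule Bochner_Integration.integral_cong[OF refl])
   fix z
   show "(X z v w * ((z - y) \<bullet> u) + X z w u * ((z - y) \<bullet> v) + X z u v * ((z - y) \<bullet> w)) * bump 2 y r z
    = (Y z v w * ((z - y) \<bullet> u) + Y z w u * ((z - y) \<bullet> v) + Y z u v * ((z - y) \<bullet> w)) * bump 2 y r z"
    using e[of z] r bump_outside[of 2 r z y] by (cases "z \<in> cball y r") auto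
  qed
  then show "(LBINT z. (X z v w * ((z - y) \<bullet> u) + X z w u * ((z - y) \<bullet> v) + X z u v * ((z - y) \<bullet> w)) * bump 2 y r z) = 0"
   using Y r unfolding weakly_closed_def by simp
 qed
 show ?thesis
 proof (rule that[OF D])
  show "pos_form (omega_pot omg f c (inv_coord c y))" if "y \<in> img_chart c" for y
   by (rule psh_pos[OF f c inv_coord_dom[OF c that]])
  show "weakly_closed (img_chart c) (%y. omega_pot omg f c (inv_coord c y))"
   by (rule cong[OF w]) (rule D(2))
  show "form_trace (omega_pot omg f c (inv_coord c y)) = form_trace (omg c (inv_coord c y)) + laplacian H y" if y: "y \<in> img_chart c" for y
   unfolding D(2)[OF y] form_trace_ddc[where H=H and z=y, OF C2_onD(4)[OF D(1) y] C2_onD(3)[OF D(1) y], symmetric]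
   by (simp add: form_trace_def sum.distrib)
 qed
qed

lemma chart_continuous:
 fixes f :: "'m => 'z::topological_space"
 assumes "!!c. c \<in> A ==> continuous_on (img_chart c) (%y. f (inv_coord c y))"
 shows "continuous_on UNIV f"
proof -
 have "continuous_on (\<Union>c\<in>A. dom_chart c) f"
 proof (rule continuous_on_open_UN)
  fix c assume c: "c \<in> A"
  show "open (dom_chart c)" by (rule open_dom[OF c])
  have "continuous_on (dom_chart c) (%x. f (inv_coord c (coord c x)))"
   by (rule continuous_on_compose2[OF assms[OF c] continuous_coord[OF c]]) simp
  then show "continuous_on (dom_chart c) f"
   by (rule continuous_on_eq) (simp add: inv_coord_coord[OF c])
 qed
 then show ?thesis using cover by simp
qed

lemma psh_continuous: "psh f ==> continuous_on UNIV f"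
proof (rule chart_continuous)
 fix c assume f: "psh f" and c: "c \<in> A"
 obtain D H where "C2_on (img_chart c) (%y. f (inv_coord c y)) D H" by (rule psh_chart[OF f c]) blast
 then show "continuous_on (img_chart c) (%y. f (inv_coord c y))" by (rule C1_onD(1)[OF C2_onD(1)])
qed

lemma psh_measurable: "psh f ==> f \<in> borel_measurable borel"
 by (rule borel_measurable_continuous_onI[OF psh_continuous])

text \<open>Here \<open>\<delta>\<close> is a lower bound of the metric and \<open>\<Lambda>\<close>
  an upper bound of its trace. The factor 8 leaves room for kernel balls of radius 6 r around points
  at distance less than r from the centre, and r <= 1/2 matches \<open>sublevel\<close>.\<close>

definition good :: "'m => ('m, 'n) chart \<times> real \<times> real \<times> real \<times> real \<times> real => bool" where
 "good x = (%(c, r, m, M, \<delta>, \<Lambda>). c \<in> A & x \<in> dom_chart c & 0 < r & r <= 1/2 & cball (coord c x) (8 * r) <= img_chart c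
  & 0 < m & 0 < M & 0 < \<delta> & 0 <= \<Lambda> & (\<forall>y\<in>cball (coord c x) (8 * r). m <= vol_density c y & vol_density c y <= M
   & form_trace (omg c (inv_coord c y)) <= \<Lambda> & (\<forall>v. \<delta> * (v \<bullet> v) <= omg c (inv_coord c y) v (J v))))"

lemma good_exists: "\<exists>e. good x e"
proof -
 obtain c R where c: "c \<in> A" "x \<in> dom_chart c" "R > 0" "cball (coord c x) R <= img_chart c" by (rule chart_ball)
 define r where "r = min (1/2) (R / 8)"
 have r: "0 < r" "r <= 1/2" "8 * r <= R" using c by (auto simp: r_def)
 let ?K = "cball (coord c x) (8 * r)"
 have K: "compact ?K" "?K <= img_chart c" using c(4) r(3) by auto
 obtain m M where m: "0 < m" "m <= M" "!!y. y \<in> ?K ==> m <= vol_density c y" "!!y. y \<in> ?K ==> vol_density c y <= M"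
  by (rule compact_bounds[OF c(1) K]) blast
 note cont = continuous_on_subset[OF form_continuous[OF c(1)] K(2)]
 obtain \<delta> where d: "\<delta> > 0" "!!y v. y \<in> ?K ==> \<delta> * (v \<bullet> v) <= omg c (inv_coord c y) v (J v)"
 proof -
  have "\<exists>\<delta>>0. \<forall>y\<in>?K. \<forall>v. \<delta> * (v \<bullet> v) <= omg c (inv_coord c y) v (J v)"
   by (rule pos_form_lower_bound[OF K(1) cont]) (rule form_pos[OF c(1) inv_coord_dom[OF c(1) subsetD[OF K(2)]]])
  then show ?thesis using that by blast
 qed
 have "continuous_on ?K (%y. form_trace (omg c (inv_coord c y)))"
  unfolding form_trace_def by (intro continuous_intros cont)
 then have "bounded ((%y. form_trace (omg c (inv_coord c y))) ` ?K)" by (intro compact_imp_bounded compact_continuous_image K(1))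
 then obtain L where L: "!!y. y \<in> ?K ==> \<bar>form_trace (omg c (inv_coord c y))\<bar> <= L"
  unfolding bounded_iff by (auto simp del: mem_cball)
 have tr: "form_trace (omg c (inv_coord c y)) <= max L 0" if "y \<in> ?K" for y
  using L[OF that] by linarith
 have Lp: "0 <= max L 0" and M0: "0 < M" using m(1,2) by linarith+
 have "good x (c, r, m, M, \<delta>, max L 0)"
  unfolding good_def prod.case
  by (intro conjI ballI allI; (rule c(1) c(2) r(1) r(2) K(2) m(1) M0 d(1) Lp | (rule m(3) m(4) tr d(2), assumption)))
 then show ?thesis by blast
qed

text \<open>The choice is made once for every point, so all constants derived from it depend only on
  \<open>A\<close> and \<open>omg\<close>, not on a potential.\<close>

definition "gd x = (SOME e. good x e)"
definition "bc x = fst (gd x)"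
definition "br x = fst (snd (gd x))"
definition "bm x = fst (snd (snd (gd x)))"
definition "bM x = fst (snd (snd (snd (gd x))))"
definition "bdel x = fst (snd (snd (snd (snd (gd x)))))"
definition "bLam x = snd (snd (snd (snd (snd (gd x)))))"
definition "bz x = coord (bc x) x"
definition "W x = inv_coord (bc x) ` ball (bz x) (br x)"
definition "W2 x = inv_coord (bc x) ` ball (bz x) (2 * br x)"

lemma good:
 "bc x \<in> A" "x \<in> dom_chart (bc x)" "br x > 0" "br x <= 1/2" "cball (bz x) (8 * br x) <= img_chart (bc x)"
 "bm x > 0" "bM x > 0" "bdel x > 0" "bLam x >= 0"
 "y \<in> cball (bz x) (8 * br x) ==> bm x <= vol_density (bc x) y"
 "y \<in> cball (bz x) (8 * br x) ==> vol_density (bc x) y <= bM x"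
 "y \<in> cball (bz x) (8 * br x) ==> form_trace (omg (bc x) (inv_coord (bc x) y)) <= bLam x"
 "y \<in> cball (bz x) (8 * br x) ==> bdel x * (v \<bullet> v) <= omg (bc x) (inv_coord (bc x) y) v (J v)"
proof -
 have e: "gd x = (bc x, br x, bm x, bM x, bdel x, bLam x)" by (simp add: bc_def br_def bm_def bM_def bdel_def bLam_def)
 have "good x (gd x)" unfolding gd_def by (rule someI_ex[OF good_exists])
 then have G: "good x (bc x, br x, bm x, bM x, bdel x, bLam x)" unfolding e .
 note G' = G[unfolded good_def prod.case, folded bz_def]
 show "bc x \<in> A" "x \<in> dom_chart (bc x)" "br x > 0" "br x <= 1/2" "cball (bz x) (8 * br x) <= img_chart (bc x)"
  "bm x > 0" "bM x > 0" "bdel x > 0" "bLam x >= 0" using G' by blast+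
 assume y: "y \<in> cball (bz x) (8 * br x)"
 then show "bm x <= vol_density (bc x) y" "vol_density (bc x) y <= bM x"
  "form_trace (omg (bc x) (inv_coord (bc x) y)) <= bLam x" "bdel x * (v \<bullet> v) <= omg (bc x) (inv_coord (bc x) y) v (J v)"
  using G' by blast+
qed

lemma W:
 fixes x :: 'm
 shows "x \<in> W x" "W x <= W2 x" "open (W x)" "open (W2 x)"
  "ball (bz x) (2 * br x) <= img_chart (bc x)" "ball (bz x) (br x) <= img_chart (bc x)"
proof -
 have s: "ball (bz x) (2 * br x) <= cball (bz x) (8 * br x)" "ball (bz x) (br x) <= ball (bz x) (2 * br x)"
  using good(3)[of x] by auto
 then show i: "ball (bz x) (2 * br x) <= img_chart (bc x)" "ball (bz x) (br x) <= img_chart (bc x)" using good(5) by blast+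
 show "W x <= W2 x" unfolding W_def W2_def using s(2) by blast
 show "open (W x)" "open (W2 x)" unfolding W_def W2_def by (intro open_inv_image good i open_ball)+
 show "x \<in> W x" unfolding W_def
  by (rule image_eqI[of _ _ "bz x"]) (use good[where x=x] inv_coord_coord in \<open>auto simp: bz_def\<close>)
qed

lemma nn_integral_inv_image:
 assumes c: "c \<in> A" and S: "open S" "S <= img_chart c" and [measurable]: "h \<in> borel_measurable borel"
 shows "(\<integral>\<^sup>+x. h x * indicator (inv_coord c ` S) x \<partial>vol) = (\<integral>\<^sup>+y. ennreal (vol_density c y) * h (inv_coord c y) * indicator S y \<partial>lborel)"
proof -
 have [measurable]: "inv_coord c ` S \<in> sets borel" by (rule inv_image_borel[OF c S])
 have i: "indicator (inv_coord c ` S) (inv_coord c y) = (indicator S y :: ennreal)" if "y \<in> img_chart c" for y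
  using inv_image_iff[OF c S(2) that] by (simp add: indicator_def)
 have "(\<integral>\<^sup>+x. h x * indicator (inv_coord c ` S) x \<partial>vol) = (\<integral>\<^sup>+y. ennreal (vol_density c y) * (h (inv_coord c y) * indicator (inv_coord c ` S) (inv_coord c y)) \<partial>lborel)"
  by (rule nn_integral_vol[OF c]) (use S(2) inv_coord_dom[OF c] in \<open>auto simp: indicator_def\<close>)
 also have "... = (\<integral>\<^sup>+y. ennreal (vol_density c y) * h (inv_coord c y) * indicator S y \<partial>lborel)"
 proof (rule nn_integral_cong)
  fix y
  show "ennreal (vol_density c y) * (h (inv_coord c y) * indicator (inv_coord c ` S) (inv_coord c y)) = ennreal (vol_density c y) * h (inv_coord c y) * indicator S y"
   using i[of y] by (cases "y \<in> img_chart c") (auto simp: vol_density_def[OF c] mult.assoc)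
 qed
 finally show ?thesis .
qed

lemma emeasure_open_pos:
 assumes "open Q" "x \<in> Q"
 shows "emeasure vol Q > 0"
proof -
 obtain c R where c: "c \<in> A" "x \<in> dom_chart c" "R > 0" "cball (coord c x) R <= img_chart c" by (rule chart_ball)
 have "open (coord c ` (Q Int dom_chart c))" "coord c x \<in> coord c ` (Q Int dom_chart c)"
  using open_coord_image[OF c(1) assms(1)] assms(2) c(2) by auto
 then obtain r where r: "r > 0" "cball (coord c x) r <= coord c ` (Q Int dom_chart c)" using open_contains_cball by blast
 let ?B = "ball (coord c x) r"
 have rI: "cball (coord c x) r <= img_chart c" using r by blast
 have B: "open ?B" "?B <= img_chart c" using rI ball_subset_cball[of "coord c x" r] by auto
 obtain m M where m: "0 < m" "!!y. y \<in> cball (coord c x) r ==> m <= vol_density c y"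
  by (rule compact_bounds[OF c(1) compact_cball rI]) blast
 have sub: "inv_coord c ` ?B <= Q"
 proof
  fix w assume "w \<in> inv_coord c ` ?B"
  then obtain y where y: "y \<in> ?B" "w = inv_coord c y" by blast
  then have "y \<in> coord c ` (Q Int dom_chart c)" using r(2) ball_subset_cball[of "coord c x" r] by blast
  then show "w \<in> Q" using y(2) inv_coord_coord[OF c(1)] by auto
 qed
 have "0 < emeasure lborel ?B"
  using content_ball_pos[OF r(1), of "coord c x"] emeasure_bounded_finite[OF bounded_ball, of "coord c x" r]
  by (simp add: measure_def enn2real_positive_iff)
 then have "0 < ennreal m * emeasure lborel ?B" using m(1) by (simp add: ennreal_zero_less_mult_iff)
 also have "... = (\<integral>\<^sup>+y. ennreal m * indicator ?B y \<partial>lborel)" by (rule nn_integral_cmult_indicator[symmetric]) simp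
 also have "... <= (\<integral>\<^sup>+y. ennreal (vol_density c y * indicator ?B y) \<partial>lborel)"
  using m(2) by (intro nn_integral_mono) (auto simp: indicator_def intro!: ennreal_leI)
 also have "... = emeasure vol (inv_coord c ` ?B)" by (rule emeasure_inv_image[OF c(1) B, symmetric])
 also have "... <= emeasure vol Q" by (rule emeasure_mono[OF sub]) (use assms in auto)
 finally show ?thesis .
qed

end

section \<open>De Giorgi's iteration and elementary inequalities\<close>

lemma bump_lower: "norm (z :: 'a::euclidean_space) <= 1/2 ==> bump 3 0 1 z >= 1/4"
proof -
 assume "norm z <= 1/2"
 then have "(norm z)\<^sup>2 <= (1/2)\<^sup>2" by (intro power_mono) auto
 then have "z \<bullet> z <= 1/4" by (simp add: dot_square_norm power2_eq_square)
 then have "3/4 <= 1 - z \<bullet> z" by linarith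
 then have "3/4 <= max 0 (1 - z \<bullet> z)" by (rule max.coboundedI2)
 then have "(3/4) ^ 3 <= (max 0 (1 - z \<bullet> z)) ^ 3" by (rule power_mono) simp
 moreover have "bump 3 0 1 z = (max 0 (1 - z \<bullet> z)) ^ 3" by (simp add: bump_def)
 moreover have "(1/4 :: real) <= (3/4) ^ 3" by (simp add: power3_eq_cube)
 ultimately show ?thesis by linarith
qed

text \<open>The exponent \<open>bt\<close> exceeds 1, so a very small value at a + \<theta> would
  decay geometrically along levels that stay above a + \<theta>/2, against the positivity of
  \<open>m\<close> there. The constant is uniform in \<open>m\<close> and \<open>a\<close>.\<close>

lemma stampacchia:
 fixes B bt p \<theta> :: real
 assumes B: "B > 0" and b: "bt > 1" and p: "p > 0" and th: "\<theta> > 0"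
 shows "\<exists>c>0. \<forall>(m :: real => real) a. (\<forall>s>a. m s > 0) --> (\<forall>s s'. s <= s' --> m s <= m s') -->
  (\<forall>s t. a < s --> s <= a + \<theta> --> t > 0 --> m (s - 3 * t) <= B * t powr (- p) * m s powr bt) --> c <= m (a + \<theta>)"
proof -
 define g where "g = bt - 1"
 define y where "y = p * ln 2"
 define x where "x = ln B - p * ln (\<theta> / 12)"
 \<comment> \<open>The solution of g lc = - x - y / g, which makes the exponent in
   \<open>claim\<close> reproduce itself in the induction.\<close>
 define lc where "lc = - (x + y / g) / g"
 have g: "g > 0" and y: "y > 0" using b p by (auto simp: g_def y_def)
 have glc: "g * lc = - x - y / g" using g by (simp add: lc_def)
 have "exp lc <= m (a + \<theta>)"
  if pos: "!!s. s > a ==> m s > 0" and mono: "!!s s'. s <= s' ==> m s <= m s'"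
   and dec: "!!s t. a < s ==> s <= a + \<theta> ==> t > 0 ==> m (s - 3 * t) <= B * t powr (- p) * m s powr bt" for m :: "real => real" and a
 proof (rule ccontr)
  assume "~ exp lc <= m (a + \<theta>)"
  then have small: "m (a + \<theta>) <= exp lc" by simp
  \<comment> \<open>The levels fall from a + \<theta> towards a + \<theta>/2, and the gap between
    consecutive ones is exactly 3 t k.\<close>
  define s where "s k = a + \<theta> / 2 + \<theta> / 2 * (1/2) ^ k" for k :: nat
  define t where "t k = \<theta> / 12 * (1/2) ^ k" for k :: nat
  have st: "s (Suc k) = s k - 3 * t k" for k by (simp add: s_def t_def)
  have pw: "(1/2::real) ^ k <= 1" "(1/2::real) ^ k > 0" for k by (auto simp: power_le_one)
  have sk: "a < s k" "s k <= a + \<theta>" "a + \<theta> / 2 <= s k" for k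
  proof -
   have "\<theta> / 2 * (1/2) ^ k > 0" "\<theta> / 2 * (1/2) ^ k <= \<theta> / 2 * 1"
    using th pw[of k] by (auto intro!: mult_left_mono)
   then show "a < s k" "s k <= a + \<theta>" "a + \<theta> / 2 <= s k" using th unfolding s_def by linarith+
  qed
  have tk: "t k > 0" for k using th pw[of k] by (simp add: t_def)
  have Bt: "B * t k powr (- p) = exp (x + real k * y)" for k
  proof -
   have "ln (t k) = ln (\<theta> / 12) + ln ((1/2) ^ k)" unfolding t_def using th by (intro ln_mult_pos) auto
   also have "ln ((1/2::real) ^ k) = - real k * ln 2" by (simp add: ln_realpow ln_div)
   finally have lt: "ln (t k) = ln (\<theta> / 12) + - real k * ln 2" .
   have "x + real k * y = ln B + (- p) * ln (t k)" unfolding lt x_def y_def by (simp add: algebra_simps)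
   then have "exp (x + real k * y) = exp (ln B) * exp ((- p) * ln (t k))" by (simp only: exp_add)
   then show ?thesis using B tk[of k] by (simp add: powr_def)
  qed
  have claim: "m (s k) <= exp (lc - real k * y / g)" for k
  proof (induction k)
   case 0
   have "s 0 = a + \<theta>" by (simp add: s_def field_simps)
   then show ?case using small by simp
  next
   case (Suc k)
   have "m (s (Suc k)) <= B * t k powr (- p) * m (s k) powr bt"
    unfolding st by (rule dec[OF sk(1,2) tk])
   also have "... <= exp (x + real k * y) * exp (lc - real k * y / g) powr bt"
    unfolding Bt using Suc pos[OF sk(1)] b by (intro mult_left_mono powr_mono2) (auto intro: less_imp_le)
   also have "... = exp (x + real k * y + bt * (lc - real k * y / g))"
    by (simp add: powr_def exp_add)
   also have "x + real k * y + bt * (lc - real k * y / g) = lc - real (Suc k) * y / g"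
   proof -
    have b: "bt = 1 + g" by (simp add: g_def)
    have "x + real k * y + bt * (lc - real k * y / g) = x + real k * y + lc - real k * y / g + g * lc - g * (real k * y / g)"
    proof -
     have "(1 + g) * (lc - w) = lc - w + g * lc - g * w" for w by (simp add: algebra_simps)
     from this[of "real k * y / g"] show ?thesis unfolding b by linarith
    qed
    also have "g * (real k * y / g) = real k * y" using g by simp
    also have "x + real k * y + lc - real k * y / g + g * lc - real k * y = lc - (real k * y / g + y / g)" unfolding glc by simp
    also have "real k * y / g + y / g = real (Suc k) * y / g" by (simp add: add_divide_distrib[symmetric] distrib_right)
    finally show ?thesis .
   qed
   finally show ?case .
  qed
  have m0: "m (a + \<theta> / 2) > 0" by (rule pos) (use th in simp)
  obtain k :: nat where k: "(lc - ln (m (a + \<theta> / 2))) * g / y < real k" using reals_Archimedean2 by blast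
  then have "lc - ln (m (a + \<theta> / 2)) < real k * y / g" using g y by (simp add: field_simps)
  then have "exp (lc - real k * y / g) < exp (ln (m (a + \<theta> / 2)))" by simp
  also have "... = m (a + \<theta> / 2)" using m0 by simp
  also have "... <= m (s k)" by (rule mono[OF sk(3)])
  finally show False using claim[of k] by simp
 qed
 then show ?thesis by (intro exI[of _ "exp lc"]) simp
qed

text \<open>The constant is (p / e)^p, the maximum of L^p exp (-L); it comes from ln x <= x - 1 at x
  = L / p.\<close>

lemma powr_exp_bound:
 fixes L p :: real
 assumes "L > 0" "p > 0"
 shows "exp (- L) <= exp (p * ln p - p) * L powr (- p)"
proof -
 have "ln (L / p) <= L / p - 1" by (rule ln_le_minus_one) (use assms in simp)
 then have "p * ln (L / p) <= p * (L / p - 1)" using assms by (intro mult_left_mono) auto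
 then have "p * ln L - p * ln p <= L - p" using assms by (simp add: ln_div right_diff_distrib)
 then have "- L <= (p * ln p - p) + (- p) * ln L" by simp
 then have "exp (- L) <= exp ((p * ln p - p) + (- p) * ln L)" by simp
 also have "... = exp (p * ln p - p) * L powr (- p)" using assms unfolding exp_add by (simp add: powr_def)
 finally show ?thesis .
qed

section \<open>Integral bounds below the maximum of a potential\<close>

context kaehler
begin

text \<open>The trace of \<open>omega_pot\<close> is nonnegative, so in the chart the Laplacian of
  \<open>f\<close> is at least -\<open>bLam x\<close>. The mean value inequality at x' then bounds a
  weighted integral of s - f, with one constant for all potentials.\<close>

lemma submean:
 "\<exists>K\<ge>0. \<forall>f s x'. psh f --> (\<forall>y. f y <= s) --> x' \<in> W x -->
  (\<integral>\<^sup>+w. ennreal (s - f w) * indicator (W2 x) w \<partial>vol) <= ennreal (K * (s - f x' + 1))"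
proof -
 \<comment> \<open>Balls of radius 6 r around points of the r-ball stay in the 8 r-ball, and the 2
   r-ball lies within R/2 of each such point, where the kernel is at least 1/4.\<close>
 define R where "R = 6 * br x"
 define Z where "Z = (LBINT z. bump 3 (0 :: complex ^ 'n) 1 z)"
 define Z4 where "Z4 = (LBINT z. bump 4 (0 :: complex ^ 'n) 1 z)"
 have Z: "Z > 0" unfolding Z_def by (rule bump_integral_pos) auto
 have Z4: "Z4 > 0" unfolding Z4_def by (rule bump_integral_pos) auto
 have r: "br x > 0" by (rule good)
 have R: "R > 0" using r by (simp add: R_def)
 define e where "e = bLam x * R\<^sup>2 / 16 * Z4"
 have e: "e >= 0" unfolding e_def using good(9)[of x] Z4 by simp
 define K where "K = bM x * (R ^ DIM(complex ^ 'n) * (4 * (Z + e)))"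
 have K: "K >= 0" unfolding K_def using good(7)[of x] R Z e by simp
 have "(\<integral>\<^sup>+w. ennreal (s - f w) * indicator (W2 x) w \<partial>vol) <= ennreal (K * (s - f x' + 1))"
  if f: "psh f" and s: "!!y. f y <= s" and x': "x' \<in> W x" for f s x'
 proof -
  let ?c = "bc x" and ?z = "bz x" and ?r = "br x"
  obtain y' where y': "y' \<in> ball ?z ?r" "x' = inv_coord ?c y'" using x' unfolding W_def by (rule imageE) blast
  have c: "?c \<in> A" by (rule good)
  let ?f = "%y. f (inv_coord ?c y)"
  obtain D H where D: "C2_on (img_chart ?c) ?f D H"
   "!!y. y \<in> img_chart ?c ==> pos_form (omega_pot omg f ?c (inv_coord ?c y))"
   "!!y. y \<in> img_chart ?c ==> form_trace (omega_pot omg f ?c (inv_coord ?c y)) = form_trace (omg ?c (inv_coord ?c y)) + laplacian H y"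
   by (rule psh_chart[OF f c]) blast
  have in8: "cball y' R <= cball ?z (8 * ?r)"
  proof
   fix w assume "w \<in> cball y' R"
   then have "dist y' w <= 6 * ?r" "dist ?z y' < ?r" using y' by (auto simp: R_def)
   then show "w \<in> cball ?z (8 * ?r)" using dist_triangle[of ?z w y'] r by simp
  qed
  have sub: "cball y' R <= img_chart ?c" using in8 good(5)[of x] by (rule subset_trans)
  have lap: "laplacian H w >= - bLam x" if w: "w \<in> cball y' R" for w
  proof -
   have wi: "w \<in> img_chart ?c" and w8: "w \<in> cball ?z (8 * ?r)" using w sub in8 by blast+
   show ?thesis using form_trace_nonneg[OF D(2)[OF wi]] D(3)[OF wi] good(12)[OF w8] by linarith
  qed
  define I where "I = (LBINT zt. ?f (y' + R *\<^sub>R zt) * bump 3 0 1 zt)"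
  have km: "?f y' * Z <= I + e"
   unfolding I_def Z_def e_def Z4_def
   by (rule kernel_mean_ge[OF open_img[OF c] sub less_imp_le[OF R] D(1) lap])
  have iI: "integrable lborel (%zt. ?f (y' + R *\<^sub>R zt) * bump 3 0 1 zt)"
   by (rule kernel_mean_deriv(2)[OF open_img[OF c] sub D(1), of R]) (use R in simp)
  have ib: "integrable lborel (%zt. s * bump 3 (0 :: complex ^ 'n) 1 zt)"
   by (intro integrable_mult_right bump_integrable) auto
  define q where "q y = indicator (cball ?z (2 * ?r)) y *\<^sub>R (s - ?f y)" for y
  have sub2: "cball ?z (2 * ?r) <= img_chart ?c" using good(5)[of x] r by (intro subset_trans[OF _ good(5)]) auto
  have iq: "integrable lborel q"
   unfolding q_def
   by (intro borel_integrable_compact compact_cball continuous_intros continuous_on_subset[OF C1_onD(1)[OF C2_onD(1)[OF D(1)]] sub2])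
  have qm: "q \<in> borel_measurable borel" using borel_measurable_integrable[OF iq] by simp
  have q0: "q y >= 0" for y unfolding q_def using s[of "inv_coord ?c y"] by (simp add: indicator_def)
  have "(LBINT y. q y) = R ^ DIM(complex ^ 'n) * (LBINT zt. q (y' + R *\<^sub>R zt))"
   by (rule lborel_integral_affine[OF qm R])
  also have "... <= R ^ DIM(complex ^ 'n) * (LBINT zt. 4 * (s * bump 3 0 1 zt - ?f (y' + R *\<^sub>R zt) * bump 3 0 1 zt))"
  proof (intro mult_left_mono integral_mono)
   show "integrable lborel (%zt. q (y' + R *\<^sub>R zt))" by (rule lborel_integrable_affine[OF iq R])
   show "integrable lborel (%zt. 4 * (s * bump 3 0 1 zt - ?f (y' + R *\<^sub>R zt) * bump 3 0 1 zt))"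
    by (intro integrable_mult_right Bochner_Integration.integrable_diff ib iI)
   fix zt :: "complex ^ 'n"
   let ?w = "y' + R *\<^sub>R zt"
   have nn: "s - ?f ?w >= 0" using s[of "inv_coord ?c ?w"] by simp
   show "q ?w <= 4 * (s * bump 3 0 1 zt - ?f ?w * bump 3 0 1 zt)"
   proof (cases "?w \<in> cball ?z (2 * ?r)")
    case True
    then have "dist ?z ?w <= 2 * ?r" "dist ?z y' <= ?r" using y' by auto
    then have "dist y' ?w <= 3 * ?r" using dist_triangle[of y' ?w ?z] by (simp add: dist_commute)
    then have "R * norm zt <= 3 * ?r" using R by (simp add: dist_norm)
    then have "norm zt <= 1/2" using r by (simp add: R_def)
    then have "1/4 <= bump 3 0 1 zt" by (rule bump_lower)
    then have "(s - ?f ?w) * (1/4) <= (s - ?f ?w) * bump 3 0 1 zt" using nn by (intro mult_left_mono)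
    then show ?thesis using True by (simp add: q_def algebra_simps)
   next
    case False
    have "(s - ?f ?w) * bump 3 0 1 zt >= 0" using nn by simp
    then show ?thesis using False by (simp add: q_def algebra_simps)
   qed
  qed (use R in simp)
  also have "(LBINT zt. 4 * (s * bump 3 0 1 zt - ?f (y' + R *\<^sub>R zt) * bump 3 0 1 zt)) = 4 * (s * Z - I)"
   unfolding I_def Z_def integral_mult_right_zero Bochner_Integration.integral_diff[OF ib iI] ..
  also have "R ^ DIM(complex ^ 'n) * (4 * (s * Z - I)) <= R ^ DIM(complex ^ 'n) * (4 * ((Z + e) * (s - ?f y' + 1)))"
  proof (intro mult_left_mono)
   have "s * Z - I <= (s - ?f y') * Z + e" using km by (simp add: algebra_simps)
   also have "... <= (Z + e) * (s - ?f y' + 1)" 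
   proof -
    have "e * (s - ?f y') >= 0" using e s[of "inv_coord ?c y'"] by simp
    moreover have "(Z + e) * (s - ?f y' + 1) = (s - ?f y') * Z + e + Z + e * (s - ?f y')" by (simp add: algebra_simps)
    ultimately show ?thesis using Z by linarith
   qed
   finally show "s * Z - I <= (Z + e) * (s - ?f y' + 1)" .
  qed (use R in auto)
  finally have qI: "(LBINT y. q y) <= R ^ DIM(complex ^ 'n) * (4 * ((Z + e) * (s - f x' + 1)))" unfolding y'(2) .
  have fm: "f \<in> borel_measurable borel" by (rule psh_measurable[OF f])
  have "(\<integral>\<^sup>+w. ennreal (s - f w) * indicator (W2 x) w \<partial>vol) =
   (\<integral>\<^sup>+y. ennreal (vol_density ?c y) * ennreal (s - ?f y) * indicator (ball ?z (2 * ?r)) y \<partial>lborel)"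
   unfolding W2_def by (rule nn_integral_inv_image[OF c open_ball W(5)]) (use fm in measurable)
  also have "... <= (\<integral>\<^sup>+y. ennreal (bM x * q y) \<partial>lborel)"
  proof (rule nn_integral_mono)
   fix y
   show "ennreal (vol_density ?c y) * ennreal (s - ?f y) * indicator (ball ?z (2 * ?r)) y <= ennreal (bM x * q y)"
   proof (cases "y \<in> ball ?z (2 * ?r)")
    case True
    then have "y \<in> cball ?z (8 * ?r)" using r by simp
    then have "vol_density ?c y <= bM x" by (rule good(11))
    then have "vol_density ?c y * (s - ?f y) <= bM x * (s - ?f y)" using s[of "inv_coord ?c y"] by (intro mult_right_mono) auto
    then show ?thesis using True vol_density_nonneg[OF c, of y] s[of "inv_coord ?c y"]
     by (simp add: q_def ennreal_mult[symmetric] ennreal_leI)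
   qed simp
  qed
  also have "... = ennreal (LBINT y. bM x * q y)"
   by (rule nn_integral_eq_integral) (use iq q0 good(7)[of x] in auto)
  also have "... <= ennreal (K * (s - f x' + 1))"
  proof (rule ennreal_leI)
   have "bM x * (LBINT y. q y) <= bM x * (R ^ DIM(complex ^ 'n) * (4 * ((Z + e) * (s - f x' + 1))))"
    using qI good(7)[of x] by (intro mult_left_mono) auto
   then show "(LBINT y. bM x * q y) <= K * (s - f x' + 1)" unfolding K_def by (simp only: mult.assoc integral_mult_right_zero)
  qed
  finally show ?thesis .
 qed
 then show ?thesis using K by blast
qed

definition "Ksub x = (SOME K. K >= 0 & (\<forall>f s x'. psh f --> (\<forall>y. f y <= s) --> x' \<in> W x -->
  (\<integral>\<^sup>+w. ennreal (s - f w) * indicator (W2 x) w \<partial>vol) <= ennreal (K * (s - f x' + 1))))"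

lemma Ksub: "Ksub x >= 0"
 "psh f ==> (!!y. f y <= s) ==> x' \<in> W x ==>
  (\<integral>\<^sup>+w. ennreal (s - f w) * indicator (W2 x) w \<partial>vol) <= ennreal (Ksub x * (s - f x' + 1))"
proof -
 have "Ksub x >= 0 & (\<forall>f s x'. psh f --> (\<forall>y. f y <= s) --> x' \<in> W x -->
  (\<integral>\<^sup>+w. ennreal (s - f w) * indicator (W2 x) w \<partial>vol) <= ennreal (Ksub x * (s - f x' + 1)))"
  unfolding Ksub_def by (rule someI_ex[OF submean])
 then show "Ksub x >= 0" "psh f ==> (!!y. f y <= s) ==> x' \<in> W x ==>
  (\<integral>\<^sup>+w. ennreal (s - f w) * indicator (W2 x) w \<partial>vol) <= ennreal (Ksub x * (s - f x' + 1))" by blast+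
qed

text \<open>A Harnack-type transfer: a potential that is close to its bound \<open>s\<close>
  somewhere in \<open>W x\<close> is so somewhere in \<open>W x'\<close>, with a constant
  independent of the potential.\<close>

definition linked :: "'m => 'm => real => bool" where
 "linked x x' K \<longleftrightarrow> K >= 0 & (\<forall>f s a. psh f --> (\<forall>y. f y <= s) --> (\<exists>y\<in>W x. s - f y <= a) --> (\<exists>y\<in>W x'. s - f y <= K * (a + 1)))"

lemma linkedD: "linked x x' K ==> psh f ==> (!!y. f y <= s) ==> y \<in> W x ==> s - f y <= a ==> \<exists>y\<in>W x'. s - f y <= K * (a + 1)"
 unfolding linked_def by blast

text \<open>If s - f were large on the whole overlap, which has positive volume, its integral over
  \<open>W2 x\<close> would exceed the bound given by \<open>Ksub\<close>.\<close>

lemma linked_overlap: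
 assumes "W x Int W x' ~= {}"
 shows "\<exists>K. linked x x' K"
proof -
 let ?Q = "W x Int W x'"
 have Q: "open ?Q" using W(3)[of x] W(3)[of x'] by blast
 interpret finite_measure vol by (rule finite_measure_vol)
 define V where "V = measure vol ?Q"
 obtain w where "w \<in> ?Q" using assms by blast
 then have "emeasure vol ?Q > 0" by (rule emeasure_open_pos[OF Q])
 then have V: "V > 0" unfolding V_def by (simp add: emeasure_eq_measure)
 define K where "K = (Ksub x + 1) / V"
 have K: "K >= 0" using Ksub(1)[of x] V by (simp add: K_def)
 have "\<exists>y\<in>W x'. s - f y <= K * (a + 1)"
  if f: "psh f" and s: "!!y. f y <= s" and y: "y \<in> W x" "s - f y <= a" for f s a y
 proof (rule ccontr)
  assume "~ ?thesis"
  then have big: "K * (a + 1) <= s - f w" if "w \<in> ?Q" for w using that by force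
  have a0: "a >= 0" using s[of y] y(2) by linarith
  have "ennreal (K * (a + 1) * V) = ennreal (K * (a + 1)) * emeasure vol ?Q"
   unfolding V_def emeasure_eq_measure using K a0 by (simp add: ennreal_mult)
  also have "... = (\<integral>\<^sup>+w. ennreal (K * (a + 1)) * indicator ?Q w \<partial>vol)"
   by (rule nn_integral_cmult_indicator[symmetric]) (use Q in simp)
  also have "... <= (\<integral>\<^sup>+w. ennreal (s - f w) * indicator (W2 x) w \<partial>vol)"
  proof (rule nn_integral_mono)
   fix w
   show "ennreal (K * (a + 1)) * indicator ?Q w <= ennreal (s - f w) * indicator (W2 x) w"
   proof (cases "w \<in> ?Q")
    case True
    then have "w \<in> W2 x" using W(2)[of x] by blast
    then show ?thesis using True ennreal_leI[OF big[OF True]] by simp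
   qed simp
  qed
  also have "... <= ennreal (Ksub x * (s - f y + 1))" by (rule Ksub(2)[OF f s y(1)])
  also have "... <= ennreal (Ksub x * (a + 1))" using y(2) Ksub(1)[of x] by (intro ennreal_leI mult_left_mono) auto
  finally have "K * (a + 1) * V <= Ksub x * (a + 1)" using a0 Ksub(1)[of x] by (subst (asm) ennreal_le_iff) auto
  moreover have "K * (a + 1) * V = (Ksub x + 1) * (a + 1)" using V by (simp add: K_def)
  ultimately show False using a0 by (simp add: algebra_simps)
 qed
 then have "linked x x' K" unfolding linked_def using K by blast
 then show ?thesis by blast
qed

lemma linked_trans:
 assumes "linked x x' K" "linked x' x'' L"
 shows "\<exists>K. linked x x'' K"
proof -
 have KL: "K >= 0" "L >= 0" using assms unfolding linked_def by blast+
 have "\<exists>y\<in>W x''. s - f y <= (L * (K + 1)) * (a + 1)"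
  if f: "psh f" and s: "!!y. f y <= s" and y: "y \<in> W x" "s - f y <= a" for f s a y
 proof -
  have a0: "a >= 0" using s[of y] y(2) by linarith
  obtain y' where y': "y' \<in> W x'" "s - f y' <= K * (a + 1)" using linkedD[OF assms(1) f s y] by blast
  obtain y'' where y'': "y'' \<in> W x''" "s - f y'' <= L * (K * (a + 1) + 1)" using linkedD[OF assms(2) f s y'] by blast
  have "L * (K * (a + 1) + 1) <= L * ((K + 1) * (a + 1))" using KL a0 by (intro mult_left_mono) (auto simp: algebra_simps)
  then show ?thesis using y'' by (intro bexI[of _ y'']) (auto simp: mult.assoc)
 qed
 then have "linked x x'' (L * (K + 1))" unfolding linked_def using KL by (intro conjI allI impI) auto
 then show ?thesis by blast
qed

text \<open>The sets \<open>W\<close> of the points linked to \<open>x\<close> and of the remaining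
  points would otherwise split the connected manifold into two disjoint nonempty open sets.\<close>

lemma linked_all: "\<exists>K. linked x x' K"
proof -
 define G where "G = {x'. \<exists>K. linked x x' K}"
 define P where "P = (\<Union>x'\<in>G. W x')"
 define Q where "Q = (\<Union>x'\<in>- G. W x')"
 have o: "open P" "open Q" unfolding P_def Q_def by (intro open_UN ballI W)+
 have un: "P Un Q = UNIV"
 proof -
  have "y \<in> P Un Q" for y unfolding P_def Q_def using W(1)[of y] by blast
  then show ?thesis by blast
 qed
 have dis: "P Int Q = {}"
 proof (rule ccontr)
  assume "P Int Q ~= {}"
  then obtain a b where ab: "a \<in> G" "b ~: G" "W a Int W b ~= {}" unfolding P_def Q_def by blast
  obtain K L where "linked x a K" "linked a b L" using ab(1) linked_overlap[OF ab(3)] unfolding G_def by blast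
  then have "b \<in> G" using linked_trans unfolding G_def by blast
  then show False using ab(2) by blast
 qed
 have "W x Int W x ~= {}" using W(1)[of x] by blast
 then have "x \<in> G" unfolding G_def using linked_overlap by blast
 then have "P ~= {}" unfolding P_def using W(1)[of x] by blast
 then have "Q = {}" using connectedD[OF connected_M o] un dis by blast
 then have "x' \<in> G" unfolding Q_def using W(1)[of x'] by blast
 then show ?thesis by (simp add: G_def)
qed

definition "Klink x x' = (SOME K. linked x x' K)"

lemma Klink: "linked x x' (Klink x x')"
 unfolding Klink_def by (rule someI_ex[OF linked_all])

lemma finite_W_cover: "\<exists>Q. finite Q & (\<Union>x\<in>Q. W x) = UNIV"
proof -
 obtain Q where "finite Q" "UNIV <= (\<Union>x\<in>Q. W x)"
  by (rule compactE_image[OF compact_M, of UNIV W]) (use W(1,3) in auto)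
 then show ?thesis by blast
qed

lemma nn_integral_le_cover:
 assumes Q: "finite Q" "(\<Union>x\<in>Q. W x) = UNIV" and h [measurable]: "h \<in> borel_measurable borel"
 shows "(\<integral>\<^sup>+w. h w \<partial>vol) <= (\<Sum>x\<in>Q. \<integral>\<^sup>+w. h w * indicator (W x) w \<partial>vol)"
proof -
 have [measurable]: "W x \<in> sets borel" for x using W(3)[of x] by simp
 have "(\<integral>\<^sup>+w. h w \<partial>vol) <= (\<integral>\<^sup>+w. (\<Sum>x\<in>Q. h w * indicator (W x) w) \<partial>vol)"
 proof (rule nn_integral_mono)
  fix w
  obtain x where x: "x \<in> Q" "w \<in> W x" using Q(2) by blast
  have "h w = h w * indicator (W x) w" using x by simp
  also have "... <= (\<Sum>x\<in>Q. h w * indicator (W x) w)"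
   by (rule member_le_sum[OF x(1) _ Q(1)]) simp
  finally show "h w <= (\<Sum>x\<in>Q. h w * indicator (W x) w)" .
 qed
 also have "... = (\<Sum>x\<in>Q. \<integral>\<^sup>+w. h w * indicator (W x) w \<partial>vol)" by (rule nn_integral_sum) simp
 finally show ?thesis .
qed

text \<open>The maximum lies in some \<open>W a\<close>. Links from \<open>a\<close> carry a point
  with bounded s - f into every set of a finite cover, and \<open>Ksub\<close> integrates from
  there.\<close>

lemma L1_bound: "\<exists>C\<ge>0. \<forall>f s. psh f --> (\<forall>y. f y <= s) --> (\<exists>x. f x = s) --> (\<integral>\<^sup>+w. ennreal (s - f w) \<partial>vol) <= ennreal C"
proof -
 obtain Q where Q: "finite Q" "(\<Union>x\<in>Q. W x) = UNIV" using finite_W_cover by blast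
 define k where "k x a = Ksub x * (Klink a x * (0 + 1) + 1)" for x a
 have kl: "Klink a x >= 0" for a x using Klink[of a x] unfolding linked_def by blast
 have k0: "k x a >= 0" for x a unfolding k_def using Ksub(1)[of x] kl[of a x] by simp
 define C where "C = (\<Sum>x\<in>Q. \<Sum>a\<in>Q. k x a)"
 have C0: "C >= 0" unfolding C_def by (intro sum_nonneg k0)
 have "(\<integral>\<^sup>+w. ennreal (s - f w) \<partial>vol) <= ennreal C"
  if f: "psh f" and s: "!!y. f y <= s" and x0: "f x0 = s" for f s x0
 proof -
  note fm [measurable] = psh_measurable[OF f]
  obtain a where a: "a \<in> Q" "x0 \<in> W a" using Q(2) by blast
  have "(\<integral>\<^sup>+w. ennreal (s - f w) \<partial>vol) <= (\<Sum>x\<in>Q. \<integral>\<^sup>+w. ennreal (s - f w) * indicator (W x) w \<partial>vol)"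
   by (rule nn_integral_le_cover[OF Q]) measurable
  also have "... <= (\<Sum>x\<in>Q. ennreal (\<Sum>a\<in>Q. k x a))"
  proof (rule sum_mono)
   fix x assume "x \<in> Q"
   obtain y where y: "y \<in> W x" "s - f y <= Klink a x * (0 + 1)"
    using linkedD[OF Klink f s a(2), of 0 x] x0 by auto
   have "(\<integral>\<^sup>+w. ennreal (s - f w) * indicator (W x) w \<partial>vol) <= (\<integral>\<^sup>+w. ennreal (s - f w) * indicator (W2 x) w \<partial>vol)"
    using W(2)[of x] by (intro nn_integral_mono mult_left_mono) (auto simp: indicator_def)
   also have "... <= ennreal (Ksub x * (s - f y + 1))" by (rule Ksub(2)[OF f s y(1)])
   also have "... <= ennreal (k x a)" unfolding k_def using y(2) Ksub(1)[of x] by (intro ennreal_leI mult_left_mono) auto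
   also have "... <= ennreal (\<Sum>a\<in>Q. k x a)" by (intro ennreal_leI member_le_sum[OF a(1)] k0 Q(1))
   finally show "(\<integral>\<^sup>+w. ennreal (s - f w) * indicator (W x) w \<partial>vol) <= ennreal (\<Sum>a\<in>Q. k x a)" .
  qed
  also have "... = ennreal C" unfolding C_def by (intro sum_ennreal sum_nonneg k0)
  finally show ?thesis .
 qed
 then show ?thesis using C0 by blast
qed

end

section \<open>Oscillation under a bound of the Monge-Ampere measure\<close>

lemma ddc_inner: "ddc (%a b. 2 * (a \<bullet> b)) v (J v) = 2 * (v \<bullet> v)" for v :: "complex ^ 'n::finite"
proof -
 have b: "bilinear (%a b :: complex ^ 'n. 2 * (a \<bullet> b))"
  using C2_onD(4)[OF C2_on_sqdist[of UNIV 0 0], of 0] by simp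
 have "J v \<bullet> J v = v \<bullet> v" by (rule inner_J_J)
 then show ?thesis using ddc_herm(2)[OF b, of v] by (simp add: inner_commute)
qed

context kaehler
begin

abbreviation entropy_le :: "real => ('m => real) => real => bool" where
 "entropy_le p F E == (\<integral>\<^sup>+w. ennreal (\<bar>F w\<bar> powr p * exp (real CARD('n) * F w)) \<partial>vol) <= ennreal E"

text \<open>The bound is asked only where \<open>f\<close> is within 1 of its value at
  \<open>x0\<close>, because for small times with a very negative minimum the flow provides it only
  there.\<close>

abbreviation ma_le :: "real => ('m => real) => ('m => real) => 'm => bool" where
 "ma_le C1 f F x0 == \<forall>c\<in>A. \<forall>y\<in>dom_chart c. f y <= f x0 + 1 --> top_power (omega_pot omg f c y) <= C1 * exp (real CARD('n) * F y) * top_power (omg c y)"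

abbreviation log_ratio :: "('m => real) => ('m => real) => bool" where
 "log_ratio f g == \<forall>c\<in>A. \<forall>y\<in>dom_chart c. g y = ln (top_power (omega_pot omg f c y) / top_power (omg c y))"

lemma chart_integral_le:
 assumes h [measurable]: "h \<in> borel_measurable borel" and S [measurable]: "S \<in> sets borel" "S <= ball (bz x) (2 * br x)"
 shows "ennreal (bm x) * (\<integral>\<^sup>+y. h (extend_inv (bc x) y) * indicator S y \<partial>lborel) <= (\<integral>\<^sup>+w. h w \<partial>vol)"
proof -
 let ?c = "bc x" and ?B = "ball (bz x) (2 * br x)"
 have c: "?c \<in> A" by (rule good)
 note [measurable] = extend_inv_measurable[OF c]
 have [measurable]: "W2 x \<in> sets borel" using W(4)[of x] by simp
 have "ennreal (bm x) * (\<integral>\<^sup>+y. h (extend_inv ?c y) * indicator S y \<partial>lborel) = (\<integral>\<^sup>+y. ennreal (bm x) * (h (extend_inv ?c y) * indicator S y) \<partial>lborel)"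
  by (rule nn_integral_cmult[symmetric]) measurable
 also have "... <= (\<integral>\<^sup>+y. ennreal (vol_density ?c y) * h (inv_coord ?c y) * indicator ?B y \<partial>lborel)"
 proof (rule nn_integral_mono)
  fix y
  show "ennreal (bm x) * (h (extend_inv ?c y) * indicator S y) <= ennreal (vol_density ?c y) * h (inv_coord ?c y) * indicator ?B y"
  proof (cases "y \<in> S")
   case True
   then have B: "y \<in> ?B" using S(2) by blast
   then have "y \<in> cball (bz x) (8 * br x)" using good(3)[of x] by simp
   then have "bm x <= vol_density ?c y" by (rule good(10))
   moreover have "extend_inv ?c y = inv_coord ?c y" using W(5)[of x] B by (auto simp: extend_inv_def[OF c])
   ultimately show ?thesis using True B by (auto intro!: mult_right_mono ennreal_leI)
  qed simp
 qed
 also have "... = (\<integral>\<^sup>+w. h w * indicator (W2 x) w \<partial>vol)"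
  unfolding W2_def by (rule nn_integral_inv_image[OF c open_ball W(5) h, symmetric])
 also have "... <= (\<integral>\<^sup>+w. h w \<partial>vol)" by (intro nn_integral_mono) (simp add: indicator_def)
 finally show ?thesis .
qed

text \<open>Where F exceeds \<open>k\<close>, the factor k^(-p) |F|^p is at least 1. Such a split,
  at varying levels, is how the entropy controls exp (n F).\<close>

lemma exp_split:
 fixes F :: "'m => real"
 assumes p: "p > 0" and k: "k > 0"
 shows "exp (real CARD('n) * F w) <= exp (real CARD('n) * k) + k powr (- p) * (\<bar>F w\<bar> powr p * exp (real CARD('n) * F w))"
proof (cases "F w <= k")
 case True
 then have "exp (real CARD('n) * F w) <= exp (real CARD('n) * k)" by (simp add: mult_left_mono)
 moreover have "k powr (- p) * (\<bar>F w\<bar> powr p * exp (real CARD('n) * F w)) >= 0" by simp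
 ultimately show ?thesis by linarith
next
 case False
 have "k powr p <= \<bar>F w\<bar> powr p" using False k p by (intro powr_mono2) auto
 then have "1 <= k powr (- p) * \<bar>F w\<bar> powr p" using k by (simp add: powr_minus field_simps)
 then have "1 * exp (real CARD('n) * F w) <= k powr (- p) * \<bar>F w\<bar> powr p * exp (real CARD('n) * F w)" by (intro mult_right_mono) auto
 then show ?thesis by (simp add: mult.assoc add_increasing)
qed

text \<open>The sublevel masses of \<open>u = f + \<delta>|z - y\<^sub>0|\<^sup>2/2\<close> satisfy the decay estimate of De Giorgi's iteration, since
 \<open>decay\<close> bounds the volume of a sublevel exponentially in the inverse of the mass of a larger one.\<close>

lemma sublevel_mass_bound:
 assumes C1: "C1 > 0" and p: "p > real CARD('n)"
 shows "\<exists>c>0. (\<forall>f F x0. psh f --> F \<in> borel_measurable borel -->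
  entropy_le p F E --> x0 \<in> W x --> (\<forall>y. f x0 <= f y) -->
  ma_le C1 f F x0 -->
  ennreal c <= (\<integral>\<^sup>+w. ennreal (exp (real CARD('n) * F w)) * indicator {w. f w <= f x0 + 1} w \<partial>vol))"
proof -
 let ?n = "real CARD('n)" and ?S = "top_power (std_form :: complex ^ 'n => _)"
 let ?c = "bc x" and ?z = "bz x" and ?r = "br x"
 interpret finite_measure vol by (rule finite_measure_vol)
 have n1: "?n >= 1" using zero_less_card_finite[where 'a='n] by linarith
 have p0: "p > 0" using p n1 by linarith
 have r: "?r > 0" "?r <= 1/2" by (rule good)+
 have c: "?c \<in> A" by (rule good)
 define Z where "Z = (LBINT z. bump 3 (0 :: complex ^ 'n) 1 z)"
 define Z4 where "Z4 = (LBINT z. bump 4 (0 :: complex ^ 'n) 1 z)"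
 have Z: "Z > 0" unfolding Z_def by (rule bump_integral_pos) auto
 have Z4: "Z4 > 0" unfolding Z4_def by (rule bump_integral_pos) auto
 have S: "?S > 0" by (rule top_power_std_form_pos)
 define \<delta> where "\<delta> = bdel x"
 have \<delta>: "\<delta> > 0" unfolding \<delta>_def by (rule good)
 have bm: "bm x > 0" and bM: "bM x > 0" by (rule good)+
 define E1 where "E1 = max E 0 / bm x"
 have E1: "E1 >= 0" using bm by (simp add: E1_def)
 define V where "V = measure vol UNIV"
 define Mt where "Mt = (exp ?n * V + max E 0) / bm x"
 have Mt: "Mt >= 0" using bm by (simp add: Mt_def V_def)
 \<comment> \<open>The bound 1 keeps the levels in the range where \<open>ma\<close> holds; the
   other bound keeps a + \<theta> below the values of \<open>u\<close> on the boundary sphere, which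
   makes the sublevel sets compact in \<open>U\<close>.\<close>
 define \<theta> where "\<theta> = min 1 (\<delta> * ?r\<^sup>2 / 4)"
 have \<theta>: "\<theta> > 0" "\<theta> <= 1" "\<theta> < \<delta> / 2 * ?r\<^sup>2" using \<delta> r by (auto simp: \<theta>_def min_def)
 \<comment> \<open>The constant in the smallness assumption of \<open>decay\<close>, with the mass
   estimated by C1 \<open>bM x\<close> times the integral of exp (n F).\<close>
 define \<kappa> where "\<kappa> = 8 * ?n * 16 ^ (CARD('n) - 1) / (?S * Z) * (C1 * bM x)"
 have \<kappa>: "\<kappa> > 0" unfolding \<kappa>_def using S Z C1 bM by simp
 \<comment> \<open>The three summands come from the volume decay, from the entropy above the
   splitting level, and from the total mass \<open>Mt\<close> in the case L < 1.\<close>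
 define B1 where "B1 = exp 2 * Z4 / 16 * exp (p * ln p - p) + ?n powr p * E1 + Mt"
 have B1: "B1 > 0" unfolding B1_def using Z4 E1 Mt by (intro add_pos_nonneg) auto
 define bt where "bt = p / ?n"
 \<comment> \<open>Here the exponent of the entropy has to exceed n: only then does the iteration
   gain.\<close>
 have bt: "bt > 1" using p n1 by (simp add: bt_def)
 obtain c0 where c0: "c0 > 0" "!!m a. (\<forall>s>a. m s > 0) ==> (\<forall>s s'. s <= s' --> m s <= m s') ==>
  (\<forall>s t. a < s --> s <= a + \<theta> --> t > 0 --> m (s - 3 * t) <= (B1 * \<kappa> powr bt) * t powr (- p) * m s powr bt) ==> c0 <= m (a + \<theta>)"
 proof -
  have "B1 * \<kappa> powr bt > 0" using B1 \<kappa> by simp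
  from stampacchia[OF this bt p0 \<theta>(1)] show ?thesis using that by blast
 qed
 have "ennreal (bm x * c0) <= (\<integral>\<^sup>+w. ennreal (exp (?n * F w)) * indicator {w. f w <= f x0 + 1} w \<partial>vol)"
  if f: "psh f" and F [measurable]: "F \<in> borel_measurable borel"
   and Ent: "entropy_le p F E" and x0: "x0 \<in> W x" and min: "!!y. f x0 <= f y"
   and ma: "!!c y. c \<in> A ==> y \<in> dom_chart c ==> f y <= f x0 + 1 ==> top_power (omega_pot omg f c y) <= C1 * exp (?n * F y) * top_power (omg c y)"
  for f F x0
 proof -
  note [measurable] = extend_inv_measurable[OF c] psh_measurable[OF f]
  define a where "a = f x0"
  obtain y0 where y0: "y0 \<in> ball ?z ?r" "x0 = inv_coord ?c y0" using x0 unfolding W_def by (rule imageE) blast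
  let ?f = "%y. f (inv_coord ?c y)"
  obtain D H where D: "C2_on (img_chart ?c) ?f D H"
   "!!y. y \<in> img_chart ?c ==> omega_pot omg f ?c (inv_coord ?c y) = (%u v. 1 * omg ?c (inv_coord ?c y) u v + 1 * ddc (H y) u v)"
   "!!y. y \<in> img_chart ?c ==> pos_form (omega_pot omg f ?c (inv_coord ?c y))"
   "weakly_closed (img_chart ?c) (%y. omega_pot omg f ?c (inv_coord ?c y))"
   by (rule psh_chart[OF f c]) blast
  define U where "U = ball y0 ?r"
  have cb2: "cball y0 ?r <= ball ?z (2 * ?r)"
  proof
   fix w assume "w \<in> cball y0 ?r"
   then have "dist y0 w <= ?r" "dist ?z y0 < ?r" using y0 by auto
   then show "w \<in> ball ?z (2 * ?r)" using dist_triangle[of ?z w y0] by simp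
  qed
  have Ub: "U <= cball y0 ?r" unfolding U_def by (rule ball_subset_cball)
  have U2: "U <= ball ?z (2 * ?r)" using Ub cb2 by (rule subset_trans)
  have cbi: "cball y0 ?r <= img_chart ?c" using cb2 W(5)[of x] by (rule subset_trans)
  have Ui: "U <= img_chart ?c" using Ub cbi by (rule subset_trans)
  have U8: "y \<in> cball ?z (8 * ?r)" if "y \<in> U" for y using subsetD[OF U2 that] r by simp
  have Uo: "open U" and Um [measurable]: "U \<in> sets borel" by (simp_all add: U_def)
  \<comment> \<open>The quadratic term lifts \<open>u\<close> above the minimum away from
    \<open>y0\<close>, while its \<open>ddc\<close>, which is \<delta> times the standard form,
    stays below \<open>omg\<close>; hence \<open>ddc\<close> of \<open>u\<close> is at most
    \<open>X\<close>.\<close>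
  define u where "u y = 1 * ?f y + \<delta> / 2 * ((y - y0) \<bullet> (y - y0) + 0)" for y
  define X where "X y = omega_pot omg f ?c (inv_coord ?c y)" for y
  have u2: "C2_on V u (%y v. 1 * D y v + \<delta> / 2 * (2 * ((y - y0) \<bullet> v))) (%y v w. 1 * H y v w + \<delta> / 2 * (2 * (v \<bullet> w)))"
   if "V <= img_chart ?c" for V
   unfolding u_def[abs_def] by (rule C2_on_add[OF C2_on_subset[OF D(1) that] C2_on_sqdist])
  have uc: "continuous_on (cball y0 ?r) u"
   by (rule continuous_on_subset[OF C1_onD(1)[OF C2_onD(1)[OF u2[OF order_refl]]] cbi])
  have ule: "a + \<delta> / 2 * ((y - y0) \<bullet> (y - y0)) <= u y" "?f y <= u y" for y
  proof -
   have "\<delta> / 2 * ((y - y0) \<bullet> (y - y0)) >= 0" using \<delta> by simp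
   then show "?f y <= u y" by (simp add: u_def)
   show "a + \<delta> / 2 * ((y - y0) \<bullet> (y - y0)) <= u y" using min[of "inv_coord ?c y"] by (simp add: u_def a_def)
  qed
  have u0: "u y0 = a" using y0(2) by (simp add: u_def a_def)
  have comp: "compact {y\<in>U. u y <= s}" if s: "s <= a + \<theta>" for s
  proof -
   have "{y\<in>U. u y <= s} = cball y0 ?r Int u -` {..s}"
   proof (intro equalityI subsetI)
    fix y assume y: "y \<in> cball y0 ?r Int u -` {..s}"
    have "dist y0 y ~= ?r"
    proof
     assume "dist y0 y = ?r"
     then have "(y - y0) \<bullet> (y - y0) = ?r\<^sup>2" by (simp add: dot_square_norm dist_norm norm_minus_commute)
     then show False using ule(1)[of y] y s \<theta>(3) by simp
    qed
    then show "y \<in> {y\<in>U. u y <= s}" using y by (simp add: U_def)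
   qed (use Ub in auto)
   then show ?thesis
    using continuous_closed_preimage[OF uc closed_cball closed_atMost, of s] bounded_subset[OF bounded_cball Int_lower1]
    by (simp add: compact_eq_bounded_closed)
  qed
  have sl: "sublevel U X u (%y v. 1 * D y v + \<delta> / 2 * (2 * ((y - y0) \<bullet> v))) (%y v w. 1 * H y v w + \<delta> / 2 * (2 * (v \<bullet> w))) s y0" if s: "s <= a + \<theta>" for s
  proof
   show "open U" by (rule Uo)
   show "U <= ball y0 (1/2)" unfolding U_def using r by auto
   show "weakly_closed U X" unfolding X_def using D(4) Ui unfolding weakly_closed_def
    by (meson continuous_on_subset subset_trans)
   show "pos_form (X y)" if "y \<in> U" for y unfolding X_def by (rule D(3)[OF subsetD[OF Ui that]])
   show "C2_on U u (%y v. 1 * D y v + \<delta> / 2 * (2 * ((y - y0) \<bullet> v))) (%y v w. 1 * H y v w + \<delta> / 2 * (2 * (v \<bullet> w)))" by (rule u2[OF Ui])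
   show "ddc (%v w. 1 * H y v w + \<delta> / 2 * (2 * (v \<bullet> w))) v (J v) <= X y v (J v)" if y: "y \<in> U" for y v
    unfolding ddc_comb ddc_inner X_def D(2)[OF subsetD[OF Ui y]]
    using good(13)[OF U8[OF y], of v] by (simp add: \<delta>_def)
   show "compact {y\<in>U. u y <= s}" by (rule comp[OF s])
  qed
  define Se where "Se s = {y\<in>U. u y < s}" for s
  have Seo: "open (Se s)" for s
  proof -
   have "open (U Int u -` {..<s})" by (rule continuous_open_preimage[OF continuous_on_subset[OF uc Ub] Uo open_lessThan])
   then show ?thesis by (simp add: Se_def vimage_def Int_def)
  qed
  have Sem [measurable]: "Se s \<in> sets borel" for s using Seo by simp
  have SeU: "Se s <= U" for s by (auto simp: Se_def)
  have Se2: "Se s <= ball ?z (2 * ?r)" for s using SeU U2 by (rule subset_trans)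
  define G where "G y = exp (?n * F (extend_inv ?c y))" for y
  have Gm [measurable]: "G \<in> borel_measurable borel" unfolding G_def by measurable
  define PG where "PG y = \<bar>F (extend_inv ?c y)\<bar> powr p * G y" for y
  have PGm [measurable]: "PG \<in> borel_measurable borel" unfolding PG_def by measurable
  have cl: "bm x * enn2real I <= K & I < \<infinity>"
   if "ennreal (bm x) * I <= ennreal K" "K >= 0" for I K
  proof -
   have fin: "I < \<infinity>"
   proof (rule ccontr)
    assume "~ I < \<infinity>"
    then have "I = top" by (simp add: less_top[symmetric])
    then have "ennreal (bm x) * I = top" using bm by (simp add: ennreal_mult_eq_top_iff)
    then show False using that(1) by (simp add: top_unique)
   qed
   then have "ennreal (bm x * enn2real I) <= ennreal K" using that(1) bm by (simp add: ennreal_mult)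
   then show ?thesis using that(2) fin by simp
  qed
  have PGi: "integrable lborel (%y. PG y * indicator U y)" "(LBINT y. PG y * indicator U y) <= E1"
  proof -
   have "ennreal (bm x) * (\<integral>\<^sup>+y. ennreal (\<bar>F (extend_inv ?c y)\<bar> powr p * exp (?n * F (extend_inv ?c y))) * indicator U y \<partial>lborel) <= (\<integral>\<^sup>+w. ennreal (\<bar>F w\<bar> powr p * exp (?n * F w)) \<partial>vol)"
    by (rule chart_integral_le[OF _ Um U2]) measurable
   also have "... <= ennreal (max E 0)" using Ent by (rule order_trans) (auto intro: ennreal_leI)
   also have "(\<integral>\<^sup>+y. ennreal (\<bar>F (extend_inv ?c y)\<bar> powr p * exp (?n * F (extend_inv ?c y))) * indicator U y \<partial>lborel) = (\<integral>\<^sup>+y. ennreal (PG y * indicator U y) \<partial>lborel)"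
    by (intro nn_integral_cong) (simp add: PG_def G_def indicator_def)
   finally have b: "bm x * enn2real (\<integral>\<^sup>+y. ennreal (PG y * indicator U y) \<partial>lborel) <= max E 0" "(\<integral>\<^sup>+y. ennreal (PG y * indicator U y) \<partial>lborel) < \<infinity>"
    using cl by auto
   have nn: "PG y * indicator U y >= 0" for y by (simp add: PG_def G_def)
   show i: "integrable lborel (%y. PG y * indicator U y)"
    by (rule integrableI_nonneg) (use nn b(2) in auto)
   have "(LBINT y. PG y * indicator U y) = enn2real (\<integral>\<^sup>+y. ennreal (PG y * indicator U y) \<partial>lborel)"
    by (rule integral_eq_nn_integral) (use nn in auto)
   then show "(LBINT y. PG y * indicator U y) <= E1" using b(1) bm by (simp add: E1_def field_simps)
  qed
  \<comment> \<open>The quantity that is iterated: the integral of exp (n F) over a sublevel set of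
    \<open>u\<close>, in chart coordinates.\<close>
  define m where "m s = (LBINT y. G y * indicator (Se s) y)" for s
  have Gi: "integrable lborel (%y. G y * indicator U y)" "(LBINT y. G y * indicator U y) <= Mt"
  proof -
   have "ennreal (bm x) * (\<integral>\<^sup>+y. ennreal (exp (?n * F (extend_inv ?c y))) * indicator U y \<partial>lborel) <= (\<integral>\<^sup>+w. ennreal (exp (?n * F w)) \<partial>vol)"
    by (rule chart_integral_le[OF _ Um U2]) measurable
   also have "... <= (\<integral>\<^sup>+w. ennreal (exp ?n) + ennreal (\<bar>F w\<bar> powr p * exp (?n * F w)) \<partial>vol)"
    using exp_split[OF p0, of 1 F] by (intro nn_integral_mono) (simp add: ennreal_plus[symmetric] ennreal_leI del: ennreal_plus)
   also have "... = ennreal (exp ?n) * emeasure vol UNIV + (\<integral>\<^sup>+w. ennreal (\<bar>F w\<bar> powr p * exp (?n * F w)) \<partial>vol)"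
    by (subst nn_integral_add) auto
   also have "... <= ennreal (exp ?n) * emeasure vol UNIV + ennreal (max E 0)"
    using Ent by (intro add_left_mono) (rule order_trans, auto intro: ennreal_leI)
   also have "... = ennreal (exp ?n * V + max E 0)"
    unfolding V_def emeasure_eq_measure by (simp add: ennreal_mult[symmetric] ennreal_plus[symmetric] del: ennreal_plus)
   also have "(\<integral>\<^sup>+y. ennreal (exp (?n * F (extend_inv ?c y))) * indicator U y \<partial>lborel) = (\<integral>\<^sup>+y. ennreal (G y * indicator U y) \<partial>lborel)"
    by (intro nn_integral_cong) (simp add: G_def indicator_def)
   finally have b: "bm x * enn2real (\<integral>\<^sup>+y. ennreal (G y * indicator U y) \<partial>lborel) <= exp ?n * V + max E 0" "(\<integral>\<^sup>+y. ennreal (G y * indicator U y) \<partial>lborel) < \<infinity>"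
    using cl[of _ "exp ?n * V + max E 0"] by (auto simp: V_def)
   have nn: "G y * indicator U y >= 0" for y by (simp add: G_def)
   show "integrable lborel (%y. G y * indicator U y)"
    by (rule integrableI_nonneg) (use nn b(2) in auto)
   have "(LBINT y. G y * indicator U y) = enn2real (\<integral>\<^sup>+y. ennreal (G y * indicator U y) \<partial>lborel)"
    by (rule integral_eq_nn_integral) (use nn in auto)
   then show "(LBINT y. G y * indicator U y) <= Mt" using b(1) bm by (simp add: Mt_def field_simps)
  qed
  have G0: "G y > 0" for y by (simp add: G_def)
  have iGs: "integrable lborel (%y. G y * indicator (Se s) y)" for s
  proof (rule Bochner_Integration.integrable_bound[OF Gi(1)])
   show "AE y in lborel. norm (G y * indicator (Se s) y) <= norm (G y * indicator U y)"
    using SeU[of s] G0 by (intro AE_I2) (auto simp: indicator_def)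
  qed measurable
  have mMt: "m s <= Mt" for s
  proof -
   have "m s <= (LBINT y. G y * indicator U y)" unfolding m_def
    by (rule integral_mono[OF iGs Gi(1)]) (use SeU[of s] G0 in \<open>auto simp: indicator_def less_imp_le\<close>)
   then show ?thesis using Gi(2) by linarith
  qed
  have mmono: "m s <= m s'" if "s <= s'" for s s'
   unfolding m_def by (rule integral_mono[OF iGs iGs]) (use that G0 in \<open>auto simp: indicator_def Se_def less_imp_le\<close>)
  have m0: "m s >= 0" for s unfolding m_def by (rule Bochner_Integration.integral_nonneg) (use G0 in \<open>auto simp: less_imp_le\<close>)
  have mpos: "m s > 0" if "s > a" for s
  proof -
   have y0S: "y0 \<in> Se s" using u0 r that by (simp add: Se_def U_def)
   have "emeasure lborel (Se s) ~= 0"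
   proof -
    obtain e where e: "e > 0" "ball y0 e <= Se s" using Seo[of s] y0S open_contains_ball by blast
    have "0 < emeasure lborel (ball y0 e)"
     using content_ball_pos[OF e(1), of y0] emeasure_bounded_finite[OF bounded_ball, of y0 e]
     by (simp add: measure_def enn2real_positive_iff)
    also have "... <= emeasure lborel (Se s)" by (rule emeasure_mono[OF e(2)]) simp
    finally show ?thesis by simp
   qed
   moreover have "Se s = {y\<in>space lborel. G y * indicator (Se s) y ~= 0}" using G0 by (auto simp: indicator_def less_imp_neq[symmetric])
   moreover have "m s = 0 \<longleftrightarrow> (AE y in lborel. G y * indicator (Se s) y = 0)"
    unfolding m_def by (rule integral_nonneg_eq_0_iff_AE[OF iGs]) (use G0 in \<open>auto simp: less_imp_le\<close>)
   moreover have "(AE y in lborel. G y * indicator (Se s) y = 0) --> emeasure lborel {y\<in>space lborel. G y * indicator (Se s) y ~= 0} = 0"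
    by (subst AE_iff_measurable[OF _ refl]) auto
   ultimately show ?thesis using m0[of s] by (metis less_eq_real_def)
  qed
  have mass: "sublevel.mass U X u s <= ennreal (C1 * bM x * m s)" if s: "s <= a + \<theta>" for s
  proof -
   have "sublevel.mass U X u s = (\<integral>\<^sup>+y. ennreal (top_power (X y)) * indicator (Se s) y \<partial>lborel)"
    unfolding sublevel.mass_def[OF sl[OF s]] Se_def ..
   also have "... <= (\<integral>\<^sup>+y. ennreal (C1 * bM x * (G y * indicator (Se s) y)) \<partial>lborel)"
   proof (rule nn_integral_mono)
    fix y
    show "ennreal (top_power (X y)) * indicator (Se s) y <= ennreal (C1 * bM x * (G y * indicator (Se s) y))"
    proof (cases "y \<in> Se s")
     case True
     have yU: "y \<in> U" using True SeU by blast
     then have yi: "y \<in> img_chart ?c" using Ui by blast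
     have "?f y <= f x0 + 1" using ule(2)[of y] True s \<theta>(2) by (simp add: Se_def a_def)
     then have "top_power (X y) <= C1 * exp (?n * F (inv_coord ?c y)) * top_power (omg ?c (inv_coord ?c y))"
      unfolding X_def by (rule ma[OF c inv_coord_dom[OF c yi]])
     also have "... = C1 * G y * vol_density ?c y" using yi by (simp add: G_def extend_inv_def[OF c] vol_density_def[OF c])
     also have "... <= C1 * G y * bM x"
      using good(11)[OF U8[OF yU]] C1 G0[of y] by (intro mult_left_mono) auto
     finally show ?thesis using True by (simp add: ennreal_leI mult_ac)
    qed simp
   qed
   also have "... = ennreal (LBINT y. C1 * bM x * (G y * indicator (Se s) y))"
    by (rule nn_integral_eq_integral) (use iGs[of s] C1 bM G0 in \<open>auto simp: less_imp_le\<close>)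
   also have "... = ennreal (C1 * bM x * m s)" by (simp add: m_def)
   finally show ?thesis .
  qed
  have iter: "m (s - 3 * t) <= (B1 * \<kappa> powr bt) * t powr (- p) * m s powr bt" if s: "a < s" "s <= a + \<theta>" and t: "t > 0" for s t
  proof -
   have ms: "m s > 0" by (rule mpos[OF s(1)])
   \<comment> \<open>The value with \<kappa> m(s) L^n = t^n, for which the smallness assumption of
     \<open>decay\<close> just holds.\<close>
   define L where "L = t / (\<kappa> * m s) powr (1 / ?n)"
   have L: "L > 0" using t \<kappa> ms by (simp add: L_def)
   have Lp: "L powr (- p) = \<kappa> powr bt * t powr (- p) * m s powr bt"
   proof -
    have "L powr (- p) = t powr (- p) / ((\<kappa> * m s) powr (1 / ?n)) powr (- p)"
     unfolding L_def by (rule powr_divide)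
    also have "((\<kappa> * m s) powr (1 / ?n)) powr (- p) = (\<kappa> * m s) powr (- bt)" by (simp add: powr_powr bt_def)
    also have "... = inverse (\<kappa> powr bt * m s powr bt)" by (simp add: powr_minus powr_mult)
    finally show ?thesis by (simp add: field_simps)
   qed
   have "m (s - 3 * t) <= B1 * L powr (- p)"
   proof (cases "L >= 1")
    \<comment> \<open>For L < 1 the estimate is trivial, since L^(-p) >= 1 and B1 >= Mt.\<close>
    case False
    have "1 <= L powr (- p)"
    proof -
     have "L powr p <= 1" using False L p0 by (intro powr_le1) auto
     then show ?thesis using L by (simp add: powr_minus field_simps)
    qed
    have "m (s - 3 * t) <= Mt" by (rule mMt)
    also have "... <= B1" unfolding B1_def using Z4 E1 by simp
    also have "... <= B1 * L powr (- p)" using B1 \<open>1 <= L powr (- p)\<close> mult_left_mono[of 1 "L powr (- p)" B1] by simp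
    finally show ?thesis .
   next
    case True
    have Ln: "\<kappa> * m s * L ^ CARD('n) = t ^ CARD('n)"
    proof -
     have "((\<kappa> * m s) powr (1 / ?n)) ^ CARD('n) = \<kappa> * m s"
      using \<kappa> ms n1 by (simp add: powr_realpow[symmetric] powr_powr)
     then show ?thesis unfolding L_def power_divide using \<kappa> ms by simp
    qed
    have dec: "measure lborel {y\<in>U. u y < s - 3 * t} <= exp (2 - 2 * L) * Z4 / 16"
     unfolding Z4_def
    proof (rule sublevel.decay[OF sl[OF s(2)] t _ mass[OF s(2)] True])
     show "0 <= C1 * bM x * m s" using C1 bM ms by simp
     have "8 * ?n * 16 ^ (CARD('n) - 1) / (?S * Z) * (C1 * bM x * m s) * L ^ CARD('n) = \<kappa> * m s * L ^ CARD('n)"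
      by (simp add: \<kappa>_def mult.assoc)
     also have "... <= t ^ CARD('n)" unfolding Ln ..
     finally show "8 * ?n * 16 ^ (CARD('n) - 1) / (?S * (LBINT z. bump 3 (0 :: complex ^ 'n) 1 z)) * (C1 * bM x * m s) * L ^ CARD('n) <= t ^ CARD('n)"
      unfolding Z_def .
    qed
    let ?S' = "Se (s - 3 * t)"
    have iS: "integrable lborel (%y. exp L * indicator ?S' y :: real)"
    proof -
     have "emeasure lborel ?S' <= emeasure lborel U" by (rule emeasure_mono[OF SeU]) simp
     also have "... < \<infinity>" unfolding U_def by (rule emeasure_bounded_finite[OF bounded_ball])
     finally show ?thesis by (intro integrable_mult_right integrable_real_indicator) auto
    qed
    have iP: "integrable lborel (%y. (L / ?n) powr (- p) * (PG y * indicator U y))" by (intro integrable_mult_right PGi(1))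
    \<comment> \<open>The split is at F = L / n: below it, the factor exp L meets a volume of order
      exp (-2 L); above it, the entropy contributes a multiple of L^(-p).\<close>
    have "m (s - 3 * t) <= (LBINT y. exp L * indicator ?S' y + (L / ?n) powr (- p) * (PG y * indicator U y))"
     unfolding m_def
    proof (rule integral_mono[OF iGs Bochner_Integration.integrable_add[OF iS iP]])
     fix y
     have "G y <= exp (?n * (L / ?n)) + (L / ?n) powr (- p) * PG y"
      unfolding G_def PG_def by (rule exp_split[OF p0]) (use L n1 in simp)
     then show "G y * indicator ?S' y <= exp L * indicator ?S' y + (L / ?n) powr (- p) * (PG y * indicator U y)"
      using SeU[of "s - 3 * t"] n1 G0[of y] by (auto simp: indicator_def PG_def)
    qed
    also have "... = exp L * measure lborel ?S' + (L / ?n) powr (- p) * (LBINT y. PG y * indicator U y)"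
     unfolding Bochner_Integration.integral_add[OF iS iP] by simp
    also have "... <= exp L * (exp (2 - 2 * L) * Z4 / 16) + (L / ?n) powr (- p) * E1"
     using dec PGi(2) by (intro add_mono mult_left_mono) (auto simp: Se_def)
    also have "exp L * (exp (2 - 2 * L) * Z4 / 16) = exp 2 * Z4 / 16 * exp (- L)"
    proof -
     have "exp L * exp (2 - 2 * L) = exp 2 * exp (- L)" unfolding exp_add[symmetric] by simp
     then show ?thesis by simp
    qed
    also have "exp 2 * Z4 / 16 * exp (- L) <= exp 2 * Z4 / 16 * (exp (p * ln p - p) * L powr (- p))"
     using Z4 by (intro mult_left_mono powr_exp_bound L p0) auto
    also have "(L / ?n) powr (- p) = ?n powr p * L powr (- p)"
     using L n1 by (simp add: powr_divide powr_minus field_simps)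
    finally have "m (s - 3 * t) <= (exp 2 * Z4 / 16 * exp (p * ln p - p) + ?n powr p * E1) * L powr (- p)"
     by (simp add: algebra_simps)
    also have "... <= B1 * L powr (- p)" unfolding B1_def using Mt by (intro mult_right_mono) auto
    finally show ?thesis .
   qed
   then show ?thesis unfolding Lp by (simp add: mult_ac)
  qed
  have c0m: "c0 <= m (a + \<theta>)" by (rule c0(2)) (use mpos mmono iter in blast)+
  have "ennreal (bm x * c0) <= ennreal (bm x * m (a + \<theta>))" using c0m bm by (intro ennreal_leI mult_left_mono) auto
  also have "... = ennreal (bm x) * (\<integral>\<^sup>+y. ennreal (G y * indicator (Se (a + \<theta>)) y) \<partial>lborel)"
  proof -
   have "(\<integral>\<^sup>+y. ennreal (G y * indicator (Se (a + \<theta>)) y) \<partial>lborel) = ennreal (m (a + \<theta>))"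
    unfolding m_def by (rule nn_integral_eq_integral[OF iGs]) (use G0 in \<open>auto simp: less_imp_le\<close>)
   then show ?thesis using bm m0 by (simp add: ennreal_mult)
  qed
  also have "(\<integral>\<^sup>+y. ennreal (G y * indicator (Se (a + \<theta>)) y) \<partial>lborel) = (\<integral>\<^sup>+y. (ennreal (exp (?n * F (extend_inv ?c y))) * indicator {w. f w <= f x0 + 1} (extend_inv ?c y)) * indicator (Se (a + \<theta>)) y \<partial>lborel)"
  proof (rule nn_integral_cong)
   fix y
   show "ennreal (G y * indicator (Se (a + \<theta>)) y) = (ennreal (exp (?n * F (extend_inv ?c y))) * indicator {w. f w <= f x0 + 1} (extend_inv ?c y)) * indicator (Se (a + \<theta>)) y"
   proof (cases "y \<in> Se (a + \<theta>)")
    case True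
    then have "extend_inv ?c y = inv_coord ?c y" using SeU Ui by (auto simp: extend_inv_def[OF c])
    moreover have "?f y <= f x0 + 1" using ule(2)[of y] True \<theta>(2) by (simp add: Se_def a_def)
    ultimately show ?thesis using True by (simp add: G_def)
   qed simp
  qed
  also have "ennreal (bm x) * ... <= (\<integral>\<^sup>+w. ennreal (exp (?n * F w)) * indicator {w. f w <= f x0 + 1} w \<partial>vol)"
   by (rule chart_integral_le[OF _ Sem Se2]) measurable
  finally show ?thesis .
 qed
 then show ?thesis using c0(1) bm by (intro exI[of _ "bm x * c0"]) simp
qed

text \<open>By the entropy bound, exp (n F) cannot carry the whole mass of
  \<open>sublevel_mass_bound\<close> at large F, so the set where \<open>f\<close> is within 1 of
  its minimum has volume bounded below. There max f - f is at least the oscillation minus 1, and its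
  integral is bounded by \<open>L1_bound\<close>.\<close>

lemma oscillation_local:
 assumes C1: "C1 > 0" and p: "p > real CARD('n)"
 shows "\<exists>C. \<forall>f F x0. psh f --> F \<in> borel_measurable borel -->
  entropy_le p F E --> x0 \<in> W x --> (\<forall>y. f x0 <= f y) -->
  ma_le C1 f F x0 -->
  (\<forall>y. f y - f x0 <= C)"
proof -
 let ?n = "real CARD('n)"
 interpret finite_measure vol by (rule finite_measure_vol)
 have n1: "?n >= 1" using zero_less_card_finite[where 'a='n] by linarith
 have p1: "p >= 1" using p n1 by linarith
 obtain c0 where c0: "0 < c0" and lower: "!!f F x0. psh f ==> F \<in> borel_measurable borel ==>
  entropy_le p F E ==> x0 \<in> W x ==> (\<forall>y. f x0 <= f y) ==>
  ma_le C1 f F x0 ==>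
  ennreal c0 <= (\<integral>\<^sup>+w. ennreal (exp (?n * F w)) * indicator {w. f w <= f x0 + 1} w \<partial>vol)"
  using sublevel_mass_bound[OF C1 p, where E=E and x=x] by blast
 obtain CL where CL: "CL >= 0" "!!f s. psh f ==> (\<forall>y. f y <= s) ==> (\<exists>x. f x = s) ==> (\<integral>\<^sup>+w. ennreal (s - f w) \<partial>vol) <= ennreal CL"
  using L1_bound by blast
 define E' where "E' = max E 0"
 \<comment> \<open>At this level the part of exp (n F) with F > k integrates to at most half of
   \<open>c0\<close>.\<close>
 define k where "k = max 1 (2 * E' / c0)"
 have k: "k >= 1" "E' / k <= c0 / 2"
 proof -
  show k1: "k >= 1" by (simp add: k_def)
  have "2 * E' / c0 <= k" by (simp add: k_def)
  then show "E' / k <= c0 / 2" using k1 c0 by (simp add: field_simps)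
 qed
 have kp: "k powr (- p) * E' <= c0 / 2"
 proof -
  have "k powr (- p) <= k powr (- 1)" using k p1 by (intro powr_mono) auto
  also have "... = 1 / k" using k by (simp add: powr_minus_divide)
  finally have "k powr (- p) * E' <= 1 / k * E'" by (intro mult_right_mono) (auto simp: E'_def)
  moreover have "1 / k * E' = E' / k" by simp
  ultimately show ?thesis using k(2) by linarith
 qed
 define C where "C = 1 + 2 * exp (?n * k) * CL / c0"
 have "f y - f x0 <= C"
  if f: "psh f" and F [measurable]: "F \<in> borel_measurable borel"
   and Ent: "entropy_le p F E" and x0: "x0 \<in> W x" and min: "\<forall>y. f x0 <= f y"
   and ma: "ma_le C1 f F x0"
  for f F x0 y
 proof -
  note [measurable] = psh_measurable[OF f]
  let ?Q = "{w. f w <= f x0 + 1}"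
  have Qm [measurable]: "?Q \<in> sets borel" by measurable
  obtain x1 where x1: "!!y. f y <= f x1"
   using continuous_attains_sup[OF compact_M _ psh_continuous[OF f]] by auto
  define d where "d = f x1 - f x0 - 1"
  have "d <= 2 * exp (?n * k) * CL / c0"
  proof (cases "d <= 0")
   case True
   have "0 <= 2 * exp (?n * k) * CL / c0" using CL(1) c0 by simp
   then show ?thesis using True by linarith
  next
   case False
   have "ennreal (d * measure vol ?Q) = ennreal d * emeasure vol ?Q"
    unfolding emeasure_eq_measure using False by (simp add: ennreal_mult)
   also have "... = (\<integral>\<^sup>+w. ennreal d * indicator ?Q w \<partial>vol)" by (rule nn_integral_cmult_indicator[symmetric]) simp
   also have "... <= (\<integral>\<^sup>+w. ennreal (f x1 - f w) \<partial>vol)"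
    by (intro nn_integral_mono) (auto simp: indicator_def d_def intro!: ennreal_leI)
   also have "... <= ennreal CL" by (rule CL(2)[OF f]) (use x1 in auto)
   finally have dQ: "d * measure vol ?Q <= CL" using CL(1) by simp
   have "ennreal c0 <= (\<integral>\<^sup>+w. ennreal (exp (?n * F w)) * indicator ?Q w \<partial>vol)"
    by (rule lower[OF f F Ent x0 min ma])
   also have "... <= (\<integral>\<^sup>+w. ennreal (exp (?n * k)) * indicator ?Q w + ennreal (k powr (- p)) * ennreal (\<bar>F w\<bar> powr p * exp (?n * F w)) \<partial>vol)"
   proof (rule nn_integral_mono)
    fix w
    have "exp (?n * F w) <= exp (?n * k) + k powr (- p) * (\<bar>F w\<bar> powr p * exp (?n * F w))"
     by (rule exp_split) (use p1 k in auto)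
    from ennreal_leI[OF this] have "ennreal (exp (?n * F w)) <= ennreal (exp (?n * k)) + ennreal (k powr (- p)) * ennreal (\<bar>F w\<bar> powr p * exp (?n * F w))"
     by (simp add: ennreal_plus ennreal_mult)
    then show "ennreal (exp (?n * F w)) * indicator ?Q w <= ennreal (exp (?n * k)) * indicator ?Q w + ennreal (k powr (- p)) * ennreal (\<bar>F w\<bar> powr p * exp (?n * F w))"
     by (cases "w \<in> ?Q") simp_all
   qed
   also have "... = ennreal (exp (?n * k)) * emeasure vol ?Q + ennreal (k powr (- p)) * (\<integral>\<^sup>+w. ennreal (\<bar>F w\<bar> powr p * exp (?n * F w)) \<partial>vol)"
    by (subst nn_integral_add) (auto simp: nn_integral_cmult nn_integral_cmult_indicator)
   also have "... <= ennreal (exp (?n * k)) * emeasure vol ?Q + ennreal (k powr (- p)) * ennreal E'"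
    using Ent by (intro add_left_mono mult_left_mono) (auto simp: E'_def intro: order_trans ennreal_leI)
   also have "... = ennreal (exp (?n * k) * measure vol ?Q + k powr (- p) * E')"
    unfolding emeasure_eq_measure by (simp add: ennreal_mult ennreal_plus E'_def)
   finally have "c0 <= exp (?n * k) * measure vol ?Q + k powr (- p) * E'"
    by (subst (asm) ennreal_le_iff) (auto simp: E'_def)
   then have "c0 / 2 <= exp (?n * k) * measure vol ?Q" using kp by linarith
   then have "c0 / 2 * d <= exp (?n * k) * measure vol ?Q * d" using False by (intro mult_right_mono) auto
   also have "... = exp (?n * k) * (d * measure vol ?Q)" by simp
   also have "... <= exp (?n * k) * CL" by (intro mult_left_mono dQ) auto
   finally show ?thesis using c0 by (simp add: field_simps)
  qed
  then show ?thesis using x1[of y] by (simp add: C_def d_def)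
 qed
 then show ?thesis by blast
qed

theorem oscillation_bound:
 assumes C1: "C1 > 0" and p: "p > real CARD('n)"
 shows "\<exists>C. \<forall>f F x0. psh f --> F \<in> borel_measurable borel -->
  entropy_le p F E --> (\<forall>y. f x0 <= f y) -->
  ma_le C1 f F x0 -->
  (\<forall>y. f y - f x0 <= C)"
proof -
 obtain Q where Q: "finite Q" "(\<Union>x\<in>Q. W x) = UNIV" using finite_W_cover by blast
 define P where "P x C \<longleftrightarrow> (\<forall>f F x0. psh f --> F \<in> borel_measurable borel -->
  entropy_le p F E --> x0 \<in> W x --> (\<forall>y. f x0 <= f y) -->
  ma_le C1 f F x0 -->
  (\<forall>y. f y - f x0 <= C))" for x C
 have "\<forall>x. \<exists>C. P x C" unfolding P_def using oscillation_local[OF C1 p, where E=E] by blast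
 then obtain C where C: "!!x. P x (C x)" using choice[of P] by blast
 have "f y - f x0 <= (\<Sum>x\<in>Q. \<bar>C x\<bar>)"
  if f: "psh f" "F \<in> borel_measurable borel" "entropy_le p F E" "\<forall>y. f x0 <= f y"
   "ma_le C1 f F x0" for f F x0 y
 proof -
  obtain x where x: "x \<in> Q" "x0 \<in> W x" using Q(2) by blast
  have "f y - f x0 <= C x" using C[of x] f x(2) unfolding P_def by blast
  also have "... <= \<bar>C x\<bar>" by simp
  also have "... <= (\<Sum>x\<in>Q. \<bar>C x\<bar>)" by (rule member_le_sum[OF x(1) _ Q(1)]) simp
  finally show ?thesis .
 qed
 then show ?thesis by blast
qed

end

section \<open>Interior maxima and one-sided derivatives\<close>

lemma second_derivative_max:
 assumes U: "open U" "z \<in> U" and f: "C2_on U f D H" and mx: "!!w. w \<in> U ==> f w <= f z"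
 shows "H z v v <= 0"
proof (rule ccontr)
 assume "~ H z v v <= 0"
 then have pos: "H z v v > 0" by simp
 define S where "S = {t. z + t *\<^sub>R v \<in> U}"
 have "open S"
 proof -
  have "open ((%t::real. z + t *\<^sub>R v) -` U)" by (intro open_vimage U continuous_intros)
  then show ?thesis by (simp add: S_def vimage_def)
 qed
 moreover have "0 \<in> S" using U by (simp add: S_def)
 ultimately obtain e where e: "e > 0" "ball 0 e <= S" using open_contains_ball by blast
 have inU: "z + t *\<^sub>R v \<in> U" if "\<bar>t\<bar> < e" for t using e(2) that by (auto simp: S_def)
 have d1: "((%t. f (z + t *\<^sub>R v)) has_real_derivative D (z + t *\<^sub>R v) v) (at t)" if "\<bar>t\<bar> < e" for t
  by (rule C1_onD(5)[OF C2_onD(1)[OF f] inU[OF that]])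
 have d2: "((%t. D (z + t *\<^sub>R v) v) has_real_derivative H z v v) (at 0)"
  by (rule C1_onD(4)[OF C2_onD(2)[OF f] U(2)])
 have z0: "D z v = 0"
 proof -
  have "((%t. f (z + t *\<^sub>R v)) has_real_derivative D z v) (at 0)" using d1[of 0] e(1) by simp
  then show ?thesis
   by (rule DERIV_local_max[OF _ e(1)]) (use inU mx in simp)
 qed
 obtain d where d: "d > 0" "!!h. 0 < h ==> h < d ==> 0 < D (z + h *\<^sub>R v) v"
  using DERIV_pos_inc_right[OF d2 pos] z0 by auto
 define h where "h = min d e / 2"
 have h: "0 < h" "h < d" "h < e" using d(1) e(1) by (auto simp: h_def)
 have "f (z + 0 *\<^sub>R v) < f (z + h *\<^sub>R v)"
 proof (rule DERIV_pos_imp_increasing_open[OF h(1)])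
  fix t assume t: "0 < t" "t < h"
  show "\<exists>y. ((%t. f (z + t *\<^sub>R v)) has_real_derivative y) (at t) & 0 < y"
   using d1[of t] d(2)[of t] t h by (intro exI[of _ "D (z + t *\<^sub>R v) v"]) auto
 next
  show "continuous_on {0..h} (%t. f (z + t *\<^sub>R v))"
   by (rule DERIV_continuous_on[OF has_field_derivative_at_within[OF d1]]) (use h in auto)
 qed
 then show False using mx[OF inU[of h]] h by simp
qed

lemma ennreal_integral_le:
 assumes "integrable M f"
 shows "ennreal (\<integral>x. f x \<partial>M) <= (\<integral>\<^sup>+x. ennreal (f x) \<partial>M)"
proof -
 have "(\<integral>x. f x \<partial>M) <= (\<integral>x. max 0 (f x) \<partial>M)"
  by (rule integral_mono[OF assms]) (use assms in auto)
 then have "ennreal (\<integral>x. f x \<partial>M) <= ennreal (\<integral>x. max 0 (f x) \<partial>M)" by (rule ennreal_leI)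
 also have "... = (\<integral>\<^sup>+x. ennreal (max 0 (f x)) \<partial>M)" by (rule nn_integral_eq_integral[symmetric]) (use assms in auto)
 also have "... = (\<integral>\<^sup>+x. ennreal (f x) \<partial>M)" by (rule nn_integral_cong) (auto simp: max_def ennreal_neg)
 finally show ?thesis .
qed

text \<open>Only difference quotients to the right are compared, and the error q s disappears in the
  limit. This allows t = 0 and needs increments forward in time only.\<close>

lemma derivative_le_of_increment:
 fixes f :: "real => real"
 assumes f: "(f has_real_derivative d) (at t within I)" and e: "e > 0" "{t..t+e} <= I"
  and inc: "!!s. 0 < s ==> s < e ==> f (t + s) - f t <= s * (k + q * s)"
 shows "d <= k"
proof -
 let ?F = "at t within {t<..<t+e}"
 have nb: "?F ~= bot" using islimpt_greaterThanLessThan1[of t "t + e"] e(1) by (simp add: trivial_limit_within)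
 have "(f has_real_derivative d) ?F" by (rule DERIV_subset[OF f]) (use e(2) in auto)
 then have l: "((%y. (f y - f t) / (y - t)) \<longlongrightarrow> d) ?F" unfolding has_field_derivative_iff .
 have r: "((%y. k + q * (y - t)) \<longlongrightarrow> k + q * (t - t)) ?F" by (intro tendsto_intros)
 have "d <= k + q * (t - t)"
 proof (rule tendsto_le[OF nb r l])
  show "eventually (%y. (f y - f t) / (y - t) <= k + q * (y - t)) ?F"
   unfolding eventually_at_filter
  proof (rule always_eventually, intro allI impI)
   fix y assume "y \<in> {t<..<t+e}"
   then show "(f y - f t) / (y - t) <= k + q * (y - t)" using inc[of "y - t"] by (simp add: pos_divide_le_eq mult.commute)
  qed
 qed
 then show ?thesis by simp
qed

lemma derivative_nonneg_at_left_max: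
 fixes f :: "real => real"
 assumes f: "(f has_real_derivative d) (at t within {t0..t})" and t: "t0 < t" and mx: "!!s. s \<in> {t0..t} ==> f s <= f t"
 shows "d >= 0"
proof -
 let ?F = "at t within {t0<..<t}"
 have nb: "?F ~= bot" using islimpt_greaterThanLessThan2[of t0 t] t by (simp add: trivial_limit_within)
 have "(f has_real_derivative d) ?F" by (rule DERIV_subset[OF f]) auto
 then have l: "((%y. (f y - f t) / (y - t)) \<longlongrightarrow> d) ?F" unfolding has_field_derivative_iff .
 show ?thesis
 proof (rule tendsto_lowerbound[OF l _ nb])
  show "eventually (%y. 0 <= (f y - f t) / (y - t)) ?F"
   unfolding eventually_at_filter
  proof (rule always_eventually, intro allI impI)
   fix y assume "y \<in> {t0<..<t}"
   then show "0 <= (f y - f t) / (y - t)" using mx[of y] by (intro divide_nonpos_neg) auto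
  qed
 qed
qed

section \<open>The logarithm of the volume ratio of a potential\<close>

context kaehler
begin

text \<open>The logarithm is at most a multiple of the trace plus a constant, and the trace is that
  of \<open>omg\<close> plus the Laplacian of \<open>f\<close>. Against a bump the Laplacian moves
  to the bump, which leaves the integral of max f - f, bounded by \<open>L1_bound\<close>. Since
  \<open>ennreal\<close> discards negative values, it is the positive part that is bounded.\<close>

lemma entropy_local:
 "\<exists>C\<ge>0. \<forall>f g. psh f --> g \<in> borel_measurable borel --> log_ratio f g -->
  (\<integral>\<^sup>+w. ennreal (g w) * indicator (W x) w \<partial>vol) <= ennreal C"
proof -
 let ?n = "real CARD('n)" and ?S = "top_power (std_form :: complex ^ 'n => _)"
 let ?c = "bc x" and ?z = "bz x" and ?r = "br x"
 have r: "?r > 0" by (rule good)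
 have c: "?c \<in> A" by (rule good)
 have bm: "bm x > 0" and bM: "bM x > 0" by (rule good)+
 obtain CL where CL: "CL >= 0" "!!f s. psh f ==> (\<forall>y. f y <= s) ==> (\<exists>x. f x = s) ==> (\<integral>\<^sup>+w. ennreal (s - f w) \<partial>vol) <= ennreal CL"
  using L1_bound by blast
 let ?K = "cball ?z (2 * ?r)" and ?B = "ball ?z (2 * ?r)"
 have K8: "?K <= cball ?z (8 * ?r)" using r by auto
 have Ki: "?K <= img_chart ?c" using K8 good(5) by (rule subset_trans)
 define cb :: "complex ^ 'n => real" where "cb = bump 3 ?z (2 * ?r)"
 define cbD where "cbD = (%z v. - 2 * real (Suc 2) * ((z - ?z) \<bullet> v) * bump 2 ?z (2 * ?r) z)"
 define cbH where "cbH = (%z u v. - 2 * real (Suc 2) * ((u \<bullet> v) * bump 2 ?z (2 * ?r) z - 2 * real 2 * ((z - ?z) \<bullet> u) * ((z - ?z) \<bullet> v) * bump (2 - 1) ?z (2 * ?r) z))"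
 have c2: "C2_on UNIV cb cbD cbH"
  using C2_on_bump[of 2 ?z "2 * ?r"] unfolding cb_def cbD_def cbH_def by (simp add: numeral_3_eq_3 numeral_2_eq_2)
 have out: "cb y = 0" "cbD y v = 0" "cbH y v w = 0" if "y ~: ?K" for y v w
  using that r bump_outside[of 3 "2 * ?r" y ?z] bump_outside[of 2 "2 * ?r" y ?z] bump_outside[of 1 "2 * ?r" y ?z]
  by (simp_all add: cb_def cbD_def cbH_def)
 have "\<exists>M. \<forall>y. \<bar>laplacian cbH y\<bar> <= M"
  by (rule compact_support_bounded[of ?K]) (auto simp: laplacian_def out intro!: continuous_intros C2_onD(5)[OF c2])
 then obtain M where M: "!!y. \<bar>laplacian cbH y\<bar> <= M" by blast
 have M0: "M >= 0" using M[of 0] abs_ge_zero by (rule order_trans[rotated])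
 \<comment> \<open>On the ball of radius r the bump of radius 2 r is at least (4 r^2 -
   r^2)^3.\<close>
 define b0 where "b0 = (3 * ?r\<^sup>2) ^ 3"
 have b0: "b0 > 0" using r by (simp add: b0_def)
 define K0 where "K0 = max 0 (ln ?S - ln (bm x))"
 define I1 where "I1 = (LBINT y. cb y) * bLam x"
 define vb where "vb = measure lborel ?B"
 define Cx where "Cx = bM x * (K0 * vb + 2 * ?n\<^sup>2 / b0 * (I1 + M * (CL / bm x)))"
 have cb0: "cb y >= 0" for y by (simp add: cb_def)
 have icb: "integrable lborel cb" unfolding cb_def by (rule bump_integrable) (use r in auto)
 have I1: "I1 >= 0" unfolding I1_def using cb0 good(9)[of x] by (intro mult_nonneg_nonneg Bochner_Integration.integral_nonneg) auto
 have Cx: "Cx >= 0" unfolding Cx_def vb_def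
  using bM b0 I1 M0 CL(1) bm by (intro mult_nonneg_nonneg add_nonneg_nonneg) (auto simp: K0_def)
 have "(\<integral>\<^sup>+w. ennreal (g w) * indicator (W x) w \<partial>vol) <= ennreal Cx"
  if f: "psh f" and g [measurable]: "g \<in> borel_measurable borel"
   and ge: "log_ratio f g" for f g
 proof -
  note fm [measurable] = psh_measurable[OF f] and em [measurable] = extend_inv_measurable[OF c]
  obtain x1 where x1: "!!y. f y <= f x1" using continuous_attains_sup[OF compact_M _ psh_continuous[OF f]] by auto
  define s where "s = f x1"
  let ?f = "%y. f (inv_coord ?c y)"
  obtain D H where D: "C2_on (img_chart ?c) ?f D H"
   "!!y. y \<in> img_chart ?c ==> pos_form (omega_pot omg f ?c (inv_coord ?c y))"
   "weakly_closed (img_chart ?c) (%y. omega_pot omg f ?c (inv_coord ?c y))"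
   "!!y. y \<in> img_chart ?c ==> form_trace (omega_pot omg f ?c (inv_coord ?c y)) = form_trace (omg ?c (inv_coord ?c y)) + laplacian H y"
   by (rule psh_chart[OF f c]) blast
  \<comment> \<open>Subtracting the maximum leaves the second derivatives unchanged and makes the
    function nonpositive, so that only its integral enters after integration by parts.\<close>
  define h where "h y = 1 * ?f y + 1 * (- s)" for y
  have h: "C2_on (img_chart ?c) h D H"
   using C2_on_add[OF D(1) C2_on_const[of _ "- s"], of 1 1] by (simp add: h_def[abs_def])
  have parts: "(LBINT y. H y b b * cb y) = (LBINT y. h y * cbH y b b)" "integrable lborel (%y. H y b b * cb y)" "integrable lborel (%y. h y * cbH y b b)" for b
  proof -
   note A1 = integral_parts[OF open_img[OF c] compact_cball Ki C2_onD(2)[OF h, of b] C1_on_subset[OF C2_onD(1)[OF c2] subset_UNIV] out(1,2), of b]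
   note A2 = integral_parts[OF open_img[OF c] compact_cball Ki C2_onD(1)[OF h] C1_on_subset[OF C2_onD(2)[OF c2, of b] subset_UNIV] out(2,3), of b]
   show "(LBINT y. H y b b * cb y) = (LBINT y. h y * cbH y b b)" using A1(3) A2(3) by simp
   show "integrable lborel (%y. H y b b * cb y)" by (rule A1(1))
   show "integrable lborel (%y. h y * cbH y b b)" by (rule A2(2))
  qed
  have ilap: "integrable lborel (%y. laplacian H y * cb y)"
   unfolding laplacian_def sum_distrib_right by (intro Bochner_Integration.integrable_sum parts)
  have ih: "integrable lborel (%y. h y * laplacian cbH y)"
   unfolding laplacian_def sum_distrib_left by (intro Bochner_Integration.integrable_sum parts)
  have hint: "(\<integral>\<^sup>+y. ennreal (- h y * indicator ?B y) \<partial>lborel) <= ennreal (CL / bm x)"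
  proof -
   have "ennreal (bm x) * (\<integral>\<^sup>+y. ennreal (s - f (extend_inv ?c y)) * indicator ?B y \<partial>lborel) <= (\<integral>\<^sup>+w. ennreal (s - f w) \<partial>vol)"
    by (rule chart_integral_le) auto
   also have "... <= ennreal CL" by (rule CL(2)[OF f]) (use x1 in \<open>auto simp: s_def\<close>)
   also have "(\<integral>\<^sup>+y. ennreal (s - f (extend_inv ?c y)) * indicator ?B y \<partial>lborel) = (\<integral>\<^sup>+y. ennreal (- h y * indicator ?B y) \<partial>lborel)"
    using W(5)[of x] by (intro nn_integral_cong) (auto simp: indicator_def h_def extend_inv_def[OF c])
   finally have "ennreal (1 / bm x) * (ennreal (bm x) * (\<integral>\<^sup>+y. ennreal (- h y * indicator ?B y) \<partial>lborel)) <= ennreal (1 / bm x) * ennreal CL"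
    by (intro mult_left_mono) auto
   then show ?thesis using bm CL(1) by (simp add: mult.assoc[symmetric] ennreal_mult[symmetric])
  qed
  have hs: "(LBINT y. laplacian H y * cb y) <= M * (CL / bm x)"
  proof -
   have "(LBINT y. laplacian H y * cb y) = (LBINT y. h y * laplacian cbH y)"
    unfolding laplacian_def sum_distrib_left sum_distrib_right
    by (subst (1 2) Bochner_Integration.integral_sum) (auto simp: parts)
   also have "ennreal ... <= (\<integral>\<^sup>+y. ennreal (h y * laplacian cbH y) \<partial>lborel)"
    by (rule ennreal_integral_le[OF ih])
   also have "... <= (\<integral>\<^sup>+y. ennreal M * ennreal (- h y * indicator ?B y) \<partial>lborel)"
   proof (rule nn_integral_mono)
    fix y
    have hy: "- h y >= 0" using x1[of "inv_coord ?c y"] by (simp add: h_def s_def)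
    show "ennreal (h y * laplacian cbH y) <= ennreal M * ennreal (- h y * indicator ?B y)"
    proof (cases "y \<in> ?B")
     case True
     have "h y * laplacian cbH y = (- h y) * (- laplacian cbH y)" by simp
     also have "... <= (- h y) * M" using M[of y] hy by (intro mult_left_mono) auto
     finally show ?thesis using True M0 hy by (simp add: ennreal_mult[symmetric] mult.commute ennreal_leI del: minus_mult_left[symmetric])
    next
     case False
     then have "~ norm (y - ?z) < 2 * ?r" by (simp add: dist_norm norm_minus_commute)
     then have "(2 * ?r)\<^sup>2 <= (norm (y - ?z))\<^sup>2" using r by (intro power_mono) auto
     then have "(2 * ?r)\<^sup>2 - (y - ?z) \<bullet> (y - ?z) <= 0" by (simp add: dot_square_norm)
     then have "bump 2 ?z (2 * ?r) y = 0" "bump (2 - 1) ?z (2 * ?r) y = 0" by (simp_all add: bump_def max_def)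
     then have "laplacian cbH y = 0" by (simp add: laplacian_def cbH_def)
     then show ?thesis by simp
    qed
   qed
   also have "... <= ennreal M * ennreal (CL / bm x)"
   proof -
    have [measurable]: "(%y. - h y * indicator ?B y) \<in> borel_measurable borel"
    proof -
     have "(%y. indicator ?B y *\<^sub>R (- h y)) \<in> borel_measurable borel"
      by (intro borel_measurable_continuous_on_indicator continuous_intros continuous_on_subset[OF C1_onD(1)[OF C2_onD(1)[OF h]] W(5)]) simp
     then show ?thesis by (simp add: mult.commute)
    qed
    have "(\<integral>\<^sup>+y. ennreal M * ennreal (- h y * indicator ?B y) \<partial>lborel) = ennreal M * (\<integral>\<^sup>+y. ennreal (- h y * indicator ?B y) \<partial>lborel)"
     by (rule nn_integral_cmult) measurable
    also have "... <= ennreal M * ennreal (CL / bm x)" by (rule mult_left_mono[OF hint]) simp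
    finally show ?thesis .
   qed
   also have "... = ennreal (M * (CL / bm x))" using CL(1) bm by (intro ennreal_mult[symmetric, OF M0]) simp
   finally show ?thesis using M0 CL(1) bm by (subst (asm) ennreal_le_iff) auto
  qed
  \<comment> \<open>A majorant of \<open>g\<close> on the smaller ball that is nonnegative
    everywhere, so its integral also bounds the positive part of \<open>g\<close>.\<close>
  define q where "q y = K0 * indicator ?B y + 2 * ?n\<^sup>2 / b0 * (cb y * bLam x + laplacian H y * cb y)" for y
  have iq: "integrable lborel q"
  proof -
   have A: "integrable lborel (%y. K0 * indicator ?B y :: real)"
    using emeasure_bounded_finite[OF bounded_ball, of ?z "2 * ?r"] by (intro integrable_mult_right integrable_real_indicator) auto
   show ?thesis unfolding q_def
    by (rule Bochner_Integration.integrable_add[OF A integrable_mult_right[OF Bochner_Integration.integrable_add[OF integrable_mult_left[OF icb] ilap]]])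
  qed
  have qi: "(LBINT y. q y) <= K0 * vb + 2 * ?n\<^sup>2 / b0 * (I1 + M * (CL / bm x))"
  proof -
   have iB: "integrable lborel (%y. K0 * indicator ?B y :: real)"
    using emeasure_bounded_finite[OF bounded_ball, of ?z "2 * ?r"] by (intro integrable_mult_right integrable_real_indicator) auto
   have i2: "integrable lborel (%y. cb y * bLam x)" by (intro integrable_mult_left icb)
   have "(LBINT y. q y) = K0 * vb + 2 * ?n\<^sup>2 / b0 * (I1 + (LBINT y. laplacian H y * cb y))"
    unfolding q_def Bochner_Integration.integral_add[OF iB integrable_mult_right[OF Bochner_Integration.integrable_add[OF i2 ilap]]]
     integral_mult_right_zero Bochner_Integration.integral_add[OF i2 ilap] integral_mult_left_zero vb_def I1_def
    by simp
   also have "... <= K0 * vb + 2 * ?n\<^sup>2 / b0 * (I1 + M * (CL / bm x))"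
    using hs b0 by (intro add_left_mono mult_left_mono) auto
   finally show ?thesis .
  qed
  have q: "0 <= q y" "y \<in> ball ?z ?r ==> g (inv_coord ?c y) <= q y" for y
  proof -
   have tr: "0 <= cb y * form_trace (omega_pot omg f ?c (inv_coord ?c y))" "cb y * form_trace (omega_pot omg f ?c (inv_coord ?c y)) <= cb y * bLam x + laplacian H y * cb y" if y: "y \<in> ?K" for y
   proof -
    have yi: "y \<in> img_chart ?c" and y8: "y \<in> cball ?z (8 * ?r)" using y Ki K8 by blast+
    show "0 <= cb y * form_trace (omega_pot omg f ?c (inv_coord ?c y))" by (intro mult_nonneg_nonneg cb0 form_trace_nonneg D(2) yi)
    have "cb y * form_trace (omg ?c (inv_coord ?c y)) <= cb y * bLam x" by (intro mult_left_mono good(12) y8 cb0)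
    then show "cb y * form_trace (omega_pot omg f ?c (inv_coord ?c y)) <= cb y * bLam x + laplacian H y * cb y"
     unfolding D(4)[OF yi] by (simp add: distrib_left mult.commute)
   qed
   have "0 <= cb y * bLam x + laplacian H y * cb y"
    using tr[of y] out(1)[of y] by (cases "y \<in> ?K") (linarith, simp)
   then have "0 <= 2 * ?n\<^sup>2 / b0 * (cb y * bLam x + laplacian H y * cb y)" using b0 by (intro mult_nonneg_nonneg[of "2 * ?n\<^sup>2 / b0"]) auto
   moreover have "0 <= K0 * (indicator ?B y :: real)" by (simp add: K0_def)
   ultimately show "0 <= q y" unfolding q_def by linarith
   assume y: "y \<in> ball ?z ?r"
   have yK: "y \<in> ?K" and yB: "y \<in> ?B" using y r by auto
   have yi: "y \<in> img_chart ?c" and y8: "y \<in> cball ?z (8 * ?r)" using yK Ki K8 by blast+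
   let ?X = "omega_pot omg f ?c (inv_coord ?c y)"
   have b: "b0 <= cb y"
   proof -
    have "(norm (y - ?z))\<^sup>2 <= ?r\<^sup>2" using y by (intro power_mono) (auto simp: dist_norm norm_minus_commute)
    then have "3 * ?r\<^sup>2 <= (2 * ?r)\<^sup>2 - (y - ?z) \<bullet> (y - ?z)" by (simp add: dot_square_norm power_mult_distrib)
    then have "3 * ?r\<^sup>2 <= max 0 ((2 * ?r)\<^sup>2 - (y - ?z) \<bullet> (y - ?z))" by (rule max.coboundedI2)
    then show ?thesis unfolding b0_def cb_def bump_def by (rule power_mono) simp
   qed
   have X: "pos_form ?X" by (rule D(2)[OF yi])
   have "g (inv_coord ?c y) = ln (top_power ?X / top_power (omg ?c (inv_coord ?c y)))"
    using ge c inv_coord_dom[OF c yi] by blast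
   also have "... = ln (top_power ?X) - ln (vol_density ?c y)"
    using top_power_pos[OF X] vol_density_pos[OF c yi] yi by (simp add: ln_div vol_density_def[OF c])
   also have "... <= ln ?S + 2 * ?n\<^sup>2 * form_trace ?X - ln (bm x)"
    using ln_top_power_le_trace[OF X] ln_mono[OF good(10)[OF y8] bm] bm vol_density_pos[OF c yi] by linarith
   also have "... <= K0 + 2 * ?n\<^sup>2 * form_trace ?X" by (simp add: K0_def)
   also have "2 * ?n\<^sup>2 * form_trace ?X <= 2 * ?n\<^sup>2 / b0 * (cb y * form_trace ?X)"
   proof -
    have "b0 * form_trace ?X <= cb y * form_trace ?X" by (intro mult_right_mono b form_trace_nonneg X)
    then have "2 * ?n\<^sup>2 / b0 * (b0 * form_trace ?X) <= 2 * ?n\<^sup>2 / b0 * (cb y * form_trace ?X)" using b0 by (intro mult_left_mono) auto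
    then show ?thesis using b0 by simp
   qed
   also have "... <= 2 * ?n\<^sup>2 / b0 * (cb y * bLam x + laplacian H y * cb y)"
    using tr(2)[OF yK] b0 by (intro mult_left_mono) auto
   finally show "g (inv_coord ?c y) <= q y" using yB by (simp add: q_def)
  qed
  have "(\<integral>\<^sup>+w. ennreal (g w) * indicator (W x) w \<partial>vol) = (\<integral>\<^sup>+y. ennreal (vol_density ?c y) * ennreal (g (inv_coord ?c y)) * indicator (ball ?z ?r) y \<partial>lborel)"
   unfolding W_def by (rule nn_integral_inv_image[OF c open_ball W(6)]) measurable
  also have "... <= (\<integral>\<^sup>+y. ennreal (bM x * q y) \<partial>lborel)"
  proof (rule nn_integral_mono)
   fix y
   show "ennreal (vol_density ?c y) * ennreal (g (inv_coord ?c y)) * indicator (ball ?z ?r) y <= ennreal (bM x * q y)"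
   proof (cases "y \<in> ball ?z ?r")
    case True
    then have "y \<in> cball ?z (8 * ?r)" using r by simp
    from good(11)[OF this] have "ennreal (vol_density ?c y) * ennreal (g (inv_coord ?c y)) <= ennreal (bM x) * ennreal (q y)"
     using q(2)[OF True] by (intro mult_mono ennreal_leI) auto
    then show ?thesis using True bM q(1)[of y] by (simp add: ennreal_mult)
   qed simp
  qed
  also have "... = ennreal (bM x * (LBINT y. q y))"
   using nn_integral_eq_integral[of lborel "%y. bM x * q y"] iq q(1) bM by simp
  also have "... <= ennreal Cx" unfolding Cx_def using qi bM by (intro ennreal_leI mult_left_mono) auto
  finally show ?thesis .
 qed
 then show ?thesis using Cx by blast
qed

lemma entropy_bound:
 "\<exists>C\<ge>0. \<forall>f g. psh f --> g \<in> borel_measurable borel --> log_ratio f g -->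
  (\<integral>\<^sup>+w. ennreal (g w) \<partial>vol) <= ennreal C"
proof -
 obtain Q where Q: "finite Q" "(\<Union>x\<in>Q. W x) = UNIV" using finite_W_cover by blast
 define P where "P x C \<longleftrightarrow> C >= 0 & (\<forall>f g. psh f --> g \<in> borel_measurable borel --> log_ratio f g -->
  (\<integral>\<^sup>+w. ennreal (g w) * indicator (W x) w \<partial>vol) <= ennreal C)" for x C
 have "\<forall>x. \<exists>C. P x C" unfolding P_def using entropy_local by blast
 then obtain C where C: "!!x. P x (C x)" using choice[of P] by blast
 have C0: "C x >= 0" for x using C[of x] unfolding P_def by blast
 have "(\<integral>\<^sup>+w. ennreal (g w) \<partial>vol) <= ennreal (\<Sum>x\<in>Q. C x)"
  if f: "psh f" "g \<in> borel_measurable borel" "log_ratio f g" for f g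
 proof -
  have "(\<integral>\<^sup>+w. ennreal (g w) \<partial>vol) <= (\<Sum>x\<in>Q. \<integral>\<^sup>+w. ennreal (g w) * indicator (W x) w \<partial>vol)"
   by (rule nn_integral_le_cover[OF Q]) (use f(2) in measurable)
  also have "... <= (\<Sum>x\<in>Q. ennreal (C x))"
   by (rule sum_mono) (use C f in \<open>unfold P_def, blast\<close>)
  also have "... = ennreal (\<Sum>x\<in>Q. C x)" by (rule sum_ennreal) (rule C0)
  finally show ?thesis .
 qed
 then show ?thesis using sum_nonneg[of Q C] C0 by blast
qed

end

section \<open>The flow: comparison in time and growth of the mean\<close>

lemma time_interval_props:
 assumes "0 < T"
 shows "0 \<in> time_interval T" "t \<in> time_interval T ==> 0 <= t"
  "t \<in> time_interval T ==> 0 <= s ==> s <= t ==> s \<in> time_interval T"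
  "t \<in> time_interval T ==> \<exists>e>0. {t..t+e} <= time_interval T"
proof -
 show "0 \<in> time_interval T" using assms by (simp add: time_interval_def zero_ereal_def[symmetric])
 show "t \<in> time_interval T ==> 0 <= t" by (simp add: time_interval_def)
 show le: "s \<in> time_interval T" if "t \<in> time_interval T" "0 <= s" "s <= t" for s t
  using that by (auto simp: time_interval_def intro: le_less_trans[of "ereal s" "ereal t"])
 assume t: "t \<in> time_interval T"
 then have "ereal t < T" by (simp add: time_interval_def)
 then obtain u where u: "t < u" "ereal u < T" using ereal_dense2[of "ereal t" T] by auto
 have "u \<in> time_interval T" using u t by (simp add: time_interval_def)
 then have "{t..t+(u-t)} <= time_interval T" using t le by (auto simp: time_interval_def)
 then show "\<exists>e>0. {t..t+e} <= time_interval T" using u(1) by (intro exI[of _ "u - t"]) simp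
qed

lemma derivative_unique_right:
 fixes f :: "real => real"
 assumes "(f has_real_derivative a) (at t within I)" "(f has_real_derivative b) (at t within I)" "e > 0" "{t..t+e} <= I"
 shows "a = b"
proof -
 let ?F = "at t within {t<..<t+e}"
 have nb: "?F ~= bot" using islimpt_greaterThanLessThan1[of t "t + e"] assms(3) by (simp add: trivial_limit_within)
 have s: "{t<..<t+e} <= I" using assms(4) by auto
 show ?thesis
  using DERIV_subset[OF assms(1) s] DERIV_subset[OF assms(2) s] tendsto_unique[OF nb] unfolding has_field_derivative_iff by blast
qed

locale flow = kaehler A omg for A :: "('m::t2_space, 'n::finite) chart set" and omg +
 fixes F :: "'m => real" and \<phi>\<^sub>0 :: "'m => real" and T :: ereal and ph :: "'m => real => real"
 assumes T: "0 < T" and sol: "C2_flow_solution A omg F \<phi>\<^sub>0 T ph"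
begin

abbreviation "I == time_interval T"

lemmas I = time_interval_props[OF T]

lemma sol_C2: "c \<in> A ==> Ck_on 2 (%(y, t). ph (inv_coord c y) t) (img_chart c \<times> I)"
 and sol_deriv: "c \<in> A ==> x \<in> dom_chart c ==> t \<in> I ==> (ph x has_real_derivative
     ln (top_power (omega_pot omg (%x. ph x t) c x) / (exp (real CARD('n) * F x) * top_power (omg c x)))) (at t within I)"
 and sol_0: "ph x 0 = \<phi>\<^sub>0 x"
 using sol unfolding C2_flow_solution_def by blast+

lemma psh_t: "t \<in> I ==> psh (%x. ph x t)"
 unfolding psh_def
proof (intro conjI ballI)
 fix c assume t: "t \<in> I" and c: "c \<in> A"
 show "Ck_on 2 (%y. ph (inv_coord c y) t) (img_chart c)"
  using Ck_on_slice[OF sol_C2[OF c] t] by simp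
qed (use sol in \<open>unfold C2_flow_solution_def, blast\<close>)

text \<open>Chosen without reference to a chart. It is unambiguous because every time in
  \<open>I\<close> has a right neighbourhood inside \<open>I\<close>.\<close>

definition dt :: "'m => real => real" where
 "dt x t = (SOME d. (ph x has_real_derivative d) (at t within I))"

lemma dt:
 assumes t: "t \<in> I"
 shows "(ph x has_real_derivative dt x t) (at t within I)"
  and "(ph x has_real_derivative d) (at t within I) ==> dt x t = d"
proof -
 obtain c where c: "c \<in> A" "x \<in> dom_chart c" by (rule chart_exists)
 show 1: "(ph x has_real_derivative dt x t) (at t within I)"
  unfolding dt_def by (rule someI) (rule sol_deriv[OF c t])
 obtain e where e: "e > 0" "{t..t+e} <= I" using I(4)[OF t] by blast
 show "(ph x has_real_derivative d) (at t within I) ==> dt x t = d"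
  by (rule derivative_unique_right[OF 1 _ e])
qed

lemma dt_eq:
 assumes c: "c \<in> A" "x \<in> dom_chart c" and t: "t \<in> I"
 shows "top_power (omega_pot omg (%x. ph x t) c x) = exp (dt x t) * (exp (real CARD('n) * F x) * top_power (omg c x))"
  and "dt x t = ln (top_power (omega_pot omg (%x. ph x t) c x) / top_power (omg c x)) - real CARD('n) * F x"
proof -
 have P: "top_power (omega_pot omg (%x. ph x t) c x) > 0" by (rule top_power_pos[OF psh_pos[OF psh_t[OF t] c]])
 have P0: "top_power (omg c x) > 0" by (rule top_power_pos[OF form_pos[OF c]])
 have e: "dt x t = ln (top_power (omega_pot omg (%x. ph x t) c x) / (exp (real CARD('n) * F x) * top_power (omg c x)))"
  by (rule dt(2)[OF t sol_deriv[OF c t]])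
 show "top_power (omega_pot omg (%x. ph x t) c x) = exp (dt x t) * (exp (real CARD('n) * F x) * top_power (omg c x))"
  unfolding e using P P0 by simp
 show "dt x t = ln (top_power (omega_pot omg (%x. ph x t) c x) / top_power (omg c x)) - real CARD('n) * F x"
  unfolding e using P P0 by (simp add: ln_div ln_mult)
qed

text \<open>The time derivative is the derivative of the joint function in direction (0, 1); the
  joint function is C^2, so \<open>dt\<close> is continuous in space and time together, up to time
  0.\<close>

lemma chart_joint:
 assumes c: "c \<in> A"
 shows "continuous_on (img_chart c \<times> I) (%(y, t). ph (inv_coord c y) t)"
  "continuous_on (img_chart c \<times> I) (%(y, t). dt (inv_coord c y) t)"
proof -
 let ?f = "%(y, t). ph (inv_coord c y) t"
 let ?S = "img_chart c \<times> I"
 have "Ck_on (Suc (Suc 0)) ?f ?S" using sol_C2[OF c] by (simp add: numeral_2_eq_2)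
 then obtain f' where f'0: "(\<forall>y\<in>?S. (?f has_derivative f' y) (at y within ?S)) & (\<forall>v. Ck_on (Suc 0) (%y. f' y v) ?S)"
  unfolding Ck_on.simps(2)[of "Suc 0"] by (rule exE)
 have f': "(?f has_derivative f' y) (at y within ?S)" if "y \<in> ?S" for y using f'0 that by blast
 show "continuous_on ?S ?f" unfolding continuous_on_eq_continuous_within
  using has_derivative_continuous[OF f'] by blast
 have cd: "continuous_on ?S (%y. f' y v)" for v
 proof -
  have "Ck_on (Suc 0) (%y. f' y v) ?S" using f'0 by blast
  then obtain g where "\<forall>y\<in>?S. ((%y. f' y v) has_derivative g y) (at y within ?S)"
   unfolding Ck_on.simps(2)[of 0] by blast
  then show ?thesis unfolding continuous_on_eq_continuous_within using has_derivative_continuous by blast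
 qed
 have "f' p (0, 1) = (%(y, t). dt (inv_coord c y) t) p" if p: "p \<in> ?S" for p
 proof -
  obtain y t where yt: "p = (y, t)" "y \<in> img_chart c" "t \<in> I" using p by blast
  have D: "((%s. ?f (y, s)) has_derivative (%h. f' (y, t) (0, h))) (at t within I)"
  proof (rule has_derivative_in_compose2[where g="?f" and f="%s. (y, s)" and t="?S" and g'=f' and f'="%h. (0, h)"])
   show "((%s. (y, s)) has_derivative (%h. (0, h))) (at t within I)" by (auto intro!: derivative_eq_intros)
   show "(?f has_derivative f' p) (at p within ?S)" if "p \<in> ?S" for p by (rule f'[OF that])
   show "(%s. (y, s)) ` I <= ?S" using yt(2) by blast
   show "t \<in> I" by (rule yt(3))
  qed
  have "f' (y, t) (0, h) = f' (y, t) (0, 1) * h" for h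
   using linear_scale[OF has_derivative_linear[OF f'], of "(y, t)" h "(0, 1)"] yt by simp
  then have eq: "(%h. f' (y, t) (0, h)) = (%h. f' (y, t) (0, 1) * h)" by (rule ext)
  have "((%s. ph (inv_coord c y) s) has_derivative (%h. f' (y, t) (0, 1) * h)) (at t within I)"
   using D unfolding eq prod.case .
  then have "(ph (inv_coord c y) has_real_derivative f' (y, t) (0, 1)) (at t within I)"
   unfolding has_field_derivative_def .
  then show ?thesis using dt(2)[OF yt(3)] yt(1) by simp
 qed
 then show "continuous_on ?S (%(y, t). dt (inv_coord c y) t)"
  using continuous_on_eq[OF cd[of "(0, 1)"]] by blast
qed

lemma joint_continuous:
 fixes h :: "'m => real => real"
 assumes h: "!!c. c \<in> A ==> continuous_on (img_chart c \<times> I) (%(y, t). h (inv_coord c y) t)"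
 shows "continuous_on (UNIV \<times> I) (%(x, t). h x t)"
 unfolding continuous_on_eq_continuous_within
proof
 fix p :: "'m \<times> real" assume p: "p \<in> UNIV \<times> I"
 obtain c where c: "c \<in> A" "fst p \<in> dom_chart c" by (rule chart_exists)
 have "continuous_on (dom_chart c \<times> I) (%p. (%(y, t). h (inv_coord c y) t) (coord c (fst p), snd p))"
  by (rule continuous_on_compose2[OF h[OF c(1)]])
   (auto intro!: continuous_intros continuous_on_compose2[OF continuous_coord[OF c(1)]])
 then have "continuous_on (dom_chart c \<times> I) (%(x, t). h x t)"
  by (rule continuous_on_eq) (auto simp: inv_coord_coord[OF c(1)])
 then have "continuous (at p within dom_chart c \<times> I) (%(x, t). h x t)"
  unfolding continuous_on_eq_continuous_within using p c(2) by (cases p) auto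
 moreover have "at p within UNIV \<times> I = at p within dom_chart c \<times> I"
  by (rule at_within_nhd[where S="dom_chart c \<times> UNIV"]) (use c open_dom[OF c(1)] in \<open>auto simp: mem_Times_iff intro: open_Times\<close>)
 ultimately show "continuous (at p within UNIV \<times> I) (%(x, t). h x t)" by simp
qed

lemma ph_continuous: "continuous_on (UNIV \<times> I) (%(x, t). ph x t)"
 and dt_continuous: "continuous_on (UNIV \<times> I) (%(x, t). dt x t)"
 using joint_continuous chart_joint by blast+

lemma slice_continuous: "t \<in> I ==> continuous_on UNIV (%x. dt x t)"
proof -
 assume t: "t \<in> I"
 have "continuous_on UNIV (%x. (%(x, t). dt x t) (x, t))"
  by (rule continuous_on_compose2[OF dt_continuous]) (use t in \<open>auto intro!: continuous_on_Pair continuous_on_id continuous_on_const\<close>)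
 then show ?thesis by simp
qed

text \<open>At a maximum in space of ph (l t + h) - l ph (t) the complex Hessians are ordered;
  together with \<open>omg\<close> <= l \<open>omg\<close> this orders the forms at time l t + h and
  l times those at time t. Comparing top powers gives dt (l t + h) <= dt (t) + n ln l, where F
  cancels because it is the same at both times. The uses are h = 0 with l near 1, and l = 1 with
  small h.\<close>

lemma max_principle:
 assumes l: "l >= 1" and h: "h >= 0" and t: "0 <= t0" "t0 <= t1" "l * t1 + h \<in> I"
  and b: "!!y. ph y (l * t0 + h) - l * ph y t0 <= b"
 shows "ph x (l * t1 + h) - l * ph x t1 <= b + l * real CARD('n) * ln l * (t1 - t0)"
proof (rule field_le_epsilon)
 fix e0 :: real assume e0: "e0 > 0"
 \<comment> \<open>The extra slope makes the inequality at the maximum strict, and over the whole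
   time interval it costs at most \<open>e0\<close>.\<close>
 define e where "e = e0 / (l * (t1 - t0) + 1)"
 have lt: "l * (t1 - t0) >= 0" using l t by simp
 have e: "e > 0" "e * l * (t1 - t0) <= e0"
 proof -
  show "e > 0" unfolding e_def using e0 lt by (intro divide_pos_pos) linarith+
  then have "e * (l * (t1 - t0)) <= e * (l * (t1 - t0) + 1)" by (intro mult_left_mono) auto
  also have "... = e0" unfolding e_def using lt by simp
  finally show "e * l * (t1 - t0) <= e0" by (simp add: mult.assoc)
 qed
 define k where "k = l * real CARD('n) * ln l + e * l"
 define w where "w = (%(x, t). ph x (l * t + h) - l * ph x t - k * (t - t0))"
 let ?S = "(UNIV :: 'm set) \<times> {t0..t1}"
 have inI: "l * t + h \<in> I" "t \<in> I" if "t \<in> {t0..t1}" for t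
 proof -
  have "l * t <= l * t1" "0 <= l * t" using that l t by (auto intro: mult_left_mono)
  then show 1: "l * t + h \<in> I" by (intro I(3)[OF t(3)]) (use h in auto)
  have "1 * t <= l * t" using l that t by (intro mult_right_mono) auto
  then show "t \<in> I" using that t h by (intro I(3)[OF 1]) auto
 qed
 have "continuous_on ?S w" unfolding w_def case_prod_unfold
  by (intro continuous_intros continuous_on_compose2[OF ph_continuous[unfolded case_prod_unfold], where f="%p. (fst p, l * snd p + h)", simplified]
    continuous_on_compose2[OF ph_continuous[unfolded case_prod_unfold], where f="%p. (fst p, snd p)", simplified])
   (use inI in auto)
 moreover have "compact ?S" by (intro compact_Times compact_M compact_Icc)
 moreover have "?S ~= {}" using t by auto
 ultimately obtain p where p: "p \<in> ?S" "!!p'. p' \<in> ?S ==> w p' <= w p"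
  using continuous_attains_sup[of ?S w] by blast
 obtain xs ts where ps: "p = (xs, ts)" "ts \<in> {t0..t1}" using p(1) by blast
 have "w p <= b"
 proof (cases "ts = t0")
  case True
  then show ?thesis using b[of xs] by (simp add: ps w_def)
 next
  case False
  then have tt: "t0 < ts" using ps by auto
  have d: "((%t. w (xs, t)) has_real_derivative l * dt xs (l * ts + h) - l * dt xs ts - k) (at ts within {t0..ts})"
  proof -
   have d1: "(ph xs has_real_derivative dt xs ts) (at ts within {t0..ts})"
    by (rule DERIV_subset[OF dt(1)[OF inI(2)[OF ps(2)]]]) (use inI(2) ps in auto)
   have "(ph xs o (%t. l * t + h) has_real_derivative dt xs (l * ts + h) * l) (at ts within {t0..ts})"
   proof (rule DERIV_image_chain)
    show "(ph xs has_real_derivative dt xs (l * ts + h)) (at (l * ts + h) within (%t. l * t + h) ` {t0..ts})"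
     by (rule DERIV_subset[OF dt(1)[OF inI(1)[OF ps(2)]]]) (use inI(1) ps in auto)
    show "((%t. l * t + h) has_real_derivative l) (at ts within {t0..ts})" by (auto intro!: derivative_eq_intros)
   qed
   then have d2: "((%t. ph xs (l * t + h)) has_real_derivative l * dt xs (l * ts + h)) (at ts within {t0..ts})"
    by (simp add: o_def mult.commute)
   show ?thesis unfolding w_def prod.case
    by (intro DERIV_diff d2 DERIV_cmult d1) (auto intro!: derivative_eq_intros)
  qed
  have "0 <= l * dt xs (l * ts + h) - l * dt xs ts - k"
   by (rule derivative_nonneg_at_left_max[OF d tt]) (use p(2) ps in auto)
  then have "l * (dt xs ts + real CARD('n) * ln l + e) <= l * dt xs (l * ts + h)" by (simp add: k_def algebra_simps)
  then have A1: "dt xs ts + real CARD('n) * ln l + e <= dt xs (l * ts + h)" using l by simp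
  obtain c where c: "c \<in> A" "xs \<in> dom_chart c" by (rule chart_exists)
  let ?y = "coord c xs"
  have y: "?y \<in> img_chart c" "inv_coord c ?y = xs" using c inv_coord_coord[OF c] by auto
  note i1 = inI(1)[OF ps(2)] and i2 = inI(2)[OF ps(2)]
  obtain D1 H1 where D1: "C2_on (img_chart c) (%y. ph (inv_coord c y) (l * ts + h)) D1 H1"
   "!!y. y \<in> img_chart c ==> omega_pot omg (%x. ph x (l * ts + h)) c (inv_coord c y) = (%u v. 1 * omg c (inv_coord c y) u v + 1 * ddc (H1 y) u v)"
   by (rule psh_chart[OF psh_t[OF i1] c(1)]) blast
  obtain D2 H2 where D2: "C2_on (img_chart c) (%y. ph (inv_coord c y) ts) D2 H2"
   "!!y. y \<in> img_chart c ==> omega_pot omg (%x. ph x ts) c (inv_coord c y) = (%u v. 1 * omg c (inv_coord c y) u v + 1 * ddc (H2 y) u v)"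
   by (rule psh_chart[OF psh_t[OF i2] c(1)]) blast
  have D3: "C2_on (img_chart c) (%y. 1 * ph (inv_coord c y) (l * ts + h) + (- l) * ph (inv_coord c y) ts)
    (%z v. 1 * D1 z v + (- l) * D2 z v) (%z u v. 1 * H1 z u v + (- l) * H2 z u v)"
   by (rule C2_on_add[OF D1(1) D2(1)])
  have H3: "1 * H1 ?y v v + (- l) * H2 ?y v v <= 0" for v
  proof (rule second_derivative_max[OF open_img[OF c(1)] y(1) D3])
   fix z assume "z \<in> img_chart c"
   show "1 * ph (inv_coord c z) (l * ts + h) + (- l) * ph (inv_coord c z) ts <= 1 * ph (inv_coord c ?y) (l * ts + h) + (- l) * ph (inv_coord c ?y) ts"
    using p(2)[of "(inv_coord c z, ts)"] ps y(2) by (simp add: w_def)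
  qed
  have dd: "ddc (H1 ?y) v (J v) <= l * ddc (H2 ?y) v (J v)" for v
   unfolding ddc_herm(2)[OF C2_onD(4)[OF D1(1) y(1)] C2_onD(3)[OF D1(1) y(1)]] ddc_herm(2)[OF C2_onD(4)[OF D2(1) y(1)] C2_onD(3)[OF D2(1) y(1)]]
   using H3[of v] H3[of "J v"] by (simp add: distrib_left)
  let ?X1 = "omega_pot omg (%x. ph x (l * ts + h)) c xs" and ?X2 = "omega_pot omg (%x. ph x ts) c xs"
  have X2: "pos_form ?X2" by (rule psh_pos[OF psh_t[OF i2] c])
  have P0: "top_power (omg c xs) > 0" by (rule top_power_pos[OF form_pos[OF c]])
  have "top_power ?X1 <= top_power (%u v. l * ?X2 u v)"
  proof (rule top_power_mono)
   show "pos_form ?X1" by (rule psh_pos[OF psh_t[OF i1] c])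
   show "herm_form (%u v. l * ?X2 u v)" by (rule pos_form_herm[OF pos_form_scale[OF X2]]) (use l in simp)
   fix v
   have w0: "omg c xs v (J v) >= 0"
   proof (cases "v = 0")
    case True
    have "bilinear (omg c xs)" by (rule herm_formD(1)[OF pos_form_herm[OF form_pos[OF c]]])
    then show ?thesis using True by (simp add: bilinear_lzero)
   next
    case False
    then show ?thesis using form_pos[OF c] unfolding pos_form_def by (simp add: less_imp_le)
   qed
   have "1 * omg c xs v (J v) <= l * omg c xs v (J v)" using l w0 by (intro mult_right_mono)
   then show "?X1 v (J v) <= l * ?X2 v (J v)"
    using D1(2)[OF y(1)] D2(2)[OF y(1)] dd[of v] unfolding y(2) by (simp add: distrib_left)
  qed
  also have "... = l ^ CARD('n) * top_power ?X2" by (rule top_power_scale)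
  finally have "exp (dt xs (l * ts + h)) * (exp (real CARD('n) * F xs) * top_power (omg c xs)) <= (l ^ CARD('n) * exp (dt xs ts)) * (exp (real CARD('n) * F xs) * top_power (omg c xs))"
   unfolding dt_eq(1)[OF c i1] dt_eq(1)[OF c i2] by (simp add: mult.assoc)
  then have "exp (dt xs (l * ts + h)) <= l ^ CARD('n) * exp (dt xs ts)" using P0 by (subst (asm) mult_le_cancel_right_pos) auto
  also have "l ^ CARD('n) = exp (real CARD('n) * ln l)" using l by (simp add: exp_of_nat_mult)
  finally have "exp (dt xs (l * ts + h)) <= exp (real CARD('n) * ln l + dt xs ts)" unfolding exp_add .
  then show ?thesis using A1 e(1) by simp
 qed
 moreover have "w (x, t1) <= w p" by (rule p(2)) (use t in auto)
 ultimately have "ph x (l * t1 + h) - l * ph x t1 <= b + k * (t1 - t0)" by (simp add: w_def)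
 also have "k * (t1 - t0) = l * real CARD('n) * ln l * (t1 - t0) + e * l * (t1 - t0)" by (simp add: k_def distrib_right)
 finally show "ph x (l * t1 + h) - l * ph x t1 <= b + l * real CARD('n) * ln l * (t1 - t0) + e0" using e(2) by linarith
qed

text \<open>Differentiating the comparison of \<open>ph(lt)/l\<close> with \<open>ph(t)\<close> at \<open>l = 1\<close>.\<close>

lemma dt_upper:
 assumes B: "!!x. \<bar>\<phi>\<^sub>0 x\<bar> <= B" and t: "t \<in> I" "t > 0"
 shows "dt x t <= (ph x t + B) / t + real CARD('n)"
proof -
 obtain e where e: "e > 0" "{t..t+e} <= I" using I(4)[OF t(1)] by blast
 show ?thesis
 proof (rule derivative_le_of_increment[OF dt(1)[OF t(1)] e, where q="real CARD('n) / t"])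
  fix s assume s: "0 < s" "s < e"
  \<comment> \<open>With this factor the scaled time l t is t + s.\<close>
  define l where "l = 1 + s / t"
  have l: "l >= 1" "l * t + 0 = t + s" using s t by (auto simp: l_def field_simps)
  have "ph x (l * t + 0) - l * ph x t <= (l - 1) * B + l * real CARD('n) * ln l * (t - 0)"
  proof (rule max_principle[OF l(1)])
   show "l * t + 0 \<in> I" unfolding l(2) using e(2) s by auto
   show "ph y (l * 0 + 0) - l * ph y 0 <= (l - 1) * B" for y
   proof -
    have "(l - 1) * (- \<phi>\<^sub>0 y) <= (l - 1) * B" using B[of y] l(1) by (intro mult_left_mono) auto
    then show ?thesis by (simp add: sol_0 algebra_simps)
   qed
  qed (use t in auto)
  moreover have "l * real CARD('n) * ln l * (t - 0) <= l * real CARD('n) * (s / t) * t"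
  proof -
   have "ln l <= s / t" using ln_le_minus_one[of l] l(1) by (simp add: l_def)
   then show ?thesis using l t by (simp only: diff_zero, intro mult_right_mono mult_left_mono) auto
  qed
  ultimately have "ph x (t + s) - l * ph x t <= (l - 1) * B + l * real CARD('n) * (s / t) * t" unfolding l(2) by linarith
  moreover have "l * real CARD('n) * (s / t) * t = l * real CARD('n) * s" using t by simp
  moreover have "s * ((ph x t + B) / t + real CARD('n) + real CARD('n) / t * s) = (l - 1) * ph x t + (l - 1) * B + l * real CARD('n) * s"
   using t by (simp add: l_def field_simps)
  moreover have "(l - 1) * ph x t = l * ph x t - ph x t" by (simp add: left_diff_distrib)
  ultimately show "ph x (t + s) - ph x t <= s * ((ph x t + B) / t + real CARD('n) + real CARD('n) / t * s)"
   by linarith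
 qed
qed

text \<open>For l = 1 the comparison says that the largest increment of \<open>ph\<close> over a
  time step s does not grow with time. A bound of \<open>dt\<close> on [1,2] limits the increment
  that starts at time 1, hence all later ones.\<close>

lemma dt_late:
 assumes k: "!!x ta. ta \<in> {1..2} ==> dt x ta <= k" and t: "t \<in> I" "t >= 2"
 shows "dt x t <= k"
proof -
 obtain e where e: "e > 0" "{t..t+e} <= I" using I(4)[OF t(1)] by blast
 \<comment> \<open>Steps below 1 keep [1, 1 + s] inside [1,2], where the hypothesis applies.\<close>
 define e' where "e' = min e 1"
 have "{t..t+e'} <= {t..t+e}" by (auto simp: e'_def)
 then have "{t..t+e'} <= I" using e(2) by (rule subset_trans)
 moreover have "e' > 0" "e' <= 1" using e(1) by (auto simp: e'_def)
 ultimately have e': "e' > 0" "{t..t+e'} <= I" "e' <= 1" by blast+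
 have early: "ta \<in> I" if "ta \<in> {1..2}" for ta by (rule I(3)[OF t(1)]) (use that t in auto)
 show ?thesis
 proof (rule derivative_le_of_increment[OF dt(1)[OF t(1)] e'(1,2), where q=0])
  fix s assume s: "0 < s" "s < e'"
  have s1: "s < 1" using s e'(3) by linarith
  have sub: "{1..1+s} <= I" by (rule subsetI, rule early) (use s1 in simp)
  have b: "ph y (1 * 1 + s) - 1 * ph y 1 <= s * k" for y
  proof -
   have "k * 1 - ph y 1 <= k * (1 + s) - ph y (1 + s)"
   proof (rule DERIV_within_nonneg_mono[where f="%ta. k * ta - ph y ta" and f'="%ta. k - dt y ta"])
    fix ta assume ta: "ta \<in> {1..1+s}"
    have ta2: "ta \<in> {1..2}" using ta s1 by simp
    show "((%ta. k * ta - ph y ta) has_real_derivative k - dt y ta) (at ta within {1..1+s})"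
     by (intro DERIV_diff DERIV_subset[OF dt(1)[OF early[OF ta2]] sub]) (auto intro!: derivative_eq_intros)
    show "k - dt y ta >= 0" using k[OF ta2] by simp
   qed (use s in simp)
   then show ?thesis by (simp add: algebra_simps)
  qed
  have "1 * t + s \<in> I" by (rule subsetD[OF e'(2)]) (use s in simp)
  then have "ph x (1 * t + s) - 1 * ph x t <= s * k + 1 * real CARD('n) * ln 1 * (t - 1)"
   by (rule max_principle[OF order_refl less_imp_le[OF s(1)] zero_le_one _ _ b, rotated]) (use t in simp)
  then show "ph x (t + s) - ph x t <= s * (k + 0 * s)" by simp
 qed
qed

text \<open>The equation at time 0 expresses F by \<open>dt\<close> and two top powers, all of them
  continuous. This supplies the measurability of F.\<close>

lemma F_continuous: "continuous_on UNIV F"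
proof (rule chart_continuous)
 fix c assume c: "c \<in> A"
 obtain D H where D: "weakly_closed (img_chart c) (%y. omega_pot omg (%x. ph x 0) c (inv_coord c y))"
  "!!y. y \<in> img_chart c ==> pos_form (omega_pot omg (%x. ph x 0) c (inv_coord c y))"
  by (rule psh_chart[OF psh_t[OF I(1)] c]) blast
 have c1: "continuous_on (img_chart c) (%y. top_power (omega_pot omg (%x. ph x 0) c (inv_coord c y)))"
  unfolding top_power_def by (intro continuous_intros) (use D(1) in \<open>auto simp: weakly_closed_def\<close>)
 have c2: "continuous_on (img_chart c) (%y. dt (inv_coord c y) 0)"
  by (rule continuous_on_compose2[OF slice_continuous[OF I(1)] continuous_inv_coord[OF c]]) simp
 have "continuous_on (img_chart c) (%y. (ln (top_power (omega_pot omg (%x. ph x 0) c (inv_coord c y)) / vol_density c y) - dt (inv_coord c y) 0) / real CARD('n))"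
 proof (intro continuous_intros c1 c2 vol_density_continuous[OF c])
  show "\<forall>y\<in>img_chart c. vol_density c y ~= 0" using vol_density_pos[OF c] by (auto simp: less_imp_neq[symmetric])
  show "\<forall>y\<in>img_chart c. top_power (omega_pot omg (%x. ph x 0) c (inv_coord c y)) / vol_density c y ~= 0"
  proof
   fix y assume y: "y \<in> img_chart c"
   show "top_power (omega_pot omg (%x. ph x 0) c (inv_coord c y)) / vol_density c y ~= 0"
    using vol_density_pos[OF c y] top_power_pos[OF D(2)[OF y]] by simp
  qed
 qed auto
 then show "continuous_on (img_chart c) (%y. F (inv_coord c y))"
 proof (rule continuous_on_eq)
  fix y assume y: "y \<in> img_chart c"
  show "(ln (top_power (omega_pot omg (%x. ph x 0) c (inv_coord c y)) / vol_density c y) - dt (inv_coord c y) 0) / real CARD('n) = F (inv_coord c y)"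
   using dt_eq(2)[OF c inv_coord_dom[OF c y] I(1)] y by (simp add: vol_density_def[OF c])
 qed
qed

lemma continuous_integrable_vol:
 fixes g :: "'m => real"
 assumes "continuous_on UNIV g"
 shows "integrable vol g"
proof -
 interpret finite_measure vol by (rule finite_measure_vol)
 have "bounded (range g)" by (intro compact_imp_bounded compact_continuous_image assms compact_M)
 then obtain M where "!!x. \<bar>g x\<bar> <= M" unfolding bounded_iff by auto
 then show ?thesis by (intro integrable_const_bound[of _ M]) (auto intro!: borel_measurable_continuous_onI[OF assms, folded measurable_cong_sets[OF sets_vol refl]] simp: measurable_cong_sets[OF sets_vol refl] borel_measurable_continuous_onI[OF assms])
qed

lemma ph_integrable: "t \<in> I ==> integrable vol (%x. ph x t)"
 by (rule continuous_integrable_vol[OF psh_continuous[OF psh_t]])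

definition "av t = (\<integral>x. ph x t \<partial>vol)"

text \<open>The derivative of \<open>av\<close> is the integral of the logarithm of the volume ratio
  minus the integral of n F. The first is at most C by the entropy bound, the second at least
  -K.\<close>

lemma av_bound:
 assumes C: "!!f g. psh f ==> g \<in> borel_measurable borel ==> log_ratio f g ==>
  (\<integral>\<^sup>+w. ennreal (g w) \<partial>vol) <= ennreal C" "C >= 0"
  and K: "(\<integral>x. real CARD('n) * F x \<partial>vol) >= - K" and t: "t \<in> I"
 shows "av t <= av 0 + (C + K) * t"
proof -
 have sub: "{0..t} <= I" using I(3)[OF t] by auto
 have "continuous_on (UNIV \<times> {0..t}) (%(x, t). dt x t)" by (rule continuous_on_subset[OF dt_continuous]) (use sub in auto)
 then have "bounded ((%(x, t). dt x t) ` (UNIV \<times> {0..t}))"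
  by (intro compact_imp_bounded compact_continuous_image compact_Times compact_M compact_Icc)
 then obtain M where M: "!!x ta. ta \<in> {0..t} ==> \<bar>dt x ta\<bar> <= M" unfolding bounded_iff by force
 have der: "(av has_real_derivative (\<integral>x. dt x ta \<partial>vol)) (at ta within {0..t})" if ta: "ta \<in> {0..t}" for ta
  unfolding av_def[abs_def]
 proof (rule deriv_under_integral[where B="%_. M"])
  show "integrable vol (%x. ph x s)" if "s \<in> {0..t}" for s using ph_integrable sub that by blast
  show "(ph x has_real_derivative dt x s) (at s within {0..t})" if "s \<in> {0..t}" for s x
   by (rule DERIV_subset[OF dt(1) sub]) (use sub that in blast)
  show "\<bar>dt x s\<bar> <= M" if "s \<in> {0..t}" for s x by (rule M[OF that])
  show "integrable vol (%_. M)" by (rule continuous_integrable_vol) simp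
  show "(%x. dt x ta) \<in> borel_measurable vol"
   by (rule borel_measurable_integrable[OF continuous_integrable_vol[OF slice_continuous]]) (use sub ta in blast)
 qed (use ta in auto)
 have le: "(\<integral>x. dt x ta \<partial>vol) <= C + K" if ta: "ta \<in> {0..t}" for ta
 proof -
  have taI: "ta \<in> I" using sub ta by blast
  define g where "g x = dt x ta + real CARD('n) * F x" for x
  have gc: "continuous_on UNIV g" unfolding g_def by (intro continuous_intros slice_continuous[OF taI] F_continuous)
  have gi: "integrable vol g" by (rule continuous_integrable_vol[OF gc])
  have "ennreal (\<integral>x. g x \<partial>vol) <= (\<integral>\<^sup>+x. ennreal (g x) \<partial>vol)" by (rule ennreal_integral_le[OF gi])
  also have "... <= ennreal C"
  proof (rule C(1)[OF psh_t[OF taI] borel_measurable_continuous_onI[OF gc]], intro ballI)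
   fix c y assume c: "c \<in> A" "y \<in> dom_chart c"
   show "g y = ln (top_power (omega_pot omg (%x. ph x ta) c y) / top_power (omg c y))"
    using dt_eq(2)[OF c taI] by (simp add: g_def)
  qed
  finally have "(\<integral>x. g x \<partial>vol) <= C" using C(2) by simp
  moreover have "(\<integral>x. g x \<partial>vol) = (\<integral>x. dt x ta \<partial>vol) + (\<integral>x. real CARD('n) * F x \<partial>vol)"
   unfolding g_def by (rule Bochner_Integration.integral_add)
    (intro continuous_integrable_vol slice_continuous[OF taI] continuous_intros F_continuous)+
  ultimately show ?thesis using K by linarith
 qed
 have "(C + K) * 0 - av 0 <= (C + K) * t - av t"
 proof (rule DERIV_within_nonneg_mono[where f="%ta. (C + K) * ta - av ta" and f'="%ta. (C + K) - (\<integral>x. dt x ta \<partial>vol)"])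
  show "0 <= t" using I(2)[OF t] .
  fix ta assume ta: "ta \<in> {0..t}"
  show "((%ta. (C + K) * ta - av ta) has_real_derivative (C + K) - (\<integral>x. dt x ta \<partial>vol)) (at ta within {0..t})"
   by (intro DERIV_diff der[OF ta]) (auto intro!: derivative_eq_intros)
  show "0 <= (C + K) - (\<integral>x. dt x ta \<partial>vol)" using le[OF ta] by simp
 qed
 then show ?thesis by simp
qed

lemma normalized_le_oscillation:
 assumes t: "t \<in> I" and osc: "!!x y. ph x t - ph y t <= C"
 shows "\<bar>normalized A omg ph x t\<bar> <= C"
proof -
 interpret finite_measure vol by (rule finite_measure_vol)
 define V where "V = measure vol UNIV"
 have "emeasure vol UNIV > 0" by (rule emeasure_open_pos[of _ undefined]) auto
 then have V: "V > 0" unfolding V_def by (simp add: emeasure_eq_measure)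
 have ic: "integrable vol (%_. k)" for k :: real by (rule continuous_integrable_vol) simp
 have lo: "(\<integral>y. ph x t - C \<partial>vol) <= av t" unfolding av_def
  by (rule integral_mono[OF ic ph_integrable[OF t]]) (use osc[of x] in \<open>simp add: algebra_simps\<close>)
 have hi: "av t <= (\<integral>y. ph x t + C \<partial>vol)" unfolding av_def
  by (rule integral_mono[OF ph_integrable[OF t] ic]) (use osc[of _ x] in \<open>simp add: algebra_simps\<close>)
 have ci: "(\<integral>y. k \<partial>vol) = V * k" for k :: real by (simp add: V_def)
 have "V * (ph x t - C) <= av t" "av t <= V * (ph x t + C)" using lo hi unfolding ci .
 then have "ph x t - C <= av t / V" "av t / V <= ph x t + C" using V by (simp_all add: field_simps)
 moreover have "normalized A omg ph x t = ph x t - av t / V"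
  by (simp add: normalized_def vol_def[symmetric] av_def V_def)
 ultimately show ?thesis by linarith
qed

text \<open>\<open>esssup\<close> takes its top value on a nonmeasurable function, so this belongs
  to the estimate. Measurability for the product sigma-algebra is checked on each piece through a
  chart, where it reduces to Borel sets of C^n times the real line.\<close>

lemma normalized_measurable:
 "(%(x, t). ereal \<bar>normalized A omg ph x t\<bar>) \<in> borel_measurable (vol \<Otimes>\<^sub>M restrict_space lborel I)"
proof -
 let ?R = "restrict_space lborel I"
 interpret finite_measure vol by (rule finite_measure_vol)
 have Ib [measurable]: "I \<in> sets borel"
 proof -
  have "{t \<in> space borel. 0 <= t & ereal t < T} \<in> sets borel" by measurable
  then show ?thesis by (simp add: time_interval_def)
 qed
 have sR: "space ?R = I" by (simp add: space_restrict_space)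
 define e where "e i x = (if x \<in> piece i then coord (ch i) x else 0)" for i and x :: 'm
 define \<Phi> where "\<Phi> i p = indicator (img_chart (ch i) \<times> I) p *\<^sub>R (%(y, t). ph (inv_coord (ch i) y) t) p" for i p
 have em: "e i \<in> measurable borel borel" if i: "i < N" for i
 proof -
  have "coord (ch i) \<in> measurable (restrict_space borel (piece i)) borel"
   by (rule borel_measurable_continuous_on_restrict[OF continuous_on_subset[OF continuous_coord[OF ch[OF i]] piece_dom]])
  then show ?thesis unfolding e_def
   by (subst measurable_restrict_space_iff[symmetric]) (use piece_borel[OF i] in auto)
 qed
 have Pm: "\<Phi> i \<in> borel_measurable borel" if i: "i < N" for i
  unfolding \<Phi>_def
 proof (rule borel_measurable_continuous_on_indicator[OF _ chart_joint(1)[OF ch[OF i]]])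
  have "img_chart (ch i) \<in> sets borel" using open_img[OF ch[OF i]] by simp
  then show "img_chart (ch i) \<times> I \<in> sets borel" using Ib by (rule borel_Times)
 qed
 have snd: "snd \<in> measurable (vol \<Otimes>\<^sub>M ?R) borel"
 proof -
  have "(%t. t) \<in> measurable ?R borel" by (rule measurable_restrict_space1) simp
  from measurable_compose[OF measurable_snd[of vol ?R] this] show ?thesis by simp
 qed
 have fst: "fst \<in> measurable (vol \<Otimes>\<^sub>M ?R) borel"
  using measurable_fst[of vol ?R] by (simp add: measurable_cong_sets[OF refl sets_vol])
 have summand: "(%p. indicator (piece i) (fst p) * \<Phi> i (e i (fst p), snd p)) \<in> borel_measurable (vol \<Otimes>\<^sub>M ?R)" if i: "i < N" for i
 proof (intro borel_measurable_times)
  show "(%p. indicator (piece i) (fst p) :: real) \<in> borel_measurable (vol \<Otimes>\<^sub>M ?R)"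
   by (rule measurable_compose[OF fst borel_measurable_indicator[OF piece_borel[OF i]]])
  have "(%p. (e i (fst p), snd p)) \<in> measurable (vol \<Otimes>\<^sub>M ?R) (borel \<Otimes>\<^sub>M borel)"
   by (rule measurable_Pair[OF measurable_compose[OF fst em[OF i]] snd])
  from measurable_compose[OF this[unfolded borel_prod] Pm[OF i]]
  show "(%p. \<Phi> i (e i (fst p), snd p)) \<in> borel_measurable (vol \<Otimes>\<^sub>M ?R)" .
 qed
 have eq: "(\<Sum>i<N. indicator (piece i) (fst p) * \<Phi> i (e i (fst p), snd p)) = ph (fst p) (snd p)" if p: "snd p \<in> I" for p
 proof -
  obtain i where i: "i < N" "fst p \<in> piece i" using piece_cover by blast
  have "(\<Sum>j<N. indicator (piece j) (fst p) * \<Phi> j (e j (fst p), snd p)) = (\<Sum>j<N. if j = i then ph (fst p) (snd p) else 0)"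
  proof (rule sum.cong[OF refl])
   fix j assume j: "j \<in> {..<N}"
   show "indicator (piece j) (fst p) * \<Phi> j (e j (fst p), snd p) = (if j = i then ph (fst p) (snd p) else 0)"
   proof (cases "j = i")
    case True
    have d: "fst p \<in> dom_chart (ch i)" using i(2) piece_dom by blast
    then show ?thesis using True i p inv_coord_coord[OF ch[OF i(1)] d] by (simp add: \<Phi>_def e_def)
   next
    case False
    then have "fst p ~: piece j" using piece_disjoint i j unfolding disjoint_family_on_def by blast
    then show ?thesis using False by simp
   qed
  qed
  also have "... = ph (fst p) (snd p)" using i(1) by simp
  finally show ?thesis .
 qed
 have m1: "(%p. ph (fst p) (snd p)) \<in> borel_measurable (vol \<Otimes>\<^sub>M ?R)"
 proof (rule measurable_cong[THEN iffD1])
  show "(%p. \<Sum>i<N. indicator (piece i) (fst p) * \<Phi> i (e i (fst p), snd p)) \<in> borel_measurable (vol \<Otimes>\<^sub>M ?R)"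
   by (rule borel_measurable_sum) (use summand in auto)
  show "(\<Sum>i<N. indicator (piece i) (fst p) * \<Phi> i (e i (fst p), snd p)) = ph (fst p) (snd p)" if "p \<in> space (vol \<Otimes>\<^sub>M ?R)" for p
   by (rule eq) (use that in \<open>auto simp: space_pair_measure sR\<close>)
 qed
 have "(%(t, x). ph x t) \<in> borel_measurable (?R \<Otimes>\<^sub>M vol)"
  using measurable_pair_swap[OF m1] by simp
 then have "av \<in> borel_measurable ?R"
  unfolding av_def[abs_def] by (rule borel_measurable_lebesgue_integral)
 from measurable_compose[OF measurable_snd[of vol ?R] this]
 have m2: "(%p. av (snd p)) \<in> borel_measurable (vol \<Otimes>\<^sub>M ?R)" .
 have "(%p. ereal \<bar>ph (fst p) (snd p) - 1 / measure vol UNIV * av (snd p)\<bar>) \<in> borel_measurable (vol \<Otimes>\<^sub>M ?R)"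
  by (intro borel_measurable_ereal borel_measurable_abs borel_measurable_diff borel_measurable_times borel_measurable_const m1 m2)
 then show ?thesis by (simp add: normalized_def vol_def[symmetric] av_def case_prod_unfold)
qed

text \<open>\<open>L1_bound\<close> controls the maximum by the mean, and the mean grows at most
  linearly from its initial value by \<open>av_bound\<close>; the factor 2 is the length of the time
  interval.\<close>

lemma sup_bound:
 assumes C: "!!f g. psh f ==> g \<in> borel_measurable borel ==> log_ratio f g ==>
  (\<integral>\<^sup>+w. ennreal (g w) \<partial>vol) <= ennreal C" "C >= 0"
  and L: "!!f s. psh f ==> (\<forall>y. f y <= s) ==> (\<exists>x. f x = s) ==> (\<integral>\<^sup>+w. ennreal (s - f w) \<partial>vol) <= ennreal L" "L >= 0"
  and K: "(\<integral>x. real CARD('n) * F x \<partial>vol) >= - K" and B: "!!x. \<bar>\<phi>\<^sub>0 x\<bar> <= B" and t: "t \<in> I" "t <= 2"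
 shows "ph x t <= B + (2 * \<bar>C + K\<bar> + L) / measure vol UNIV"
proof -
 interpret finite_measure vol by (rule finite_measure_vol)
 define V where "V = measure vol UNIV"
 have "emeasure vol UNIV > 0" by (rule emeasure_open_pos[of _ undefined]) auto
 then have V: "V > 0" unfolding V_def by (simp add: emeasure_eq_measure)
 have ic: "integrable vol (%_. k)" for k :: real by (rule continuous_integrable_vol) simp
 have ci: "(\<integral>y. k \<partial>vol) = V * k" for k :: real by (simp add: V_def)
 obtain x1 where x1: "!!y. ph y t <= ph x1 t" using continuous_attains_sup[OF compact_M _ psh_continuous[OF psh_t[OF t(1)]]] by auto
 have "ennreal (\<integral>y. ph x1 t - ph y t \<partial>vol) <= (\<integral>\<^sup>+y. ennreal (ph x1 t - ph y t) \<partial>vol)"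
  by (rule ennreal_integral_le[OF Bochner_Integration.integrable_diff[OF ic ph_integrable[OF t(1)]]])
 also have "... <= ennreal L" by (rule L(1)[OF psh_t[OF t(1)]]) (use x1 in auto)
 finally have "(\<integral>y. ph x1 t - ph y t \<partial>vol) <= L" using L(2) by simp
 then have 1: "V * ph x1 t - av t <= L"
  unfolding Bochner_Integration.integral_diff[OF ic ph_integrable[OF t(1)]] ci av_def .
 have "av t <= av 0 + (C + K) * t" by (rule av_bound[OF C K t(1)])
 also have "(C + K) * t <= \<bar>C + K\<bar> * 2" using t I(2)[OF t(1)] by (intro mult_mono) auto
 also have "av 0 <= (\<integral>y. B \<partial>vol)" unfolding av_def
  by (rule integral_mono[OF ph_integrable[OF I(1)] ic]) (use B in \<open>simp add: sol_0 abs_le_iff\<close>)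
 finally have "V * ph x1 t <= V * B + (2 * \<bar>C + K\<bar> + L)" using 1 unfolding ci by linarith
 then have "ph x1 t <= B + (2 * \<bar>C + K\<bar> + L) / V" using V by (simp add: field_simps)
 then show ?thesis using x1[of x] unfolding V_def by linarith
qed

end

section \<open>The uniform estimate along the flow\<close>

theorem theorem1p1:
  fixes A :: "('m::t2_space, 'n::finite) chart set"
    and \<omega>\<^sub>0 :: "('m, 'n) two_form"
    and \<phi>\<^sub>0 :: "'m \<Rightarrow> real"
    and p K E :: real
  assumes "compact_kaehler_manifold A \<omega>\<^sub>0"
    and "p > real CARD('n) + 1"
  shows "\<exists>C::real. \<forall>(T::ereal) (F :: 'm \<Rightarrow> real) (\<phi> :: 'm \<Rightarrow> real \<Rightarrow> real).
    0 < T \<longrightarrow>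
    C2_flow_solution A \<omega>\<^sub>0 F \<phi>\<^sub>0 T \<phi> \<longrightarrow>
    p_entropy A \<omega>\<^sub>0 p F \<le> ennreal E \<longrightarrow>
    (\<integral>x. real CARD('n) * F x \<partial>volume_measure A \<omega>\<^sub>0) \<ge> - K \<longrightarrow>
    Linf_norm (volume_measure A \<omega>\<^sub>0 \<Otimes>\<^sub>M restrict_space lborel (time_interval T))
      (\<lambda>(x, t). normalized A \<omega>\<^sub>0 \<phi> x t) \<le> ereal C"
proof -
 let ?n = "real CARD('n)"
 interpret kaehler A \<omega>\<^sub>0 by unfold_locales (rule assms(1))
 have p: "p > ?n" using assms(2) by linarith
 \<comment> \<open>The constant must be fixed before a solution is given, but only the existence of
   a solution makes \<open>\<phi>\<^sub>0\<close> continuous and hence bounded. The bound is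
   therefore chosen conditionally.\<close>
 obtain B0 where B0: "(\<exists>B. \<forall>x. \<bar>\<phi>\<^sub>0 x\<bar> <= B) ==> \<forall>x. \<bar>\<phi>\<^sub>0 x\<bar> <= B0" by blast
 obtain CE where CE: "CE >= 0" "!!f g. psh f ==> g \<in> borel_measurable borel ==> log_ratio f g ==>
  (\<integral>\<^sup>+w. ennreal (g w) \<partial>vol) <= ennreal CE" using entropy_bound by blast
 obtain CL where CL: "CL >= 0" "!!f s. psh f ==> (\<forall>y. f y <= s) ==> (\<exists>x. f x = s) ==> (\<integral>\<^sup>+w. ennreal (s - f w) \<partial>vol) <= ennreal CL"
  using L1_bound by blast
 define B where "B = max B0 0"
 define U where "U = B + (2 * \<bar>CE + K\<bar> + CL) / measure vol UNIV"
 \<comment> \<open>A bound of the right-hand side of \<open>dt_upper\<close> for times in [1,2],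
   where the solution is at most \<open>U\<close>.\<close>
 define k where "k = U + B + ?n"
 have Bn: "B >= 0" by (simp add: B_def)
 have Un: "U >= 0" unfolding U_def using Bn CL(1) by (intro add_nonneg_nonneg divide_nonneg_nonneg) auto
 define P where "P C1 C \<longleftrightarrow> (\<forall>f F x0. psh f --> F \<in> borel_measurable borel -->
  entropy_le p F E --> (\<forall>y. f x0 <= f y) -->
  ma_le C1 f F x0 -->
  (\<forall>y. f y - f x0 <= C))" for C1 C
 have ex: "\<exists>C. P C1 C" if "C1 > 0" for C1 unfolding P_def by (rule oscillation_bound[OF that p])
 \<comment> \<open>exp n is the constant for times up to 2 with a very negative minimum, and exp k
   the constant for all later times; both are known before the solution.\<close>
 obtain Ca where Ca: "P (exp ?n) Ca" using ex[OF exp_gt_zero] by blast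
 obtain Cb where Cb: "P (exp k) Cb" using ex[OF exp_gt_zero] by blast
 define C where "C = \<bar>Ca\<bar> + \<bar>Cb\<bar> + U + B + 1"
 have main: "Linf_norm (volume_measure A \<omega>\<^sub>0 \<Otimes>\<^sub>M restrict_space lborel (time_interval T))
   (%(x, t). normalized A \<omega>\<^sub>0 \<phi> x t) <= ereal C"
  if T: "0 < T" and sol: "C2_flow_solution A \<omega>\<^sub>0 F \<phi>\<^sub>0 T \<phi>" and ent: "p_entropy A \<omega>\<^sub>0 p F <= ennreal E"
   and K: "(\<integral>x. ?n * F x \<partial>volume_measure A \<omega>\<^sub>0) >= - K" for T F \<phi>
 proof -
  interpret flow A \<omega>\<^sub>0 F \<phi>\<^sub>0 T \<phi> by unfold_locales (rule T, rule sol)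
  have Fm: "F \<in> borel_measurable borel" by (rule borel_measurable_continuous_onI[OF F_continuous])
  have ent': "entropy_le p F E"
   using ent unfolding p_entropy_def vol_def .
  have K': "(\<integral>x. ?n * F x \<partial>vol) >= - K" using K unfolding vol_def .
  have B: "\<bar>\<phi>\<^sub>0 x\<bar> <= B" for x
  proof -
   have "continuous_on UNIV \<phi>\<^sub>0" using psh_continuous[OF psh_t[OF I(1)]] by (simp add: sol_0)
   then have "bounded (range \<phi>\<^sub>0)" by (intro compact_imp_bounded compact_continuous_image compact_M)
   then have "\<exists>B. \<forall>x. \<bar>\<phi>\<^sub>0 x\<bar> <= B" unfolding bounded_iff by auto
   from B0[OF this] have "\<bar>\<phi>\<^sub>0 x\<bar> <= B0" by blast
   then show ?thesis unfolding B_def by linarith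
  qed
  have sup: "\<phi> x t <= U" if "t \<in> I" "t <= 2" for x t
   unfolding U_def by (rule sup_bound[OF CE(2,1) CL(2,1) K' B that])
  have osc: "\<phi> x t - \<phi> y t <= C" if t: "t \<in> I" for x y t
  proof -
   obtain x0 where x0: "!!y. \<phi> x0 t <= \<phi> y t"
    using continuous_attains_inf[OF compact_M _ psh_continuous[OF psh_t[OF t]]] by auto
   have dtb: "top_power (omega_pot \<omega>\<^sub>0 (%x. \<phi> x t) c w) <= exp d * exp (?n * F w) * top_power (\<omega>\<^sub>0 c w)"
    if "dt w t <= d" "c \<in> A" "w \<in> dom_chart c" for c w d
   proof -
    have "exp (dt w t) * (exp (?n * F w) * top_power (\<omega>\<^sub>0 c w)) <= exp d * (exp (?n * F w) * top_power (\<omega>\<^sub>0 c w))"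
     using that(1) top_power_pos[OF form_pos[OF that(2,3)]] by (intro mult_right_mono) auto
    then show ?thesis unfolding dt_eq(1)[OF that(2,3) t] by (simp add: mult.assoc)
   qed
   have "\<phi> x t - \<phi> x0 t <= C"
   proof (cases "t <= 2")
    case True
    show ?thesis
    \<comment> \<open>If the minimum is at least -B - 1, the upper bound \<open>U\<close> alone
      limits the oscillation. Otherwise the solution is at most -B wherever it is within 1 of its
      minimum, and there \<open>dt_upper\<close> gives at most n.\<close>
    proof (cases "\<phi> x0 t >= - B - 1")
     case True
     then show ?thesis using sup[OF t \<open>t <= 2\<close>, of x] unfolding C_def by linarith
    next
     case False
     \<comment> \<open>\<open>dt_upper\<close> divides by t; at time 0 the minimum is at least -B,
       so this case cannot occur there.\<close>
     have t0: "t > 0"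
     proof (rule ccontr)
      assume "~ t > 0"
      then have "t = 0" using I(2)[OF t] by linarith
      then show False using False B[of x0] by (simp add: sol_0)
     qed
     have "\<phi> x t - \<phi> x0 t <= Ca"
     proof (rule Ca[unfolded P_def, rule_format, OF psh_t[OF t] Fm ent' x0])
      fix c w assume c: "c \<in> A" "w \<in> dom_chart c" and w: "\<phi> w t <= \<phi> x0 t + 1"
      have "(\<phi> w t + B) / t <= 0" using w False t0 by (intro divide_nonpos_pos) auto
      then have "dt w t <= ?n" using dt_upper[OF B t t0, of w] by linarith
      then show "top_power (omega_pot \<omega>\<^sub>0 (%x. \<phi> x t) c w) <= exp ?n * exp (?n * F w) * top_power (\<omega>\<^sub>0 c w)"
       by (rule dtb[OF _ c])
     qed
     then show ?thesis using Un Bn unfolding C_def by linarith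
    qed
   next
    case False
    have k: "dt w ta <= k" if ta: "ta \<in> {1..2}" for w ta
    proof -
     have taI: "ta \<in> I" by (rule I(3)[OF t]) (use ta False in auto)
     have "(\<phi> w ta + B) / ta <= (U + B) / ta" using sup[OF taI, of w] ta by (intro divide_right_mono) auto
     also have "... <= U + B"
     proof -
      have "(U + B) * 1 <= (U + B) * ta" using Un Bn ta by (intro mult_left_mono) auto
      then show ?thesis using ta by (simp add: pos_divide_le_eq)
     qed
     finally show ?thesis using dt_upper[OF B taI, of w] ta unfolding k_def by simp
    qed
    have "\<phi> x t - \<phi> x0 t <= Cb"
    proof (rule Cb[unfolded P_def, rule_format, OF psh_t[OF t] Fm ent' x0])
     fix c w assume c: "c \<in> A" "w \<in> dom_chart c"
     have "dt w t <= k" by (rule dt_late[OF k t]) (use False in auto)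
     then show "top_power (omega_pot \<omega>\<^sub>0 (%x. \<phi> x t) c w) <= exp k * exp (?n * F w) * top_power (\<omega>\<^sub>0 c w)"
      by (rule dtb[OF _ c])
    qed
    then show ?thesis using Un Bn unfolding C_def by linarith
   qed
   then show ?thesis using x0[of y] by linarith
  qed
  show ?thesis
   unfolding Linf_norm_def
  proof (rule esssup_I)
   show "(%x. ereal \<bar>case x of (x, t) => normalized A \<omega>\<^sub>0 \<phi> x t\<bar>) \<in> borel_measurable (volume_measure A \<omega>\<^sub>0 \<Otimes>\<^sub>M restrict_space lborel (time_interval T))"
    using normalized_measurable by (simp add: vol_def case_prod_unfold)
   show "AE x in volume_measure A \<omega>\<^sub>0 \<Otimes>\<^sub>M restrict_space lborel (time_interval T). ereal \<bar>case x of (x, t) => normalized A \<omega>\<^sub>0 \<phi> x t\<bar> <= ereal C"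
   proof (rule AE_I2)
    fix q assume "q \<in> space (volume_measure A \<omega>\<^sub>0 \<Otimes>\<^sub>M restrict_space lborel (time_interval T))"
    then have "snd q \<in> time_interval T" by (auto simp: space_pair_measure space_restrict_space)
    from normalized_le_oscillation[OF this osc[OF this], of "fst q"]
    show "ereal \<bar>case q of (x, t) => normalized A \<omega>\<^sub>0 \<phi> x t\<bar> <= ereal C" by (simp add: case_prod_unfold)
   qed
  qed
 qed
 then show ?thesis by blast
qed

end
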